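(* Let $k$ be a number field (not necessarily Galois over $\mathbb{Q}$) with ring of integers $\mathcal{O}_k$, let $n \ge 2$, let $\mathfrak{p}_1,\dots,\mathfrak{p}_r$ be distinct prime ideals of $\mathcal{O}_k$ with norms $q_i = N_{k/\mathbb{Q}}\mathfrak{p}_i$, and let $\mu_1,\dots,\mu_r$ be partitions of $n$. Then the following are equivalent: (1) $\nu_{n,q_i}^{\ast}(C_{\mu_i}) > 0$ for $1 \le i \le r$. (2) There exists a relative $S_n$-number field $K/k$ with the properties: (P1-$k$) $K$ contains a monogenic order $O = \mathcal{O}_k[1,\theta,\dots,\theta^{n-1}]$ whose relative discriminant $\mathrm{Disc}(O\mid\mathcal{O}_k)$ is coprime to $\mathfrak{p}_1\mathfrak{p}_2\cdots\mathfrak{p}_r$; (P2-$k$) the Galois closure $K^{spl}$ of $K$ over $k$ is unramified at all primes above the $\mathfrak{p}_i$, and $\left[\frac{K^{spl}/k}{\mathfrak{p}_i}\right] = C_{\mu_i}$ for $1 \le i \le r$. (3) There exist infinitely many relative $S_n$-number fields $K/k$ having properties (P1-$k$) and (P2-$k$).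
   Context: A relative $S_n$-number field over $k$ is an extension $K/k$ with $[K:k]=n$ whose Galois closure over $k$ has Galois group $S_n$; this group is viewed as a permutation group on the $n$ $k$-embeddings of $K$, so conjugacy classes correspond to cycle types $C_\mu$, $\mu\vdash n$, and the Artin symbol of an unramified prime is the conjugacy class of its Frobenius. The relative discriminant of an order $O \supseteq \mathcal{O}_k$ of $K$ is the ideal of $\mathcal{O}_k$ generated by the discriminants of all $k$-bases of $K$ contained in $O$. For $m\ge1$, $M_m(X) = \frac{1}{m}\sum_{d\mid m}\mu(d)X^{m/d}$ ($\mu(d)$ the Möbius function); $\binom{w}{k} = \frac{w(w-1)\cdots(w-k+1)}{k!}$; $c_i(\mu)$ is the number of parts of $\mu$ equal to $i$; and $\nu_{n,q}^{\ast}(C_\mu) = \frac{1}{q^{n-1}(q-1)}\prod_{i=1}^n\binom{M_i(q)}{c_i(\mu)}$. *)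

theory Defs
  imports
    Complex_Main
    "HOL-Library.Multiset"
    "HOL-Computational_Algebra.Squarefree"
    "HOL-Combinatorics.Orbits"
    "HOL-Algebra.Algebra"
    "HOL-Algebra.Sym_Groups"
    "HOL-Algebra.Algebraic_Closure_Type"
    "Jordan_Normal_Form.Determinant"
begin

text \<open>Number fields are realised as subfields of the complex numbers.\<close>

abbreviation CC :: "complex ring" where
  "CC \<equiv> ring_of_type_algebra"

definition number_field :: "complex set \<Rightarrow> bool" where
  "number_field k \<longleftrightarrow> subfield k CC \<and> ring.finite_dimension CC \<rat> k"

definition field_ring :: "complex set \<Rightarrow> complex ring" where
  "field_ring k = CC\<lparr>carrier := k\<rparr>"

definition ring_of_integers :: "complex set \<Rightarrow> complex ring" where
  "ring_of_integers k = CC\<lparr>carrier := {x \<in> k. algebraic_int x}\<rparr>"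

definition ideal_norm :: "complex set \<Rightarrow> complex set \<Rightarrow> nat" where
  "ideal_norm k I = card (carrier (ring_of_integers k Quot I))"

definition prime_of :: "complex set \<Rightarrow> complex set \<Rightarrow> bool" where
  "prime_of k P \<longleftrightarrow> primeideal P (ring_of_integers k) \<and> P \<noteq> {0}"

definition embeddings :: "complex set \<Rightarrow> complex set \<Rightarrow> (complex \<Rightarrow> complex) set" where
  "embeddings k K = {\<tau> \<in> Ring.ring_hom (field_ring K) CC \<inter> extensional K. \<forall>x\<in>k. \<tau> x = x}"

text \<open>The Galois closure is the compositum of the conjugates of \<open>K\<close> over \<open>k\<close>.\<close>

definition galois_closure :: "complex set \<Rightarrow> complex set \<Rightarrow> complex set" where
  "galois_closure k K = generate_field CC (\<Union>\<tau>\<in>embeddings k K. \<tau> ` K)"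

definition galois_group :: "complex set \<Rightarrow> complex set \<Rightarrow> (complex \<Rightarrow> complex) monoid" where
  "galois_group k L = (BijGroup L)\<lparr>carrier :=
     {\<sigma> \<in> ring_iso (field_ring L) (field_ring L) \<inter> extensional L. \<forall>x\<in>k. \<sigma> x = x}\<rparr>"

definition Sn_field :: "nat \<Rightarrow> complex set \<Rightarrow> complex set \<Rightarrow> bool" where
  "Sn_field n k K \<longleftrightarrow> subfield K CC \<and> k \<subseteq> K \<and> ring.dimension CC n k K \<and>
     galois_group k (galois_closure k K) \<cong> sym_group n"

definition partition_of :: "nat multiset \<Rightarrow> nat \<Rightarrow> bool" where
  "partition_of mu n \<longleftrightarrow> 0 \<notin># mu \<and> sum_mset mu = n"

definition cycle_type :: "('a \<Rightarrow> 'a) \<Rightarrow> 'a set \<Rightarrow> nat multiset" where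
  "cycle_type f A = image_mset card (mset_set (Orbits.orbit f ` A))"

definition cycle_class :: "complex set \<Rightarrow> complex set \<Rightarrow> nat multiset \<Rightarrow> (complex \<Rightarrow> complex) set" where
  "cycle_class k K mu =
     {\<sigma> \<in> carrier (galois_group k (galois_closure k K)).
        cycle_type (\<lambda>\<tau>. compose K \<sigma> \<tau>) (embeddings k K) = mu}"

definition primes_above :: "complex set \<Rightarrow> complex set \<Rightarrow> complex set \<Rightarrow> complex set set" where
  "primes_above k L \<pp> = {P. prime_of L P \<and> P \<inter> carrier (ring_of_integers k) = \<pp>}"

definition ramification_index :: "complex set \<Rightarrow> complex set \<Rightarrow> complex set \<Rightarrow> nat" where
  "ramification_index L \<pp> P =
     (GREATEST e::nat. Idl\<^bsub>ring_of_integers L\<^esub> \<pp> \<subseteq> P [^]\<^bsub>ideals_set (ring_of_integers L)\<^esub> e)"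

definition unramified_above :: "complex set \<Rightarrow> complex set \<Rightarrow> complex set \<Rightarrow> bool" where
  "unramified_above k L \<pp> \<longleftrightarrow> (\<forall>P\<in>primes_above k L \<pp>. ramification_index L \<pp> P = 1)"

definition is_frobenius ::
    "complex set \<Rightarrow> complex set \<Rightarrow> complex set \<Rightarrow> complex set \<Rightarrow> (complex \<Rightarrow> complex) \<Rightarrow> bool" where
  "is_frobenius k L \<pp> P \<sigma> \<longleftrightarrow> \<sigma> \<in> carrier (galois_group k L) \<and>
     (\<forall>x\<in>carrier (ring_of_integers L). \<sigma> x - x ^ ideal_norm k \<pp> \<in> P)"

definition conj_class :: "('a, 'b) monoid_scheme \<Rightarrow> 'a \<Rightarrow> 'a set" where
  "conj_class G x = {g \<otimes>\<^bsub>G\<^esub> x \<otimes>\<^bsub>G\<^esub> inv\<^bsub>G\<^esub> g | g. g \<in> carrier G}"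

text \<open>
  For \<open>\<pp>\<close> unramified in \<open>L\<close>, the Frobenius elements at the various primes above \<open>\<pp>\<close> are all
  conjugate, so the union below is a single conjugacy class.
\<close>

definition artin_symbol ::
    "complex set \<Rightarrow> complex set \<Rightarrow> complex set \<Rightarrow> (complex \<Rightarrow> complex) set" where
  "artin_symbol k L \<pp> =
     \<Union>{conj_class (galois_group k L) \<sigma> | \<sigma> P. P \<in> primes_above k L \<pp> \<and> is_frobenius k L \<pp> P \<sigma>}"

definition field_basis :: "complex set \<Rightarrow> complex set \<Rightarrow> complex list \<Rightarrow> bool" where
  "field_basis k K Us \<longleftrightarrow> ring.independent CC k Us \<and> ring.Span CC k Us = K"

definition is_order :: "complex set \<Rightarrow> complex set \<Rightarrow> complex set \<Rightarrow> bool" where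
  "is_order k K R \<longleftrightarrow> subring R CC \<and> carrier (ring_of_integers k) \<subseteq> R \<and> R \<subseteq> K \<and>
     (\<exists>Us. ring.Span CC (carrier (ring_of_integers k)) Us = R) \<and>
     (\<exists>Us. set Us \<subseteq> R \<and> field_basis k K Us)"

definition field_trace :: "complex set \<Rightarrow> complex set \<Rightarrow> complex \<Rightarrow> complex" where
  "field_trace k K x = (\<Sum>\<tau>\<in>embeddings k K. \<tau> x)"

definition basis_disc :: "complex set \<Rightarrow> complex set \<Rightarrow> complex list \<Rightarrow> complex" where
  "basis_disc k K Us =
     det (mat (length Us) (length Us) (\<lambda>(i, j). field_trace k K (Us ! i * Us ! j)))"

definition rel_disc :: "complex set \<Rightarrow> complex set \<Rightarrow> complex set \<Rightarrow> complex set" where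
  "rel_disc k K R = Idl\<^bsub>ring_of_integers k\<^esub> {basis_disc k K Us | Us. set Us \<subseteq> R \<and> field_basis k K Us}"

definition power_order :: "complex set \<Rightarrow> nat \<Rightarrow> complex \<Rightarrow> complex set" where
  "power_order k n \<theta> = ring.Span CC (carrier (ring_of_integers k)) (map (\<lambda>i. \<theta> ^ i) [0..<n])"

definition coprime_ideals :: "('a, 'b) ring_scheme \<Rightarrow> 'a set \<Rightarrow> 'a set \<Rightarrow> bool" where
  "coprime_ideals R I J \<longleftrightarrow> I <+>\<^bsub>R\<^esub> J = carrier R"

definition property_P1 ::
    "complex set \<Rightarrow> nat \<Rightarrow> nat \<Rightarrow> (nat \<Rightarrow> complex set) \<Rightarrow> complex set \<Rightarrow> bool" where
  "property_P1 k n r \<pp> K \<longleftrightarrow>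
     (\<exists>\<theta>\<in>K. is_order k K (power_order k n \<theta>) \<and>
        coprime_ideals (ring_of_integers k) (rel_disc k K (power_order k n \<theta>))
          (\<Otimes>\<^bsub>ideals_set (ring_of_integers k)\<^esub> i\<in>{1..r}. \<pp> i))"

definition property_P2 ::
    "complex set \<Rightarrow> nat \<Rightarrow> (nat \<Rightarrow> complex set) \<Rightarrow> (nat \<Rightarrow> nat multiset) \<Rightarrow> complex set \<Rightarrow> bool" where
  "property_P2 k r \<pp> mu K \<longleftrightarrow>
     (\<forall>i\<in>{1..r}. unramified_above k (galois_closure k K) (\<pp> i) \<and>
        artin_symbol k (galois_closure k K) (\<pp> i) = cycle_class k K (mu i))"

definition moebius :: "nat \<Rightarrow> int" where
  "moebius d = (if squarefree d then (- 1) ^ card (prime_factors d) else 0)"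

definition necklace :: "nat \<Rightarrow> real \<Rightarrow> real" where
  "necklace m x = (1 / real m) * (\<Sum>d | d dvd m. of_int (moebius d) * x ^ (m div d))"

definition nu_star :: "nat \<Rightarrow> nat \<Rightarrow> nat multiset \<Rightarrow> real" where
  "nu_star n q mu = 1 / (real q ^ (n - 1) * (real q - 1)) *
     (\<Prod>i=1..n. necklace i (real q) gchoose count mu i)"

end

theory Submission
  imports Defs "Jordan_Normal_Form.Char_Poly"
begin

text \<open>
  Fix a prime \<open>Q\<close> of the ring of all algebraic integers above a prime \<open>P\<close> of \<open>k\<close> of norm \<open>q\<close>. The
  complex numbers \<open>x\<close> with \<open>x ^ (q ^ j) = x\<close> for some \<open>j > 0\<close> (zero and the roots of unity of order
  prime to \<open>q\<close>) are pairwise incongruent modulo \<open>Q\<close> and represent all residue classes, and on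
  them the Frobenius is the map \<open>x \<mapsto> x ^ q\<close>. This map has \<open>M_j(q)\<close> orbits of length \<open>j\<close>, so
  \<open>\<nu>*\<close> is positive exactly if it has an invariant subset of cycle type \<open>\<mu>\<close>.

  Given a field with the two properties, the conjugates of \<open>\<theta>\<close> are distinct modulo \<open>Q\<close>, and their
  residues form such an invariant subset. Conversely, choose invariant subsets \<open>R\<^sub>i\<close> of type \<open>\<mu>\<^sub>i\<close> and
  use the Chinese remainder theorem to find a monic \<open>f\<close> over the integers of \<open>k\<close> that reduces to
  the product of the \<open>X - \<rho>\<close>, \<open>\<rho> \<in> R\<^sub>i\<close>, at every \<open>P\<^sub>i\<close>. Auxiliary primes of types \<open>(n)\<close>, \<open>(n - 1, 1)\<close>
  and \<open>(2, 1, \<dots>, 1)\<close> force the Galois group of \<open>f\<close> to be the full symmetric group.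

  Existence and uniqueness of Frobenius elements, their conjugacy and unramifiedness are all derived
  from one identity: expanding \<open>\<Prod>(t - \<sigma> s)\<close> over the ordered pairs of distinct roots \<open>s\<close>, \<open>t\<close> gives,
  up to a factor prime to \<open>P\<close>, a pair of dual bases for the trace form.
\<close>


section \<open>Subrings of the complex numbers, their ideals and polynomials\<close>

text \<open>Integral bases and factorisation of ideals are replaced by multiplication with elements
  outside a prime. This is possible because the roots of the polynomial stay distinct modulo every
  prime above the given ones: the product \<open>dsc\<close> of their differences is then outside
  such a prime, and the expanded identity may be divided by it. Where a local ring would be used, a
  multiplier outside the prime is carried along. All algebraic integers form one ambient ring, so
  that a single prime \<open>Q\<close> provides an algebraic closure of the residue field. The
  polynomial can be prescribed modulo \<open>Q\<close> before its splitting field is known; an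
  invariant set of roots makes the coefficients of the product fixed by the power map modulo
  \<open>Q\<close>, hence congruent to elements of \<open>OI k\<close>. Auxiliary primes have norm
  at least \<open>n\<close>: the type (1, ..., 1), which separates new fields from old ones, needs
  \<open>n\<close> orbits of length one, and there are exactly \<open>q\<close> of them. The three
  types that force the symmetric group repeat no part except 1, so a single orbit of each other
  length is enough for them.\<close>

locale csubring =
  fixes A :: "complex set"
  assumes zero: "0 \<in> A" and one: "1 \<in> A"
    and add: "x \<in> A \<Longrightarrow> y \<in> A \<Longrightarrow> x + y \<in> A"
    and diff: "x \<in> A \<Longrightarrow> y \<in> A \<Longrightarrow> x - y \<in> A"
    and mult: "x \<in> A \<Longrightarrow> y \<in> A \<Longrightarrow> x * y \<in> A"
begin

lemma uminus: "x \<in> A \<Longrightarrow> - x \<in> A"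
  using diff[OF zero, of x] by simp

lemma power: "x \<in> A \<Longrightarrow> x ^ n \<in> A"
  by (induction n) (auto intro: one mult)

lemma sum: "(\<And>i. i \<in> I \<Longrightarrow> f i \<in> A) \<Longrightarrow> sum f I \<in> A"
  by (induction I rule: infinite_finite_induct) (auto intro: zero add)

lemma prod: "(\<And>i. i \<in> I \<Longrightarrow> f i \<in> A) \<Longrightarrow> prod f I \<in> A"
  by (induction I rule: infinite_finite_induct) (auto intro: one mult)

lemma of_nat: "of_nat n \<in> A"
  by (induction n) (auto intro: zero one add)

lemma of_int: "of_int n \<in> A"
  by (cases n rule: int_cases2) (auto intro: of_nat uminus)

lemma Ints: "x \<in> \<int> \<Longrightarrow> x \<in> A"
  by (auto elim!: Ints_cases intro: of_int)

lemma signof: "(signof p :: complex) \<in> A"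
  by (auto simp: sign_def intro: one uminus)

end

lemma csubring_Ints: "csubring \<int>"
  by unfold_locales auto

locale cfield = csubring F for F +
  assumes inverse: "x \<in> F \<Longrightarrow> inverse x \<in> F"

section \<open>Polynomials with coefficients in a subring\<close>

definition pover :: "complex set \<Rightarrow> complex poly \<Rightarrow> bool" where
  "pover A p \<longleftrightarrow> (\<forall>i. poly.coeff p i \<in> A)"

lemma pover_mono: "pover A p \<Longrightarrow> A \<subseteq> B \<Longrightarrow> pover B p"
  by (auto simp: pover_def)

context csubring
begin

lemma pover_0: "pover A 0" by (simp add: pover_def zero)
lemma pover_1: "pover A 1" by (auto simp: pover_def zero one)

lemma pover_pCons: "c \<in> A \<Longrightarrow> pover A p \<Longrightarrow> pover A (pCons c p)"
  by (auto simp: pover_def coeff_pCons split: nat.splits)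

lemma pover_const: "c \<in> A \<Longrightarrow> pover A [:c:]"
  by (intro pover_pCons pover_0)

lemma pover_add: "pover A p \<Longrightarrow> pover A q \<Longrightarrow> pover A (p + q)"
  by (auto simp: pover_def add)

lemma pover_diff: "pover A p \<Longrightarrow> pover A q \<Longrightarrow> pover A (p - q)"
  by (auto simp: pover_def diff)

lemma pover_mult: "pover A p \<Longrightarrow> pover A q \<Longrightarrow> pover A (p * q)"
  by (auto simp: pover_def coeff_mult intro!: sum mult)

lemma pover_smult: "c \<in> A \<Longrightarrow> pover A q \<Longrightarrow> pover A (Polynomial.smult c q)"
  by (auto simp: pover_def mult)

lemma pover_monom: "c \<in> A \<Longrightarrow> pover A (Polynomial.monom c n)"
  by (auto simp: pover_def zero)

lemma pover_prod: "(\<And>i. i \<in> I \<Longrightarrow> pover A (f i)) \<Longrightarrow> pover A (prod f I)"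
  by (induction I rule: infinite_finite_induct) (auto intro: pover_1 pover_mult)

lemma pover_sum: "(\<And>i. i \<in> I \<Longrightarrow> pover A (f i)) \<Longrightarrow> pover A (sum f I)"
  by (induction I rule: infinite_finite_induct) (auto intro: pover_0 pover_add)

lemma poly_in: "pover A p \<Longrightarrow> x \<in> A \<Longrightarrow> poly p x \<in> A"
  by (auto simp: poly_altdef pover_def intro!: sum mult power)

text \<open>Long division divides only by the leading coefficient of the divisor, so for monic
  \<open>m\<close> it stays inside a ring such as \<open>OI k\<close>. The alternative
  \<open>r = 0\<close> covers divisors of degree 0.\<close>

lemma monic_division:
  assumes "pover A p" "pover A m" "monic m"
  shows "\<exists>q r. pover A q \<and> pover A r \<and> p = q * m + r \<and> (r = 0 \<or> Polynomial.degree r < Polynomial.degree m)"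
  using assms(1)
proof (induction "Polynomial.degree p" arbitrary: p rule: less_induct)
  case less
  show ?case
  proof (cases "p = 0 \<or> Polynomial.degree p < Polynomial.degree m")
    case True
    then show ?thesis using less.prems pover_0
      by (intro exI[of _ 0] exI[of _ p]) auto
  next
    case False
    then have p0: "p \<noteq> 0" and le: "Polynomial.degree m \<le> Polynomial.degree p" by auto
    have m0: "m \<noteq> 0" using assms(3) by auto
    define t where "t = Polynomial.monom (lead_coeff p) (Polynomial.degree p - Polynomial.degree m)"
    have t: "pover A t" unfolding t_def using less.prems by (intro pover_monom) (auto simp: pover_def)
    have lcp: "lead_coeff p \<noteq> 0" using p0 by auto
    have t0: "t \<noteq> 0" using lcp by (auto simp: t_def)
    have degtm: "Polynomial.degree (t * m) = Polynomial.degree p"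
      using le lcp m0 t0 by (simp add: degree_mult_eq t_def degree_monom_eq)
    have "lead_coeff (t * m) = lead_coeff p"
      using assms(3) lcp by (simp add: lead_coeff_mult t_def degree_monom_eq)
    with degtm have lc: "poly.coeff (t * m) (Polynomial.degree p) = lead_coeff p" by simp
    define p' where "p' = p - t * m"
    have p': "pover A p'" unfolding p'_def by (intro pover_diff less.prems pover_mult t assms)
    show ?thesis
    proof (cases "p' = 0 \<or> Polynomial.degree p' < Polynomial.degree p")
      case True
      have "\<exists>q r. pover A q \<and> pover A r \<and> p' = q * m + r \<and> (r = 0 \<or> Polynomial.degree r < Polynomial.degree m)"
      proof (cases "p' = 0")
        case True
        then show ?thesis using pover_0 by (intro exI[of _ 0]) auto
      next
        case False
        with True less.hyps[of p'] p' show ?thesis by blast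
      qed
      then obtain q r where qr: "pover A q" "pover A r" "p' = q * m + r"
        "r = 0 \<or> Polynomial.degree r < Polynomial.degree m" by blast
      show ?thesis
        using qr pover_add[OF qr(1) t]
        by (intro exI[of _ "q + t"] exI[of _ r]) (auto simp: p'_def algebra_simps)
    next
      case False
      then have "p' \<noteq> 0" "Polynomial.degree p \<le> Polynomial.degree p'" by auto
      moreover have "Polynomial.degree p' \<le> Polynomial.degree p"
        unfolding p'_def by (rule degree_diff_le) (use degtm in auto)
      ultimately have "Polynomial.degree p' = Polynomial.degree p" by simp
      moreover have "poly.coeff p' (Polynomial.degree p) = 0" unfolding p'_def using lc by simp
      ultimately have "lead_coeff p' = 0" by simp
      with \<open>p' \<noteq> 0\<close> show ?thesis by simp
    qed
  qed
qed

end

section \<open>Ideals, congruences and determinants modulo an ideal\<close>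

locale cideal = csubring A for A +
  fixes I :: "complex set"
  assumes sub: "I \<subseteq> A" and izero: "0 \<in> I"
    and iadd: "x \<in> I \<Longrightarrow> y \<in> I \<Longrightarrow> x + y \<in> I"
    and imult: "a \<in> A \<Longrightarrow> x \<in> I \<Longrightarrow> a * x \<in> I"
begin

lemma imult': "a \<in> A \<Longrightarrow> x \<in> I \<Longrightarrow> x * a \<in> I"
  using imult[of a x] by (simp add: mult.commute)

lemma iuminus: "x \<in> I \<Longrightarrow> - x \<in> I"
  using imult[of "-1" x] uminus[OF one] by simp

lemma idiff: "x \<in> I \<Longrightarrow> y \<in> I \<Longrightarrow> x - y \<in> I"
  using iadd[of x "-y"] iuminus by simp

lemma isum: "(\<And>i. i \<in> J \<Longrightarrow> f i \<in> I) \<Longrightarrow> Groups_Big.sum f J \<in> I"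
  by (induction J rule: infinite_finite_induct) (auto intro: izero iadd)

lemma ipower: "x \<in> I \<Longrightarrow> n > 0 \<Longrightarrow> x ^ n \<in> I"
  using imult'[of "x ^ (n - 1)" x] sub power[of x "n - 1"] by (cases n) (auto simp: mult.commute)

lemma iprod: "finite J \<Longrightarrow> j \<in> J \<Longrightarrow> (\<And>i. i \<in> J \<Longrightarrow> f i \<in> A) \<Longrightarrow> f j \<in> I \<Longrightarrow> Groups_Big.prod f J \<in> I"
  by (subst prod.remove[of J j]) (auto intro!: imult' prod)

text \<open>Only the difference is constrained; \<open>x\<close> and \<open>y\<close> need not lie
  in \<open>A\<close>. The multiplicative rules therefore ask for membership of the right-hand
  sides, and \<open>cg_A\<close> supplies it for the left-hand sides.\<close>

definition cg :: "complex \<Rightarrow> complex \<Rightarrow> bool" where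
  "cg x y \<longleftrightarrow> x - y \<in> I"

lemma cg_refl [simp]: "cg x x" by (simp add: cg_def izero)

lemma cg_sym: "cg x y \<Longrightarrow> cg y x"
  unfolding cg_def using iuminus[of "x - y"] by simp

lemma cg_trans [trans]: "cg x y \<Longrightarrow> cg y z \<Longrightarrow> cg x z"
  unfolding cg_def using iadd[of "x - y" "y - z"] by simp

lemma cg_in: "cg x y \<Longrightarrow> x \<in> I \<longleftrightarrow> y \<in> I"
  unfolding cg_def using iadd[of "x - y" y] idiff[of x "x - y"] by auto

lemma cg_0: "cg x 0 \<longleftrightarrow> x \<in> I" by (simp add: cg_def)

lemma cg_A: "cg x y \<Longrightarrow> y \<in> A \<Longrightarrow> x \<in> A"
  unfolding cg_def using add[of "x - y" y] sub by auto

lemma cg_add: "cg x x' \<Longrightarrow> cg y y' \<Longrightarrow> cg (x + y) (x' + y')"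
  unfolding cg_def using iadd[of "x - x'" "y - y'"] by (simp add: algebra_simps)

lemma cg_mult:
  assumes "cg x x'" "cg y y'" "x' \<in> A" "y' \<in> A"
  shows "cg (x * y) (x' * y')"
proof -
  have "y \<in> A" using assms cg_A by blast
  have "x * y - x' * y' = y * (x - x') + x' * (y - y')" by (simp add: algebra_simps)
  then show ?thesis unfolding cg_def using assms \<open>y \<in> A\<close> by (auto intro!: iadd imult simp: cg_def)
qed

lemma cg_power: "cg x y \<Longrightarrow> y \<in> A \<Longrightarrow> cg (x ^ n) (y ^ n)"
  by (induction n) (auto intro!: cg_mult power)

lemma cg_sum: "(\<And>i. i \<in> J \<Longrightarrow> cg (f i) (g i)) \<Longrightarrow> cg (Groups_Big.sum f J) (Groups_Big.sum g J)"
  by (induction J rule: infinite_finite_induct) (auto intro: cg_add)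

lemma cg_prod: "(\<And>i. i \<in> J \<Longrightarrow> cg (f i) (g i)) \<Longrightarrow> (\<And>i. i \<in> J \<Longrightarrow> g i \<in> A) \<Longrightarrow>
    cg (Groups_Big.prod f J) (Groups_Big.prod g J)"
  by (induction J rule: infinite_finite_induct) (auto intro!: cg_mult prod)

text \<open>By the Leibniz formula the determinant is a polynomial in the entries with coefficients
  1 and -1.\<close>

lemma cg_det:
  assumes "\<And>i j. i < m \<Longrightarrow> j < m \<Longrightarrow> cg (W i j) (Y i j)"
    and "\<And>i j. i < m \<Longrightarrow> j < m \<Longrightarrow> Y i j \<in> A"
  shows "cg (det (mat m m (\<lambda>(i, j). W i j))) (det (mat m m (\<lambda>(i, j). Y i j)))"
proof -
  have *: "det (mat m m (\<lambda>(i, j). Z i j)) =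
      (\<Sum>p\<in>{p. p permutes {0..<m}}. signof p * (\<Prod>i = 0..<m. Z i (p i)))" for Z :: "nat \<Rightarrow> nat \<Rightarrow> complex"
    by (subst det_def'[of _ m]) (auto intro!: sum.cong prod.cong dest: permutes_in_image)
  have "cg (W i (p i)) (Y i (p i)) \<and> Y i (p i) \<in> A" if "p permutes {0..<m}" "i < m" for p i
    using assms that permutes_in_image[of p "{0..<m}" i] by auto
  then show ?thesis unfolding *
    by (intro cg_sum cg_mult cg_prod prod signof) auto
qed

lemma det_in:
  assumes "\<And>i j. i < m \<Longrightarrow> j < m \<Longrightarrow> Y i j \<in> A"
  shows "det (mat m m (\<lambda>(i, j). Y i j)) \<in> A"
proof -
  have *: "det (mat m m (\<lambda>(i, j). Z i j)) =
      (\<Sum>p\<in>{p. p permutes {0..<m}}. signof p * (\<Prod>i = 0..<m. Z i (p i)))" for Z :: "nat \<Rightarrow> nat \<Rightarrow> complex"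
    by (subst det_def'[of _ m]) (auto intro!: sum.cong prod.cong dest: permutes_in_image)
  have "Y i (p i) \<in> A" if "p permutes {0..<m}" "i < m" for p i
    using assms that permutes_in_image[of p "{0..<m}" i] by auto
  then show ?thesis unfolding * by (intro sum mult prod signof) auto
qed

end

locale cprime = cideal A P for A P +
  assumes one_notin: "1 \<notin> P"
    and prime: "x \<in> A \<Longrightarrow> y \<in> A \<Longrightarrow> x * y \<in> P \<Longrightarrow> x \<in> P \<or> y \<in> P"
begin

lemma prime_power: "x \<in> A \<Longrightarrow> x ^ n \<in> P \<Longrightarrow> x \<in> P"
  by (induction n) (use prime power one_notin in auto)

lemma prime_prod: "finite J \<Longrightarrow> (\<And>i. i \<in> J \<Longrightarrow> f i \<in> A) \<Longrightarrow> Groups_Big.prod f J \<in> P \<Longrightarrow> \<exists>i\<in>J. f i \<in> P"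
proof (induction J rule: finite_induct)
  case (insert j J)
  then have "f j \<in> P \<or> Groups_Big.prod f J \<in> P" by (intro prime prod) auto
  then show ?case using insert by auto
qed (use one_notin in auto)

end

section \<open>Algebraic integers\<close>

text \<open>The coefficient set may be an ideal: \<open>lspan P B\<close> is then \<open>P\<close>
  times the module spanned by the finite set \<open>B\<close>, which is the form needed for
  Nakayama's lemma.\<close>

definition lspan :: "complex set \<Rightarrow> complex set \<Rightarrow> complex set" where
  "lspan A B = {\<Sum>b\<in>B. c b * b | c. \<forall>b\<in>B. c b \<in> A}"

lemma lspan_I: "(\<And>b. b \<in> B \<Longrightarrow> c b \<in> A) \<Longrightarrow> x = (\<Sum>b\<in>B. c b * b) \<Longrightarrow> x \<in> lspan A B"
  unfolding lspan_def by blast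

context cideal
begin

lemma lspan_zero: "0 \<in> lspan I B"
  by (rule lspan_I[where c = "\<lambda>_. 0"]) (auto simp: izero)

lemma lspan_add: "x \<in> lspan I B \<Longrightarrow> y \<in> lspan I B \<Longrightarrow> x + y \<in> lspan I B"
proof -
  assume "x \<in> lspan I B" "y \<in> lspan I B"
  then obtain c d where *: "\<And>b. b \<in> B \<Longrightarrow> c b \<in> I" "x = (\<Sum>b\<in>B. c b * b)"
    "\<And>b. b \<in> B \<Longrightarrow> d b \<in> I" "y = (\<Sum>b\<in>B. d b * b)" unfolding lspan_def by blast
  then show ?thesis
    by (intro lspan_I[where c = "\<lambda>b. c b + d b"]) (auto simp: sum.distrib algebra_simps iadd)
qed

lemma lspan_sum: "(\<And>i. i \<in> J \<Longrightarrow> f i \<in> lspan I B) \<Longrightarrow> Groups_Big.sum f J \<in> lspan I B"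
  by (induction J rule: infinite_finite_induct) (auto intro: lspan_zero lspan_add)

lemma lspan_smult:
  assumes "a \<in> A" "x \<in> lspan I B"
  shows "a * x \<in> lspan I B"
proof -
  from assms obtain c where *: "\<And>b. b \<in> B \<Longrightarrow> c b \<in> I" "x = (\<Sum>b\<in>B. c b * b)"
    unfolding lspan_def by blast
  show ?thesis unfolding *
    by (rule lspan_I[where c = "\<lambda>b. a * c b"]) (auto simp: sum_distrib_left algebra_simps imult * assms)
qed

lemma lspan_ideal_mult:
  assumes "a \<in> I" "x \<in> lspan A B"
  shows "a * x \<in> lspan I B"
proof -
  from assms obtain c where *: "\<And>b. b \<in> B \<Longrightarrow> c b \<in> A" "x = (\<Sum>b\<in>B. c b * b)"
    unfolding lspan_def by blast
  show ?thesis unfolding *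
    by (rule lspan_I[where c = "\<lambda>b. a * c b"]) (auto simp: sum_distrib_left algebra_simps imult' * assms)
qed

lemma lspan_subset:
  assumes "finite B'" "B \<subseteq> B'"
  shows "lspan I B \<subseteq> lspan I B'"
proof
  fix x assume "x \<in> lspan I B"
  then obtain c where *: "\<And>b. b \<in> B \<Longrightarrow> c b \<in> I" "x = (\<Sum>b\<in>B. c b * b)"
    unfolding lspan_def by blast
  have "x = (\<Sum>b\<in>B'. (if b \<in> B then c b else 0) * b)"
    unfolding * using assms by (intro sum.mono_neutral_cong_left) auto
  then show "x \<in> lspan I B'"
    by (intro lspan_I[where c = "\<lambda>b. if b \<in> B then c b else 0"]) (auto simp: izero *)
qed

end

lemma lspan_mono: "A \<subseteq> A' \<Longrightarrow> lspan A B \<subseteq> lspan A' B"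
  unfolding lspan_def by blast

lemma (in csubring) cideal_self: "cideal A A"
  by unfold_locales (auto intro: zero add mult)

lemma lspan_base: "finite B \<Longrightarrow> b \<in> B \<Longrightarrow> 0 \<in> A \<Longrightarrow> 1 \<in> A \<Longrightarrow> b \<in> lspan A B"
  by (rule lspan_I[where c = "\<lambda>x. if x = b then 1 else 0"])
    (auto simp: if_distrib[of "\<lambda>y. y * _"] cong: if_cong)

text \<open>The numbers \<open>a i\<close> form a nonzero vector in the kernel of
  \<open>z - M\<close>.\<close>

lemma det_eigen_zero:
  fixes a :: "nat \<Rightarrow> complex"
  assumes "\<And>i. i < m \<Longrightarrow> z * a i = (\<Sum>l<m. M i l * a l)" and "i0 < m" "a i0 \<noteq> 0"
  shows "det (mat m m (\<lambda>(i, j). (if i = j then z else 0) - M i j)) = 0"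
proof -
  let ?A = "mat m m (\<lambda>(i, j). (if i = j then z else 0) - M i j)"
  have "vec m a \<noteq> 0\<^sub>v m" using assms(2,3) by (metis index_vec index_zero_vec(1))
  moreover have "?A *\<^sub>v vec m a = 0\<^sub>v m"
  proof (rule eq_vecI)
    fix i assume "i < dim_vec (0\<^sub>v m)"
    then have i: "i < m" by simp
    have "(?A *\<^sub>v vec m a) $ i = (\<Sum>j<m. ((if i = j then z else 0) - M i j) * a j)"
      using i by (simp add: scalar_prod_def atLeast0LessThan)
    also have "\<dots> = (\<Sum>j<m. (if i = j then z * a j else 0)) - (\<Sum>j<m. M i j * a j)"
      unfolding sum_subtractf[symmetric] by (rule sum.cong) (auto simp: algebra_simps)
    also have "\<dots> = 0" using i assms(1)[OF i] by simp
    finally show "(?A *\<^sub>v vec m a) $ i = 0\<^sub>v m $ i" using i by simp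
  qed simp
  ultimately show ?thesis
    by (subst det_0_iff_vec_prod_zero[of _ m]) (auto intro!: exI[of _ "vec m a"])
qed

lemma lspan_matrix:
  assumes "finite B" "\<And>b. b \<in> B \<Longrightarrow> z * b \<in> lspan I B"
  obtains h M where "bij_betw h {..<card B} B" "\<And>i j. i < card B \<Longrightarrow> j < card B \<Longrightarrow> M i j \<in> I"
    "\<And>i. i < card B \<Longrightarrow> z * h i = (\<Sum>l<card B. M i l * h l)"
proof -
  obtain h where h: "bij_betw h {..<card B} B"
    using ex_bij_betw_nat_finite[OF assms(1)] atLeast0LessThan by auto
  have "\<forall>b\<in>B. \<exists>c. (\<forall>b'\<in>B. c b' \<in> I) \<and> z * b = (\<Sum>b'\<in>B. c b' * b')"
    using assms(2) unfolding lspan_def by blast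
  then obtain c where c: "\<And>b b'. b \<in> B \<Longrightarrow> b' \<in> B \<Longrightarrow> c b b' \<in> I"
    "\<And>b. b \<in> B \<Longrightarrow> z * b = (\<Sum>b'\<in>B. c b b' * b')" by metis
  have hB: "h i \<in> B" if "i < card B" for i using h that by (auto simp: bij_betw_def)
  show ?thesis
  proof (rule that[OF h, of "\<lambda>i j. c (h i) (h j)"])
    fix i assume i: "i < card B"
    show "z * h i = (\<Sum>l<card B. c (h i) (h l) * h l)"
      unfolding c(2)[OF hB[OF i]] by (rule sum.reindex_bij_betw[OF h, symmetric])
  qed (use c hB in auto)
qed

text \<open>Nakayama's lemma in determinant form.\<close>

lemma (in cprime) det_trick:
  assumes "finite B" "b0 \<in> B" "b0 \<noteq> 0" "u \<in> A" "\<And>b. b \<in> B \<Longrightarrow> u * b \<in> lspan P B"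
  shows "u \<in> P"
proof -
  obtain h M where h: "bij_betw h {..<card B} B" "\<And>i j. i < card B \<Longrightarrow> j < card B \<Longrightarrow> M i j \<in> P"
    "\<And>i. i < card B \<Longrightarrow> u * h i = (\<Sum>l<card B. M i l * h l)"
    using lspan_matrix[OF assms(1,5)] by blast
  let ?m = "card B"
  have "b0 \<in> h ` {..<?m}" using h(1) assms(2) by (simp add: bij_betw_def)
  then obtain i0 where i0: "i0 < ?m" "h i0 = b0" by auto
  have "det (mat ?m ?m (\<lambda>(i, j). (if i = j then u else 0) - M i j)) = 0"
    by (rule det_eigen_zero[OF h(3) i0(1)]) (use i0 assms in auto)
  \<comment> \<open>Modulo \<open>P\<close> the matrix \<open>u - M\<close> is the scalar matrix
    \<open>u\<close>, whose determinant is \<open>u ^ card B\<close>.\<close>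
  moreover have "cg (det (mat ?m ?m (\<lambda>(i, j). (if i = j then u else 0) - M i j)))
      (det (mat ?m ?m (\<lambda>(i, j). (if i = j then u else 0))))"
    using h(2) assms(4) zero by (intro cg_det) (auto simp: cg_def intro: iuminus)
  moreover have "mat ?m ?m (\<lambda>(i, j). (if i = j then u else 0)) = u \<cdot>\<^sub>m 1\<^sub>m ?m"
    by (rule eq_matI) auto
  then have "det (mat ?m ?m (\<lambda>(i, j). (if i = j then u else 0))) = u ^ ?m" by simp
  ultimately have "u ^ ?m \<in> P" using cg_in izero by simp
  then show ?thesis using prime_power assms by blast
qed

text \<open>Multiplication by \<open>z\<close> on the lattice is given by an integer matrix;
  \<open>z\<close> is an eigenvalue, hence a root of the characteristic polynomial, which is monic
  with integer coefficients.\<close>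

lemma algebraic_int_if_lattice:
  assumes "finite B" "b0 \<in> B" "b0 \<noteq> 0" "\<And>b. b \<in> B \<Longrightarrow> z * b \<in> lspan \<int> B"
  shows "algebraic_int (z :: complex)"
proof -
  obtain h M where h: "bij_betw h {..<card B} B" "\<And>i j. i < card B \<Longrightarrow> j < card B \<Longrightarrow> M i j \<in> \<int>"
    "\<And>i. i < card B \<Longrightarrow> z * h i = (\<Sum>l<card B. M i l * h l)"
    using lspan_matrix[OF assms(1,4)] by blast
  let ?m = "card B"
  have "b0 \<in> h ` {..<?m}" using h(1) assms(2) by (simp add: bij_betw_def)
  then obtain i0 where i0: "i0 < ?m" "h i0 = b0" by auto
  \<comment> \<open>The entries are complex numbers known to be integers; the floor of the real part
    recovers them in type \<open>int\<close>.\<close>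
  define N where "N = mat ?m ?m (\<lambda>(i, j). \<lfloor>Re (M i j)\<rfloor>)"
  have M: "of_int \<lfloor>Re (M i j)\<rfloor> = M i j" if "i < ?m" "j < ?m" for i j
    using h(2)[OF that] by (auto elim!: Ints_cases)
  have N: "N \<in> carrier_mat ?m ?m" by (simp add: N_def)
  let ?N = "map_mat of_int N :: complex mat"
  have "eigenvalue ?N z"
    unfolding eigenvalue_def eigenvector_def
  proof (intro exI[of _ "vec ?m h"] conjI)
    show "vec ?m h \<noteq> 0\<^sub>v (dim_row ?N)" using i0 assms(3) N by (metis carrier_matD(1) index_map_mat(2) index_vec index_zero_vec(1))
    show "?N *\<^sub>v vec ?m h = z \<cdot>\<^sub>v vec ?m h"
      using N by (intro eq_vecI) (auto simp: N_def scalar_prod_def atLeast0LessThan h(3) M)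
  qed (use N in auto)
  then have "poly (char_poly ?N) z = 0"
    using eigenvalue_root_char_poly[of ?N ?m] N by auto
  then have "poly (of_int_poly (char_poly N)) z = 0"
    using of_int_hom.char_poly_hom[OF N, where ?'a = complex] by simp
  moreover have "monic (char_poly N)" using degree_monic_char_poly[OF N] by auto
  ultimately show ?thesis unfolding algebraic_int_altdef_ipoly by blast
qed

text \<open>If \<open>W\<close> stabilises the lattice spanned by \<open>B\<close>, then
  \<open>W\<close> and \<open>x\<close> stabilise the one spanned by the products
  \<open>b * x ^ l\<close> with \<open>l\<close> below the degree: the monic relation rewrites the
  next power of \<open>x\<close> through lower ones, with coefficients that act on the span of
  \<open>B\<close>.\<close>

lemma lattice_step:
  assumes "finite B" "1 \<in> B" and st: "\<And>y b. y \<in> W \<Longrightarrow> b \<in> B \<Longrightarrow> y * b \<in> lspan \<int> B"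
    and p: "monic p" "poly p x = 0" "\<And>i. poly.coeff p i \<in> W \<union> \<int>"
  shows "\<exists>B'. finite B' \<and> 1 \<in> B' \<and> (\<forall>y\<in>insert x W. \<forall>b\<in>B'. y * b \<in> lspan \<int> B')"
proof -
  interpret Z: cideal \<int> \<int> using csubring.cideal_self[OF csubring_Ints] .
  define n where "n = Polynomial.degree p"
  have n: "n > 0"
  proof (rule ccontr)
    assume "\<not> n > 0"
    then have "p = [:1:]" using p(1) degree_0_id[of p] by (simp add: n_def)
    then show False using p(2) by simp
  qed
  define B' where "B' = (\<lambda>(b, l). b * x ^ l) ` (B \<times> {..<n})"
  have B': "finite B'" unfolding B'_def using assms by simp
  have mem: "b * x ^ l \<in> B'" if "b \<in> B" "l < n" for b l unfolding B'_def using that by force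
  have mv: "z * x ^ l \<in> lspan \<int> B'" if z: "z \<in> lspan \<int> B" and l: "l < n" for z l
  proof -
    from z obtain c where c: "\<And>b. b \<in> B \<Longrightarrow> c b \<in> \<int>" "z = (\<Sum>b\<in>B. c b * b)"
      unfolding lspan_def by blast
    have "z * x ^ l = (\<Sum>b\<in>B. c b * (b * x ^ l))" unfolding c sum_distrib_right by (simp add: algebra_simps)
    also have "\<dots> \<in> lspan \<int> B'"
      by (intro Z.lspan_sum Z.lspan_smult c(1) lspan_base B' mem l) auto
    finally show ?thesis .
  qed
  have coeff_st: "poly.coeff p i * b \<in> lspan \<int> B" if "b \<in> B" for i b
  proof (cases "poly.coeff p i \<in> W")
    case False
    then show ?thesis using p(3)[of i] that assms(1) by (auto intro!: Z.lspan_smult lspan_base)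
  qed (use st that in auto)
  have "y * b' \<in> lspan \<int> B'" if "y \<in> insert x W" "b' \<in> B'" for y b'
  proof -
    from that(2) obtain b l where b: "b \<in> B" "l < n" "b' = b * x ^ l" unfolding B'_def by auto
    show ?thesis
    proof (cases "y \<in> W")
      case True
      then show ?thesis using mv[OF st[OF True b(1)] b(2)] b(3) by (simp add: algebra_simps)
    next
      case False
      then have y: "y = x" using that by simp
      show ?thesis
      proof (cases "Suc l < n")
        case True
        then show ?thesis using lspan_base[OF B' mem[OF b(1) True]] y b(3)
          by (simp add: algebra_simps)
      next
        case False
        then have l: "Suc l = n" using b by simp
        have "0 = (\<Sum>i<n. poly.coeff p i * x ^ i) + x ^ n"
          using p(1,2) unfolding poly_altdef n_def[symmetric] by (simp add: lessThan_Suc_atMost[symmetric])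
        then have "x ^ n = - (\<Sum>i<n. poly.coeff p i * x ^ i)" by (simp add: eq_neg_iff_add_eq_0 add.commute)
        then have "y * b' = (\<Sum>i<n. (- 1) * ((poly.coeff p i * b) * x ^ i))"
          unfolding y b(3) using l by (simp add: algebra_simps sum_distrib_left sum_negf flip: power_Suc)
        also have "\<dots> \<in> lspan \<int> B'"
          by (intro Z.lspan_sum Z.lspan_smult mv coeff_st b) auto
        finally show ?thesis .
      qed
    qed
  qed
  moreover have "1 \<in> B'" using mem[OF assms(2), of 0] n by simp
  ultimately show ?thesis using B' by blast
qed

lemma lattice_exists:
  assumes "finite W" "\<And>x. x \<in> W \<Longrightarrow> algebraic_int x"
  shows "\<exists>B. finite B \<and> (1::complex) \<in> B \<and> (\<forall>y\<in>W. \<forall>b\<in>B. y * b \<in> lspan \<int> B)"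
  using assms
proof (induction W rule: finite_induct)
  case empty
  then show ?case by (intro exI[of _ "{1}"]) auto
next
  case (insert x W)
  then obtain B where B: "finite B" "(1::complex) \<in> B" "\<And>y b. y \<in> W \<Longrightarrow> b \<in> B \<Longrightarrow> y * b \<in> lspan \<int> B"
    by auto
  from insert.prems[of x] obtain p where p: "monic p" "\<And>i. poly.coeff p i \<in> \<int>" "poly p x = 0"
    by (auto simp: algebraic_int.simps)
  show ?case using lattice_step[OF B p(1,3)] p(2) by blast
qed

text \<open>Integrality is transitive: the coefficients stabilise a common lattice, and one more
  step adjoins \<open>x\<close>.\<close>

theorem algebraic_int_root_of_monic:
  fixes x :: complex
  assumes "monic p" "poly p x = 0" "\<And>i. algebraic_int (poly.coeff p i)"
  shows "algebraic_int x"
proof -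
  have "finite (set (coeffs p))" by simp
  then obtain B where B: "finite B" "1 \<in> B" "\<And>y b. y \<in> set (coeffs p) \<Longrightarrow> b \<in> B \<Longrightarrow> y * b \<in> lspan \<int> B"
    using lattice_exists[of "set (coeffs p)"] assms(3) by (force simp: in_set_conv_nth nth_coeffs_coeff length_coeffs_degree)
  have "poly.coeff p i \<in> set (coeffs p) \<union> \<int>" for i
    using range_coeff[of p] rangeI[of "poly.coeff p" i] by auto
  from lattice_step[OF B assms(1,2) this] obtain B' where
    "finite B'" "1 \<in> B'" "\<forall>b\<in>B'. x * b \<in> lspan \<int> B'" by auto
  then show ?thesis using algebraic_int_if_lattice[of B' 1 x] by auto
qed

abbreviation "AI \<equiv> {x :: complex. algebraic_int x}"

text \<open>Two algebraic integers stabilise a common lattice, and so do their sum, difference and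
  product.\<close>

interpretation AI: csubring AI
proof
  interpret Z: cideal \<int> \<int> using csubring.cideal_self[OF csubring_Ints] .
  fix x y :: complex
  assume "x \<in> AI" "y \<in> AI"
  then have "algebraic_int a" if "a \<in> {x, y}" for a using that by auto
  then obtain B where B: "finite B" "1 \<in> B" "\<And>u b. u \<in> {x, y} \<Longrightarrow> b \<in> B \<Longrightarrow> u * b \<in> lspan \<int> B"
    using lattice_exists[of "{x, y}"] by auto
  have yl: "y * l \<in> lspan \<int> B" if l: "l \<in> lspan \<int> B" for l
  proof -
    from l obtain c where c: "\<And>b. b \<in> B \<Longrightarrow> c b \<in> \<int>" "l = (\<Sum>b\<in>B. c b * b)"
      unfolding lspan_def by blast
    have "y * l = (\<Sum>b\<in>B. c b * (y * b))" unfolding c by (simp add: sum_distrib_left algebra_simps)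
    also have "\<dots> \<in> lspan \<int> B" by (intro Z.lspan_sum Z.lspan_smult c(1) B) auto
    finally show ?thesis .
  qed
  show "x + y \<in> AI" "x - y \<in> AI" "x * y \<in> AI"
  proof -
    have "algebraic_int (x + y)"
      by (rule algebraic_int_if_lattice[OF B(1,2)])
        (use B(3) Z.lspan_add in \<open>auto simp: distrib_right\<close>)
    moreover have "algebraic_int (x - y)"
    proof (rule algebraic_int_if_lattice[OF B(1,2)])
      fix b assume b: "b \<in> B"
      have "(x - y) * b = x * b + (-1) * (y * b)" by (simp add: algebra_simps)
      also have "\<dots> \<in> lspan \<int> B" by (intro Z.lspan_add Z.lspan_smult B) (auto simp: b)
      finally show "(x - y) * b \<in> lspan \<int> B" .
    qed simp
    moreover have "algebraic_int (x * y)"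
    proof (rule algebraic_int_if_lattice[OF B(1,2)])
      fix b assume b: "b \<in> B"
      have "x * y * b = y * (x * b)" by (simp add: algebra_simps)
      also have "\<dots> \<in> lspan \<int> B" by (intro yl B) (auto simp: b)
      finally show "x * y * b \<in> lspan \<int> B" .
    qed simp
    ultimately show "x + y \<in> AI" "x - y \<in> AI" "x * y \<in> AI" by auto
  qed
qed (auto intro: int_imp_algebraic_int)

section \<open>Prime ideals above a given ideal\<close>

text \<open>Zorn's lemma gives an ideal that is maximal among those containing \<open>I\<close> and
  missing 1; maximality makes it prime.\<close>

lemma (in cideal) exists_prime_above:
  assumes "1 \<notin> I"
  shows "\<exists>Q. cprime A Q \<and> I \<subseteq> Q"
proof -
  define S where "S = {J. cideal A J \<and> I \<subseteq> J \<and> 1 \<notin> J}"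
  have "\<exists>M\<in>S. \<forall>W\<in>S. M \<subseteq> W \<longrightarrow> W = M"
  proof (rule subset_Zorn_nonempty)
    show "S \<noteq> {}" using assms cideal_axioms by (auto simp: S_def)
    fix C assume C: "C \<noteq> {}" "subset.chain S C"
    then have CS: "\<And>J. J \<in> C \<Longrightarrow> cideal A J \<and> I \<subseteq> J \<and> 1 \<notin> J"
      and tot: "\<And>J K. J \<in> C \<Longrightarrow> K \<in> C \<Longrightarrow> J \<subseteq> K \<or> K \<subseteq> J"
      by (auto simp: S_def subset.chain_def)
    have "cideal A (\<Union>C)"
    proof unfold_locales
      show "\<Union>C \<subseteq> A" by (rule Union_least, rule cideal.sub[OF conjunct1[OF CS]])
      from C(1) obtain J where J: "J \<in> C" by auto
      then show "0 \<in> \<Union>C" using cideal.izero[OF conjunct1[OF CS[OF J]]] by auto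
      fix x y assume "x \<in> \<Union>C" "y \<in> \<Union>C"
      then obtain J K where J: "J \<in> C" "x \<in> J" "K \<in> C" "y \<in> K" by auto
      have "J \<subseteq> K \<or> K \<subseteq> J" by (rule tot) (use J in auto)
      then have "x \<in> K \<or> y \<in> J" using J(2,4) by auto
      then have "x + y \<in> K \<or> x + y \<in> J"
        using J(2,4) cideal.iadd[OF conjunct1[OF CS[OF J(1)]], of x y]
          cideal.iadd[OF conjunct1[OF CS[OF J(3)]], of x y] by argo
      then show "x + y \<in> \<Union>C" using J by auto
    next
      fix a x assume a: "a \<in> A" and "x \<in> \<Union>C"
      then obtain J where J: "J \<in> C" "x \<in> J" by auto
      then show "a * x \<in> \<Union>C" using cideal.imult[OF conjunct1[OF CS[OF J(1)]] a J(2)] by auto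
    qed
    moreover have "I \<subseteq> \<Union>C" "1 \<notin> \<Union>C" using CS C(1) by auto
    ultimately show "\<Union>C \<in> S" unfolding S_def by auto
  qed
  then obtain M where M: "cideal A M" "I \<subseteq> M" "1 \<notin> M"
    and mx: "\<And>W. cideal A W \<Longrightarrow> I \<subseteq> W \<Longrightarrow> 1 \<notin> W \<Longrightarrow> M \<subseteq> W \<Longrightarrow> W = M"
  proof -
    from \<open>\<exists>M\<in>S. _\<close> obtain M where "M \<in> S" "\<And>W. W \<in> S \<Longrightarrow> M \<subseteq> W \<Longrightarrow> W = M" by auto
    then show ?thesis by (intro that[of M]) (auto simp: S_def)
  qed
  interpret M: cideal A M by fact
  \<comment> \<open>Maximality of \<open>M\<close> in usable form: \<open>M + A x\<close> contains
    1, as it would otherwise be a larger admissible ideal.\<close>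
  have ext: "\<exists>m\<in>M. \<exists>a\<in>A. 1 = m + a * x" if x: "x \<in> A" "x \<notin> M" for x
  proof (rule ccontr)
    assume no: "\<not> ?thesis"
    define W where "W = {m + a * x | m a. m \<in> M \<and> a \<in> A}"
    have "cideal A W"
    proof unfold_locales
      show "W \<subseteq> A" unfolding W_def using M.sub x by (auto intro!: add mult)
      show "0 \<in> W" unfolding W_def using M.izero zero by force
      fix u v assume "u \<in> W" "v \<in> W"
      then obtain m a m' a' where "u = m + a * x" "v = m' + a' * x" "m \<in> M" "m' \<in> M" "a \<in> A" "a' \<in> A"
        unfolding W_def by blast
      then show "u + v \<in> W" unfolding W_def
        by (intro CollectI exI[of _ "m + m'"] exI[of _ "a + a'"]) (auto intro: M.iadd add simp: algebra_simps)
    next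
      fix b u assume "b \<in> A" "u \<in> W"
      then obtain m a where "u = m + a * x" "m \<in> M" "a \<in> A" unfolding W_def by blast
      then show "b * u \<in> W" unfolding W_def using \<open>b \<in> A\<close>
        by (intro CollectI exI[of _ "b * m"] exI[of _ "b * a"]) (auto intro: M.imult mult simp: algebra_simps)
    qed
    moreover have "M \<subseteq> W" unfolding W_def using zero by force
    moreover have "1 \<notin> W" using no unfolding W_def by blast
    ultimately have "W = M" using mx[of W] M(2) by auto
    moreover have "x \<in> W" unfolding W_def using M.izero one by force
    ultimately show False using x by simp
  qed
  have "cprime A M"
  proof (unfold_locales, rule M(3))
    fix x y assume xy: "x \<in> A" "y \<in> A" "x * y \<in> M"
    show "x \<in> M \<or> y \<in> M"
    proof (rule ccontr)
      assume "\<not> ?thesis"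
      then obtain m a m' a' where *: "m \<in> M" "a \<in> A" "1 = m + a * x" "m' \<in> M" "a' \<in> A" "1 = m' + a' * y"
        using ext[OF xy(1)] ext[OF xy(2)] by auto
      have "1 = (m + a * x) * (m' + a' * y)" using *(3,6) by simp
      also have "\<dots> = (m' + a' * y) * m + (a * x) * m' + (a * a') * (x * y)" by (simp add: algebra_simps)
      also have "\<dots> \<in> M"
        by (intro M.iadd M.imult[OF _ xy(3)] M.imult[OF _ *(1)] M.imult[OF _ *(4)] add mult)
          (use * xy M.sub in auto)
      finally show False using M(3) by simp
    qed
  qed
  then show ?thesis using M(2) by blast
qed

text \<open>Were \<open>P\<close> to generate the unit ideal among all algebraic integers, 1 would
  be a finite combination of elements of \<open>P\<close>. The coefficients stabilise a lattice, so
  1 maps its \<open>A\<close>-span into \<open>P\<close> times itself and lies in \<open>P\<close>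
  by the determinant trick. The hypothesis on inverses, which says that \<open>P\<close> is maximal,
  keeps \<open>Q \<inter> A\<close> from being larger than \<open>P\<close>.\<close>

theorem lying_over:
  assumes "cprime A P" "A \<subseteq> AI" and mxl: "\<And>x. x \<in> A - P \<Longrightarrow> \<exists>y\<in>A. x * y - 1 \<in> P"
  shows "\<exists>Q. cprime AI Q \<and> Q \<inter> A = P"
proof -
  interpret P: cprime A P by fact
  interpret U: cideal AI AI using AI.cideal_self .
  \<comment> \<open>The ideal of \<open>AI\<close> generated by \<open>P\<close>, assembled from
    finite subsets because \<open>lspan\<close> sums over the whole of its second argument.\<close>
  define J where "J = (\<Union>B\<in>{B. finite B \<and> B \<subseteq> P}. lspan AI B)"
  interpret J: cideal AI J
  proof unfold_locales
    show "J \<subseteq> AI"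
    proof
      fix x assume "x \<in> J"
      then obtain B c where B: "B \<subseteq> P" "\<And>b. b \<in> B \<Longrightarrow> c b \<in> AI" "x = (\<Sum>b\<in>B. c b * b)"
        unfolding J_def lspan_def by blast
      show "x \<in> AI" unfolding B(3) by (intro AI.sum AI.mult B(2)) (use B(1) assms(2) P.sub in auto)
    qed
    show "0 \<in> J" unfolding J_def using U.lspan_zero by blast
    fix x y assume "x \<in> J" "y \<in> J"
    then obtain B B' where B: "finite B" "B \<subseteq> P" "x \<in> lspan AI B" "finite B'" "B' \<subseteq> P" "y \<in> lspan AI B'"
      unfolding J_def by blast
    then have "x \<in> lspan AI (B \<union> B')" "y \<in> lspan AI (B \<union> B')"
      using U.lspan_subset[of "B \<union> B'" B] U.lspan_subset[of "B \<union> B'" B'] by auto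
    then have "x + y \<in> lspan AI (B \<union> B')" by (rule U.lspan_add)
    then show "x + y \<in> J" unfolding J_def using B by (intro UN_I[of "B \<union> B'"]) auto
  next
    fix a x assume a: "a \<in> AI" and "x \<in> J"
    then obtain B where "finite B" "B \<subseteq> P" "x \<in> lspan AI B" unfolding J_def by auto
    then show "a * x \<in> J" unfolding J_def using U.lspan_smult[OF a] by auto
  qed
  have "1 \<notin> J"
  proof
    assume "1 \<in> J"
    then obtain B c where B: "finite B" "B \<subseteq> P" "\<And>b. b \<in> B \<Longrightarrow> algebraic_int (c b)" "1 = (\<Sum>b\<in>B. c b * b)"
      unfolding J_def lspan_def by blast
    obtain B' where B': "finite B'" "1 \<in> B'" "\<And>y b. y \<in> c ` B \<Longrightarrow> b \<in> B' \<Longrightarrow> y * b \<in> lspan \<int> B'"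
    proof -
      have "\<exists>B'. finite B' \<and> 1 \<in> B' \<and> (\<forall>y\<in>c ` B. \<forall>b\<in>B'. y * b \<in> lspan \<int> B')"
        by (rule lattice_exists) (use B in auto)
      then show ?thesis using that by blast
    qed
    have ZA: "lspan \<int> B' \<subseteq> lspan A B'" by (rule lspan_mono) (use P.Ints in auto)
    have "1 \<in> P"
    proof (rule P.det_trick[OF B'(1,2)])
      fix b' assume b': "b' \<in> B'"
      have "1 * b' = (\<Sum>b\<in>B. c b * b) * b'" using B(4) by simp
      also have "\<dots> = (\<Sum>b\<in>B. b * (c b * b'))" unfolding sum_distrib_right by (simp add: algebra_simps)
      also have "\<dots> \<in> lspan P B'"
      proof (intro P.lspan_sum P.lspan_ideal_mult)
        fix b assume b: "b \<in> B"
        then show "b \<in> P" using B(2) by auto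
        show "c b * b' \<in> lspan A B'" using B'(3)[of "c b" b'] b b' ZA by auto
      qed
      finally show "1 * b' \<in> lspan P B'" .
    qed (auto intro: P.one)
    then show False using P.one_notin by simp
  qed
  from J.exists_prime_above[OF this] obtain Q where Q: "cprime AI Q" "J \<subseteq> Q" by blast
  interpret Q: cprime AI Q by fact
  have PJ: "P \<subseteq> J"
  proof
    fix x assume "x \<in> P"
    then have "x \<in> lspan AI {x}" by (intro lspan_base) auto
    then show "x \<in> J" unfolding J_def using \<open>x \<in> P\<close> by (intro UN_I[of "{x}"]) auto
  qed
  have "Q \<inter> A \<subseteq> P"
  proof
    fix x assume x: "x \<in> Q \<inter> A"
    show "x \<in> P"
    proof (rule ccontr)
      assume "x \<notin> P"
      then obtain y where y: "y \<in> A" "x * y - 1 \<in> P" using mxl[of x] x by auto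
      then have "x * y - 1 \<in> Q" "x * y \<in> Q" using PJ Q(2) x assms(2) Q.imult'[of y x] by auto
      then show False using Q.idiff[of "x * y" "x * y - 1"] Q.one_notin by simp
    qed
  qed
  then have "Q \<inter> A = P" using Q(2) PJ P.sub by auto
  then show ?thesis using Q(1) by auto
qed

section \<open>Field extensions inside the complex numbers\<close>

text \<open>The base \<open>k\<close> is allowed to be any set: \<open>adj {} H\<close> is the
  subfield generated by \<open>H\<close>, the form in which the Galois closure is given.\<close>

definition adj :: "complex set \<Rightarrow> complex set \<Rightarrow> complex set" where
  "adj k S = \<Inter>{E. cfield E \<and> k \<union> S \<subseteq> E}"

lemma cfieldI:
  assumes "0 \<in> F" "1 \<in> F" "\<And>x y. x \<in> F \<Longrightarrow> y \<in> F \<Longrightarrow> x + y \<in> F \<and> x - y \<in> F \<and> x * y \<in> F"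
    "\<And>x. x \<in> F \<Longrightarrow> Fields.inverse x \<in> F"
  shows "cfield F"
  using assms by (simp add: cfield_def cfield_axioms_def csubring_def)

lemma cfield_adj: "cfield (adj k S)"
  unfolding adj_def
  by unfold_locales (auto simp: cfield_def cfield_axioms_def csubring_def)

lemma adj_base: "k \<subseteq> adj k S" and adj_gen: "S \<subseteq> adj k S"
  unfolding adj_def by auto

lemma adj_least: "cfield E \<Longrightarrow> k \<subseteq> E \<Longrightarrow> S \<subseteq> E \<Longrightarrow> adj k S \<subseteq> E"
  unfolding adj_def by auto

lemma adj_empty: "cfield k \<Longrightarrow> adj k {} = k"
  using adj_base[of k "{}"] adj_least[of k k "{}"] by auto

lemma adj_insert: "adj k (insert x S) = adj (adj k S) {x}"
proof
  show "adj k (insert x S) \<subseteq> adj (adj k S) {x}"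
    using adj_base[of "adj k S" "{x}"] adj_gen[of "{x}" "adj k S"] adj_base[of k S] adj_gen[of S k]
    by (intro adj_least cfield_adj) auto
  show "adj (adj k S) {x} \<subseteq> adj k (insert x S)"
    using adj_base[of k "insert x S"] adj_gen[of "insert x S" k]
    by (intro adj_least cfield_adj) auto
qed

definition algebraic_over :: "complex set \<Rightarrow> complex \<Rightarrow> bool" where
  "algebraic_over F x \<longleftrightarrow> (\<exists>p. p \<noteq> 0 \<and> pover F p \<and> poly p x = 0)"

lemma algebraic_over_mono: "algebraic_over F x \<Longrightarrow> F \<subseteq> E \<Longrightarrow> algebraic_over E x"
  unfolding algebraic_over_def using pover_mono by blast

lemma (in csubring) algebraic_over_if_algebraic_int: "algebraic_int x \<Longrightarrow> algebraic_over A x"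
  unfolding algebraic_over_def pover_def by (erule algebraic_int.cases) (metis Ints coeff_0 zero_neq_one)

text \<open>Characterised as the monic generator of the ideal of polynomials over \<open>F\<close>
  that vanish at \<open>x\<close>; irreducibility enters through
  \<open>minpoly_bezout\<close>.\<close>

definition minpoly :: "complex set \<Rightarrow> complex \<Rightarrow> complex poly \<Rightarrow> bool" where
  "minpoly F x m \<longleftrightarrow> monic m \<and> pover F m \<and> poly m x = 0 \<and>
     (\<forall>p. pover F p \<longrightarrow> poly p x = 0 \<longrightarrow> (\<exists>r. pover F r \<and> p = r * m))"

context cfield
begin

lemma make_monic:
  assumes "pover F p" "p \<noteq> 0"
  shows "pover F (Polynomial.smult (inverse (lead_coeff p)) p)" "monic (Polynomial.smult (inverse (lead_coeff p)) p)"
  using assms by (auto simp: pover_def intro!: mult inverse)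

lemma minpoly_exists:
  assumes "algebraic_over F x"
  shows "\<exists>m. minpoly F x m"
proof -
  define Q where "Q p \<longleftrightarrow> p \<noteq> 0 \<and> pover F p \<and> poly p x = 0" for p
  have "\<exists>p. Q p" using assms unfolding algebraic_over_def Q_def by auto
  then obtain p where p: "Q p" "\<And>p'. Q p' \<Longrightarrow> Polynomial.degree p \<le> Polynomial.degree p'"
    using ex_has_least_nat[of Q _ Polynomial.degree] by blast
  define m where "m = Polynomial.smult (inverse (lead_coeff p)) p"
  have m: "pover F m" "monic m" using make_monic[of p] p(1) by (auto simp: Q_def m_def)
  have mx: "poly m x = 0" using p(1) by (simp add: m_def Q_def)
  have deg: "Polynomial.degree m = Polynomial.degree p" using p(1) by (simp add: m_def Q_def)
  have "\<exists>r. pover F r \<and> p' = r * m" if p': "pover F p'" "poly p' x = 0" for p'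
  proof -
    obtain a r where ar: "pover F a" "pover F r" "p' = a * m + r"
      "r = 0 \<or> Polynomial.degree r < Polynomial.degree m"
      using monic_division[OF p'(1) m] by blast
    have "poly r x = 0" using p'(2) mx ar(3) by simp
    then have "r = 0" using ar(2,4) p(2)[of r] deg unfolding Q_def by fastforce
    then show ?thesis using ar by auto
  qed
  then show ?thesis unfolding minpoly_def using m mx by blast
qed

text \<open>A nonzero combination of \<open>m\<close> and \<open>p\<close> of least degree, made
  monic, divides both. It does not vanish at \<open>x\<close> because \<open>p\<close> does not, so
  its cofactor in \<open>m\<close> vanishes there and is itself a multiple of \<open>m\<close>;
  hence the common divisor is 1.\<close>

lemma minpoly_bezout:
  assumes m: "minpoly F x m" and p: "pover F p" "poly p x \<noteq> 0"
  shows "\<exists>a b. pover F a \<and> pover F b \<and> a * m + b * p = 1"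
proof -
  define Q where "Q d \<longleftrightarrow> d \<noteq> 0 \<and> (\<exists>a b. pover F a \<and> pover F b \<and> d = a * m + b * p)" for d
  have mF: "pover F m" "monic m" "poly m x = 0" using m by (auto simp: minpoly_def)
  have "m \<noteq> 0" using mF(2) by auto
  then have "Q m" unfolding Q_def using pover_0 pover_1
    by (intro conjI exI[of _ 1] exI[of _ "0::complex poly"]) auto
  then obtain d where d: "Q d" "\<And>d'. Q d' \<Longrightarrow> Polynomial.degree d \<le> Polynomial.degree d'"
    using ex_has_least_nat[of Q _ Polynomial.degree] by blast
  then obtain a b where ab: "d \<noteq> 0" "pover F a" "pover F b" "d = a * m + b * p" unfolding Q_def by blast
  have dF: "pover F d" using ab mF p by (auto intro!: pover_add pover_mult)
  define c where "c = inverse (lead_coeff d)"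
  have c: "c \<in> F" "c \<noteq> 0" using dF ab(1) by (auto simp: c_def pover_def intro: inverse)
  define e where "e = Polynomial.smult c d"
  have e: "pover F e" "monic e" using make_monic[OF dF ab(1)] by (auto simp: e_def c_def)
  have dege: "Polynomial.degree e = Polynomial.degree d" using c by (simp add: e_def)
  define a' b' where "a' = Polynomial.smult c a" and "b' = Polynomial.smult c b"
  have ab': "pover F a'" "pover F b'" "e = a' * m + b' * p"
    using ab c unfolding a'_def b'_def e_def by (auto intro: pover_smult simp: smult_add_right)
  have dvd: "\<exists>r. pover F r \<and> f = r * e"
    if f: "pover F u" "pover F v" "f = u * m + v * p" for f u v
  proof -
    have fF: "pover F f" using f mF p by (auto intro!: pover_add pover_mult)
    obtain g r where gr: "pover F g" "pover F r" "f = g * e + r"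
      "r = 0 \<or> Polynomial.degree r < Polynomial.degree e"
      using monic_division[OF fF e] by blast
    have "r = (u - g * a') * m + (v - g * b') * p"
      using gr(3) f(3) ab'(3) by (simp add: algebra_simps)
    then have "r = 0 \<or> Q r" unfolding Q_def using pover_diff[OF f(1) pover_mult[OF gr(1) ab'(1)]]
        pover_diff[OF f(2) pover_mult[OF gr(1) ab'(2)]] by auto
    then have "r = 0" using gr(4) d(2)[of r] dege by auto
    then show ?thesis using gr by auto
  qed
  obtain r1 where r1: "pover F r1" "m = r1 * e"
    using dvd[of 1 0 m] pover_0 pover_1 by auto
  obtain r2 where r2: "pover F r2" "p = r2 * e"
    using dvd[of 0 1 p] pover_0 pover_1 by auto
  have "poly e x \<noteq> 0" using r2 p(2) by auto
  then have "poly r1 x = 0" using r1(2) mF(3) by simp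
  then obtain r3 where r3: "r1 = r3 * m" using m r1(1) by (auto simp: minpoly_def)
  have m0: "m \<noteq> 0" using mF(2) by auto
  have "m * (r3 * e) = m * 1" using r1(2) r3 by (simp add: algebra_simps)
  then have one: "r3 * e = 1" using m0 by (metis mult_left_cancel)
  then have "Polynomial.degree r3 + Polynomial.degree e = 0"
    by (metis degree_1 degree_mult_eq mult_zero_left mult_zero_right zero_neq_one)
  then have "e = 1" using e(2) degree_0_id[of e] by (simp add: one_pCons)
  then show ?thesis using ab' by metis
qed

text \<open>Separability in characteristic 0: the nonzero derivative has smaller degree, so it does
  not vanish at \<open>x\<close>, and the Bezout relation then excludes common zeros of
  \<open>m\<close> and its derivative.\<close>

lemma minpoly_card_roots:
  assumes m: "minpoly F x m"
  shows "card {y. poly m y = 0} = Polynomial.degree m"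
proof -
  have mF: "pover F m" "monic m" "poly m x = 0" using m by (auto simp: minpoly_def)
  have m0: "m \<noteq> 0" using mF(2) by auto
  have dm: "Polynomial.degree m > 0"
  proof (rule ccontr)
    assume "\<not> ?thesis"
    then have "m = 1" using mF(2) degree_0_id[of m] by (simp add: one_pCons)
    then show False using mF(3) by simp
  qed
  have dF: "pover F (pderiv m)"
    using mF by (auto simp: pover_def coeff_pderiv intro!: mult intro: of_nat[of "Suc _", simplified])
  have "poly (pderiv m) x \<noteq> 0"
  proof
    assume "poly (pderiv m) x = 0"
    then obtain r where r: "pderiv m = r * m" using m dF by (auto simp: minpoly_def)
    have "pderiv m \<noteq> 0" using dm by (simp add: pderiv_eq_0_iff)
    then have "Polynomial.degree (pderiv m) \<ge> Polynomial.degree m"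
      using r m0 by (auto simp: degree_mult_eq)
    then show False using dm by (simp add: degree_pderiv)
  qed
  then obtain a b where "a * m + b * pderiv m = 1" using minpoly_bezout[OF m dF] by blast
  then have "poly a y * poly m y + poly b y * poly (pderiv m) y = 1" for y
    by (metis poly_1 poly_add poly_mult)
  then have "\<not> (poly m y = 0 \<and> poly (pderiv m) y = 0)" for y
    by (metis add.right_neutral mult_zero_right zero_neq_one)
  then have "rsquarefree m" unfolding rsquarefree_roots using m0 by auto
  then show ?thesis using rsquarefree_card_degree[OF m0] by simp
qed

text \<open>The polynomial values already form a field, since the Bezout relation provides
  inverses.\<close>

lemma adj_single:
  assumes m: "minpoly F x m"
  shows "adj F {x} = {poly p x | p. pover F p}"
proof
  have mF: "pover F m" "monic m" "poly m x = 0" using m by (auto simp: minpoly_def)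
  let ?E = "{poly p x | p. pover F p}"
  have "cfield ?E"
  proof unfold_locales
    fix u v assume "u \<in> ?E" "v \<in> ?E"
    then obtain p p' where "pover F p" "u = poly p x" "pover F p'" "v = poly p' x" by blast
    then show "u + v \<in> ?E" "u - v \<in> ?E" "u * v \<in> ?E"
      by (auto intro: exI[of _ "p + p'"] exI[of _ "p - p'"] exI[of _ "p * p'"] pover_add pover_diff pover_mult)
  next
    fix u assume "u \<in> ?E"
    then obtain p where p: "pover F p" "u = poly p x" by blast
    show "inverse u \<in> ?E"
    proof (cases "u = 0")
      case True
      then show ?thesis using pover_0 by (auto intro!: exI[of _ 0])
    next
      case False
      then obtain a b where ab: "pover F b" "a * m + b * p = 1" using minpoly_bezout[OF m p(1)] p(2) by auto
      have "poly (a * m + b * p) x = 1" using ab by simp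
      then have "poly b x * u = 1" using mF(3) p(2) by simp
      then have "inverse u = poly b x" using inverse_unique[of u "poly b x"] by (simp add: mult.commute)
      then show ?thesis using ab by auto
    qed
  next
    show "0 \<in> ?E" using pover_0 by (auto intro!: exI[of _ 0])
    show "1 \<in> ?E" using pover_1 by (auto intro!: exI[of _ 1])
  qed
  moreover have "F \<subseteq> ?E"
  proof
    fix c assume "c \<in> F"
    then show "c \<in> ?E" by (auto intro!: exI[of _ "[:c:]"] pover_const)
  qed
  moreover have "x \<in> ?E" by (auto intro!: exI[of _ "[:0, 1:]"] pover_pCons zero one pover_0)
  ultimately show "adj F {x} \<subseteq> ?E" by (intro adj_least) auto
  interpret E: cfield "adj F {x}" by (rule cfield_adj)
  show "?E \<subseteq> adj F {x}"
  proof
    fix z assume "z \<in> ?E"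
    then obtain p where p: "pover F p" "z = poly p x" by blast
    have "pover (adj F {x}) p" using p(1) adj_base by (rule pover_mono)
    then show "z \<in> adj F {x}" unfolding p(2) by (rule E.poly_in) (use adj_gen[of "{x}" F] in auto)
  qed
qed

end

section \<open>Homomorphisms and their extensions\<close>

text \<open>The map is total on the complex numbers and unconstrained outside \<open>F\<close>;
  uniqueness of homomorphisms therefore has to be stated on \<open>F\<close> or for
  \<open>extensional\<close> maps.\<close>

locale fhom = cfield F for F +
  fixes \<tau> :: "complex \<Rightarrow> complex"
  assumes hone: "\<tau> 1 = 1"
    and hadd: "x \<in> F \<Longrightarrow> y \<in> F \<Longrightarrow> \<tau> (x + y) = \<tau> x + \<tau> y"
    and hmult: "x \<in> F \<Longrightarrow> y \<in> F \<Longrightarrow> \<tau> (x * y) = \<tau> x * \<tau> y"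
begin

lemma hzero [simp]: "\<tau> 0 = 0" using hadd[OF zero zero] by simp

lemma huminus: "x \<in> F \<Longrightarrow> \<tau> (- x) = - \<tau> x"
  using hadd[of x "- x"] uminus[of x] by (simp add: add_eq_0_iff)

lemma hdiff: "x \<in> F \<Longrightarrow> y \<in> F \<Longrightarrow> \<tau> (x - y) = \<tau> x - \<tau> y"
  using hadd[of x "- y"] uminus[of y] huminus[of y] by simp

lemma hpower: "x \<in> F \<Longrightarrow> \<tau> (x ^ n) = \<tau> x ^ n"
  by (induction n) (auto simp: hone hmult power)

lemma hsum: "(\<And>i. i \<in> I \<Longrightarrow> f i \<in> F) \<Longrightarrow> \<tau> (Groups_Big.sum f I) = (\<Sum>i\<in>I. \<tau> (f i))"
  by (induction I rule: infinite_finite_induct) (auto simp: hadd sum)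

lemma hprod: "(\<And>i. i \<in> I \<Longrightarrow> f i \<in> F) \<Longrightarrow> \<tau> (Groups_Big.prod f I) = (\<Prod>i\<in>I. \<tau> (f i))"
  by (induction I rule: infinite_finite_induct) (auto simp: hmult hone prod)

lemma hinverse: "x \<in> F \<Longrightarrow> \<tau> (Fields.inverse x) = Fields.inverse (\<tau> x)"
proof (cases "x = 0")
  case False
  assume x: "x \<in> F"
  have "\<tau> x * \<tau> (Fields.inverse x) = 1"
    using hmult[OF x inverse[OF x]] False hone by simp
  then show ?thesis by (metis inverse_unique)
qed simp

lemma hinj: "inj_on \<tau> F"
proof (rule inj_onI)
  fix x y assume xy: "x \<in> F" "y \<in> F" "\<tau> x = \<tau> y"
  show "x = y"
  proof (rule ccontr)
    assume "x \<noteq> y"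
    then have "\<tau> ((x - y) * Fields.inverse (x - y)) = 1" by (simp add: hone)
    moreover have "\<tau> ((x - y) * Fields.inverse (x - y)) = \<tau> (x - y) * \<tau> (Fields.inverse (x - y))"
      using xy by (intro hmult diff inverse)
    moreover have "\<tau> (x - y) = 0" using xy by (simp add: hdiff)
    ultimately show False by simp
  qed
qed

lemma coeff_hpoly: "poly.coeff (map_poly \<tau> p) i = \<tau> (poly.coeff p i)"
  by (simp add: coeff_map_poly)

lemma hpoly_add: "pover F p \<Longrightarrow> pover F q \<Longrightarrow> map_poly \<tau> (p + q) = map_poly \<tau> p + map_poly \<tau> q"
  by (rule poly_eqI) (auto simp: coeff_hpoly hadd pover_def)

lemma hpoly_mult: "pover F p \<Longrightarrow> pover F q \<Longrightarrow> map_poly \<tau> (p * q) = map_poly \<tau> p * map_poly \<tau> q"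
  by (rule poly_eqI) (auto simp: coeff_hpoly coeff_mult hsum hmult mult pover_def)

lemma hpoly_degree: "monic p \<Longrightarrow> Polynomial.degree (map_poly \<tau> p) = Polynomial.degree p \<and> monic (map_poly \<tau> p)"
  by (metis coeff_hpoly degree_map_poly_le hone le_antisym le_degree zero_neq_one)

lemma hpoly_poly: "pover F p \<Longrightarrow> x \<in> F \<Longrightarrow> \<tau> (poly p x) = poly (map_poly \<tau> p) (\<tau> x)"
proof -
  assume p: "pover F p" "x \<in> F"
  have "\<tau> (poly p x) = (\<Sum>i\<le>Polynomial.degree p. \<tau> (poly.coeff p i) * \<tau> x ^ i)"
    using p unfolding poly_altdef
    by (subst hsum) (auto intro!: sum.cong mult power simp: hmult power hpower pover_def)
  also have "\<dots> = poly (map_poly \<tau> p) (\<tau> x)"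
    unfolding poly_altdef coeff_hpoly[symmetric]
    by (rule sum.mono_neutral_right) (auto simp: degree_map_poly_le coeff_eq_0)
  finally show ?thesis .
qed

lemma hfix_poly: "(\<And>x. x \<in> k \<Longrightarrow> \<tau> x = x) \<Longrightarrow> pover k p \<Longrightarrow> map_poly \<tau> p = p"
  by (rule poly_eqI) (auto simp: coeff_hpoly pover_def)

lemma hInts: "x \<in> \<int> \<Longrightarrow> \<tau> x = x"
proof -
  have nat: "\<tau> (of_nat n) = of_nat n" for n
    by (induction n) (auto simp: hadd hone one of_nat)
  assume "x \<in> \<int>"
  then obtain i where "x = of_int i" by (auto elim: Ints_cases)
  then show ?thesis by (cases i rule: int_cases2) (auto simp: nat huminus of_nat)
qed

lemma halgebraic_int: "x \<in> F \<Longrightarrow> algebraic_int x \<Longrightarrow> algebraic_int (\<tau> x)"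
proof -
  assume x: "x \<in> F" "algebraic_int x"
  then obtain p where p: "monic p" "\<forall>i. poly.coeff p i \<in> \<int>" "poly p x = 0"
    by (auto simp: algebraic_int.simps)
  have "map_poly \<tau> p = p" using p(2) hInts by (intro hfix_poly[of \<int>]) (auto simp: pover_def)
  moreover have "pover F p" using p(2) Ints by (auto simp: pover_def)
  ultimately have "poly p (\<tau> x) = 0" using hpoly_poly[of p x] x p(3) by simp
  then show ?thesis using p by (auto simp: algebraic_int.simps)
qed

lemma himage: "cfield (\<tau> ` F)"
proof unfold_locales
  show "0 \<in> \<tau> ` F" using zero by (metis hzero image_eqI)
  show "1 \<in> \<tau> ` F" using one by (metis hone image_eqI)
next
  fix u v assume "u \<in> \<tau> ` F" "v \<in> \<tau> ` F"
  then obtain x y where "x \<in> F" "y \<in> F" "u = \<tau> x" "v = \<tau> y" by auto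
  then show "u + v \<in> \<tau> ` F" "u - v \<in> \<tau> ` F" "u * v \<in> \<tau> ` F"
    using hadd[of x y] hdiff[of x y] hmult[of x y] add[of x y] diff[of x y] mult[of x y]
    by (metis image_eqI)+
next
  fix u assume "u \<in> \<tau> ` F"
  then obtain x where "x \<in> F" "u = \<tau> x" by auto
  then show "Fields.inverse u \<in> \<tau> ` F" using hinverse[of x] inverse[of x] by (metis image_eqI)
qed

text \<open>The extension sends \<open>poly p x\<close> to the value at \<open>y\<close> of the
  transported polynomial. Two choices of \<open>p\<close> differ by a multiple of \<open>m\<close>,
  whose transport vanishes at \<open>y\<close>.\<close>

lemma extend_single:
  assumes m: "minpoly F x m" and y: "poly (map_poly \<tau> m) y = 0"
  obtains \<tau>' where "fhom (adj F {x}) \<tau>'" "\<And>z. z \<in> F \<Longrightarrow> \<tau>' z = \<tau> z" "\<tau>' x = y"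
    "\<And>p. pover F p \<Longrightarrow> \<tau>' (poly p x) = poly (map_poly \<tau> p) y"
proof -
  have mF: "pover F m" "monic m" "poly m x = 0" using m by (auto simp: minpoly_def)
  \<comment> \<open>\<open>SOME\<close> picks one representing polynomial; \<open>key\<close> shows
    that the value does not depend on the choice.\<close>
  define \<tau>' where "\<tau>' z = poly (map_poly \<tau> (SOME p. pover F p \<and> poly p x = z)) y" for z
  have key: "\<tau>' (poly p x) = poly (map_poly \<tau> p) y" if p: "pover F p" for p
  proof -
    define q where "q = (SOME q. pover F q \<and> poly q x = poly p x)"
    have q: "pover F q" "poly q x = poly p x"
      unfolding q_def using someI[of "\<lambda>q. pover F q \<and> poly q x = poly p x" p] p by auto
    then have "pover F (q - p)" "poly (q - p) x = 0" using p pover_diff by auto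
    then obtain r where r: "pover F r" "q - p = r * m" using m unfolding minpoly_def by blast
    then have "q = r * m + p" by (simp add: algebra_simps)
    then have "map_poly \<tau> q = map_poly \<tau> r * map_poly \<tau> m + map_poly \<tau> p"
      using p r mF by (simp add: hpoly_add hpoly_mult pover_mult)
    then show ?thesis using y unfolding \<tau>'_def q_def[symmetric] by simp
  qed
  have E: "adj F {x} = {poly p x | p. pover F p}" by (rule adj_single[OF m])
  interpret E: cfield "adj F {x}" by (rule cfield_adj)
  have F: "\<tau>' z = \<tau> z" if "z \<in> F" for z
  proof -
    have "map_poly \<tau> [:z:] = [:\<tau> z:]"
      by (rule poly_eqI) (auto simp: coeff_hpoly coeff_pCons split: nat.splits)
    then show ?thesis using key[OF pover_const[OF that]] by simp
  qed
  show thesis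
  proof (rule that[OF _ F _ key])
    show "fhom (adj F {x}) \<tau>'"
    proof unfold_locales
      show "\<tau>' 1 = 1" using F[OF one] hone by simp
      fix u v assume "u \<in> adj F {x}" "v \<in> adj F {x}"
      then obtain p p' where p: "pover F p" "u = poly p x" "pover F p'" "v = poly p' x" unfolding E by blast
      show "\<tau>' (u + v) = \<tau>' u + \<tau>' v"
        using key[OF pover_add[OF p(1,3)]] key[OF p(1)] key[OF p(3)] p by (simp add: hpoly_add)
      show "\<tau>' (u * v) = \<tau>' u * \<tau>' v"
        using key[OF pover_mult[OF p(1,3)]] key[OF p(1)] key[OF p(3)] p by (simp add: hpoly_mult)
    qed
    have "map_poly \<tau> [:0, 1:] = [:0, 1:]"
      by (rule poly_eqI) (auto simp: coeff_hpoly coeff_pCons hone split: nat.splits)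
    then show "\<tau>' x = y" using key[of "[:0, 1:]"] by (simp add: pover_pCons zero one pover_0)
  qed auto
qed

lemma extend_one:
  assumes "algebraic_over F x"
  shows "\<exists>\<tau>'. fhom (adj F {x}) \<tau>' \<and> (\<forall>z\<in>F. \<tau>' z = \<tau> z)"
proof -
  obtain m where m: "minpoly F x m" using minpoly_exists[OF assms] by blast
  have mF: "pover F m" "monic m" "poly m x = 0" using m by (auto simp: minpoly_def)
  have "Polynomial.degree m \<noteq> 0"
  proof
    assume "Polynomial.degree m = 0"
    then have "m = 1" using mF(2) degree_0_id[of m] by (simp add: one_pCons)
    then show False using mF(3) by simp
  qed
  then have "Polynomial.degree (map_poly \<tau> m) \<noteq> 0" using hpoly_degree[OF mF(2)] by simp
  then obtain y where y: "poly (map_poly \<tau> m) y = 0"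
    using fundamental_theorem_of_algebra[of "map_poly \<tau> m"] by (auto simp: constant_degree)
  show ?thesis by (rule extend_single[OF m y]) auto
qed

end

lemma fhom_id: "cfield F \<Longrightarrow> fhom F (\<lambda>x. x)"
  by (simp add: fhom_def fhom_axioms_def)

text \<open>Induction over the generators. A homomorphism that moves \<open>x\<close> inside the
  smaller field \<open>E\<close> is extended to the larger one. If \<open>x\<close> is outside
  \<open>E\<close>, it is the value at \<open>s\<close> of a polynomial \<open>r\<close> of degree
  below that of the minimal polynomial of \<open>s\<close>, and \<open>s\<close> is sent to a
  conjugate where \<open>r\<close> takes another value.\<close>

theorem (in cfield) moved_by_hom:
  assumes "finite S" "\<And>s. s \<in> S \<Longrightarrow> algebraic_over F s" "x \<in> adj F S" "x \<notin> F"
  shows "\<exists>\<tau>. fhom (adj F S) \<tau> \<and> (\<forall>z\<in>F. \<tau> z = z) \<and> \<tau> x \<noteq> x"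
  using assms
proof (induction S arbitrary: x rule: finite_induct)
  case empty
  then show ?case using adj_empty[OF cfield_axioms] by auto
next
  case (insert s S)
  define E where "E = adj F S"
  have FE: "F \<subseteq> E" unfolding E_def by (rule adj_base)
  interpret E: cfield E unfolding E_def by (rule cfield_adj)
  have alg: "algebraic_over E s" using insert.prems algebraic_over_mono[OF _ FE] by auto
  show ?case
  proof (cases "x \<in> E")
    case True
    then obtain \<tau> where \<tau>: "fhom E \<tau>" "\<forall>z\<in>F. \<tau> z = z" "\<tau> x \<noteq> x"
      using insert.IH[of x] insert.prems by (auto simp: E_def)
    interpret \<tau>: fhom E \<tau> by fact
    obtain \<tau>' where "fhom (adj E {s}) \<tau>'" "\<forall>z\<in>E. \<tau>' z = \<tau> z" using \<tau>.extend_one[OF alg] by blast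
    then show ?thesis using \<tau> True FE by (intro exI[of _ \<tau>']) (auto simp: adj_insert[of F s S] E_def)
  next
    case False
    obtain m where m: "minpoly E s m" using E.minpoly_exists[OF alg] by blast
    have mF: "pover E m" "monic m" "poly m s = 0" using m by (auto simp: minpoly_def)
    have "x \<in> adj E {s}" using insert.prems by (simp add: adj_insert[of F s S] E_def)
    then obtain p where p: "pover E p" "x = poly p s" unfolding E.adj_single[OF m] by blast
    obtain a r where ar: "pover E a" "pover E r" "p = a * m + r"
      "r = 0 \<or> Polynomial.degree r < Polynomial.degree m"
      using E.monic_division[OF p(1) mF(1,2)] by blast
    have xr: "x = poly r s" using ar(3) p(2) mF(3) by simp
    have r: "Polynomial.degree r < Polynomial.degree m" using ar(4) xr False E.zero by auto
    \<comment> \<open>Otherwise \<open>r - x\<close> has at least as many zeros as the degree of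
      \<open>m\<close>, more than its own degree, so \<open>r\<close> is the constant
      \<open>x\<close> and \<open>x\<close> lies in \<open>E\<close>.\<close>
    have "\<exists>y. poly m y = 0 \<and> poly r y \<noteq> x"
    proof (rule ccontr)
      assume "\<not> ?thesis"
      then have sub: "{y. poly m y = 0} \<subseteq> {y. poly (r - [:x:]) y = 0}" by auto
      have "r - [:x:] = 0"
      proof (rule ccontr)
        assume n0: "r - [:x:] \<noteq> 0"
        have "Polynomial.degree m \<le> card {y. poly (r - [:x:]) y = 0}"
          using card_mono[OF poly_roots_finite[OF n0] sub] E.minpoly_card_roots[OF m] by simp
        also have "\<dots> \<le> Polynomial.degree (r - [:x:])"
          by (rule card_poly_roots_bound[OF n0])
        also have "\<dots> \<le> Polynomial.degree r" by (rule degree_diff_le) auto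
        finally show False using r by simp
      qed
      then have "poly.coeff r 0 = x" by simp
      then show False using ar(2) False by (metis pover_def)
    qed
    then obtain y where y: "poly m y = 0" "poly r y \<noteq> x" by blast
    interpret i: fhom E "\<lambda>x. x" by (rule fhom_id) unfold_locales
    have id: "map_poly (\<lambda>x. x) p = p" for p :: "complex poly" by (rule poly_eqI) (simp add: coeff_map_poly)
    obtain \<tau>' where \<tau>': "fhom (adj E {s}) \<tau>'" "\<And>z. z \<in> E \<Longrightarrow> \<tau>' z = z"
      "\<And>p. pover E p \<Longrightarrow> \<tau>' (poly p s) = poly p y"
    proof -
      have "poly (map_poly (\<lambda>x. x) m) y = 0" using y(1) by (simp only: id)
      then show ?thesis by (rule i.extend_single[OF m]) (rule that, assumption+, simp only: id)
    qed
    have "\<tau>' x \<noteq> x" using y(2) \<tau>'(3)[OF ar(2)] xr by simp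
    moreover have "fhom (adj F (insert s S)) \<tau>'" using \<tau>'(1) by (simp only: adj_insert[of F s S] E_def)
    moreover have "\<forall>z\<in>F. \<tau>' z = z" using \<tau>'(2) FE by blast
    ultimately show ?thesis by blast
  qed
qed

section \<open>The Galois group of a normal extension\<close>

lemma subfield_CC_iff: "subfield F CC \<longleftrightarrow> cfield F"
proof -
  interpret C: field CC by (rule field_from_type_algebra)
  have sim: "carrier CC = UNIV" "\<And>x y. x \<otimes>\<^bsub>CC\<^esub> y = x * y" "\<And>x y. x \<oplus>\<^bsub>CC\<^esub> y = x + y"
    "\<zero>\<^bsub>CC\<^esub> = 0" "\<one>\<^bsub>CC\<^esub> = 1" by (auto simp: ring_of_type_algebra_def)
  have min: "\<ominus>\<^bsub>CC\<^esub> x = - x" for x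
    using C.minus_equality[of "-x" x] by (simp add: sim)
  have inv: "inv\<^bsub>CC\<^esub> x = Fields.inverse x" if "x \<noteq> 0" for x
    using C.inv_unique'[of x "Fields.inverse x"] that by (simp add: sim)
  show ?thesis
  proof
    assume s: "subfield F CC"
    then have sr: "subring F CC" by (rule subfieldE(1))
    have z: "0 \<in> F" using subringE(2)[OF sr] by (simp add: sim)
    have ad: "x + y \<in> F" if "x \<in> F" "y \<in> F" for x y using subringE(7)[OF sr that] by (simp add: sim)
    have um: "- x \<in> F" if "x \<in> F" for x using subringE(5)[OF sr that] by (simp add: min)
    show "cfield F"
    proof unfold_locales
      fix x y assume "x \<in> F" "y \<in> F"
      then show "x - y \<in> F" using ad[of x "-y"] um[of y] by simp
      show "x * y \<in> F" using subringE(6)[OF sr \<open>x \<in> F\<close> \<open>y \<in> F\<close>] by (simp add: sim)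
    next
      fix x assume x: "x \<in> F"
      show "Fields.inverse x \<in> F"
        using C.subfield_m_inv(1)[OF s, of x] x z inv[of x] by (cases "x = 0") (auto simp: sim)
    qed (use z ad subringE(3)[OF sr] in \<open>auto simp: sim\<close>)
  next
    assume "cfield F"
    then interpret cfield F .
    have "subring F CC"
      by (rule C.subringI) (auto simp: sim min zero one add mult uminus)
    then show "subfield F CC"
      by (rule C.subfieldI') (auto simp: sim inv inverse)
  qed
qed

lemma generate_field_CC: "generate_field CC H = adj {} H"
proof -
  interpret C: field CC by (rule field_from_type_algebra)
  have "generate_field CC H = \<Inter>{K. subfield K CC \<and> H \<subseteq> K}"
    by (rule C.generate_field_min_subfield2) (auto simp: ring_of_type_algebra_def)
  then show ?thesis by (simp add: adj_def subfield_CC_iff)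
qed

lemma field_ring_simps [simp]:
  "carrier (field_ring L) = L" "x \<otimes>\<^bsub>field_ring L\<^esub> y = x * y" "x \<oplus>\<^bsub>field_ring L\<^esub> y = x + y"
  "\<zero>\<^bsub>field_ring L\<^esub> = 0" "\<one>\<^bsub>field_ring L\<^esub> = 1"
  by (auto simp: field_ring_def ring_of_type_algebra_def)

lemma CC_simps [simp]:
  "carrier CC = UNIV" "x \<otimes>\<^bsub>CC\<^esub> y = x * y" "x \<oplus>\<^bsub>CC\<^esub> y = x + y" "\<zero>\<^bsub>CC\<^esub> = 0" "\<one>\<^bsub>CC\<^esub> = 1"
  by (auto simp: ring_of_type_algebra_def)

lemma embeddings_iff:
  "cfield K \<Longrightarrow> \<tau> \<in> embeddings k K \<longleftrightarrow> \<tau> \<in> extensional K \<and> fhom K \<tau> \<and> (\<forall>x\<in>k. \<tau> x = x)"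
  by (auto simp: embeddings_def Ring.ring_hom_def fhom_def fhom_axioms_def)

lemma galois_group_iff:
  "cfield L \<Longrightarrow> \<sigma> \<in> carrier (galois_group k L) \<longleftrightarrow>
     \<sigma> \<in> extensional L \<and> bij_betw \<sigma> L L \<and> fhom L \<sigma> \<and> (\<forall>x\<in>k. \<sigma> x = x)"
  by (auto simp: galois_group_def ring_iso_def Ring.ring_hom_def fhom_def fhom_axioms_def bij_betw_def)

text \<open>Normality is the condition that every \<open>k\<close>-homomorphism of \<open>L\<close>
  into the complex numbers maps the finite generating set \<open>S\<close> into itself. The
  conjugates of a primitive element and the roots of a polynomial over \<open>k\<close> are both of
  this kind, and the locale is used for both.\<close>

locale normal_ext = k: cfield k for k +
  fixes S L :: "complex set"
  assumes finS: "finite S" and S_AI: "S \<subseteq> AI" and L_eq: "L = adj k S"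
    and normal: "fhom L \<tau> \<Longrightarrow> (\<And>x. x \<in> k \<Longrightarrow> \<tau> x = x) \<Longrightarrow> s \<in> S \<Longrightarrow> \<tau> s \<in> S"
begin

sublocale L: cfield L unfolding L_eq by (rule cfield_adj)

abbreviation "G \<equiv> carrier (galois_group k L)"

lemma kL: "k \<subseteq> L" and SL: "S \<subseteq> L" unfolding L_eq by (rule adj_base adj_gen)+

lemma G_D:
  assumes "\<sigma> \<in> G"
  shows "\<sigma> \<in> extensional L" "bij_betw \<sigma> L L" "fhom L \<sigma>" "x \<in> k \<Longrightarrow> \<sigma> x = x" "\<sigma> \<in> Bij L"
  using assms by (auto simp: galois_group_iff[OF L.cfield_axioms] Bij_def)

lemma G_in: "\<sigma> \<in> G \<Longrightarrow> x \<in> L \<Longrightarrow> \<sigma> x \<in> L"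
  using G_D(2) bij_betwE by blast

lemma G_S: "\<sigma> \<in> G \<Longrightarrow> s \<in> S \<Longrightarrow> \<sigma> s \<in> S"
  using normal[OF G_D(3)] G_D(4) by auto

lemma G_S_bij: "\<sigma> \<in> G \<Longrightarrow> bij_betw \<sigma> S S"
proof -
  assume \<sigma>: "\<sigma> \<in> G"
  then have "inj_on \<sigma> S" using G_D(2)[OF \<sigma>] SL by (meson bij_betw_def inj_on_subset)
  then show ?thesis using G_S[OF \<sigma>] finS
    by (simp add: bij_betw_def endo_inj_surj image_subsetI)
qed

lemma eq_on_L:
  assumes "fhom L \<sigma>" "fhom L \<tau>" "\<And>x. x \<in> k \<Longrightarrow> \<sigma> x = \<tau> x" "\<And>s. s \<in> S \<Longrightarrow> \<sigma> s = \<tau> s" "x \<in> L"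
  shows "\<sigma> x = \<tau> x"
proof -
  interpret s: fhom L \<sigma> by fact
  interpret t: fhom L \<tau> by fact
  have "cfield {x \<in> L. \<sigma> x = \<tau> x}"
  proof (rule cfieldI)
    show "0 \<in> {x \<in> L. \<sigma> x = \<tau> x}" "1 \<in> {x \<in> L. \<sigma> x = \<tau> x}"
      by (auto simp: L.zero L.one s.hone t.hone)
    fix x assume x: "x \<in> {x \<in> L. \<sigma> x = \<tau> x}"
    then show "inverse x \<in> {x \<in> L. \<sigma> x = \<tau> x}" using s.hinverse[of x] t.hinverse[of x] L.inverse[of x] by simp
    fix y assume y: "y \<in> {x \<in> L. \<sigma> x = \<tau> x}"
    show "x + y \<in> {x \<in> L. \<sigma> x = \<tau> x} \<and> x - y \<in> {x \<in> L. \<sigma> x = \<tau> x} \<and> x * y \<in> {x \<in> L. \<sigma> x = \<tau> x}"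
      using x y s.hadd[of x y] t.hadd[of x y] s.hdiff[of x y] t.hdiff[of x y] s.hmult[of x y] t.hmult[of x y]
        L.add[of x y] L.diff[of x y] L.mult[of x y] by simp
  qed
  then have "adj k S \<subseteq> {x \<in> L. \<sigma> x = \<tau> x}"
    using assms(3,4) kL SL by (intro adj_least) auto
  then show ?thesis using assms(5) L_eq by auto
qed

lemma G_eqI:
  assumes "\<sigma> \<in> G" "\<tau> \<in> G" "\<And>s. s \<in> S \<Longrightarrow> \<sigma> s = \<tau> s"
  shows "\<sigma> = \<tau>"
proof (rule extensionalityI[of _ L])
  fix x assume x: "x \<in> L"
  show "\<sigma> x = \<tau> x"
  proof (rule eq_on_L[OF G_D(3)[OF assms(1)] G_D(3)[OF assms(2)] _ assms(3) x])
    fix z assume "z \<in> k"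
    then show "\<sigma> z = \<tau> z" using G_D(4)[OF assms(1)] G_D(4)[OF assms(2)] by simp
  qed
qed (rule G_D(1)[OF assms(1)] G_D(1)[OF assms(2)])+

text \<open>A \<open>k\<close>-homomorphism permutes the finite set \<open>S\<close>, so its image
  is a field containing \<open>k\<close> and \<open>S\<close>: surjectivity is automatic.\<close>

lemma G_I:
  assumes "fhom L \<tau>" "\<And>x. x \<in> k \<Longrightarrow> \<tau> x = x"
  shows "restrict \<tau> L \<in> G"
proof -
  interpret t: fhom L \<tau> by fact
  have "inj_on \<tau> S" using t.hinj SL by (meson inj_on_subset)
  then have S: "\<tau> ` S = S" using normal[OF assms] finS by (simp add: endo_inj_surj image_subsetI)
  have "L \<subseteq> \<tau> ` L"
  proof -
    have "k \<subseteq> \<tau> ` L" using assms(2) kL by force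
    moreover have "S \<subseteq> \<tau> ` L" using S SL by blast
    ultimately have "adj k S \<subseteq> \<tau> ` L" by (rule adj_least[OF t.himage])
    then show ?thesis using L_eq by simp
  qed
  moreover have "\<tau> ` L \<subseteq> L"
  proof -
    have "cfield {x \<in> L. \<tau> x \<in> L}"
      by (rule cfieldI)
        (auto simp: L.zero L.one t.hone L.add L.diff L.mult L.inverse t.hadd t.hdiff t.hmult t.hinverse)
    then have "adj k S \<subseteq> {x \<in> L. \<tau> x \<in> L}"
      using assms(2) kL SL normal[OF assms] by (intro adj_least) auto
    then show ?thesis using L_eq by auto
  qed
  ultimately have "bij_betw \<tau> L L" using t.hinj by (auto simp: bij_betw_def)
  moreover have "fhom L (restrict \<tau> L)"
    by unfold_locales (auto simp: t.hone t.hadd t.hmult L.one L.add L.mult)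
  moreover have "bij_betw (restrict \<tau> L) L L" using \<open>bij_betw \<tau> L L\<close> by (simp cong: bij_betw_cong)
  moreover have "\<forall>x\<in>k. restrict \<tau> L x = x" using assms(2) kL by (simp add: subset_iff)
  ultimately show ?thesis by (simp add: galois_group_iff[OF L.cfield_axioms])
qed

lemma G_comp: "\<sigma> \<in> G \<Longrightarrow> \<tau> \<in> G \<Longrightarrow> compose L \<sigma> \<tau> \<in> G"
proof -
  assume s: "\<sigma> \<in> G" and t: "\<tau> \<in> G"
  interpret s: fhom L \<sigma> using G_D(3)[OF s] .
  interpret t: fhom L \<tau> using G_D(3)[OF t] .
  have "fhom L (\<lambda>x. \<sigma> (\<tau> x))"
    by unfold_locales (auto simp: s.hone t.hone t.hadd t.hmult s.hadd s.hmult G_in[OF t])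
  then have "restrict (\<lambda>x. \<sigma> (\<tau> x)) L \<in> G"
    by (rule G_I) (simp add: G_D(4)[OF s] G_D(4)[OF t])
  then show ?thesis by (simp add: compose_def)
qed

lemma G_id: "(\<lambda>x\<in>L. x) \<in> G"
  by (rule G_I[OF fhom_id]) (auto intro: L.cfield_axioms)

lemma G_inv:
  assumes "\<sigma> \<in> G"
  obtains \<rho> where "\<rho> \<in> G" "\<And>x. x \<in> L \<Longrightarrow> \<rho> (\<sigma> x) = x" "\<And>x. x \<in> L \<Longrightarrow> \<sigma> (\<rho> x) = x"
    "\<rho> = inv\<^bsub>BijGroup L\<^esub> \<sigma>"
proof -
  interpret s: fhom L \<sigma> using G_D(3)[OF assms] .
  let ?r = "inv_into L \<sigma>"
  have bij: "bij_betw \<sigma> L L" using G_D(2)[OF assms] .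
  have r: "?r x \<in> L" "\<sigma> (?r x) = x" "?r (\<sigma> x) = x" if "x \<in> L" for x
    using that bij by (auto simp: bij_betw_def inv_into_into f_inv_into_f)
  have inj: "u = v" if "\<sigma> u = \<sigma> v" "u \<in> L" "v \<in> L" for u v
    using bij that by (auto simp: bij_betw_def inj_on_def)
  have "fhom L ?r"
  proof unfold_locales
    show "?r 1 = 1" using r(3)[OF L.one] by (simp add: s.hone)
    fix x y assume xy: "x \<in> L" "y \<in> L"
    show "?r (x + y) = ?r x + ?r y"
      by (rule inj) (use xy in \<open>auto simp: r s.hadd L.add\<close>)
    show "?r (x * y) = ?r x * ?r y"
      by (rule inj) (use xy in \<open>auto simp: r s.hmult L.mult\<close>)
  qed
  moreover have "?r x = x" if "x \<in> k" for x using r(3)[of x] that kL G_D(4)[OF assms that] by auto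
  ultimately have "restrict ?r L \<in> G" by (rule G_I)
  moreover have "restrict ?r L = inv\<^bsub>BijGroup L\<^esub> \<sigma>"
    using inv_BijGroup[of \<sigma> L] G_D(5)[OF assms] by simp
  moreover have "restrict ?r L (\<sigma> x) = x" "\<sigma> (restrict ?r L x) = x" if "x \<in> L" for x
    using r[OF that] G_in[OF assms that] that by simp_all
  ultimately show ?thesis by (intro that[of "restrict ?r L"])
qed

lemma subgroup_G: "subgroup G (BijGroup L)"
proof (rule subgroup.intro)
  show "G \<subseteq> carrier (BijGroup L)" using G_D(5) by (auto simp: BijGroup_def)
  show "\<one>\<^bsub>BijGroup L\<^esub> \<in> G" using G_id by (simp add: BijGroup_def)
  fix x assume x: "x \<in> G"
  show "inv\<^bsub>BijGroup L\<^esub> x \<in> G" by (rule G_inv[OF x]) simp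
  fix y assume y: "y \<in> G"
  show "x \<otimes>\<^bsub>BijGroup L\<^esub> y \<in> G"
    using G_comp[OF x y] G_D(5)[OF x] G_D(5)[OF y] by (simp add: BijGroup_def)
qed

lemma galois_group_eq: "galois_group k L = (BijGroup L)\<lparr>carrier := G\<rparr>"
  by (simp add: galois_group_def)

lemma group_G: "group (galois_group k L)"
  using subgroup.subgroup_is_group[OF subgroup_G group_BijGroup] galois_group_eq by simp

lemma G_mult: "\<sigma> \<in> G \<Longrightarrow> \<tau> \<in> G \<Longrightarrow> \<sigma> \<otimes>\<^bsub>galois_group k L\<^esub> \<tau> = compose L \<sigma> \<tau>"
  using G_D(5)[of \<sigma>] G_D(5)[of \<tau>] by (simp add: galois_group_def BijGroup_def)

lemma G_inv_eq:
  assumes "\<sigma> \<in> G"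
  shows "inv\<^bsub>galois_group k L\<^esub> \<sigma> \<in> G" "x \<in> L \<Longrightarrow> (inv\<^bsub>galois_group k L\<^esub> \<sigma>) (\<sigma> x) = x"
    "x \<in> L \<Longrightarrow> \<sigma> ((inv\<^bsub>galois_group k L\<^esub> \<sigma>) x) = x"
proof -
  have eq: "inv\<^bsub>galois_group k L\<^esub> \<sigma> = inv\<^bsub>BijGroup L\<^esub> \<sigma>"
    using group.m_inv_consistent[OF group_BijGroup subgroup_G assms] galois_group_eq by simp
  show "inv\<^bsub>galois_group k L\<^esub> \<sigma> \<in> G" "x \<in> L \<Longrightarrow> (inv\<^bsub>galois_group k L\<^esub> \<sigma>) (\<sigma> x) = x"
    "x \<in> L \<Longrightarrow> \<sigma> ((inv\<^bsub>galois_group k L\<^esub> \<sigma>) x) = x"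
  proof (goal_cases)
    case 1
    show ?case by (rule G_inv[OF assms]) (simp add: eq)
  next
    case 2
    show ?case by (rule G_inv[OF assms]) (use 2 in \<open>simp add: eq\<close>)
  next
    case 3
    show ?case by (rule G_inv[OF assms]) (use 3 in \<open>simp add: eq\<close>)
  qed
qed

lemma finite_G: "finite G"
proof -
  have "inj_on (\<lambda>\<sigma>. restrict \<sigma> S) G"
  proof (rule inj_onI, rule G_eqI)
    fix \<sigma> \<tau> s assume "restrict \<sigma> S = restrict \<tau> S" "s \<in> S"
    then show "\<sigma> s = \<tau> s" by (metis restrict_apply')
  qed
  moreover have "(\<lambda>\<sigma>. restrict \<sigma> S) ` G \<subseteq> S \<rightarrow>\<^sub>E S"
  proof (rule image_subsetI)
    fix \<sigma> assume "\<sigma> \<in> G"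
    then show "restrict \<sigma> S \<in> S \<rightarrow>\<^sub>E S" using G_S[of \<sigma>] by (simp add: restrict_PiE_iff)
  qed
  moreover have "finite (S \<rightarrow>\<^sub>E S)" using finS by (intro finite_PiE) simp_all
  ultimately show ?thesis by (meson finite_imageD finite_subset)
qed

text \<open>An element outside \<open>k\<close> is moved by some homomorphism over \<open>k\<close>,
  and its restriction to \<open>L\<close> belongs to \<open>G\<close>.\<close>

theorem fixed_field:
  assumes "x \<in> L" "\<And>\<sigma>. \<sigma> \<in> G \<Longrightarrow> \<sigma> x = x"
  shows "x \<in> k"
proof (rule ccontr)
  assume "x \<notin> k"
  then obtain \<tau> where "fhom (adj k S) \<tau>" "\<forall>z\<in>k. \<tau> z = z" "\<tau> x \<noteq> x"
  proof -
    have "algebraic_over k s" if "s \<in> S" for s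
      by (rule k.algebraic_over_if_algebraic_int) (use that S_AI in auto)
    then show ?thesis using k.moved_by_hom[OF finS, of x] assms(1) \<open>x \<notin> k\<close> that
      by (auto simp: L_eq[symmetric])
  qed
  then have "restrict \<tau> L \<in> G" "restrict \<tau> L x \<noteq> x"
    using G_I[of \<tau>] assms(1) by (simp_all add: L_eq[symmetric])
  then show False using assms(2)[of "restrict \<tau> L"] by simp
qed

lemma G_AI: "\<sigma> \<in> G \<Longrightarrow> x \<in> L \<Longrightarrow> algebraic_int x \<Longrightarrow> algebraic_int (\<sigma> x)"
  using fhom.halgebraic_int[OF G_D(3)] by blast

lemma G_reindex:
  assumes "\<tau> \<in> G"
  shows "bij_betw (\<lambda>\<sigma>. compose L \<tau> \<sigma>) G G"
proof -
  have "inj_on (\<lambda>\<sigma>. compose L \<tau> \<sigma>) G"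
  proof (rule inj_onI)
    fix \<sigma> \<rho> assume *: "\<sigma> \<in> G" "\<rho> \<in> G" "compose L \<tau> \<sigma> = compose L \<tau> \<rho>"
    show "\<sigma> = \<rho>"
    proof (rule G_eqI[OF *(1,2)])
      fix s assume s: "s \<in> S"
      then have "s \<in> L" using SL by blast
      then have "\<tau> (\<sigma> s) = \<tau> (\<rho> s)" using fun_cong[OF *(3), of s] by (simp add: compose_def)
      moreover have "\<sigma> s \<in> L" "\<rho> s \<in> L" using G_in[OF *(1), of s] G_in[OF *(2), of s] s SL by blast+
      ultimately show "\<sigma> s = \<rho> s" using fhom.hinj[OF G_D(3)[OF assms]] unfolding inj_on_def by blast
    qed
  qed
  moreover have "(\<lambda>\<sigma>. compose L \<tau> \<sigma>) ` G \<subseteq> G" by (rule image_subsetI, rule G_comp[OF assms])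
  ultimately show ?thesis using endo_inj_surj[OF finite_G] unfolding bij_betw_def by blast
qed

definition Tr :: "complex \<Rightarrow> complex" where
  "Tr x = (\<Sum>\<sigma>\<in>G. \<sigma> x)"

lemma Tr_in_k: "x \<in> L \<Longrightarrow> Tr x \<in> k"
proof (rule fixed_field)
  assume x: "x \<in> L"
  show "Tr x \<in> L" unfolding Tr_def by (rule L.sum, rule G_in[OF _ x])
  fix \<tau> assume t: "\<tau> \<in> G"
  interpret t: fhom L \<tau> using G_D(3)[OF t] .
  have "\<tau> (Tr x) = (\<Sum>\<sigma>\<in>G. \<tau> (\<sigma> x))" unfolding Tr_def by (rule t.hsum, rule G_in[OF _ x])
  also have "\<dots> = (\<Sum>\<sigma>\<in>G. compose L \<tau> \<sigma> x)" using x by (simp add: compose_def)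
  also have "\<dots> = Tr x" unfolding Tr_def by (rule sum.reindex_bij_betw[OF G_reindex[OF t]])
  finally show "\<tau> (Tr x) = Tr x" .
qed

lemma Tr_AI: "x \<in> L \<Longrightarrow> algebraic_int x \<Longrightarrow> algebraic_int (Tr x)"
  using AI.sum[of G "\<lambda>\<sigma>. \<sigma> x"] G_AI[of _ x] by (simp add: Tr_def)

end

section \<open>Frobenius elements\<close>

definition OI :: "complex set \<Rightarrow> complex set" where
  "OI k = {x \<in> k. algebraic_int x}"

lemma ring_of_integers_simps [simp]:
  "carrier (ring_of_integers k) = OI k" "x \<otimes>\<^bsub>ring_of_integers k\<^esub> y = x * y"
  "x \<oplus>\<^bsub>ring_of_integers k\<^esub> y = x + y" "\<zero>\<^bsub>ring_of_integers k\<^esub> = 0" "\<one>\<^bsub>ring_of_integers k\<^esub> = 1"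
  by (auto simp: ring_of_integers_def ring_of_type_algebra_def OI_def)

lemma (in csubring) csubring_OI: "csubring (OI A)"
proof (unfold_locales)
  fix x y assume "x \<in> OI A" "y \<in> OI A"
  then show "x + y \<in> OI A" "x - y \<in> OI A" "x * y \<in> OI A"
    using add[of x y] diff[of x y] mult[of x y] AI.add[of x y] AI.diff[of x y] AI.mult[of x y]
    by (simp_all add: OI_def)
qed (use zero one AI.zero AI.one in \<open>simp_all add: OI_def\<close>)

context normal_ext
begin

lemma G_OI: "\<sigma> \<in> G \<Longrightarrow> x \<in> OI L \<Longrightarrow> \<sigma> x \<in> OI L"
  using G_in[of \<sigma> x] G_AI[of \<sigma> x] by (simp add: OI_def)

lemma S_OI: "S \<subseteq> OI L" using SL S_AI by (auto simp: OI_def)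

lemma OI_k: "OI k \<subseteq> OI L" using kL by (auto simp: OI_def)

lemma OI_L: "OI L \<subseteq> L" by (auto simp: OI_def)

lemma Tr_OI: "x \<in> OI L \<Longrightarrow> Tr x \<in> OI k"
  using Tr_in_k[of x] Tr_AI[of x] by (simp add: OI_def)

sublocale OL: csubring "OI L" by (rule L.csubring_OI)

lemma G_comp_apply: "x \<in> L \<Longrightarrow> compose L \<sigma> \<tau> x = \<sigma> (\<tau> x)"
  by (simp add: compose_def)

section \<open>Expansion of the product of the root differences\<close>

definition pairs where "pairs = {x \<in> S \<times> S. fst x \<noteq> snd x}"

text \<open>Up to sign, the discriminant of the polynomial with root set \<open>S\<close>. Ordered
  pairs make it invariant under all permutations of \<open>S\<close>.\<close>

definition dsc where "dsc = (\<Prod>x\<in>pairs. snd x - fst x)"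

text \<open>In the expansion of the product over all pairs, \<open>U\<close> collects the factors
  from which \<open>snd x\<close> is chosen, giving \<open>eU U\<close>; the other factors
  contribute \<open>- fst x\<close>, giving \<open>fU U\<close>.\<close>

definition eU where "eU U = (\<Prod>x\<in>U. snd x)" for U :: "(complex \<times> complex) set"

definition fU where "fU U = (\<Prod>x\<in>pairs - U. - fst x)"

lemma finite_pairs: "finite pairs" unfolding pairs_def using finS by simp

lemma pairs_OI: "x \<in> pairs \<Longrightarrow> fst x \<in> OI L \<and> snd x \<in> OI L"
  using S_OI by (auto simp: pairs_def)

lemma eU_OI: "U \<subseteq> pairs \<Longrightarrow> eU U \<in> OI L"
  unfolding eU_def by (rule OL.prod) (use pairs_OI in blast)

lemma fU_OI: "fU U \<in> OI L"
  unfolding fU_def by (rule OL.prod, rule OL.uminus) (use pairs_OI in blast)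

lemma dsc_OI: "dsc \<in> OI L"
  unfolding dsc_def by (rule OL.prod, rule OL.diff) (use pairs_OI in blast)+

text \<open>The automorphism acts on one half of each term and the exponent on the other. The
  exponent is 1 for the dual basis identity and \<open>q\<close> for the Frobenius.\<close>

lemma expand:
  assumes "\<sigma> \<in> G"
  shows "(\<Sum>U\<in>Pow pairs. eU U ^ n * \<sigma> (fU U)) = (\<Prod>x\<in>pairs. snd x ^ n - \<sigma> (fst x))"
proof -
  interpret s: fhom L \<sigma> using G_D(3)[OF assms] .
  have 1: "fst x \<in> L" if "x \<in> pairs" for x using pairs_OI[OF that] OI_L by blast
  have "\<sigma> (fU U) = (\<Prod>x\<in>pairs - U. - \<sigma> (fst x))" for U
  proof -
    have "\<sigma> (fU U) = (\<Prod>x\<in>pairs - U. \<sigma> (- fst x))"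
      unfolding fU_def by (rule s.hprod, rule L.uminus) (use 1 in blast)
    also have "\<dots> = (\<Prod>x\<in>pairs - U. - \<sigma> (fst x))" by (rule prod.cong) (use 1 s.huminus in auto)
    finally show ?thesis .
  qed
  then have "(\<Sum>U\<in>Pow pairs. eU U ^ n * \<sigma> (fU U)) =
      (\<Sum>U\<in>Pow pairs. (\<Prod>x\<in>U. snd x ^ n) * (\<Prod>x\<in>pairs - U. - \<sigma> (fst x)))"
    by (simp add: eU_def prod_power_distrib)
  also have "\<dots> = (\<Prod>x\<in>pairs. snd x ^ n + - \<sigma> (fst x))" by (rule prod_add[OF finite_pairs, symmetric])
  finally show ?thesis by simp
qed

lemma trace_expand:
  assumes "y \<in> L"
  shows "(\<Sum>U\<in>Pow pairs. eU U ^ n * Tr (fU U * y)) = (\<Sum>\<sigma>\<in>G. (\<Prod>x\<in>pairs. snd x ^ n - \<sigma> (fst x)) * \<sigma> y)"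
proof -
  have fL: "fU U \<in> L" for U using fU_OI OI_L by blast
  have "(\<Sum>U\<in>Pow pairs. eU U ^ n * Tr (fU U * y)) = (\<Sum>U\<in>Pow pairs. \<Sum>\<sigma>\<in>G. eU U ^ n * \<sigma> (fU U) * \<sigma> y)"
    unfolding Tr_def sum_distrib_left
    by (intro sum.cong refl) (simp add: fhom.hmult[OF G_D(3) fL assms] mult.assoc)
  also have "\<dots> = (\<Sum>\<sigma>\<in>G. \<Sum>U\<in>Pow pairs. eU U ^ n * \<sigma> (fU U) * \<sigma> y)" by (rule sum.swap)
  also have "\<dots> = (\<Sum>\<sigma>\<in>G. (\<Sum>U\<in>Pow pairs. eU U ^ n * \<sigma> (fU U)) * \<sigma> y)" by (simp add: sum_distrib_right)
  also have "\<dots> = (\<Sum>\<sigma>\<in>G. (\<Prod>x\<in>pairs. snd x ^ n - \<sigma> (fst x)) * \<sigma> y)"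
    by (intro sum.cong refl) (simp add: expand)
  finally show ?thesis .
qed

text \<open>The elements \<open>eU U\<close> and \<open>fU U\<close> behave like dual bases up to the factor \<open>dsc\<close>: the sum of
  \<open>eU U * \<sigma> (fU U)\<close> over all \<open>U\<close> is \<open>dsc\<close> for the identity and vanishes for every other \<open>\<sigma>\<close>.\<close>

lemma dual_basis:
  assumes "y \<in> L"
  shows "dsc * y = (\<Sum>U\<in>Pow pairs. eU U * Tr (fU U * y))"
proof -
  have z: "(\<Prod>x\<in>pairs. snd x ^ 1 - \<sigma> (fst x)) = 0" if s: "\<sigma> \<in> G" "\<sigma> \<noteq> (\<lambda>x\<in>L. x)" for \<sigma>
  proof -
    have "\<exists>s\<in>S. \<sigma> s \<noteq> s"
    proof (rule ccontr)
      assume no: "\<not> ?thesis"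
      have "\<sigma> = (\<lambda>x\<in>L. x)"
      proof (rule G_eqI[OF s(1) G_id])
        fix t assume "t \<in> S"
        then show "\<sigma> t = (\<lambda>x\<in>L. x) t" using no SL by auto
      qed
      then show False using s(2) by simp
    qed
    then obtain t where t: "t \<in> S" "\<sigma> t \<noteq> t" by blast
    \<comment> \<open>The factor belonging to this pair is \<open>\<sigma> t - \<sigma> t\<close>,
      so the whole product vanishes.\<close>
    have "(t, \<sigma> t) \<in> pairs" using t G_S[OF s(1) t(1)] by (simp add: pairs_def)
    then show ?thesis by (intro prod_zero[OF finite_pairs]) (rule bexI[of _ "(t, \<sigma> t)"], auto)
  qed
  have "(\<Sum>U\<in>Pow pairs. eU U ^ 1 * Tr (fU U * y)) = (\<Sum>\<sigma>\<in>G. (\<Prod>x\<in>pairs. snd x ^ 1 - \<sigma> (fst x)) * \<sigma> y)"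
    by (rule trace_expand[OF assms])
  also have "\<dots> = (\<Sum>\<sigma>\<in>{\<lambda>x\<in>L. x}. (\<Prod>x\<in>pairs. snd x ^ 1 - \<sigma> (fst x)) * \<sigma> y)"
    by (rule sum.mono_neutral_right[OF finite_G]) (use G_id z in auto)
  also have "\<dots> = dsc * y"
  proof -
    have "(\<Prod>x\<in>pairs. snd x ^ 1 - (\<lambda>x\<in>L. x) (fst x)) = dsc"
      unfolding dsc_def by (rule prod.cong) (use pairs_OI OI_L in auto)
    then show ?thesis using assms by simp
  qed
  finally show ?thesis by simp
qed

lemma prod_roots_coeffs: "pover (OI k) (\<Prod>t\<in>S. [:- t, 1:])"
proof -
  let ?F = "\<Prod>t\<in>S. [:- t, 1:]"
  have t1: "pover (OI L) [:- t, 1:]" if "t \<in> S" for t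
    using that S_OI by (intro OL.pover_pCons OL.pover_0 OL.uminus OL.one) auto
  have F: "pover (OI L) ?F" by (rule OL.pover_prod, rule t1)
  have FL: "pover L (\<Prod>t\<in>T. [:- t, 1:])" if "T \<subseteq> S" for T
    by (rule L.pover_prod) (use pover_mono[OF t1 OI_L] that in blast)
  have "poly.coeff ?F i \<in> OI k" for i
  proof -
    have c: "poly.coeff ?F i \<in> OI L" using F by (simp add: pover_def)
    have "poly.coeff ?F i \<in> k"
    proof (rule fixed_field)
      show "poly.coeff ?F i \<in> L" using c OI_L by blast
      fix \<sigma> assume s: "\<sigma> \<in> G"
      interpret s: fhom L \<sigma> using G_D(3)[OF s] .
      have "map_poly \<sigma> (\<Prod>t\<in>T. [:- t, 1:]) = (\<Prod>t\<in>T. [:- \<sigma> t, 1:])" if "T \<subseteq> S" for T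
        using finite_subset[OF that finS] that
      proof (induction T rule: finite_induct)
        case empty
        show ?case by (simp add: poly_eq_iff s.coeff_hpoly s.hone)
      next
        case (insert t T)
        have t: "t \<in> S" "t \<in> L" using insert SL by auto
        have "map_poly \<sigma> [:- t, 1:] = [:- \<sigma> t, 1:]"
          by (rule poly_eqI) (auto simp: s.coeff_hpoly coeff_pCons s.hone s.huminus[OF t(2)] split: nat.splits)
        moreover have "pover L [:- t, 1:]" using FL[of "{t}"] t by simp
        moreover have "pover L (\<Prod>t\<in>T. [:- t, 1:])" using FL[of T] insert by simp
        ultimately show ?case using insert s.hpoly_mult[of "[:- t, 1:]" "\<Prod>t\<in>T. [:- t, 1:]"]
          by (simp only: prod.insert[OF insert.hyps(1,2)] insert_subset)
      qed
      then have "map_poly \<sigma> ?F = (\<Prod>t\<in>S. [:- \<sigma> t, 1:])" by simp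
      also have "\<dots> = ?F" by (rule prod.reindex_bij_betw[OF G_S_bij[OF s]])
      finally show "\<sigma> (poly.coeff ?F i) = poly.coeff ?F i" by (metis s.coeff_hpoly)
    qed
    then show ?thesis using c by (simp add: OI_def)
  qed
  then show ?thesis by (simp add: pover_def)
qed

end

text \<open>Here \<open>P\<close> is a prime of \<open>L\<close>, and \<open>q\<close> will be the
  norm of the prime of \<open>k\<close> below it. The assumptions collect what is used of the
  residue field: the power map is additive and trivial on \<open>OI k\<close>, and the elements of
  \<open>S\<close> have distinct residues.\<close>

locale frob = normal_ext k S L + P: cprime "OI L" P for k S L P +
  fixes q :: nat
  assumes qpos: "q > 0"
    and frob_add: "x \<in> OI L \<Longrightarrow> y \<in> OI L \<Longrightarrow> (x + y) ^ q - (x ^ q + y ^ q) \<in> P"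
    and frob_k: "a \<in> OI k \<Longrightarrow> a ^ q - a \<in> P"
    and distinct: "s \<in> S \<Longrightarrow> t \<in> S \<Longrightarrow> s - t \<in> P \<Longrightarrow> s = t"
begin

lemma dsc_notin: "dsc \<notin> P"
proof
  assume "dsc \<in> P"
  then have "\<exists>x\<in>pairs. snd x - fst x \<in> P"
    unfolding dsc_def
    by (rule P.prime_prod[OF finite_pairs, rotated]) (rule OL.diff, use pairs_OI in blast, use pairs_OI in blast)
  then show False using distinct by (auto simp: pairs_def)
qed

lemma frob_sum: "(\<And>i. i \<in> I \<Longrightarrow> f i \<in> OI L) \<Longrightarrow> P.cg ((\<Sum>i\<in>I. f i) ^ q) (\<Sum>i\<in>I. f i ^ q)"
proof (induction I rule: infinite_finite_induct)
  case (insert i I)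
  have "f i \<in> OI L" "(\<Sum>i\<in>I. f i) \<in> OI L" using insert.prems by (auto intro: OL.sum)
  from frob_add[OF this] have "P.cg ((f i + (\<Sum>i\<in>I. f i)) ^ q) (f i ^ q + (\<Sum>i\<in>I. f i) ^ q)"
    by (simp add: P.cg_def)
  also have "P.cg (f i ^ q + (\<Sum>i\<in>I. f i) ^ q) (f i ^ q + (\<Sum>i\<in>I. f i ^ q))"
    by (rule P.cg_add) (use insert in auto)
  finally show ?case using insert by simp
qed (use qpos in \<open>auto simp: power_0_left\<close>)

lemma frob_poly:
  assumes "pover (OI k) F" "x \<in> OI L"
  shows "P.cg (poly F (x ^ q)) (poly F x ^ q)"
proof -
  have c: "poly.coeff F i \<in> OI k" "poly.coeff F i \<in> OI L" for i using assms(1) OI_k by (auto simp: pover_def)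
  have "P.cg (poly F x ^ q) (\<Sum>i\<le>Polynomial.degree F. (poly.coeff F i * x ^ i) ^ q)"
    unfolding poly_altdef by (rule frob_sum) (intro OL.mult OL.power c assms)
  also have "P.cg (\<Sum>i\<le>Polynomial.degree F. (poly.coeff F i * x ^ i) ^ q)
      (\<Sum>i\<le>Polynomial.degree F. poly.coeff F i * (x ^ q) ^ i)"
  proof (rule P.cg_sum)
    fix i
    have "P.cg (poly.coeff F i ^ q * (x ^ q) ^ i) (poly.coeff F i * (x ^ q) ^ i)"
      using frob_k[OF c(1)[of i]] by (intro P.cg_mult OL.power c assms P.cg_refl) (simp add: P.cg_def)
    then show "P.cg ((poly.coeff F i * x ^ i) ^ q) (poly.coeff F i * (x ^ q) ^ i)"
      by (simp add: power_mult_distrib power_mult[symmetric] mult.commute)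
  qed
  finally show ?thesis unfolding poly_altdef[of F "x ^ q"] by (rule P.cg_sym)
qed

text \<open>The polynomial with root set \<open>S\<close> has coefficients in \<open>OI k\<close>,
  so modulo \<open>P\<close> its value at \<open>s ^ q\<close> is the \<open>q\<close>-th power of
  its value at \<open>s\<close>, which is 0.\<close>

lemma frob_S:
  assumes "s \<in> S"
  shows "\<exists>t\<in>S. s ^ q - t \<in> P"
proof -
  let ?F = "\<Prod>t\<in>S. [:- t, 1:]"
  have s: "s \<in> OI L" using assms S_OI by blast
  have "poly ?F s = 0" using assms finS by (auto simp: poly_prod)
  then have "poly ?F s ^ q = 0" using qpos by simp
  then have "poly ?F (s ^ q) \<in> P" using frob_poly[OF prod_roots_coeffs s] by (simp only: P.cg_0)
  then have "(\<Prod>t\<in>S. s ^ q - t) \<in> P" by (simp add: poly_prod)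
  then show ?thesis
    by (rule P.prime_prod[OF finS, rotated]) (use S_OI s in \<open>auto intro!: OL.diff OL.power\<close>)
qed

definition C where "C \<sigma> = (\<Prod>x\<in>pairs. snd x ^ q - \<sigma> (fst x))"

text \<open>This is the \<open>q\<close>-th power of the dual basis identity: modulo
  \<open>P\<close> the power distributes over the sum and leaves the traces unchanged, because they
  lie in \<open>OI k\<close>.\<close>

lemma frob_combination:
  assumes "y \<in> OI L"
  shows "P.cg (dsc ^ q * y ^ q) (\<Sum>\<sigma>\<in>G. C \<sigma> * \<sigma> y)"
proof -
  have yL: "y \<in> L" using assms OI_L by blast
  have fy: "fU U * y \<in> OI L" for U using fU_OI assms by (rule OL.mult)
  have T: "Tr (fU U * y) \<in> OI k" "Tr (fU U * y) \<in> OI L" for U using Tr_OI[OF fy] OI_k by blast+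
  have "dsc ^ q * y ^ q = (\<Sum>U\<in>Pow pairs. eU U * Tr (fU U * y)) ^ q"
    by (simp add: power_mult_distrib[symmetric] dual_basis[OF yL])
  also have "P.cg \<dots> (\<Sum>U\<in>Pow pairs. (eU U * Tr (fU U * y)) ^ q)"
    by (rule frob_sum) (intro OL.mult eU_OI T, simp)
  also have "P.cg \<dots> (\<Sum>U\<in>Pow pairs. eU U ^ q * Tr (fU U * y))"
    using frob_k[OF T(1)] unfolding power_mult_distrib
    by (intro P.cg_sum P.cg_mult P.cg_refl OL.power eU_OI T) (simp_all add: P.cg_def)
  also have "(\<Sum>U\<in>Pow pairs. eU U ^ q * Tr (fU U * y)) = (\<Sum>\<sigma>\<in>G. C \<sigma> * \<sigma> y)"
    unfolding C_def by (rule trace_expand[OF yL])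
  finally show ?thesis .
qed

text \<open>By \<open>frob_S\<close>, \<open>s ^ q\<close> is congruent to \<open>\<sigma> u\<close>
  for some \<open>u\<close> in \<open>S\<close>. If \<open>u\<close> differed from \<open>s\<close>,
  the pair \<open>(u, s)\<close> would put a factor of \<open>C \<sigma>\<close> into
  \<open>P\<close>.\<close>

lemma C_notin:
  assumes "\<sigma> \<in> G" "C \<sigma> \<notin> P" "s \<in> S"
  shows "\<sigma> s - s ^ q \<in> P"
proof -
  obtain t where t: "t \<in> S" "s ^ q - t \<in> P" using frob_S[OF assms(3)] by blast
  then have "t \<in> \<sigma> ` S" using G_S_bij[OF assms(1)] by (simp add: bij_betw_def)
  then obtain u where u: "u \<in> S" "t = \<sigma> u" by blast
  have "u = s"
  proof (rule ccontr)
    assume "u \<noteq> s"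
    then have x: "(u, s) \<in> pairs" using u assms by (simp add: pairs_def)
    have "C \<sigma> \<in> P" unfolding C_def
    proof (rule P.iprod[OF finite_pairs x])
      fix x assume x: "x \<in> pairs"
      show "snd x ^ q - \<sigma> (fst x) \<in> OI L"
        using pairs_OI[OF x] G_OI[OF assms(1), of "fst x"] by (intro OL.diff OL.power) auto
    qed (use t u in simp)
    then show False using assms by simp
  qed
  then show ?thesis using t u P.iuminus[of "s ^ q - t"] by simp
qed

lemma frob_unique_aux:
  assumes "\<sigma> \<in> G" "\<tau> \<in> G" "\<And>s. s \<in> S \<Longrightarrow> \<sigma> s - s ^ q \<in> P" "\<And>s. s \<in> S \<Longrightarrow> \<tau> s - s ^ q \<in> P"
  shows "\<sigma> = \<tau>"
proof (rule G_eqI[OF assms(1,2)])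
  fix s assume s: "s \<in> S"
  have "\<sigma> s - \<tau> s \<in> P" using P.idiff[OF assms(3)[OF s] assms(4)[OF s]] by simp
  then show "\<sigma> s = \<tau> s" by (rule distinct[OF G_S[OF assms(1) s] G_S[OF assms(2) s]])
qed

text \<open>Modulo \<open>P\<close> at most one \<open>C \<sigma>\<close> survives, by
  \<open>C_notin\<close> and distinctness on \<open>S\<close>. Taking \<open>y = 1\<close> shows
  that one does survive and is congruent to \<open>dsc ^ q\<close>, which lies outside
  \<open>P\<close> and can be cancelled.\<close>

theorem frobenius_exists: "\<exists>\<phi>\<in>G. \<forall>y\<in>OI L. \<phi> y - y ^ q \<in> P"
proof -
  have one: "\<sigma> 1 = 1" if "\<sigma> \<in> G" for \<sigma> using fhom.hone[OF G_D(3)[OF that]] .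
  have dq: "dsc ^ q \<notin> P" using dsc_notin P.prime_power[OF dsc_OI] by blast
  have "(\<Sum>\<sigma>\<in>G. C \<sigma> * \<sigma> 1) = (\<Sum>\<sigma>\<in>G. C \<sigma>)" by (rule sum.cong) (simp_all add: one)
  then have eq: "P.cg (dsc ^ q) (\<Sum>\<sigma>\<in>G. C \<sigma>)" using frob_combination[OF OL.one] by simp
  have "\<exists>\<phi>\<in>G. C \<phi> \<notin> P"
  proof (rule ccontr)
    assume "\<not> ?thesis"
    then have "(\<Sum>\<sigma>\<in>G. C \<sigma>) \<in> P" by (intro P.isum) blast
    then show False using P.cg_in[OF eq] dq by simp
  qed
  then obtain \<phi> where \<phi>: "\<phi> \<in> G" "C \<phi> \<notin> P" by blast
  have others: "C \<sigma> \<in> P" if "\<sigma> \<in> G" "\<sigma> \<noteq> \<phi>" for \<sigma>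
    using frob_unique_aux[OF that(1) \<phi>(1)] C_notin[OF that(1)] C_notin[OF \<phi>] that(2) by blast
  have only: "P.cg (\<Sum>\<sigma>\<in>G. C \<sigma> * \<sigma> y) (C \<phi> * \<phi> y)" if y: "y \<in> OI L" for y
  proof -
    have "(\<Sum>\<sigma>\<in>G. C \<sigma> * \<sigma> y) = C \<phi> * \<phi> y + (\<Sum>\<sigma>\<in>G - {\<phi>}. C \<sigma> * \<sigma> y)"
      by (rule sum.remove[OF finite_G \<phi>(1)])
    moreover have "(\<Sum>\<sigma>\<in>G - {\<phi>}. C \<sigma> * \<sigma> y) \<in> P"
    proof (rule P.isum)
      fix \<sigma> assume "\<sigma> \<in> G - {\<phi>}"
      then show "C \<sigma> * \<sigma> y \<in> P" using others[of \<sigma>] G_OI[of \<sigma> y] y by (intro P.imult') auto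
    qed
    ultimately show ?thesis by (simp add: P.cg_def)
  qed
  have "P.cg (dsc ^ q) (C \<phi>)"     using P.cg_trans[OF eq] only[OF OL.one] one[OF \<phi>(1)] \<open>(\<Sum>\<sigma>\<in>G. C \<sigma> * \<sigma> 1) = _\<close> by simp
  then have c1: "P.cg (C \<phi>) (dsc ^ q)" by (rule P.cg_sym)
  have "\<phi> y - y ^ q \<in> P" if y: "y \<in> OI L" for y
  proof -
    have "P.cg (dsc ^ q * y ^ q) (C \<phi> * \<phi> y)" using P.cg_trans[OF frob_combination[OF y] only[OF y]] .
    also have "P.cg (C \<phi> * \<phi> y) (dsc ^ q * \<phi> y)"
      by (rule P.cg_mult[OF c1 P.cg_refl]) (rule OL.power[OF dsc_OI], rule G_OI[OF \<phi>(1) y])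
    finally have "dsc ^ q * (\<phi> y - y ^ q) \<in> P"
      using P.iuminus[of "dsc ^ q * y ^ q - dsc ^ q * \<phi> y"] by (simp add: P.cg_def algebra_simps)
    moreover have "\<phi> y - y ^ q \<in> OI L" using G_OI[OF \<phi>(1) y] y by (intro OL.diff OL.power)
    ultimately show ?thesis using P.prime[OF OL.power[OF dsc_OI]] dq by blast
  qed
  then show ?thesis using \<phi>(1) by blast
qed

lemma frobenius_unique:
  assumes "\<sigma> \<in> G" "\<tau> \<in> G" "\<forall>y\<in>OI L. \<sigma> y - y ^ q \<in> P" "\<forall>y\<in>OI L. \<tau> y - y ^ q \<in> P"
  shows "\<sigma> = \<tau>"
  by (rule frob_unique_aux[OF assms(1,2)]) (use assms(3,4) S_OI in blast)+

text \<open>If every \<open>\<sigma>\<close> had some \<open>w \<sigma>\<close> in \<open>Q\<close>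
  with \<open>\<sigma> (w \<sigma>)\<close> outside \<open>P\<close>, the product \<open>z\<close>
  of these images would be outside \<open>P\<close> while all conjugates of \<open>z\<close> lie in
  \<open>Q\<close>. The traces in the dual basis identity for \<open>z\<close> then lie in
  \<open>Q \<inter> k\<close>, hence in \<open>P\<close>, and so does
  \<open>dsc * z\<close>.\<close>

lemma primes_conjugate:
  assumes "cprime (OI L) Q" "Q \<inter> k \<subseteq> P"
  shows "\<exists>\<sigma>\<in>G. \<forall>x\<in>Q. \<sigma> x \<in> P"
proof (rule ccontr)
  interpret Q: cprime "OI L" Q by fact
  assume "\<not> ?thesis"
  then have "\<forall>\<sigma>\<in>G. \<exists>x. x \<in> Q \<and> \<sigma> x \<notin> P" by blast
  then obtain w where w: "\<And>\<sigma>. \<sigma> \<in> G \<Longrightarrow> w \<sigma> \<in> Q \<and> \<sigma> (w \<sigma>) \<notin> P" by metis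
  have wO: "w \<sigma> \<in> OI L" if "\<sigma> \<in> G" for \<sigma> using w[OF that] Q.sub by blast
  define z where "z = (\<Prod>\<sigma>\<in>G. \<sigma> (w \<sigma>))"
  have zf: "\<sigma> (w \<sigma>) \<in> OI L" if "\<sigma> \<in> G" for \<sigma> using G_OI[OF that wO[OF that]] .
  have z: "z \<in> OI L" unfolding z_def by (rule OL.prod, rule zf)
  have zP: "z \<notin> P"
  proof
    assume "z \<in> P"
    then have "\<exists>\<sigma>\<in>G. \<sigma> (w \<sigma>) \<in> P" unfolding z_def
      by (rule P.prime_prod[OF finite_G, rotated]) (rule zf)
    then show False using w by blast
  qed
  have zQ: "\<tau> z \<in> Q" if t: "\<tau> \<in> G" for \<tau>
  proof -
    interpret t: fhom L \<tau> using G_D(3)[OF t] .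
    obtain \<rho> where r: "\<rho> \<in> G" "\<And>x. x \<in> L \<Longrightarrow> \<tau> (\<rho> x) = x"
      by (rule G_inv[OF t]) (rule that)
    have "\<tau> z = (\<Prod>\<sigma>\<in>G. \<tau> (\<sigma> (w \<sigma>)))"
      unfolding z_def by (rule t.hprod) (use zf OI_L in blast)
    also have "\<dots> \<in> Q"
    proof (rule Q.iprod[OF finite_G r(1)])
      \<comment> \<open>Since \<open>\<rho>\<close> is inverse to \<open>\<tau>\<close>, this factor
        is \<open>w \<rho>\<close> itself.\<close>
      show "\<tau> (\<rho> (w \<rho>)) \<in> Q" using r(2)[of "w \<rho>"] w[OF r(1)] wO[OF r(1)] OI_L by auto
      fix \<sigma> assume s: "\<sigma> \<in> G"
      show "\<tau> (\<sigma> (w \<sigma>)) \<in> OI L" by (rule G_OI[OF t zf[OF s]])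
    qed
    finally show ?thesis .
  qed
  have zL: "z \<in> L" using z OI_L by blast
  have T: "Tr (fU U * z) \<in> P" for U
  proof -
    have fz: "fU U * z \<in> OI L" using fU_OI z by (rule OL.mult)
    have "Tr (fU U * z) \<in> Q" unfolding Tr_def
    proof (rule Q.isum)
      fix \<tau> assume t: "\<tau> \<in> G"
      have "\<tau> (fU U * z) = \<tau> (fU U) * \<tau> z"
        using fhom.hmult[OF G_D(3)[OF t] _ zL, of "fU U"] fU_OI OI_L by blast
      then show "\<tau> (fU U * z) \<in> Q" using Q.imult[OF G_OI[OF t fU_OI] zQ[OF t]] by simp
    qed
    moreover have "Tr (fU U * z) \<in> k" using Tr_OI[OF fz] by (simp add: OI_def)
    ultimately show ?thesis using assms(2) by blast
  qed
  have "dsc * z \<in> P" unfolding dual_basis[OF zL]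
    by (rule P.isum, rule P.imult) (auto intro: eU_OI T)
  then show False using P.prime[OF dsc_OI z] dsc_notin zP by blast
qed

text \<open>As \<open>G\<close> is finite, the inverse of \<open>\<sigma>\<close> is one of its
  powers, and these map \<open>P\<close> into itself as well.\<close>

lemma G_stable_inverse:
  assumes "\<sigma> \<in> G" "\<And>x. x \<in> P \<Longrightarrow> \<sigma> x \<in> P" "x \<in> L" "\<sigma> x \<in> P"
  shows "x \<in> P"
proof -
  interpret Gr: group "galois_group k L" by (rule group_G)
  have pw: "\<sigma> [^]\<^bsub>galois_group k L\<^esub> (n::nat) \<in> G \<and> (\<forall>x\<in>P. (\<sigma> [^]\<^bsub>galois_group k L\<^esub> n) x \<in> P)" for n
  proof (induction n)
    case 0
    have "\<one>\<^bsub>galois_group k L\<^esub> = (\<lambda>x\<in>L. x)" by (simp add: galois_group_def BijGroup_def)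
    then have "\<sigma> [^]\<^bsub>galois_group k L\<^esub> (0::nat) = (\<lambda>x\<in>L. x)" by simp
    moreover have "\<forall>x\<in>P. (\<lambda>x\<in>L. x) x \<in> P" using P.sub OI_L by auto
    ultimately show ?case using G_id by metis
  next
    case (Suc n)
    let ?p = "\<sigma> [^]\<^bsub>galois_group k L\<^esub> n"
    have "\<sigma> [^]\<^bsub>galois_group k L\<^esub> Suc n = compose L ?p \<sigma>" using G_mult[of ?p \<sigma>] Suc assms(1) by simp
    moreover have "compose L ?p \<sigma> x \<in> P" if "x \<in> P" for x
    proof -
      have "x \<in> L" using that P.sub OI_L by blast
      then show ?thesis using Suc assms(2)[OF that] by (simp add: compose_def)
    qed
    ultimately show ?case using G_comp[of ?p \<sigma>] Suc assms(1) by simp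
  qed
  define n where "n = Coset.order (galois_group k L) - 1"
  have "Coset.order (galois_group k L) > 0"
    using finite_G G_id by (auto simp: Coset.order_def card_gt_0_iff)
  then have n: "Suc n = Coset.order (galois_group k L)" by (simp add: n_def)
  have "\<sigma> [^]\<^bsub>galois_group k L\<^esub> Suc n = \<one>\<^bsub>galois_group k L\<^esub>"
    unfolding n using Gr.pow_order_eq_1 assms(1) by simp
  then have "compose L (\<sigma> [^]\<^bsub>galois_group k L\<^esub> n) \<sigma> = (\<lambda>x\<in>L. x)"
    using G_mult[of "\<sigma> [^]\<^bsub>galois_group k L\<^esub> n" \<sigma>] pw[of n] assms(1)
    by (simp add: galois_group_def BijGroup_def)
  then have "(\<sigma> [^]\<^bsub>galois_group k L\<^esub> n) (\<sigma> x) = x"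
    using assms(3) by (metis compose_eq restrict_apply')
  then show ?thesis using pw[of n] assms(4) by metis
qed

text \<open>Elementwise form of unramifiedness: up to a multiplier outside \<open>P\<close>, every
  element of \<open>P\<close> is generated by \<open>P \<inter> k\<close>. A factor \<open>v\<close>
  outside \<open>P\<close> is found that moves all conjugates of \<open>v * z\<close> into
  \<open>P\<close>; the traces in the dual basis identity for \<open>v * z\<close> then lie in
  \<open>P \<inter> k\<close>.\<close>

lemma prime_in_extended:
  assumes z: "z \<in> P" and gen: "\<And>a. a \<in> P \<inter> k \<Longrightarrow> a \<in> lspan (OI k) B"
  shows "\<exists>u\<in>OI L. u \<notin> P \<and> u * z \<in> lspan (OI L) B"
proof -
  interpret O: cideal "OI L" "OI L" by (rule OL.cideal_self)
  have zO: "z \<in> OI L" "z \<in> L" using z P.sub OI_L by blast+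
  have "\<exists>y\<in>OI L. y \<notin> P \<and> (\<tau> z \<in> P \<or> \<tau> y \<in> P)" if t: "\<tau> \<in> G" for \<tau>
  proof (cases "\<tau> z \<in> P")
    case True
    then show ?thesis using OL.one P.one_notin by blast
  next
    case False
    obtain \<rho> where r: "\<rho> \<in> G" "\<And>x. x \<in> L \<Longrightarrow> \<rho> (\<tau> x) = x" "\<And>x. x \<in> L \<Longrightarrow> \<tau> (\<rho> x) = x"
      by (rule G_inv[OF t]) (rule that)
    \<comment> \<open>If the inverse \<open>\<rho>\<close> of \<open>\<tau>\<close> mapped
      \<open>P\<close> into itself, then \<open>\<rho> (\<tau> z) = z\<close> in \<open>P\<close>
      would force \<open>\<tau> z\<close> into \<open>P\<close>.\<close>
    have "\<exists>w\<in>P. \<rho> w \<notin> P"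
    proof (rule ccontr)
      assume "\<not> ?thesis"
      then have st: "\<And>x. x \<in> P \<Longrightarrow> \<rho> x \<in> P" by blast
      have "\<tau> z \<in> P"
        by (rule G_stable_inverse[OF r(1) st G_in[OF t zO(2)]]) (use r(2)[OF zO(2)] z in simp_all)
      then show False using False by simp
    qed
    then obtain w where w: "w \<in> P" "\<rho> w \<notin> P" by blast
    then have wO: "w \<in> OI L" using P.sub by blast
    have "\<tau> (\<rho> w) = w" by (rule r(3)) (use wO OI_L in blast)
    then show ?thesis using G_OI[OF r(1) wO] w by metis
  qed
  then obtain y where y: "\<And>\<tau>. \<tau> \<in> G \<Longrightarrow> y \<tau> \<in> OI L \<and> y \<tau> \<notin> P \<and> (\<tau> z \<in> P \<or> \<tau> (y \<tau>) \<in> P)" by metis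
  define v where "v = (\<Prod>\<tau>\<in>G. y \<tau>)"
  have v: "v \<in> OI L" unfolding v_def by (rule OL.prod) (use y in blast)
  have vP: "v \<notin> P"
  proof
    assume "v \<in> P"
    then have "\<exists>\<tau>\<in>G. y \<tau> \<in> P" unfolding v_def
      by (rule P.prime_prod[OF finite_G, rotated]) (use y in blast)
    then show False using y by blast
  qed
  have vz: "v * z \<in> OI L" "v * z \<in> L" using v zO(1) OL.mult OI_L by blast+
  have J: "\<tau> (v * z) \<in> P" if t: "\<tau> \<in> G" for \<tau>
  proof -
    interpret t: fhom L \<tau> using G_D(3)[OF t] .
    have eq: "\<tau> (v * z) = \<tau> v * \<tau> z" using v zO OI_L by (intro t.hmult) auto
    show ?thesis
    proof (cases "\<tau> z \<in> P")
      case True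
      then show ?thesis unfolding eq by (rule P.imult[OF G_OI[OF t v]])
    next
      case False
      have yL: "y \<sigma> \<in> L" if "\<sigma> \<in> G" for \<sigma> using y[OF that] OI_L by blast
      have "\<tau> v = (\<Prod>\<sigma>\<in>G. \<tau> (y \<sigma>))" unfolding v_def by (rule t.hprod, rule yL)
      also have "\<dots> \<in> P"
      proof (rule P.iprod[OF finite_G t])
        show "\<tau> (y \<tau>) \<in> P" using y[OF t] False by blast
        fix \<sigma> assume "\<sigma> \<in> G"
        then show "\<tau> (y \<sigma>) \<in> OI L" using y[of \<sigma>] G_OI[OF t] by blast
      qed
      finally show ?thesis unfolding eq by (rule P.imult'[OF G_OI[OF t zO(1)]])
    qed
  qed
  have T: "Tr (fU U * (v * z)) \<in> lspan (OI L) B" for U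
  proof -
    have fz: "fU U * (v * z) \<in> OI L" using fU_OI vz(1) by (rule OL.mult)
    have "Tr (fU U * (v * z)) \<in> P" unfolding Tr_def
    proof (rule P.isum)
      fix \<tau> assume t: "\<tau> \<in> G"
      have "\<tau> (fU U * (v * z)) = \<tau> (fU U) * \<tau> (v * z)"
        using fhom.hmult[OF G_D(3)[OF t] _ vz(2), of "fU U"] fU_OI OI_L by blast
      then show "\<tau> (fU U * (v * z)) \<in> P" using P.imult[OF G_OI[OF t fU_OI] J[OF t]] by simp
    qed
    moreover have "Tr (fU U * (v * z)) \<in> k" using Tr_OI[OF fz] by (simp add: OI_def)
    ultimately show ?thesis using gen lspan_mono[OF OI_k] by blast
  qed
  have "dsc * (v * z) \<in> lspan (OI L) B" unfolding dual_basis[OF vz(2)]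
    by (rule O.lspan_sum, rule O.lspan_smult) (auto intro: eU_OI T)
  moreover have "dsc * v \<notin> P" using P.prime[OF dsc_OI v] dsc_notin vP by blast
  ultimately show ?thesis using OL.mult[OF dsc_OI v] by (intro bexI[of _ "dsc * v"]) (auto simp: mult.assoc)
qed

text \<open>Under the inclusion each generator \<open>b\<close> has a multiplier outside
  \<open>P\<close> that carries it into \<open>P\<close> times the span of \<open>B\<close>. The
  product of all multipliers does so for every generator at once and lies in \<open>P\<close> by the
  determinant trick, against primality.\<close>

theorem not_in_square:
  assumes B: "finite B" "B \<subseteq> P \<inter> k" "b0 \<in> B" "b0 \<noteq> 0"
    and gen: "\<And>a. a \<in> P \<inter> k \<Longrightarrow> a \<in> lspan (OI k) B"
  shows "\<not> P \<inter> k \<subseteq> ideal_prod (ring_of_integers L) P P"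
proof
  assume sq: "P \<inter> k \<subseteq> ideal_prod (ring_of_integers L) P P"
  have "\<exists>u\<in>OI L. u \<notin> P \<and> u * z \<in> lspan P B" if "z \<in> ideal_prod (ring_of_integers L) P P" for z
    using that
  proof (induction z rule: ideal_prod.induct)
    case (prod i j)
    \<comment> \<open>One factor is written through \<open>B\<close> after multiplication by
      \<open>u\<close>; the other factor puts the coefficients into \<open>P\<close>.\<close>
    obtain u where u: "u \<in> OI L" "u \<notin> P" "u * i \<in> lspan (OI L) B" using prime_in_extended[OF prod(1) gen] by blast
    have "j * (u * i) \<in> lspan P B" by (rule P.lspan_ideal_mult[OF prod(2) u(3)])
    then show ?case using u by (intro bexI[of _ u]) (simp_all add: algebra_simps)
  next
    case (sum s1 s2)
    then obtain u v where u: "u \<in> OI L" "u \<notin> P" "u * s1 \<in> lspan P B"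
      and v: "v \<in> OI L" "v \<notin> P" "v * s2 \<in> lspan P B" by blast
    have "v * (u * s1) + u * (v * s2) \<in> lspan P B"
      by (intro P.lspan_add P.lspan_smult u v)
    moreover have "u * v \<notin> P" using P.prime[OF u(1) v(1)] u v by blast
    ultimately show ?case using OL.mult[OF u(1) v(1)]
      by (intro bexI[of _ "u * v"]) (simp_all add: algebra_simps)
  qed
  then have "\<forall>b\<in>B. \<exists>u. u \<in> OI L \<and> u \<notin> P \<and> u * b \<in> lspan P B" using sq B(2) by blast
  then obtain u where u: "\<And>b. b \<in> B \<Longrightarrow> u b \<in> OI L \<and> u b \<notin> P \<and> u b * b \<in> lspan P B" by metis
  define v where "v = (\<Prod>b\<in>B. u b)"
  have v: "v \<in> OI L" unfolding v_def by (rule OL.prod) (use u in blast)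
  have "v \<in> P"
  proof (rule P.det_trick[OF B(1,3,4) v])
    fix b assume b: "b \<in> B"
    have "v = u b * (\<Prod>b\<in>B - {b}. u b)" unfolding v_def by (rule prod.remove[OF B(1) b])
    then have "v * b = (\<Prod>b\<in>B - {b}. u b) * (u b * b)" by simp
    also have "\<dots> \<in> lspan P B"
      by (rule P.lspan_smult) (use u[OF b] in \<open>auto intro!: OL.prod simp: u\<close>)
    finally show "v * b \<in> lspan P B" .
  qed
  then have "\<exists>b\<in>B. u b \<in> P" unfolding v_def
    by (rule P.prime_prod[OF B(1), rotated]) (use u in blast)
  then show False using u by blast
qed

end

section \<open>Cycle types\<close>

text \<open>The orbit of \<open>x\<close> starts at \<open>f x\<close>, so
  \<open>x \<in> Orbits.orbit f x\<close> says that \<open>x\<close> is periodic. In contrast to a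
  permutation of a finite set, this also describes the power map on the infinite set
  \<open>Tch q\<close>.\<close>

definition perm_on :: "('a \<Rightarrow> 'a) \<Rightarrow> 'a set \<Rightarrow> bool" where
  "perm_on f A \<longleftrightarrow> (\<forall>x\<in>A. f x \<in> A \<and> x \<in> Orbits.orbit f x)"

lemma perm_onD: "perm_on f A \<Longrightarrow> x \<in> A \<Longrightarrow> f x \<in> A" "perm_on f A \<Longrightarrow> x \<in> A \<Longrightarrow> x \<in> Orbits.orbit f x"
  by (auto simp: perm_on_def)

lemma perm_on_orbit_subset: "perm_on f A \<Longrightarrow> x \<in> A \<Longrightarrow> Orbits.orbit f x \<subseteq> A"
proof
  fix y assume *: "perm_on f A" "x \<in> A" "y \<in> Orbits.orbit f x"
  from *(3) show "y \<in> A" by induction (use *(1,2) in \<open>auto simp: perm_on_def\<close>)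
qed

lemma bij_betw_imp_perm_on:
  assumes "finite A" "bij_betw f A A"
  shows "perm_on f A"
  unfolding perm_on_def
proof (intro ballI conjI)
  fix x assume x: "x \<in> A"
  have fA: "f \<in> A \<rightarrow> A" using assms(2) by (auto simp: bij_betw_def)
  then show "f x \<in> A" using x by auto
  have "perm_restrict f A permutes A"
    by (rule bij_imp_permutes) (use assms(2) in \<open>auto simp: perm_restrict_def cong: bij_betw_cong\<close>)
  then have "x \<in> Orbits.orbit (perm_restrict f A) x"
    using assms(1) permutation_permutes by (intro permutation_self_in_orbit) blast
  also have "Orbits.orbit (perm_restrict f A) x = Orbits.orbit f x"
    using x fA by (intro orbit_cong0[symmetric, of _ A]) (auto simp: perm_restrict_def)
  finally show "x \<in> Orbits.orbit f x" .
qed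

lemma orbit_eq: "x \<in> Orbits.orbit f x \<Longrightarrow> y \<in> Orbits.orbit f x \<Longrightarrow> Orbits.orbit f y = Orbits.orbit f x"
  using orbit_swap[of x f y] orbit_trans[of _ f] by blast

text \<open>The cardinality of the orbit of a periodic point is its least period.\<close>

lemma funpow_eq_iff_mod:
  assumes "x \<in> Orbits.orbit f x"
  shows "(f ^^ i) x = (f ^^ j) x \<longleftrightarrow> i mod card (Orbits.orbit f x) = j mod card (Orbits.orbit f x)"
proof -
  let ?d = "funpow_dist1 f x x"
  have inj: "inj_on (\<lambda>n. (f ^^ n) x) {0..<?d}" by (rule inj_on_funpow_dist1[OF assms])
  have "card (Orbits.orbit f x) = ?d"
    using card_image[OF inj] orbit_conv_funpow_dist1[OF assms] by simp
  moreover have per: "(f ^^ ?d) x = x" by (rule funpow_dist1_prop[OF assms])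
  have "(f ^^ i) x = (f ^^ j) x \<longleftrightarrow> (f ^^ (i mod ?d)) x = (f ^^ (j mod ?d)) x"
    using funpow_mod_eq[OF per] by simp
  moreover have "\<dots> \<longleftrightarrow> i mod ?d = j mod ?d"
    using inj_on_eq_iff[OF inj, of "i mod ?d" "j mod ?d"] by simp
  ultimately show ?thesis by simp
qed

lemma count_cycle_type:
  assumes "finite A"
  shows "count (cycle_type f A) j = card {X' \<in> Orbits.orbit f ` A. card X' = j}"
proof -
  have fin: "finite (Orbits.orbit f ` A)" using assms by simp
  have "count (cycle_type f A) j = (\<Sum>y\<in>card -` {j} \<inter> Orbits.orbit f ` A. count (mset_set (Orbits.orbit f ` A)) y)"
    unfolding cycle_type_def count_image_mset using fin by simp
  also have "\<dots> = (\<Sum>y\<in>card -` {j} \<inter> Orbits.orbit f ` A. 1)" by (rule sum.cong) (use fin in auto)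
  also have "\<dots> = card (card -` {j} \<inter> Orbits.orbit f ` A)" by simp
  also have "card -` {j} \<inter> Orbits.orbit f ` A = {X' \<in> Orbits.orbit f ` A. card X' = j}" by auto
  finally show ?thesis .
qed

lemma size_cycle_type: "size (cycle_type f A) = card (Orbits.orbit f ` A)"
  by (simp add: cycle_type_def)

lemma Union_orbits:
  assumes "perm_on f A"
  shows "\<Union>(Orbits.orbit f ` A) = A"
proof
  show "\<Union>(Orbits.orbit f ` A) \<subseteq> A" using perm_on_orbit_subset[OF assms] by (rule UN_least)
  show "A \<subseteq> \<Union>(Orbits.orbit f ` A)" using perm_onD(2)[OF assms] by (intro subsetI UN_I)
qed

lemma orbits_disjoint:
  assumes "perm_on f A" "O1 \<in> Orbits.orbit f ` A" "O2 \<in> Orbits.orbit f ` A" "x \<in> O1" "x \<in> O2"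
  shows "O1 = O2"
proof -
  obtain y z where y: "y \<in> A" "O1 = Orbits.orbit f y" "z \<in> A" "O2 = Orbits.orbit f z" using assms by blast
  then show ?thesis using orbit_eq[of y f x] orbit_eq[of z f x] perm_onD(2)[OF assms(1)] assms(4,5) by simp
qed

lemma sum_cycle_type:
  assumes "finite A" "perm_on f A"
  shows "sum_mset (cycle_type f A) = card A"
proof -
  have "sum_mset (cycle_type f A) = (\<Sum>X'\<in>Orbits.orbit f ` A. card X')"
    unfolding cycle_type_def by (simp add: sum_unfold_sum_mset)
  also have "\<dots> = card (\<Union>(Orbits.orbit f ` A))"
  proof (rule card_Union_disjoint[symmetric])
    show "pairwise disjnt (Orbits.orbit f ` A)"
    proof (rule pairwiseI)
      fix U V assume "U \<in> Orbits.orbit f ` A" "V \<in> Orbits.orbit f ` A" "U \<noteq> V"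
      then show "disjnt U V" using orbits_disjoint[OF assms(2), of U V] unfolding disjnt_def by blast
    qed
    fix X' assume "X' \<in> Orbits.orbit f ` A"
    then show "finite X'" using assms finite_subset[OF perm_on_orbit_subset[OF assms(2)]] by blast
  qed
  finally show ?thesis using Union_orbits[OF assms(2)] by simp
qed

text \<open>An equivariant injection maps orbits onto orbits of the same size. The same fact passes
  from embeddings to conjugates, from roots to their residues, and from an automorphism to its
  conjugates.\<close>

lemma cycle_type_image:
  assumes "perm_on f A" "inj_on h A" "\<And>x. x \<in> A \<Longrightarrow> h (f x) = g (h x)"
  shows "cycle_type g (h ` A) = cycle_type f A"
proof -
  have o: "h ` Orbits.orbit f x = Orbits.orbit g (h x)" if "x \<in> A" for x
    by (rule orbit_inverse[OF perm_onD(2)[OF assms(1) that]])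
      (use assms(3) perm_on_orbit_subset[OF assms(1) that] in auto)
  let ?Q = "Orbits.orbit f ` A"
  have eq: "Orbits.orbit g ` h ` A = (\<lambda>U. h ` U) ` ?Q" using o by (simp add: image_image cong: image_cong)
  have sub: "U \<subseteq> A" if "U \<in> ?Q" for U using that perm_on_orbit_subset[OF assms(1)] by blast
  have inj: "inj_on (\<lambda>U. h ` U) ?Q"
    by (rule inj_onI) (use inj_on_image_eq_iff[OF assms(2)] sub in blast)
  have "cycle_type g (h ` A) = image_mset card (image_mset (\<lambda>U. h ` U) (mset_set ?Q))"
    unfolding cycle_type_def eq image_mset_mset_set[OF inj] ..
  also have "\<dots> = image_mset (\<lambda>U. card (h ` U)) (mset_set ?Q)" by (simp add: image_mset.compositionality comp_def)
  also have "\<dots> = image_mset card (mset_set ?Q)"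
  proof (rule image_mset_cong)
    fix U assume "U \<in># mset_set ?Q"
    then have "U \<in> ?Q" by (metis elem_mset_set empty_iff infinite_set_mset_mset_set)
    then show "card (h ` U) = card U" using card_image inj_on_subset[OF assms(2) sub] by blast
  qed
  finally show ?thesis by (simp add: cycle_type_def)
qed

lemma bij_of_image_mset_eq:
  assumes "finite A" "finite B" "image_mset c (mset_set A) = image_mset d (mset_set B)"
  shows "\<exists>b. bij_betw b A B \<and> (\<forall>x\<in>A. d (b x) = c x)"
  using assms
proof (induction A arbitrary: B rule: finite_induct)
  case empty
  then have "mset_set B = {#}" by simp
  then have "B = {}" using empty.prems(1) by (simp add: mset_set_empty_iff)
  then show ?case by (auto simp: bij_betw_def)
next
  case (insert a A)
  have "c a \<in># image_mset d (mset_set B)"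
    using insert.prems(2)[symmetric] insert.hyps by simp
  then obtain b0 where b0: "b0 \<in> B" "d b0 = c a" using insert.prems(1) by auto
  have B: "mset_set B = add_mset b0 (mset_set (B - {b0}))" using b0 insert.prems(1)
    by (simp add: mset_set.remove)
  have "image_mset c (mset_set A) = image_mset d (mset_set (B - {b0}))"
    using insert.prems(2) insert.hyps b0 by (simp add: B)
  then obtain b where b: "bij_betw b A (B - {b0})" "\<forall>x\<in>A. d (b x) = c x"
    using insert.IH[of "B - {b0}"] insert.prems(1) by auto
  define b' where "b' = (\<lambda>x. if x = a then b0 else b x)"
  have "bij_betw b' A (B - {b0})" using b(1) insert.hyps(2)     by (subst bij_betw_cong[of _ _ b]) (auto simp: b'_def)
  moreover have "bij_betw b' {a} {b0}" by (simp add: b'_def bij_betw_def)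
  ultimately have "bij_betw b' (A \<union> {a}) ((B - {b0}) \<union> {b0})" by (rule bij_betw_combine) auto
  moreover have "(B - {b0}) \<union> {b0} = B" using b0 by auto
  ultimately have "bij_betw b' (insert a A) B" by simp
  moreover have "\<forall>x\<in>insert a A. d (b' x) = c x" using b(2) b0(2) by (auto simp: b'_def)
  ultimately show ?case by blast
qed

text \<open>Orbits are matched by length and given base points; the \<open>i\<close>-th iterate of
  one base point is sent to the \<open>i\<close>-th iterate of the other. Only \<open>i\<close>
  modulo the common length matters on either side.\<close>

lemma conjugating_bijection:
  assumes fin: "finite A" "finite B" and f: "perm_on f A" and g: "perm_on g B"
    and ct: "cycle_type f A = cycle_type g B"
  shows "\<exists>h. bij_betw h A B \<and> (\<forall>x\<in>A. h (f x) = g (h x))"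
proof -
  let ?P = "Orbits.orbit f ` A" and ?Q = "Orbits.orbit g ` B"
  obtain b where b: "bij_betw b ?P ?Q" "\<And>U. U \<in> ?P \<Longrightarrow> card (b U) = card U"
    using bij_of_image_mset_eq[of ?P ?Q card card] fin ct unfolding cycle_type_def by auto
  have bQ: "b U \<in> ?Q" if "U \<in> ?P" for U using b(1) that by (auto simp: bij_betw_def)
  have "\<forall>U\<in>?P. \<exists>a. a \<in> A \<and> U = Orbits.orbit f a" by blast
  then obtain a where a: "\<And>U. U \<in> ?P \<Longrightarrow> a U \<in> A \<and> U = Orbits.orbit f (a U)" by metis
  have "\<forall>U\<in>?Q. \<exists>a. a \<in> B \<and> U = Orbits.orbit g a" by blast
  then obtain a' where a': "\<And>U. U \<in> ?Q \<Longrightarrow> a' U \<in> B \<and> U = Orbits.orbit g (a' U)" by metis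
  \<comment> \<open>\<open>rf x\<close> is the base point of the orbit of \<open>x\<close>, and
    \<open>rg x\<close> that of its partner orbit.\<close>
  define rf where "rf x = a (Orbits.orbit f x)" for x
  define rg where "rg x = a' (b (Orbits.orbit f x))" for x
  have rf: "rf x \<in> A" "Orbits.orbit f (rf x) = Orbits.orbit f x" "rf x \<in> Orbits.orbit f (rf x)" if "x \<in> A" for x
    using a[of "Orbits.orbit f x"] that perm_onD(2)[OF f] by (auto simp: rf_def)
  have rg: "rg x \<in> B" "Orbits.orbit g (rg x) = b (Orbits.orbit f x)" "rg x \<in> Orbits.orbit g (rg x)"
    "card (Orbits.orbit g (rg x)) = card (Orbits.orbit f (rf x))" if "x \<in> A" for x
    using a'[of "b (Orbits.orbit f x)"] bQ[of "Orbits.orbit f x"] b(2)[of "Orbits.orbit f x"] that perm_onD(2)[OF g] rf(2)[OF that]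
    by (auto simp: rg_def)
  \<comment> \<open>Any exponent that reaches \<open>x\<close> from its base point;
    \<open>key\<close> allows it to be replaced by any other.\<close>
  define idx where "idx x = (SOME i. (f ^^ i) (rf x) = x)" for x
  have idx: "(f ^^ idx x) (rf x) = x" if x: "x \<in> A" for x
  proof -
    have "x \<in> Orbits.orbit f (rf x)" using rf(2)[OF x] perm_onD(2)[OF f x] by simp
    then have "\<exists>i. (f ^^ i) (rf x) = x" unfolding orbit_altdef by (auto intro: sym)
    then show ?thesis unfolding idx_def by (rule someI_ex)
  qed
  define h where "h x = (g ^^ idx x) (rg x)" for x
  have key: "h x = (g ^^ i) (rg x)" if x: "x \<in> A" and i: "(f ^^ i) (rf x) = x" for x i
  proof -
    have "(f ^^ idx x) (rf x) = (f ^^ i) (rf x)" using idx[OF x] i by simp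
    then have "idx x mod card (Orbits.orbit f (rf x)) = i mod card (Orbits.orbit f (rf x))"
      using funpow_eq_iff_mod[OF rf(3)[OF x]] by simp
    then show ?thesis unfolding h_def using funpow_eq_iff_mod[OF rg(3)[OF x]] rg(4)[OF x] by simp
  qed
  have orb_h: "Orbits.orbit g (h x) = b (Orbits.orbit f x)" if x: "x \<in> A" for x
  proof -
    have "h x \<in> Orbits.orbit g (rg x)" unfolding h_def by (rule funpow_in_orbit[OF rg(3)[OF x]])
    then show ?thesis using orbit_eq[OF rg(3)[OF x]] rg(2)[OF x] by simp
  qed
  have same: "rf (f x) = rf x" "rg (f x) = rg x" if x: "x \<in> A" for x
    using self_in_orbit_step[OF perm_onD(2)[OF f x]] by (simp_all add: rf_def rg_def)
  have eqv: "h (f x) = g (h x)" if x: "x \<in> A" for x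
  proof -
    have "(f ^^ Suc (idx x)) (rf (f x)) = f x" using idx[OF x] same(1)[OF x] by simp
    then have "h (f x) = (g ^^ Suc (idx x)) (rg (f x))" by (rule key[OF perm_onD(1)[OF f x]])
    then show ?thesis using same(2)[OF x] by (simp add: h_def)
  qed
  have inj: "inj_on h A"
  proof (rule inj_onI)
    fix x y assume x: "x \<in> A" and y: "y \<in> A" and eq: "h x = h y"
    have "b (Orbits.orbit f x) = b (Orbits.orbit f y)" using orb_h[OF x] orb_h[OF y] eq by simp
    then have o: "Orbits.orbit f x = Orbits.orbit f y"
      using inj_onD[OF bij_betw_imp_inj_on[OF b(1)]] x y by blast
    then have r: "rf x = rf y" "rg x = rg y" by (simp_all add: rf_def rg_def)
    have "(g ^^ idx x) (rg x) = (g ^^ idx y) (rg x)" using eq unfolding h_def r(2) .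
    then have "idx x mod card (Orbits.orbit f (rf x)) = idx y mod card (Orbits.orbit f (rf x))"
      unfolding funpow_eq_iff_mod[OF rg(3)[OF x]] rg(4)[OF x] .
    then have "(f ^^ idx x) (rf x) = (f ^^ idx y) (rf x)"
      unfolding funpow_eq_iff_mod[OF rf(3)[OF x]] .
    then show "x = y" using idx[OF x] idx[OF y] unfolding r(1) by metis
  qed
  have hB: "h ` A \<subseteq> B"
  proof (rule image_subsetI)
    fix x assume x: "x \<in> A"
    have "h x \<in> Orbits.orbit g (rg x)" unfolding h_def by (rule funpow_in_orbit[OF rg(3)[OF x]])
    then show "h x \<in> B" using perm_on_orbit_subset[OF g rg(1)[OF x]] by blast
  qed
  have "card A = card B" using sum_cycle_type[OF fin(1) f] sum_cycle_type[OF fin(2) g] ct by simp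
  then have "h ` A = B" using card_image[OF inj] card_subset_eq[OF fin(2) hB] by simp
  then show ?thesis using inj eqv by (auto simp: bij_betw_def)
qed

lemma cycle_type_single:
  assumes "perm_on f A" "cycle_type f A = {#n#}" "x \<in> A"
  shows "Orbits.orbit f x = A"
proof -
  have "card (Orbits.orbit f ` A) = 1" using size_cycle_type[of f A] assms(2) by simp
  then obtain U where "Orbits.orbit f ` A = {U}" by (auto simp: card_1_singleton_iff)
  then show ?thesis using Union_orbits[OF assms(1)] assms(3) by (metis ccpo_Sup_singleton image_eqI singletonD)
qed

lemma cycle_type_transposition:
  assumes "finite A" "perm_on f A" "cycle_type f A = {#2#} + replicate_mset m 1"
  shows "\<exists>b\<in>A. \<exists>c\<in>A. b \<noteq> c \<and> f b = c \<and> f c = b \<and> (\<forall>x\<in>A - {b, c}. f x = x)"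
proof -
  have "card {X' \<in> Orbits.orbit f ` A. card X' = 2} = 1"
    using count_cycle_type[OF assms(1), of f 2] assms(3) by simp
  then obtain U where U: "{X' \<in> Orbits.orbit f ` A. card X' = 2} = {U}" by (auto simp: card_1_singleton_iff)
  then have UA: "U \<in> Orbits.orbit f ` A" "card U = 2" by blast+
  then obtain b where b: "b \<in> A" "U = Orbits.orbit f b" by blast
  have bU: "b \<in> U" using perm_onD(2)[OF assms(2) b(1)] b(2) by simp
  have fbU: "f b \<in> U" using b(2) by (simp add: orbit.base)
  have fb: "f b \<noteq> b"
  proof
    assume "f b = b"
    then have "U = {b}" using orbit_eq_singleton_iff[of f b] b(2) by simp
    then show False using UA(2) by simp
  qed
  have Ueq: "U = {b, f b}"
  proof -
    have "finite U" using UA(2) by (metis card.infinite zero_neq_numeral)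
    moreover have "{b, f b} \<subseteq> U" "card {b, f b} = 2" using bU fbU fb by auto
    ultimately show ?thesis using card_subset_eq[of U "{b, f b}"] UA(2) by simp
  qed
  have ffb: "f (f b) = b"
  proof -
    have "f (f b) \<in> U" using fbU b(2) orbit.step by metis
    moreover have "f (f b) \<noteq> f b"
    proof
      assume "f (f b) = f b"
      then have "Orbits.orbit f (f b) = {f b}" by (simp add: orbit_eq_singleton_iff)
      moreover have "Orbits.orbit f (f b) = U"
        using orbit_eq[of b f "f b"] bU fbU b(2) by simp
      ultimately show False using UA(2) by simp
    qed
    ultimately show ?thesis using Ueq by blast
  qed
  have "f x = x" if x: "x \<in> A - {b, f b}" for x
  proof -
    let ?V = "Orbits.orbit f x"
    have xV: "x \<in> ?V" using perm_onD(2)[OF assms(2)] x by blast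
    have "?V \<noteq> U" using xV Ueq x by blast
    then have c2: "card ?V \<noteq> 2" using U x by blast
    have "card ?V \<in># cycle_type f A" unfolding cycle_type_def using assms(1) x by simp
    then have "card ?V = 1" using c2 assms(3) by (auto split: if_splits)
    then have "?V = {x}" using xV by (metis card_1_singletonE singletonD)
    then show ?thesis by (simp add: orbit_eq_singleton_iff)
  qed
  then show ?thesis using b(1) perm_onD(1)[OF assms(2) b(1)] fb ffb by blast
qed

text \<open>There are two orbits in all, so a single one remains when the fixed point is removed.
  The case \<open>m = 1\<close>, with two fixed points, occurs for \<open>n = 2\<close>.\<close>

lemma cycle_type_fix_one:
  assumes "finite A" "perm_on f A" "cycle_type f A = {#m, 1#}"
  shows "\<exists>a\<in>A. f a = a \<and> (\<forall>x\<in>A - {a}. \<forall>y\<in>A - {a}. y \<in> Orbits.orbit f x)"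
proof -
  have "1 \<in># cycle_type f A" using assms(3) by simp
  then obtain a where a: "a \<in> A" "card (Orbits.orbit f a) = 1"
    unfolding cycle_type_def using assms(1) by auto
  have sa: "a \<in> Orbits.orbit f a" using perm_onD(2)[OF assms(2) a(1)] .
  then have oa: "Orbits.orbit f a = {a}" using a(2) by (metis card_1_singletonE singletonD)
  then have fa: "f a = a" by (simp add: orbit_eq_singleton_iff)
  have "card (Orbits.orbit f ` A) = 2" using size_cycle_type[of f A] assms(3) by simp
  have "y \<in> Orbits.orbit f x" if x: "x \<in> A - {a}" and y: "y \<in> A - {a}" for x y
  proof (rule ccontr)
    assume no: "y \<notin> Orbits.orbit f x"
    have sx: "x \<in> Orbits.orbit f x" and sy: "y \<in> Orbits.orbit f y"
      using perm_onD(2)[OF assms(2)] x y by blast+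
    have "Orbits.orbit f x \<noteq> {a}" "Orbits.orbit f y \<noteq> {a}" "Orbits.orbit f x \<noteq> Orbits.orbit f y"
      using sx sy no x y by blast+
    then have "card {{a}, Orbits.orbit f x, Orbits.orbit f y} = 3" by simp
    moreover have "{{a}, Orbits.orbit f x, Orbits.orbit f y} \<subseteq> Orbits.orbit f ` A" using oa a(1) x y by blast
    ultimately have "3 \<le> card (Orbits.orbit f ` A)" using assms(1) by (metis card_mono finite_imageI)
    then show False using \<open>card (Orbits.orbit f ` A) = 2\<close> by simp
  qed
  then show ?thesis using a(1) fa by blast
qed

section \<open>A criterion for the full symmetric group\<close>

lemma conj_transpose:
  assumes "bij g"
  shows "g \<circ> Transposition.transpose b c \<circ> Hilbert_Choice.inv g = Transposition.transpose (g b) (g c)"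
proof
  fix x
  obtain y where y: "x = g y" using bij_is_surj[OF assms] by (metis surjD)
  have "Hilbert_Choice.inv g x = y" using y bij_is_inj[OF assms] by simp
  then show "(g \<circ> Transposition.transpose b c \<circ> Hilbert_Choice.inv g) x = Transposition.transpose (g b) (g c) x"
    using y bij_is_inj[OF assms] by (auto simp: Transposition.transpose_def inj_eq)
qed

text \<open>Powers of the transitive \<open>c1\<close> move one point of the given transposition to
  \<open>a\<close>. Powers of \<open>c2\<close> fix \<open>a\<close> and move its partner to every
  other point, so all transpositions involving \<open>a\<close> are obtained, and from them all
  transpositions.\<close>

lemma all_permutations:
  assumes fin: "finite A" and H: "\<And>p. p \<in> H \<Longrightarrow> p permutes A"
    and id: "id \<in> H" and comp: "\<And>p r. p \<in> H \<Longrightarrow> r \<in> H \<Longrightarrow> p \<circ> r \<in> H"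
    and inv: "\<And>p. p \<in> H \<Longrightarrow> Hilbert_Choice.inv p \<in> H"
    and c1: "c1 \<in> H" "\<And>x y. x \<in> A \<Longrightarrow> y \<in> A \<Longrightarrow> y \<in> Orbits.orbit c1 x"
    and c2: "c2 \<in> H" "a \<in> A" "c2 a = a" "\<And>x y. x \<in> A - {a} \<Longrightarrow> y \<in> A - {a} \<Longrightarrow> y \<in> Orbits.orbit c2 x"
    and t: "Transposition.transpose b c \<in> H" "b \<in> A" "c \<in> A" "b \<noteq> c"
    and p: "p permutes A"
  shows "p \<in> H"
proof -
  have pw: "r ^^ i \<in> H" if r: "r \<in> H" for r i
  proof (induction i)
    case 0
    show ?case unfolding funpow.simps by (rule id)
  next
    case (Suc i)
    then show ?case unfolding funpow.simps by (rule comp[OF r])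
  qed
  have cj: "Transposition.transpose (g x) (g y) \<in> H" if "g \<in> H" "Transposition.transpose x y \<in> H" for g x y
    using conj_transpose[OF permutes_bij[OF H[OF that(1)]], of x y] comp[OF comp[OF that] inv[OF that(1)]] by simp
  have mv: "\<exists>g\<in>H. g x = y \<and> (r z = z \<longrightarrow> g z = z)" if r: "r \<in> H" and y: "y \<in> Orbits.orbit r x" for r x y z
  proof -
    obtain i where "y = (r ^^ i) x" using y by (auto simp: orbit_altdef)
    moreover have "r z = z \<longrightarrow> (r ^^ i) z = z" by (induction i) auto
    ultimately show ?thesis using pw[OF r] by blast
  qed
  obtain g where g: "g \<in> H" "g b = a" using mv[OF c1(1) c1(2)[OF t(2) c2(2)]] by blast
  define d where "d = g c"
  have d: "d \<in> A" "d \<noteq> a"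
    using permutes_in_image[OF H[OF g(1)]] t(3,4) g(2) permutes_inj[OF H[OF g(1)]]
    by (auto simp: d_def inj_eq)
  have ad: "Transposition.transpose a d \<in> H" using cj[OF g(1) t(1)] g(2) by (simp add: d_def)
  have star: "Transposition.transpose a e \<in> H" if e: "e \<in> A" "e \<noteq> a" for e
  proof -
    obtain g' where "g' \<in> H" "g' d = e" "g' a = a"
      using mv[OF c2(1) c2(4)[of d e], of a] d e c2(3) by blast
    then show ?thesis using cj[of g' a d] ad by simp
  qed
  have all: "Transposition.transpose x y \<in> H" if "x \<in> A" "y \<in> A" "x \<noteq> y" for x y
  proof (cases "x = a \<or> y = a")
    case True
    then show ?thesis using star[of x] star[of y] that by (metis transpose_commute)
  next
    case False
    then have "Transposition.transpose x a \<circ> Transposition.transpose a y \<circ> Transposition.transpose x a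
        = Transposition.transpose x y"
      using that by (intro transpose_comp_triple) auto
    then show ?thesis using comp[OF comp] star[of x] star[of y] False that by (metis transpose_commute)
  qed
  show ?thesis using p fin
  proof (induction rule: permutes_induct)
    case (swap x y p)
    then show ?case using comp all by blast
  qed (rule id)
qed

section \<open>Orbits of the power map on roots of unity\<close>

definition Tch :: "nat \<Rightarrow> complex set" where
  "Tch q = {x. \<exists>j>0. x ^ (q ^ j) = x}"

lemma funpow_power: "((\<lambda>x::complex. x ^ q) ^^ j) x = x ^ (q ^ j)"
  by (induction j) (simp_all add: power_mult[symmetric] mult.commute)

lemma Tch_perm: "perm_on (\<lambda>x. x ^ q) (Tch q)"
  unfolding perm_on_def
proof (intro ballI conjI)
  fix x assume "x \<in> Tch q"
  then obtain j where j: "j > 0" "x ^ (q ^ j) = x" by (auto simp: Tch_def)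
  have "(x ^ q) ^ (q ^ j) = (x ^ (q ^ j)) ^ q" by (simp add: power_mult[symmetric] mult.commute)
  then show "x ^ q \<in> Tch q" using j by (auto simp: Tch_def)
  show "x \<in> Orbits.orbit (\<lambda>x. x ^ q) x"
    unfolding orbit_altdef using j funpow_power[of j q x] by (metis (mono_tags, lifting) mem_Collect_eq)
qed

text \<open>The number of orbits of length \<open>j\<close>, which is the combinatorial meaning of
  the value M_j(q).\<close>

definition NO :: "nat \<Rightarrow> nat \<Rightarrow> nat" where
  "NO q j = card {U \<in> Orbits.orbit (\<lambda>x. x ^ q) ` Tch q. card U = j}"

text \<open>The points fixed by the \<open>j\<close>-th iterate; modulo \<open>Q\<close> they
  represent the field with \<open>q ^ j\<close> elements.\<close>

abbreviation "Fx q j \<equiv> {x::complex. x ^ (q ^ j) = x}"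

lemma Fx_split: "q \<ge> 2 \<Longrightarrow> j \<ge> 1 \<Longrightarrow> Fx q j = insert 0 {z. z ^ (q ^ j - 1) = 1}"
proof -
  assume q: "q \<ge> 2" "j \<ge> 1"
  have "q ^ j > 0" using q by simp
  then have "x ^ (q ^ j) = x * x ^ (q ^ j - 1)" for x :: complex by (simp add: power_Suc[symmetric])
  then have "x ^ (q ^ j) = x \<longleftrightarrow> x = 0 \<or> x ^ (q ^ j - 1) = 1" for x :: complex by simp
  then show ?thesis by auto
qed

lemma Fx_card: assumes "q \<ge> 2" "j \<ge> 1" shows "finite (Fx q j)" "card (Fx q j) = q ^ j"
proof -
  have "q ^ j \<ge> q ^ 1" using assms by (intro power_increasing) auto
  then have m: "q ^ j - 1 > 0" using assms(1) by simp
  have fin: "finite {z::complex. z ^ (q ^ j - 1) = 1}"     by (rule finite_roots_unity) (use m in simp)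
  then show "finite (Fx q j)" using Fx_split[OF assms] by simp
  have "0 \<notin> {z::complex. z ^ (q ^ j - 1) = 1}" using m by (simp add: power_0_left)
  then show "card (Fx q j) = q ^ j"
    using Fx_split[OF assms] card_roots_unity_eq[OF m] fin m by (simp add: card_insert_if)
qed

lemma Fx_iff:
  assumes "x \<in> Tch q"
  shows "x \<in> Fx q j \<longleftrightarrow> card (Orbits.orbit (\<lambda>x. x ^ q) x) dvd j"
  using funpow_eq_iff_mod[OF perm_onD(2)[OF Tch_perm assms], of j 0] by (auto simp: funpow_power mod_eq_0_iff_dvd)

lemma Fx_Tch: "j \<ge> 1 \<Longrightarrow> Fx q j \<subseteq> Tch q"
  by (auto simp: Tch_def intro!: exI[of _ j])

lemma orbits_finite:
  assumes "q \<ge> 2" "d \<ge> 1"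
  shows "finite {U \<in> Orbits.orbit (\<lambda>x. x ^ q) ` Tch q. card U = d}"
    "\<Union>{U \<in> Orbits.orbit (\<lambda>x. x ^ q) ` Tch q. card U = d} = {x \<in> Tch q. card (Orbits.orbit (\<lambda>x. x ^ q) x) = d}"
proof -
  let ?W = "{U \<in> Orbits.orbit (\<lambda>x. x ^ q) ` Tch q. card U = d}"
  show eq: "\<Union>?W = {x \<in> Tch q. card (Orbits.orbit (\<lambda>x. x ^ q) x) = d}"
  proof (intro Set.set_eqI iffI)
    fix x assume "x \<in> \<Union>?W"
    then obtain y where y: "y \<in> Tch q" "card (Orbits.orbit (\<lambda>x. x ^ q) y) = d" "x \<in> Orbits.orbit (\<lambda>x. x ^ q) y" by blast
    then have "x \<in> Tch q" using perm_on_orbit_subset[OF Tch_perm y(1)] by blast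
    then show "x \<in> {x \<in> Tch q. card (Orbits.orbit (\<lambda>x. x ^ q) x) = d}"
      using orbit_eq[OF perm_onD(2)[OF Tch_perm y(1)] y(3)] y by simp
  next
    fix x assume "x \<in> {x \<in> Tch q. card (Orbits.orbit (\<lambda>x. x ^ q) x) = d}"
    then show "x \<in> \<Union>?W" using perm_onD(2)[OF Tch_perm] by blast
  qed
  have "\<Union>?W \<subseteq> Fx q d" unfolding eq using Fx_iff[of _ q d] by auto
  then have "finite (\<Union>?W)" using Fx_card(1)[OF assms] finite_subset by blast
  then show "finite ?W" by (rule finite_UnionD)
qed

lemma orbits_count:
  assumes "q \<ge> 2" "d \<ge> 1"
  shows "card {x \<in> Tch q. card (Orbits.orbit (\<lambda>x. x ^ q) x) = d} = d * NO q d"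
proof -
  let ?W = "{U \<in> Orbits.orbit (\<lambda>x. x ^ q) ` Tch q. card U = d}"
  have "card (\<Union>?W) = (\<Sum>U\<in>?W. card U)"
  proof (rule card_Union_disjoint)
    show "pairwise disjnt ?W"
    proof (rule pairwiseI)
      fix U V assume "U \<in> ?W" "V \<in> ?W" "U \<noteq> V"
      then show "disjnt U V" using orbits_disjoint[OF Tch_perm, of U q V] unfolding disjnt_def by blast
    qed
    fix U assume "U \<in> ?W"
    then have "card U \<noteq> 0" using assms(2) by simp
    then show "finite U" by (rule contrapos_np) (rule card.infinite)
  qed
  also have "\<dots> = (\<Sum>U\<in>?W. d)" by (rule sum.cong) auto
  also have "\<dots> = d * NO q d" unfolding NO_def by simp
  finally show ?thesis using orbits_finite(2)[OF assms] by simp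
qed

text \<open>Zero and the roots of unity of order dividing \<open>q ^ j - 1\<close> are counted
  according to their periods, which are divisors of \<open>j\<close>.\<close>

lemma count_by_period:
  assumes "q \<ge> 2" "j \<ge> 1"
  shows "q ^ j = (\<Sum>d | d dvd j. d * NO q d)"
proof -
  have fin: "finite {d. d dvd j}" using assms by simp
  have pos: "d \<ge> 1" if "d dvd j" for d using that assms(2) by (cases d) auto
  have "Fx q j = (\<Union>d\<in>{d. d dvd j}. {x \<in> Tch q. card (Orbits.orbit (\<lambda>x. x ^ q) x) = d})"
  proof (intro Set.set_eqI iffI)
    fix x assume x: "x \<in> Fx q j"
    then have "x \<in> Tch q" using Fx_Tch[OF assms(2)] by auto
    then show "x \<in> (\<Union>d\<in>{d. d dvd j}. {x \<in> Tch q. card (Orbits.orbit (\<lambda>x. x ^ q) x) = d})"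
      using Fx_iff[of x q j] x by simp
  next
    fix x assume "x \<in> (\<Union>d\<in>{d. d dvd j}. {x \<in> Tch q. card (Orbits.orbit (\<lambda>x. x ^ q) x) = d})"
    then show "x \<in> Fx q j" using Fx_iff[of x q j] by auto
  qed
  then have "q ^ j = card (\<Union>d\<in>{d. d dvd j}. {x \<in> Tch q. card (Orbits.orbit (\<lambda>x. x ^ q) x) = d})"
    using Fx_card(2)[OF assms] by simp
  also have "\<dots> = (\<Sum>d | d dvd j. card {x \<in> Tch q. card (Orbits.orbit (\<lambda>x. x ^ q) x) = d})"
  proof (rule card_UN_disjoint[OF fin])
    show "\<forall>d\<in>{d. d dvd j}. finite {x \<in> Tch q. card (Orbits.orbit (\<lambda>x. x ^ q) x) = d}"
    proof
      fix d assume "d \<in> {d. d dvd j}"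
      then have d: "d \<ge> 1" using pos by simp
      have "{x \<in> Tch q. card (Orbits.orbit (\<lambda>x. x ^ q) x) = d} \<subseteq> Fx q d" using Fx_iff[of _ q d] by auto
      then show "finite {x \<in> Tch q. card (Orbits.orbit (\<lambda>x. x ^ q) x) = d}"
        using Fx_card(1)[OF assms(1) d] finite_subset by blast
    qed
  qed auto
  also have "\<dots> = (\<Sum>d | d dvd j. d * NO q d)"
    by (rule sum.cong) (use orbits_count[OF assms(1)] pos in auto)
  finally show ?thesis .
qed

lemma NO_1: "q \<ge> 2 \<Longrightarrow> NO q 1 = q"
  using count_by_period[of q 1] by simp

text \<open>Without orbits of length \<open>j\<close>, only proper divisors contribute to
  \<open>q ^ j\<close>. Each contributes at most \<open>q ^ d\<close>, and the sum of
  \<open>q ^ d\<close> over all \<open>d < j\<close> is less than \<open>q ^ j\<close>.\<close>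

lemma NO_pos:
  assumes "q \<ge> 2" "j \<ge> 1"
  shows "NO q j \<ge> 1"
proof (rule ccontr)
  assume "\<not> ?thesis"
  then have z: "NO q j = 0" by simp
  have fin: "finite {d. d dvd j}" using assms by simp
  have geo: "(\<Sum>d<m. q ^ d) < q ^ m" for m
  proof (induction m)
    case (Suc m)
    have "(\<Sum>d<Suc m. q ^ d) < q ^ m + q ^ m" using Suc by simp
    also have "\<dots> \<le> q ^ Suc m" using assms(1) by (simp add: mult_2[symmetric])
    finally show ?case .
  qed simp
  have "q ^ j = (\<Sum>d | d dvd j. d * NO q d)" by (rule count_by_period[OF assms])
  also have "\<dots> = (\<Sum>d\<in>{d. d dvd j} - {j}. d * NO q d)"
    by (rule sum.mono_neutral_right[OF fin]) (auto simp: z)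
  also have "\<dots> \<le> (\<Sum>d\<in>{d. d dvd j} - {j}. q ^ d)"
  proof (rule sum_mono)
    fix d assume "d \<in> {d. d dvd j} - {j}"
    then have d: "d \<ge> 1" using assms(2) by (cases d) auto
    have "d * NO q d \<le> (\<Sum>e | e dvd d. e * NO q e)" using d by (intro member_le_sum) auto
    then show "d * NO q d \<le> q ^ d" using count_by_period[OF assms(1) d] by simp
  qed
  also have "\<dots> \<le> (\<Sum>d<j. q ^ d)"
  proof (rule sum_mono2)
    show "{d. d dvd j} - {j} \<subseteq> {..<j}" using assms(2) by (auto dest: dvd_imp_le simp: nat_less_le)
  qed auto
  also have "\<dots> < q ^ j" by (rule geo)
  finally show False by simp
qed

section \<open>Moebius inversion and the necklace polynomial\<close>

lemma squarefree_prod_primes: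
  assumes "squarefree (d::nat)"
  shows "\<Prod>(prime_factors d) = d"
proof -
  have d0: "d \<noteq> 0" using assms by (metis not_squarefree_0)
  have "d = (\<Prod>p\<in>prime_factors d. p ^ multiplicity p d)" by (rule prime_factorization_nat) (use d0 in simp)
  also have "\<dots> = (\<Prod>p\<in>prime_factors d. p)"
  proof (rule prod.cong[OF refl])
    fix p assume "p \<in> prime_factors d"
    then have "multiplicity p d = 1" using assms d0 squarefree_factorial_semiring''[OF d0]
      by (metis One_nat_def le_antisym not_less_eq_eq prime_factors_multiplicity mem_Collect_eq
          in_prime_factors_imp_prime zero_less_one less_eq_Suc_le)
    then show "p ^ multiplicity p d = p" by simp
  qed
  finally show ?thesis by simp
qed

lemma prod_primes:
  assumes "finite U" "\<And>p. p \<in> U \<Longrightarrow> Factorial_Ring.prime (p::nat)"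
  shows "prime_factors (\<Prod>U) = U" "squarefree (\<Prod>U)"
proof -
  have "0 \<notin> (\<lambda>p. p) ` U" using assms(2) by force
  then have "prime_factors (\<Prod>U) = \<Union>((prime_factors \<circ> (\<lambda>p. p)) ` U)"
    using prime_factors_prod[of U "\<lambda>p. p"] assms(1) by simp
  also have "\<dots> = (\<Union>p\<in>U. {p})" using assms(2) by (auto simp: prime_prime_factors)
  finally show "prime_factors (\<Prod>U) = U" by simp
  show "squarefree (\<Prod>U)"
    by (rule squarefree_prod_coprime) (use assms primes_coprime squarefree_prime in \<open>auto simp: primes_coprime\<close>)
qed

text \<open>Squarefree divisors correspond to sets of prime factors, which turns the sum into the
  expansion of a product of factors \<open>- 1 + 1\<close>, empty exactly for
  \<open>n = 1\<close>.\<close>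

lemma sum_moebius:
  assumes "(n::nat) > 0"
  shows "(\<Sum>d | d dvd n. moebius d) = (if n = 1 then 1 else 0)"
proof -
  let ?F = "prime_factors n"
  let ?D = "{d. d dvd n \<and> squarefree d}"
  have fin: "finite {d. d dvd n}" using assms by simp
  have "(\<Sum>d | d dvd n. moebius d) = (\<Sum>d\<in>?D. (- 1) ^ card (prime_factors d))"
    by (rule sum.mono_neutral_cong_right[OF fin]) (auto simp: moebius_def)
  also have "\<dots> = (\<Sum>U\<in>Pow ?F. (- 1) ^ card U)"
  proof (rule sum.reindex_bij_witness[where i = "\<lambda>U. \<Prod>U" and j = prime_factors])
    fix d assume d: "d \<in> ?D"
    then show "\<Prod>(prime_factors d) = d" using squarefree_prod_primes by simp
    show "prime_factors d \<in> Pow ?F" using d assms dvd_prime_factors[of n d] by simp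
  next
    fix U assume U: "U \<in> Pow ?F"
    then have "finite U" "\<And>p. p \<in> U \<Longrightarrow> Factorial_Ring.prime p" by (auto intro: finite_subset[of U ?F])
    note * = prod_primes[OF this]
    show "prime_factors (\<Prod>U) = U" by (rule *(1))
    have "\<Prod>U dvd (\<Prod>p\<in>?F. p)" using U by (intro prod_dvd_prod_subset) auto
    also have "\<dots> dvd (\<Prod>p\<in>?F. p ^ multiplicity p n)"
      by (rule prod_dvd_prod) (auto simp: prime_factors_multiplicity intro: dvd_power)
    also have "\<dots> = n" using prime_factorization_nat[of n] assms by simp
    finally show "\<Prod>U \<in> ?D" using *(2) by simp
  qed simp
  also have "\<dots> = (\<Prod>p\<in>?F. (- 1) + (1::int))"
    by (subst prod_add) simp_all
  also have "\<dots> = (if n = 1 then 1 else 0)"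
  proof (cases "n = 1")
    case False
    then obtain p where "Factorial_Ring.prime p" "p dvd n" using prime_factor_nat by blast
    then have "?F \<noteq> {}" using assms by (auto simp: prime_factors_dvd)
    then show ?thesis using False by (simp add: power_0_left)
  qed simp
  finally show ?thesis .
qed

text \<open>Moebius inversion of \<open>count_by_period\<close>: after interchanging the sums, the
  inner sum over the divisors of \<open>j div e\<close> vanishes unless
  \<open>e = j\<close>.\<close>

lemma necklace_eq_NO:
  assumes "q \<ge> 2" "j \<ge> 1"
  shows "necklace j (real q) = real (NO q j)"
proof -
  let ?D = "{d. d dvd j}"
  have fin: "finite ?D" using assms by simp
  let ?N = "\<lambda>e. real e * real (NO q e)"
  have "(\<Sum>d\<in>?D. of_int (moebius d) * real q ^ (j div d)) =
      (\<Sum>d\<in>?D. \<Sum>e\<in>?D. if d * e dvd j then of_int (moebius d) * ?N e else 0)"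
  proof (rule sum.cong[OF refl])
    fix d assume d: "d \<in> ?D"
    then have d0: "d \<noteq> 0" using assms(2) by (metis dvd_0_left mem_Collect_eq not_one_le_zero)
    have jd: "j div d \<ge> 1" using d assms(2) d0 by (metis dvd_div_eq_0_iff le_zero_eq less_one mem_Collect_eq not_le)
    have "real q ^ (j div d) = real (\<Sum>e | e dvd j div d. e * NO q e)"
      using count_by_period[OF assms(1) jd] by (metis of_nat_power)
    also have "\<dots> = (\<Sum>e | e dvd j div d. ?N e)" by simp
    also have "\<dots> = (\<Sum>e\<in>?D. if d * e dvd j then ?N e else 0)"
    proof (rule sum.mono_neutral_cong_left[OF fin])
      show "{e. e dvd j div d} \<subseteq> ?D"
      proof
        fix e assume "e \<in> {e. e dvd j div d}"
        moreover have "j div d dvd j" using d by (metis dvd_mult_div_cancel dvd_triv_right mem_Collect_eq)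
        ultimately show "e \<in> ?D" using dvd_trans by blast
      qed
    qed (use d d0 in \<open>auto simp: dvd_div_iff_mult mult.commute\<close>)
    finally show "of_int (moebius d) * real q ^ (j div d) =
        (\<Sum>e\<in>?D. if d * e dvd j then of_int (moebius d) * ?N e else 0)"
      by (simp add: sum_distrib_left if_distrib cong: if_cong)
  qed
  also have "\<dots> = (\<Sum>e\<in>?D. \<Sum>d\<in>?D. if d * e dvd j then of_int (moebius d) * ?N e else 0)" by (rule sum.swap)
  also have "\<dots> = (\<Sum>e\<in>?D. ?N e * of_int (\<Sum>d | d dvd j div e. moebius d))"
  proof (rule sum.cong[OF refl])
    fix e assume e: "e \<in> ?D"
    then have e0: "e \<noteq> 0" using assms(2) by (metis dvd_0_left mem_Collect_eq not_one_le_zero)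
    have "(\<Sum>d\<in>?D. if d * e dvd j then of_int (moebius d) * ?N e else 0) = (\<Sum>d | d dvd j div e. of_int (moebius d) * ?N e)"
    proof (rule sum.mono_neutral_cong_right[OF fin])
      show "{d. d dvd j div e} \<subseteq> ?D"
      proof
        fix d assume "d \<in> {d. d dvd j div e}"
        moreover have "j div e dvd j" using e by (metis dvd_mult_div_cancel dvd_triv_right mem_Collect_eq)
        ultimately show "d \<in> ?D" using dvd_trans by blast
      qed
    qed (use e e0 in \<open>auto simp: dvd_div_iff_mult mult.commute\<close>)
    then show "(\<Sum>d\<in>?D. if d * e dvd j then of_int (moebius d) * ?N e else 0) =
        ?N e * of_int (\<Sum>d | d dvd j div e. moebius d)"
      by (simp add: sum_distrib_left mult.commute)
  qed
  also have "\<dots> = (\<Sum>e\<in>?D. if e = j then ?N e else 0)"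
  proof (rule sum.cong[OF refl])
    fix e assume e: "e \<in> ?D"
    then have e0: "e \<noteq> 0" using assms(2) by (metis dvd_0_left mem_Collect_eq not_one_le_zero)
    have "j div e > 0" using e assms(2) e0 by (metis dvd_div_eq_0_iff gr0I mem_Collect_eq not_one_le_zero)
    moreover have "j div e = 1 \<longleftrightarrow> e = j" using e e0 by (auto elim!: dvdE)
    ultimately show "?N e * of_int (\<Sum>d | d dvd j div e. moebius d) = (if e = j then ?N e else 0)"
      using sum_moebius[of "j div e"] by simp
  qed
  also have "\<dots> = ?N j" using fin by simp
  finally show ?thesis unfolding necklace_def using assms(2) by simp
qed

lemma gchoose_NO: "real N gchoose c \<ge> 0" "real N gchoose c > 0 \<longleftrightarrow> c \<le> N"
proof -
  have "real N gchoose c = real (N choose c)" by (simp add: binomial_gbinomial)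
  then show "real N gchoose c \<ge> 0" "real N gchoose c > 0 \<longleftrightarrow> c \<le> N" by (auto simp: zero_less_binomial_iff)
qed

lemma zero_less_mult_pos_iff: "(0::real) < c \<Longrightarrow> 0 < c * x \<longleftrightarrow> 0 < x"
  by (simp add: zero_less_mult_iff)

text \<open>Each factor is a binomial coefficient of natural numbers, hence nonnegative, and it
  vanishes exactly when more orbits are requested than exist.\<close>

theorem nu_star_pos_iff:
  assumes "q \<ge> 2"
  shows "nu_star n q mu > 0 \<longleftrightarrow> (\<forall>i\<in>{1..n}. count mu i \<le> NO q i)"
proof -
  have "(\<Prod>i=1..n. necklace i (real q) gchoose count mu i) = (\<Prod>i=1..n. real (NO q i) gchoose count mu i)"
    by (rule prod.cong) (use necklace_eq_NO[OF assms] in auto)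
  moreover have "(\<Prod>i=1..n. real (NO q i) gchoose count mu i) \<ge> 0" by (rule prod_nonneg) (simp add: gchoose_NO)
  moreover have "(\<Prod>i=1..n. real (NO q i) gchoose count mu i) = 0 \<longleftrightarrow> \<not> (\<forall>i\<in>{1..n}. count mu i \<le> NO q i)"
  proof -
    have "real (NO q i) gchoose count mu i = 0 \<longleftrightarrow> \<not> count mu i \<le> NO q i" for i
      using gchoose_NO[of "NO q i" "count mu i"] by linarith
    then show ?thesis by (simp add: prod_zero_iff)
  qed
  moreover have "1 / (real q ^ (n - 1) * (real q - 1)) > 0" using assms by simp
  then have "nu_star n q mu > 0 \<longleftrightarrow> (\<Prod>i=1..n. necklace i (real q) gchoose count mu i) > 0"
    unfolding nu_star_def by (rule zero_less_mult_pos_iff)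
  ultimately show ?thesis by linarith
qed

text \<open>For each length \<open>i\<close>, a selection of \<open>count mu i\<close> orbits of
  that length is taken; the union of all selected orbits is the required set.\<close>

lemma type_realizable:
  assumes "q \<ge> 2" "partition_of mu n" "\<forall>i\<in>{1..n}. count mu i \<le> NO q i"
  shows "\<exists>R\<subseteq>Tch q. finite R \<and> perm_on (\<lambda>x. x ^ q) R \<and> cycle_type (\<lambda>x. x ^ q) R = mu \<and> card R = n"
proof -
  let ?o = "Orbits.orbit (\<lambda>x::complex. x ^ q)"
  \<comment> \<open>All parts of a partition of \<open>n\<close> lie between 1 and \<open>n\<close>,
    so the bounds on this range control the whole multiset.\<close>
  have range: "count mu i = 0" if "i \<notin> {1..n}" for i
  proof (rule ccontr)
    assume "count mu i \<noteq> 0"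
    then have i: "i \<in># mu" by (simp add: count_eq_zero_iff)
    then have "i \<noteq> 0" using assms(2) unfolding partition_of_def by metis
    moreover have "i \<le> n" using i assms(2) by (auto simp: partition_of_def dest: multi_member_split)
    ultimately show False using that by simp
  qed
  have "\<exists>W. W \<subseteq> {U \<in> ?o ` Tch q. card U = i} \<and> card W = count mu i \<and> finite W" for i
  proof (cases "i \<in> {1..n}")
    case True
    then have "count mu i \<le> card {U \<in> ?o ` Tch q. card U = i}" using assms(3) by (simp add: NO_def)
    then obtain W where "W \<subseteq> {U \<in> ?o ` Tch q. card U = i}" "card W = count mu i" "finite W"
      by (rule obtain_subset_with_card_n)
    then show ?thesis by (intro exI[of _ W] conjI)
  next
    case False
    show ?thesis by (rule exI[of _ "{}"]) (simp add: range[OF False])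
  qed
  then have "\<forall>i. \<exists>W. W \<subseteq> {U \<in> ?o ` Tch q. card U = i} \<and> card W = count mu i \<and> finite W" ..
  from choice[OF this] obtain W where
    W0: "\<forall>i. W i \<subseteq> {U \<in> ?o ` Tch q. card U = i} \<and> card (W i) = count mu i \<and> finite (W i)" ..
  have W: "W i \<subseteq> {U \<in> ?o ` Tch q. card U = i}" "card (W i) = count mu i" "finite (W i)" for i
    using spec[OF W0, of i] by blast+
  define V where "V = (\<Union>i\<in>{1..n}. W i)"
  have V: "finite V" "V \<subseteq> ?o ` Tch q"
  proof -
    show "finite V" unfolding V_def by (rule finite_UN_I) (simp_all add: W(3))
    show "V \<subseteq> ?o ` Tch q" unfolding V_def by (rule UN_least) (use W(1) in auto)
  qed
  define R where "R = \<Union>V"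
  have "finite U" if U: "U \<in> V" for U
  proof -
    obtain y where "y \<in> Tch q" "U = ?o y" using U V(2) by blast
    then show ?thesis using finite_orbit[OF perm_onD(2)[OF Tch_perm]] by simp
  qed
  then have finR: "finite R" using V(1) by (simp add: R_def)
  have RT: "R \<subseteq> Tch q"
  proof
    fix x assume "x \<in> R"
    then obtain y where "y \<in> Tch q" "x \<in> ?o y" using V(2) unfolding R_def by blast
    then show "x \<in> Tch q" using perm_on_orbit_subset[OF Tch_perm] by blast
  qed
  have RV: "?o x \<in> V" if x: "x \<in> R" for x
  proof -
    obtain y where y: "y \<in> Tch q" "x \<in> ?o y" "?o y \<in> V" using x V(2) unfolding R_def by blast
    then show ?thesis using orbit_eq[OF perm_onD(2)[OF Tch_perm y(1)] y(2)] by simp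
  qed
  have perm: "perm_on (\<lambda>x. x ^ q) R"
    unfolding perm_on_def
  proof (intro ballI conjI)
    fix x assume x: "x \<in> R"
    show "x \<in> ?o x" by (rule perm_onD(2)[OF Tch_perm]) (use RT x in blast)
    show "x ^ q \<in> R" using RV[OF x] orbit.base[of "\<lambda>x. x ^ q" x] unfolding R_def by blast
  qed
  have img: "?o ` R = V"
  proof
    show "?o ` R \<subseteq> V" using RV by blast
    show "V \<subseteq> ?o ` R"
    proof
      fix U assume U: "U \<in> V"
      then obtain y where y: "y \<in> Tch q" "U = ?o y" using V(2) by blast
      then have "y \<in> R" using U perm_onD(2)[OF Tch_perm y(1)] unfolding R_def by blast
      then show "U \<in> ?o ` R" using y by blast
    qed
  qed
  have ct: "cycle_type (\<lambda>x. x ^ q) R = mu"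
  proof (rule multiset_eqI)
    fix j
    have "{U \<in> ?o ` R. card U = j} = (if j \<in> {1..n} then W j else {})"
    proof (intro Set.set_eqI iffI)
      fix U assume "U \<in> {U \<in> ?o ` R. card U = j}"
      then obtain i where "i \<in> {1..n}" "U \<in> W i" "card U = j" unfolding img V_def by blast
      then show "U \<in> (if j \<in> {1..n} then W j else {})" using W(1)[of i] by auto
    next
      fix U assume "U \<in> (if j \<in> {1..n} then W j else {})"
      then have "j \<in> {1..n}" "U \<in> W j" by (auto split: if_splits)
      then show "U \<in> {U \<in> ?o ` R. card U = j}" unfolding img V_def using W(1)[of j] by blast
    qed
    then show "count (cycle_type (\<lambda>x. x ^ q) R) j = count mu j"
      unfolding count_cycle_type[OF finR] using W(2)[of j] range[of j] by simp
  qed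
  have "card R = n" using sum_cycle_type[OF finR perm] ct assms(2) by (simp add: partition_of_def)
  then show ?thesis using RT finR perm ct by blast
qed

lemma type_bounded:
  assumes "q \<ge> 2" "R \<subseteq> Tch q" "finite R" "i \<ge> 1"
  shows "count (cycle_type (\<lambda>x. x ^ q) R) i \<le> NO q i"
  unfolding count_cycle_type[OF assms(3)] NO_def
  by (rule card_mono[OF orbits_finite(1)[OF assms(1,4)]]) (use assms(2) in blast)

text \<open>Serves the auxiliary types, which repeat no part except 1: every length has an orbit by
  \<open>NO_pos\<close>, and length one has \<open>q\<close> of them.\<close>

lemma simple_type_bounded:
  assumes "q \<ge> 2" "\<And>i. i \<noteq> 1 \<Longrightarrow> count mu i \<le> 1" "count mu 1 \<le> q"
  shows "\<forall>i\<in>{1..n}. count mu i \<le> NO q i"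
proof
  fix i assume "i \<in> {1..n}"
  then have "NO q i \<ge> 1" using NO_pos[OF assms(1)] by simp
  then show "count mu i \<le> NO q i"
    using assms(2)[of i] assms(3) NO_1[OF assms(1)] by (cases "i = 1") auto
qed

section \<open>Rings of integers and their prime ideals\<close>

interpretation CC: cring CC by (rule cring_from_type_algebra)

lemma (in csubring) subring_CC: "subring A CC"
proof (rule CC.subringI)
  fix x assume "x \<in> A"
  moreover have "\<ominus>\<^bsub>CC\<^esub> x = - x" by (rule CC.minus_equality) simp_all
  ultimately show "\<ominus>\<^bsub>CC\<^esub> x \<in> A" by (simp add: uminus)
qed (simp_all add: one mult add)

lemma csubring_if_subring_CC: "subring A CC \<Longrightarrow> csubring A"
proof -
  assume s: "subring A CC"
  have m: "- x \<in> A" if "x \<in> A" for x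
  proof -
    have "\<ominus>\<^bsub>CC\<^esub> x = - x" by (rule CC.minus_equality) simp_all
    then show ?thesis using subringE(5)[OF s that] by simp
  qed
  have a: "x + y \<in> A" if "x \<in> A" "y \<in> A" for x y using subringE(7)[OF s that] by simp
  show ?thesis
  proof unfold_locales
    fix x y assume "x \<in> A" "y \<in> A"
    then show "x - y \<in> A" using a[of x "- y"] m[of y] by simp
    show "x * y \<in> A" using subringE(6)[OF s \<open>x \<in> A\<close> \<open>y \<in> A\<close>] by simp
  qed (use subringE(2,3)[OF s] a in simp_all)
qed

context cfield
begin

lemma cring_OI: "cring (ring_of_integers F)"
proof -
  interpret O: csubring "OI F" by (rule csubring_OI)
  have "subcring (OI F) CC" by (rule CC.subcringI'[OF O.subring_CC])
  then have "cring (CC\<lparr>carrier := OI F\<rparr>)" by (subst (asm) CC.subcring_iff) simp_all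
  then show ?thesis by (simp add: ring_of_integers_def OI_def)
qed

lemma OI_uminus: "x \<in> OI F \<Longrightarrow> \<ominus>\<^bsub>ring_of_integers F\<^esub> x = - x"
proof -
  assume x: "x \<in> OI F"
  interpret O: csubring "OI F" by (rule csubring_OI)
  interpret R: cring "ring_of_integers F" by (rule cring_OI)
  show ?thesis by (rule R.minus_equality) (use x O.uminus in simp_all)
qed

lemma ideal_iff: "ideal I (ring_of_integers F) \<longleftrightarrow> cideal (OI F) I"
proof
  interpret O: csubring "OI F" by (rule csubring_OI)
  interpret R: cring "ring_of_integers F" by (rule cring_OI)
  {
    assume "ideal I (ring_of_integers F)"
    then interpret I: ideal I "ring_of_integers F" .
    show "cideal (OI F) I"
    proof unfold_locales
      show "I \<subseteq> OI F" using I.a_subset by simp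
      show "0 \<in> I" using I.zero_closed by simp
      fix x y assume "x \<in> I" "y \<in> I"
      then show "x + y \<in> I" using I.a_closed by simp
    next
      fix a x assume "a \<in> OI F" "x \<in> I"
      then show "a * x \<in> I" using I.I_l_closed[of x a] by simp
    qed
  next
    assume "cideal (OI F) I"
    then interpret I: cideal "OI F" I .
    show "ideal I (ring_of_integers F)"
    proof (rule idealI[OF R.ring_axioms])
      show "subgroup I (add_monoid (ring_of_integers F))"
      proof (rule R.add.subgroupI)
        fix a assume a: "a \<in> I"
        have "\<ominus>\<^bsub>ring_of_integers F\<^esub> a = - a" by (rule OI_uminus) (use a I.sub in blast)
        then show "\<ominus>\<^bsub>ring_of_integers F\<^esub> a \<in> I" using I.iuminus[OF a] by simp
      qed (use I.sub I.izero I.iadd in auto)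
    qed (use I.imult I.imult' in simp_all)
  }
qed

lemma primeideal_iff: "primeideal P (ring_of_integers F) \<longleftrightarrow> cprime (OI F) P"
proof
  assume "primeideal P (ring_of_integers F)"
  then interpret P: primeideal P "ring_of_integers F" .
  interpret I: cideal "OI F" P using ideal_iff P.ideal_axioms by blast
  show "cprime (OI F) P"
  proof unfold_locales
    show "1 \<notin> P"
    proof
      assume one: "1 \<in> P"
      have "OI F \<subseteq> P"
      proof
        fix x assume "x \<in> OI F"
        then show "x \<in> P" using I.imult[OF _ one, of x] by simp
      qed
      then show False using P.I_notcarr I.sub by simp
    qed
    fix x y assume "x \<in> OI F" "y \<in> OI F" "x * y \<in> P"
    then show "x \<in> P \<or> y \<in> P" using P.I_prime[of x y] by simp
  qed
next
  assume "cprime (OI F) P"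
  then interpret P: cprime "OI F" P .
  show "primeideal P (ring_of_integers F)"
  proof (rule primeidealI)
    show "ideal P (ring_of_integers F)" using ideal_iff P.cideal_axioms by blast
    show "carrier (ring_of_integers F) \<noteq> P" using P.one P.one_notin by auto
    fix a b assume "a \<in> carrier (ring_of_integers F)" "b \<in> carrier (ring_of_integers F)" "a \<otimes>\<^bsub>ring_of_integers F\<^esub> b \<in> P"
    then show "a \<in> P \<or> b \<in> P" using P.prime[of a b] by simp
  qed (rule cring_OI)
qed

end

section \<open>Residue systems and the norm of an ideal\<close>

lemma combine_CC: "length Ks = length Us \<Longrightarrow> CC.combine Ks Us = (\<Sum>i<length Us. Ks ! i * Us ! i)"
proof (induction Ks Us rule: list_induct2)
  case (Cons k Ks u Us)
  then show ?case by (simp add: sum.lessThan_Suc_shift del: sum.lessThan_Suc)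
qed simp

lemma clear_denominators:
  assumes "finite J" "\<And>i. i \<in> J \<Longrightarrow> f i \<in> (\<rat> :: complex set)"
  shows "\<exists>d::int. d \<noteq> 0 \<and> (\<forall>i\<in>J. of_int d * f i \<in> \<int>)"
  using assms
proof (induction J rule: finite_induct)
  case (insert j J)
  then obtain d where d: "d \<noteq> 0" "\<And>i. i \<in> J \<Longrightarrow> of_int d * f i \<in> \<int>" by auto
  obtain a b where ab: "f j = of_int a / of_int b" "b > 0"
    using insert.prems[of j] by (auto elim: Rats_cases')
  have 1: "of_int (d * b) * f i \<in> \<int>" if "i \<in> J" for i
  proof -
    have "of_int (d * b) * f i = of_int b * (of_int d * f i)" by simp
    then show ?thesis using Ints_mult[OF Ints_of_int d(2)[OF that], of b] by (simp only:)
  qed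
  have 2: "of_int (d * b) * f j \<in> \<int>" using ab by simp
  show ?case using 1 2 d(1) ab(2) by (intro exI[of _ "d * b"]) auto
qed (auto intro: exI[of _ 1])

text \<open>While all coefficients are divisible by \<open>p\<close> they can be divided by it; the
  sum of their absolute values decreases, so this ends.\<close>

lemma primitive_relation:
  fixes c :: "nat \<Rightarrow> int" and x :: "nat \<Rightarrow> complex" and p :: nat
  assumes "Factorial_Ring.prime p" "(\<Sum>i<m. of_int (c i) * x i) = 0" "\<exists>i<m. c i \<noteq> 0"
  shows "\<exists>c'. (\<Sum>i<m. of_int (c' i) * x i) = 0 \<and> (\<exists>i<m. \<not> int p dvd c' i)"
  using assms(2,3)
proof (induction "\<Sum>i<m. nat \<bar>c i\<bar>" arbitrary: c rule: less_induct)
  case less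
  show ?case
  proof (cases "\<exists>i<m. \<not> int p dvd c i")
    case True
    then show ?thesis using less.prems by blast
  next
    case False
    define c' where "c' i = c i div int p" for i
    have p: "p > 1" using assms(1) prime_gt_1_nat by blast
    have c: "c i = int p * c' i" if "i < m" for i using False that by (simp add: c'_def)
    have "(\<Sum>i<m. of_int (c i) * x i) = of_nat p * (\<Sum>i<m. of_int (c' i) * x i)"
      unfolding sum_distrib_left by (rule sum.cong) (simp_all add: c)
    then have z: "(\<Sum>i<m. of_int (c' i) * x i) = 0" using less.prems(1) p by simp
    obtain i0 where i0: "i0 < m" "c i0 \<noteq> 0" using less.prems(2) by blast
    then have nz: "c' i0 \<noteq> 0" using c[OF i0(1)] by auto
    have le: "nat \<bar>c' i\<bar> \<le> nat \<bar>c i\<bar>" if "i < m" for i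
      using c[OF that] p by (simp add: abs_mult nat_mult_distrib)
    have "nat \<bar>c' i0\<bar> < nat \<bar>c i0\<bar>" using c[OF i0(1)] p nz by (simp add: abs_mult nat_mult_distrib)
    then have "(\<Sum>i<m. nat \<bar>c' i\<bar>) < (\<Sum>i<m. nat \<bar>c i\<bar>)"
      using i0 le by (intro sum_strict_mono_ex1) auto
    then show ?thesis using less.hyps[of c'] z nz i0(1) by blast
  qed
qed

text \<open>A maximal family that is linearly independent modulo \<open>p\<close> gives a complete residue system modulo
  any ideal containing \<open>p\<close>; its size is bounded by the degree of the number field.\<close>

lemma residue_system:
  fixes p :: nat
  assumes k: "number_field k" and I: "cideal (OI k) I" and p: "Factorial_Ring.prime p" "of_nat p \<in> I"
  shows "\<exists>m V. V \<subseteq> OI k \<and> finite V \<and> card V = p ^ m \<and> (\<forall>a\<in>OI k. \<exists>v\<in>V. a - v \<in> I) \<and>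
    (\<forall>v\<in>V. \<forall>w\<in>V. v - w \<in> I \<longrightarrow> v = w)"
proof -
  interpret I: cideal "OI k" I by fact
  have kf: "cfield k" using k by (simp add: number_field_def subfield_CC_iff)
  interpret Q: cfield "\<rat>" by (rule cfieldI) auto
  have Qs: "subfield \<rat> CC" by (simp add: subfield_CC_iff Q.cfield_axioms)
  obtain N where N: "CC.dimension N \<rat> k" using k by (auto simp: number_field_def CC.finite_dimension_def)
  \<comment> \<open>Linear independence of the residues of the \<open>x i\<close> modulo
    \<open>I\<close> over the field with \<open>p\<close> elements, expressed by integer
    coefficients.\<close>
  define ind where "ind m x \<longleftrightarrow> (\<forall>i<m. x i \<in> OI k) \<and>
    (\<forall>c::nat \<Rightarrow> int. (\<Sum>i<m. of_int (c i) * x i) \<in> I \<longrightarrow> (\<forall>i<m. int p dvd c i))" for m x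
  \<comment> \<open>More than \<open>N\<close> elements satisfy a rational relation. Cleared of
    denominators and made primitive it has a coefficient prime to \<open>p\<close>, yet its value 0
    lies in \<open>I\<close>.\<close>
  have bound: "m \<le> N" if ex: "\<exists>x. ind m x" for m
  proof (rule ccontr)
    assume mN: "\<not> m \<le> N"
    obtain x where x: "ind m x" using ex by blast
    let ?U = "map x [0..<m]"
    have "set ?U \<subseteq> k" using x by (auto simp: ind_def OI_def)
    then have "\<not> CC.independent \<rat> ?U"
      using CC.independent_length_le_dimension[OF Qs N, of ?U] mN by auto
    then obtain Ks where Ks: "length Ks = length ?U" "CC.combine Ks ?U = 0" "set Ks \<subseteq> \<rat>" "set Ks \<noteq> {0}"
      using CC.dependent_imp_non_trivial_combine[OF Qs, of ?U] by auto
    have len: "length Ks = m" using Ks(1) by simp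
    have rel: "(\<Sum>i<m. Ks ! i * x i) = 0" using Ks(2) combine_CC[OF Ks(1)] by simp
    have "m > 0" using mN by simp
    have "\<exists>i<m. Ks ! i \<noteq> 0"
    proof (rule ccontr)
      assume no: "\<not> ?thesis"
      have "set Ks \<subseteq> {0}" using no len by (auto simp: in_set_conv_nth)
      moreover have "Ks ! 0 \<in> set Ks" using \<open>m > 0\<close> len by simp
      ultimately show False using Ks(4) by (metis empty_iff subset_singletonD)
    qed
    then obtain i0 where i0: "i0 < m" "Ks ! i0 \<noteq> 0" by blast
    have "\<exists>d::int. d \<noteq> 0 \<and> (\<forall>i\<in>{..<m}. of_int d * Ks ! i \<in> \<int>)"
      by (rule clear_denominators) (use Ks(3) len in \<open>auto simp: subset_iff\<close>)
    then obtain d :: int where d: "d \<noteq> 0" "\<And>i. i < m \<Longrightarrow> of_int d * Ks ! i \<in> \<int>" by auto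
    define c where "c i = \<lfloor>Re (of_int d * Ks ! i)\<rfloor>" for i
    have c: "of_int (c i) = of_int d * Ks ! i" if i: "i < m" for i
    proof -
      obtain z where z: "of_int d * Ks ! i = of_int z" using d(2)[OF i] by (rule Ints_cases)
      show ?thesis unfolding c_def z by simp
    qed
    have "(\<Sum>i<m. of_int (c i) * x i) = of_int d * (\<Sum>i<m. Ks ! i * x i)"
      unfolding sum_distrib_left by (rule sum.cong) (simp_all add: c)
    then have z: "(\<Sum>i<m. of_int (c i) * x i) = 0" using rel by simp
    have "c i0 \<noteq> 0" using c[OF i0(1)] i0(2) d(1) by auto
    then obtain c' where c': "(\<Sum>i<m. of_int (c' i) * x i) = 0" "\<exists>i<m. \<not> int p dvd c' i"
      using primitive_relation[OF p(1) z] i0(1) by blast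
    then have "(\<Sum>i<m. of_int (c' i) * x i) \<in> I" using I.izero by simp
    then have "\<forall>i<m. int p dvd c' i" using x unfolding ind_def by blast
    then show False using c'(2) by blast
  qed
  have "ind 0 (\<lambda>_. 0)" by (simp add: ind_def)
  then have ex: "\<exists>m. \<exists>x. ind m x" by blast
  define m where "m = (GREATEST m. \<exists>x. ind m x)"
  have "\<exists>x. ind m x" unfolding m_def by (rule GreatestI_ex_nat[OF ex, of N]) (rule bound)
  then obtain x where x: "ind m x" by blast
  have mx: "\<not> ind (Suc m) y" for y
  proof
    assume "ind (Suc m) y"
    then have "Suc m \<le> m" unfolding m_def by (intro Greatest_le_nat[of _ _ N] bound) blast+
    then show False by simp
  qed
  have xO: "x i \<in> OI k" if "i < m" for i using x that by (simp add: ind_def)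
  have indx: "int p dvd c i" if "(\<Sum>i<m. of_int (c i) * x i) \<in> I" "i < m" for c i
    using x that unfolding ind_def by blast
  have pI: "of_int z * a \<in> I" if "int p dvd z" "a \<in> OI k" for z a
  proof -
    obtain t where t: "z = int p * t" using \<open>int p dvd z\<close> by blast
    have "of_int t * a \<in> OI k" by (rule I.mult[OF I.of_int that(2)])
    from I.imult[OF this p(2)] show ?thesis by (simp add: t algebra_simps)
  qed
  let ?C = "{..<m} \<rightarrow>\<^sub>E {..<p}"
  define s where "s c = (\<Sum>i<m. of_nat (c i) * x i)" for c :: "nat \<Rightarrow> nat"
  have sO: "s c \<in> OI k" for c unfolding s_def by (rule I.sum, rule I.mult[OF I.of_nat]) (simp add: xO)
  have inj: "c = c'" if c: "c \<in> ?C" "c' \<in> ?C" "s c - s c' \<in> I" for c c'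
  proof (rule PiE_ext[OF c(1,2)])
    fix i assume i: "i \<in> {..<m}"
    have "(\<Sum>i<m. of_int (int (c i) - int (c' i)) * x i) = s c - s c'"
      unfolding s_def sum_subtractf[symmetric] by (simp add: algebra_simps)
    then have "int p dvd int (c i) - int (c' i)" using indx[of "\<lambda>i. int (c i) - int (c' i)" i] c(3) i by simp
    moreover have "c i < p" "c' i < p" using c(1,2) i by (auto simp: PiE_def Pi_def)
    ultimately show "c i = c' i"
      by (metis mod_eq_dvd_iff nat_int_comparison(1) mod_less zmod_int of_nat_eq_iff)
  qed
  \<comment> \<open>By maximality \<open>a\<close> takes part in a relation modulo \<open>I\<close>.
    Its coefficient is prime to \<open>p\<close>, since otherwise the relation would already hold
    among the \<open>x i\<close>; it is inverted modulo \<open>p\<close>, and the other coefficients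
    are reduced to the range below \<open>p\<close>.\<close>
  have surj: "\<exists>c\<in>?C. a - s c \<in> I" if a: "a \<in> OI k" for a
  proof -
    define y where "y = x(m := a)"
    have "\<forall>i<Suc m. y i \<in> OI k" using xO a by (auto simp: y_def less_Suc_eq)
    then obtain c :: "nat \<Rightarrow> int" where c: "(\<Sum>i<Suc m. of_int (c i) * y i) \<in> I" "\<not> (\<forall>i<Suc m. int p dvd c i)"
      using mx[of y] unfolding ind_def by blast
    have "(\<Sum>i<m. of_int (c i) * y i) = (\<Sum>i<m. of_int (c i) * x i)" by (rule sum.cong) (auto simp: y_def)
    then have c1: "(\<Sum>i<m. of_int (c i) * x i) + of_int (c m) * a \<in> I" using c(1) by (simp add: y_def)
    have pc: "\<not> int p dvd c m"
    proof
      assume d: "int p dvd c m"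
      have "(\<Sum>i<m. of_int (c i) * x i) \<in> I" using I.idiff[OF c1 pI[OF d a]] by simp
      then have "\<forall>i<m. int p dvd c i" using indx by blast
      then show False using c(2) d by (auto simp: less_Suc_eq)
    qed
    have "coprime (int p) (c m)" using pc p(1) by (simp add: prime_imp_coprime)
    then obtain u v where uv: "u * c m + v * int p = 1"
      using bezout_int[of "c m" "int p"] by (metis coprime_iff_gcd_eq_1 gcd.commute)
    \<comment> \<open>The value \<open>undefined\<close> outside the index range makes
      \<open>e\<close> a member of the extensional function space \<open>?C\<close>.\<close>
    define e where "e i = (if i < m then nat ((- (u * c i)) mod int p) else undefined)" for i
    have p0: "int p > 0" using p(1) prime_gt_0_nat by simp
    have eC: "e \<in> ?C"
    proof (rule PiE_I)
      fix i assume i: "i \<in> {..<m}"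
      have "0 \<le> (- (u * c i)) mod int p" "(- (u * c i)) mod int p < int p" using p0 by simp_all
      then show "e i \<in> {..<p}" using i by (simp add: e_def nat_less_iff)
    qed (simp add: e_def)
    have ed: "int p dvd (- (u * c i)) - int (e i)" if "i < m" for i
    proof -
      have "int (e i) = (- (u * c i)) mod int p" using that p0 by (simp add: e_def)
      then show ?thesis by (simp add: mod_eq_dvd_iff[symmetric])
    qed
    have "of_int 1 * a = (of_int (u * c m + v * int p) * a :: complex)" using uv by simp
    then have a_eq: "of_int u * (of_int (c m) * a) + of_int (int p * v) * a = a" by (simp add: algebra_simps)
    have T_eq: "(\<Sum>i<m. of_int ((- (u * c i)) - int (e i)) * x i) = - (of_int u * (\<Sum>i<m. of_int (c i) * x i)) - s e"
      unfolding s_def sum_distrib_left sum_negf[symmetric] sum_subtractf[symmetric]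
      by (rule sum.cong) (simp_all add: algebra_simps)
    have "of_int u * ((\<Sum>i<m. of_int (c i) * x i) + of_int (c m) * a) + of_int (int p * v) * a
        + (\<Sum>i<m. of_int ((- (u * c i)) - int (e i)) * x i)
      = (of_int u * (of_int (c m) * a) + of_int (int p * v) * a) - s e"
      unfolding T_eq distrib_left by simp
    then have eq: "a - s e = of_int u * ((\<Sum>i<m. of_int (c i) * x i) + of_int (c m) * a) + of_int (int p * v) * a
        + (\<Sum>i<m. of_int ((- (u * c i)) - int (e i)) * x i)" unfolding a_eq by (rule sym)
    have "a - s e \<in> I" unfolding eq
    proof (rule I.iadd[OF I.iadd])
      show "of_int u * ((\<Sum>i<m. of_int (c i) * x i) + of_int (c m) * a) \<in> I" by (rule I.imult[OF I.of_int c1])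
      show "of_int (int p * v) * a \<in> I" by (rule pI) (simp_all add: a)
      show "(\<Sum>i<m. of_int ((- (u * c i)) - int (e i)) * x i) \<in> I"
        by (rule I.isum, rule pI) (simp_all add: ed xO)
    qed
    then show ?thesis using eC by blast
  qed
  define V where "V = s ` ?C"
  have finC: "finite ?C" by (rule finite_PiE) simp_all
  have "inj_on s ?C" by (rule inj_onI, rule inj) (simp_all add: I.izero)
  then have "card V = p ^ m" unfolding V_def using card_image card_PiE[of "{..<m}" "\<lambda>_. {..<p}"] by fastforce
  moreover have "finite V" "V \<subseteq> OI k" unfolding V_def using finC sO by auto
  moreover have "\<forall>a\<in>OI k. \<exists>v\<in>V. a - v \<in> I" unfolding V_def using surj by blast
  moreover have "\<forall>v\<in>V. \<forall>w\<in>V. v - w \<in> I \<longrightarrow> v = w"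
  proof (intro ballI impI)
    fix v w assume "v \<in> V" "w \<in> V" and vw: "v - w \<in> I"
    then obtain c c' where c: "c \<in> ?C" "c' \<in> ?C" "v = s c" "w = s c'" unfolding V_def by blast
    then show "v = w" using inj[OF c(1,2)] vw by simp
  qed
  ultimately show ?thesis by blast
qed

lemma card_quotient:
  assumes "cfield k" "cideal (OI k) I" "V \<subseteq> OI k" "\<forall>a\<in>OI k. \<exists>v\<in>V. a - v \<in> I"
    "\<forall>v\<in>V. \<forall>w\<in>V. v - w \<in> I \<longrightarrow> v = w"
  shows "ideal_norm k I = card V"
proof -
  interpret I: cideal "OI k" I by fact
  let ?c = "\<lambda>a. I +>\<^bsub>ring_of_integers k\<^esub> a"
  have coset: "?c a = (\<lambda>h. h + a) ` I" for a by (auto simp: a_r_coset_def')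
  have eq: "?c a = ?c b \<longleftrightarrow> a - b \<in> I" for a b
  proof
    assume "?c a = ?c b"
    moreover have "a \<in> ?c a" unfolding coset using I.izero by force
    ultimately obtain h where "h \<in> I" "a = h + b" unfolding coset by blast
    then show "a - b \<in> I" by simp
  next
    assume ab: "a - b \<in> I"
    show "?c a = ?c b" unfolding coset
    proof (intro subset_antisym image_subsetI)
      fix h assume h: "h \<in> I"
      have "h + a = (h + (a - b)) + b" by simp
      then show "h + a \<in> (\<lambda>h. h + b) ` I" using I.iadd[OF h ab] by blast
      have "h + b = (h - (a - b)) + a" by simp
      then show "h + b \<in> (\<lambda>h. h + a) ` I" using I.idiff[OF h ab] by blast
    qed
  qed
  have "carrier (ring_of_integers k Quot I) = ?c ` OI k" by (auto simp: FactRing_def A_RCOSETS_def')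
  also have "\<dots> = ?c ` V"
  proof
    show "?c ` OI k \<subseteq> ?c ` V"
    proof (rule image_subsetI)
      fix a assume "a \<in> OI k"
      then obtain v where "v \<in> V" "a - v \<in> I" using assms(4) by blast
      then show "?c a \<in> ?c ` V" using eq[of a v] by blast
    qed
  qed (use assms(3) in blast)
  finally have "ideal_norm k I = card (?c ` V)" by (simp add: ideal_norm_def)
  also have "\<dots> = card V" by (rule card_image, rule inj_onI) (use assms(5) eq in blast)
  finally show ?thesis .
qed

text \<open>A nonzero element of \<open>P\<close> divides the constant term of a monic integral
  equation that it satisfies; if this term is 0, a factor X is cancelled first. So \<open>P\<close>
  contains a nonzero integer and hence one of its prime factors.\<close>

lemma prime_in_prime_ideal:
  assumes "cprime (OI k) P" "P \<noteq> {0}"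
  shows "\<exists>p. Factorial_Ring.prime p \<and> of_nat p \<in> P"
proof -
  interpret P: cprime "OI k" P by fact
  obtain a where a: "a \<in> P" "a \<noteq> 0" using assms(2) P.izero by blast
  then have aO: "a \<in> OI k" using P.sub by blast
  then obtain f where f: "monic f" "\<forall>i. poly.coeff f i \<in> \<int>" "poly f a = 0"
    by (auto simp: OI_def algebraic_int.simps)
  have "\<exists>N::int. N \<noteq> 0 \<and> of_int N \<in> P" using f
  proof (induction "Polynomial.degree f" arbitrary: f rule: less_induct)
    case less
    obtain c g where fg: "f = pCons c g" by (cases f) auto
    have g: "\<forall>i. poly.coeff g i \<in> \<int>" using less.prems(2) fg by (metis coeff_pCons_Suc)
    have c: "c \<in> \<int>" using less.prems(2) fg by (metis coeff_pCons_0)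
    have rel: "c = - (a * poly g a)" using less.prems(3) fg by (simp add: add_eq_0_iff2)
    have "poly g a \<in> OI k"
      by (rule P.poly_in[OF _ aO]) (use g P.Ints in \<open>simp add: pover_def\<close>)
    then have cP: "c \<in> P" using rel P.iuminus[OF P.imult'[OF _ a(1)]] by simp
    show ?case
    proof (cases "c = 0")
      case True
      have g0: "g \<noteq> 0" using less.prems(1) fg True by auto
      have "Polynomial.degree f = Suc (Polynomial.degree g)" using g0 fg by simp
      moreover from this have "monic g" using less.prems(1) fg by simp
      moreover have "poly g a = 0" using rel True a(2) by simp
      ultimately show ?thesis using less.hyps[of g] g by simp
    next
      case False
      obtain N where "c = of_int N" using c by (rule Ints_cases)
      then show ?thesis using False cP by (intro exI[of _ N]) simp
    qed
  qed
  then obtain N :: int where N: "N \<noteq> 0" "of_int N \<in> P" by blast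
  define n where "n = nat \<bar>N\<bar>"
  have n: "n > 0" "of_nat n \<in> P"
    using N P.iuminus[OF N(2)] by (auto simp: n_def abs_if)
  have "\<exists>p\<in>prime_factors n. of_nat p \<in> P"
  proof -
    have eq: "(\<Prod>p\<in>prime_factors n. p ^ multiplicity p n) = n" by (rule prime_factorization_nat[OF n(1), symmetric])
    have "(\<Prod>p\<in>prime_factors n. of_nat p ^ multiplicity p n) = (of_nat (\<Prod>p\<in>prime_factors n. p ^ multiplicity p n) :: complex)"
      by simp
    then have "(\<Prod>p\<in>prime_factors n. of_nat p ^ multiplicity p n) \<in> P" using n(2) by (simp only: eq)
    then have "\<exists>p\<in>prime_factors n. of_nat p ^ multiplicity p n \<in> P"
      by (rule P.prime_prod[rotated 2]) (simp_all add: P.power P.of_nat)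
    then show ?thesis using P.prime_power[OF P.of_nat] by blast
  qed
  then show ?thesis by blast
qed

section \<open>Arithmetic of the finite residue field\<close>

lemma (in cideal) freshman:
  fixes p :: nat
  assumes p: "Factorial_Ring.prime p" "of_nat p \<in> I" and xy: "x \<in> A" "y \<in> A"
  shows "cg ((x + y) ^ (p ^ m)) (x ^ (p ^ m) + y ^ (p ^ m))"
proof (induction m)
  case (Suc m)
  have step: "cg ((u + v) ^ p) (u ^ p + v ^ p)" if uv: "u \<in> A" "v \<in> A" for u v
  proof -
    have p1: "p > 1" using p(1) prime_gt_1_nat by blast
    let ?t = "\<lambda>i. of_nat (p choose i) * u ^ i * v ^ (p - i)"
    have "{..p} = insert 0 (insert p {1..<p})" using p1 by auto
    then have "(u + v) ^ p = v ^ p + (u ^ p + (\<Sum>i\<in>{1..<p}. ?t i))"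
      unfolding binomial_ring using p1 by simp
    moreover have "(\<Sum>i\<in>{1..<p}. ?t i) \<in> I"
    proof (rule isum)
      fix i assume i: "i \<in> {1..<p}"
      have "i * (p choose i) = p * ((p - 1) choose (i - 1))"
        using i binomial_absorption[of "i - 1" p] by (cases i) simp_all
      then have "p dvd i * (p choose i)" by simp
      moreover have "\<not> p dvd i" using i by (auto dest: dvd_imp_le)
      ultimately have "p dvd p choose i" using p(1) prime_dvd_mult_iff by blast
      then obtain t where t: "p choose i = p * t" by blast
      have "?t i = (of_nat t * u ^ i * v ^ (p - i)) * of_nat p" by (simp add: t algebra_simps)
      also have "\<dots> \<in> I" by (rule imult[OF _ p(2)]) (intro mult power of_nat uv)
      finally show "?t i \<in> I" .
    qed
    ultimately show ?thesis by (simp add: cg_def)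
  qed
  have "cg (((x + y) ^ (p ^ m)) ^ p) ((x ^ (p ^ m) + y ^ (p ^ m)) ^ p)"
    by (rule cg_power[OF Suc]) (intro add power xy)
  also have "cg ((x ^ (p ^ m) + y ^ (p ^ m)) ^ p) ((x ^ (p ^ m)) ^ p + (y ^ (p ^ m)) ^ p)"
    by (rule step) (intro power xy)+
  finally show ?case by (simp add: power_mult[symmetric] mult.commute)
qed simp

text \<open>The residue field is represented by a complete system \<open>V\<close> of
  \<open>q\<close> residues instead of a quotient ring; \<open>p\<close> is its
  characteristic.\<close>

locale residue_prime =
  fixes k :: "complex set" and P :: "complex set" and p m q :: nat and V :: "complex set"
  assumes kf: "cfield k" and P: "cprime (OI k) P"
    and p: "Factorial_Ring.prime p" "of_nat p \<in> P" and q: "q = p ^ m" "m > 0"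
    and V: "V \<subseteq> OI k" "finite V" "card V = q" "\<And>a. a \<in> OI k \<Longrightarrow> \<exists>v\<in>V. a - v \<in> P"
      "\<And>v w. v \<in> V \<Longrightarrow> w \<in> V \<Longrightarrow> v - w \<in> P \<Longrightarrow> v = w"
begin

sublocale P: cprime "OI k" P by (rule P)

lemma q2: "q \<ge> 2"
proof -
  have "p \<ge> 2" using p(1) prime_ge_2_nat by blast
  then have "p ^ 1 \<le> p ^ m" using q(2) by (intro power_increasing) auto
  then show ?thesis using \<open>p \<ge> 2\<close> q(1) by simp
qed

text \<open>Fermat's little theorem: multiplication by \<open>a\<close> permutes the nonzero
  residues, and the two expressions for their product are compared.\<close>

lemma pow_q_minus_1:
  assumes "a \<in> OI k" "a \<notin> P"
  shows "a ^ (q - 1) - 1 \<in> P"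
proof -
  define W where "W = {v \<in> V. v \<notin> P}"
  have W: "finite W" "W \<subseteq> OI k" using V(1,2) by (auto simp: W_def)
  obtain z where z: "z \<in> V" "0 - z \<in> P" using V(4)[OF P.zero] by blast
  have zP: "z \<in> P" using P.iuminus[OF z(2)] by simp
  have "V - W = {z}"
  proof (intro subset_antisym subsetI)
    fix v assume "v \<in> V - W"
    then have "v \<in> V" "v \<in> P" by (auto simp: W_def)
    then show "v \<in> {z}" using V(5)[of v z] z(1) P.idiff[OF _ zP] by blast
  qed (use z zP in \<open>auto simp: W_def\<close>)
  then have "V = insert z W" "z \<notin> W" using z(1) by (auto simp: W_def)
  then have cW: "card W = q - 1" using V(3) W(1) by simp
  define r where "r v = (SOME w. w \<in> V \<and> a * v - w \<in> P)" for v
  have r: "r v \<in> V" "a * v - r v \<in> P" if "v \<in> OI k" for v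
  proof -
    have "\<exists>w. w \<in> V \<and> a * v - w \<in> P" using V(4)[OF P.mult[OF assms(1) that]] by blast
    then have "r v \<in> V \<and> a * v - r v \<in> P" unfolding r_def by (rule someI_ex)
    then show "r v \<in> V" "a * v - r v \<in> P" by blast+
  qed
  have rW: "r v \<in> W" if v: "v \<in> W" for v
  proof -
    have vO: "v \<in> OI k" "v \<notin> P" using v W(2) by (auto simp: W_def)
    have "r v \<notin> P"
    proof
      assume "r v \<in> P"
      then have "a * v - r v + r v \<in> P" by (rule P.iadd[OF r(2)[OF vO(1)]])
      then have "a * v \<in> P" by simp
      then show False using P.prime[OF assms(1) vO(1)] assms(2) vO(2) by blast
    qed
    then show ?thesis using r(1)[OF vO(1)] by (simp add: W_def)
  qed
  have "inj_on r W"
  proof (rule inj_onI)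
    fix v w assume v: "v \<in> W" and w: "w \<in> W" and eq: "r v = r w"
    have O: "v \<in> OI k" "w \<in> OI k" using v w W(2) by blast+
    have "a * (v - w) \<in> P" using P.idiff[OF r(2)[OF O(1)] r(2)[OF O(2)]] eq by (simp add: algebra_simps)
    then have "v - w \<in> P" using P.prime[OF assms(1) P.diff[OF O]] assms(2) by blast
    then show "v = w" using V(5)[of v w] v w by (simp add: W_def)
  qed
  then have bij: "bij_betw r W W" using W(1) rW unfolding bij_betw_def by (simp add: endo_inj_surj image_subsetI)
  have "P.cg (\<Prod>v\<in>W. a * v) (\<Prod>v\<in>W. r v)"
  proof (rule P.cg_prod)
    fix v assume "v \<in> W"
    then have "v \<in> OI k" using W(2) by blast
    then show "P.cg (a * v) (r v)" "r v \<in> OI k" using r[of v] V(1) by (auto simp: P.cg_def)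
  qed
  also have "(\<Prod>v\<in>W. r v) = (\<Prod>v\<in>W. v)" by (rule prod.reindex_bij_betw[OF bij])
  finally have "(a ^ (q - 1) - 1) * (\<Prod>v\<in>W. v) \<in> P"
    by (simp add: P.cg_def prod.distrib cW algebra_simps)
  moreover have "(\<Prod>v\<in>W. v) \<notin> P"
  proof
    assume "(\<Prod>v\<in>W. v) \<in> P"
    then have "\<exists>v\<in>W. v \<in> P" by (rule P.prime_prod[OF W(1), rotated]) (use W(2) in blast)
    then show False by (simp add: W_def)
  qed
  moreover have "(\<Prod>v\<in>W. v) \<in> OI k" by (rule P.prod) (use W(2) in blast)
  ultimately show ?thesis using P.prime[OF P.diff[OF P.power[OF assms(1)] P.one]] by blast
qed

lemma pow_q:
  assumes "a \<in> OI k"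
  shows "a ^ q - a \<in> P"
proof (cases "a \<in> P")
  case True
  then show ?thesis using P.idiff[OF P.ipower[OF True, of q] True] q2 by simp
next
  case False
  have "a ^ q = a * a ^ (q - 1)" using q2 by (simp add: power_Suc[symmetric])
  then have "a ^ q - a = a * (a ^ (q - 1) - 1)" by (simp add: algebra_simps)
  then show ?thesis using P.imult[OF assms pow_q_minus_1[OF assms False]] by simp
qed

lemma OI_AI: "OI k \<subseteq> AI" by (auto simp: OI_def)

lemma exists_above: "\<exists>Q. cprime AI Q \<and> Q \<inter> OI k = P"
proof (rule lying_over[OF P OI_AI])
  fix x assume x: "x \<in> OI k - P"
  \<comment> \<open>By \<open>pow_q_minus_1\<close> the power \<open>x ^ (q - 2)\<close> is an
    inverse of \<open>x\<close> modulo \<open>P\<close>, as required by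
    \<open>lying_over\<close>.\<close>
  have "x * x ^ (q - 2) = x ^ (q - 1)" using q2 by (simp add: power_Suc[symmetric] Suc_diff_Suc numeral_2_eq_2)
  then have "x * x ^ (q - 2) - 1 \<in> P" using pow_q_minus_1[of x] x by simp
  then show "\<exists>y\<in>OI k. x * y - 1 \<in> P" using P.power[of x "q - 2"] x by blast
qed

end

lemma residue_prime_exists:
  assumes "number_field k" "prime_of k P"
  shows "\<exists>p m V. residue_prime k P p m (ideal_norm k P) V"
proof -
  have kf: "cfield k" using assms(1) by (simp add: number_field_def subfield_CC_iff)
  have P: "cprime (OI k) P" "P \<noteq> {0}" using assms(2) cfield.primeideal_iff[OF kf] by (simp_all add: prime_of_def)
  interpret P: cprime "OI k" P by (rule P(1))
  obtain p where p: "Factorial_Ring.prime p" "of_nat p \<in> P" using prime_in_prime_ideal[OF P] by blast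
  obtain m V where V: "V \<subseteq> OI k" "finite V" "card V = p ^ m" "\<forall>a\<in>OI k. \<exists>v\<in>V. a - v \<in> P"
    "\<forall>v\<in>V. \<forall>w\<in>V. v - w \<in> P \<longrightarrow> v = w"
    using residue_system[OF assms(1) P.cideal_axioms p] by blast
  have norm: "ideal_norm k P = card V" by (rule card_quotient[OF kf P.cideal_axioms V(1,4,5)])
  have "m > 0"
  proof (rule ccontr)
    assume "\<not> m > 0"
    then have "card V = 1" using V(3) by simp
    then obtain v0 where v0: "V = {v0}" by (auto simp: card_1_singleton_iff)
    have "1 - v0 \<in> P" "0 - v0 \<in> P" using V(4) v0 P.one P.zero by auto
    then show False using P.idiff[of "1 - v0" "0 - v0"] P.one_notin by simp
  qed
  then have "residue_prime k P p m (ideal_norm k P) V"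
    unfolding residue_prime_def using kf P(1) p V norm by simp
  then show ?thesis by blast
qed

section \<open>Generators of a prime ideal, and primes of large norm\<close>

lemma (in csubring) cideal_multiples:
  assumes c: "c \<in> A"
  shows "cideal A ((\<lambda>a. c * a) ` A)"
proof unfold_locales
  show "(\<lambda>a. c * a) ` A \<subseteq> A" by (rule image_subsetI) (rule mult[OF c])
  show "0 \<in> (\<lambda>a. c * a) ` A" by (rule image_eqI[of _ _ 0]) (simp_all add: zero)
  fix x y assume "x \<in> (\<lambda>a. c * a) ` A" "y \<in> (\<lambda>a. c * a) ` A"
  then obtain a b where ab: "a \<in> A" "b \<in> A" "x = c * a" "y = c * b" by blast
  then have "x + y = c * (a + b)" by (simp add: algebra_simps)
  then show "x + y \<in> (\<lambda>a. c * a) ` A" using add[OF ab(1,2)] by (rule image_eqI)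
next
  fix a x assume a: "a \<in> A" and "x \<in> (\<lambda>a. c * a) ` A"
  then obtain b where b: "b \<in> A" "x = c * b" by blast
  then have "a * x = c * (a * b)" by (simp add: algebra_simps)
  then show "a * x \<in> (\<lambda>a. c * a) ` A" using mult[OF a b(1)] by (rule image_eqI)
qed

text \<open>Modulo the multiples of \<open>p\<close> there are only finitely many residues, so
  \<open>P\<close> is generated by \<open>p\<close> and those representatives that lie in
  \<open>P\<close>.\<close>

lemma finitely_generated:
  assumes "number_field k" "prime_of k P"
  shows "\<exists>B b0. finite B \<and> B \<subseteq> P \<and> b0 \<in> B \<and> b0 \<noteq> 0 \<and> P \<subseteq> lspan (OI k) B"
proof -
  have kf: "cfield k" using assms(1) by (simp add: number_field_def subfield_CC_iff)
  have P: "cprime (OI k) P" "P \<noteq> {0}" using assms(2) cfield.primeideal_iff[OF kf] by (simp_all add: prime_of_def)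
  interpret P: cprime "OI k" P by (rule P(1))
  interpret O: cideal "OI k" "OI k" by (rule P.cideal_self)
  obtain p where p: "Factorial_Ring.prime p" "of_nat p \<in> P" using prime_in_prime_ideal[OF P] by blast
  define I where "I = (\<lambda>a. of_nat p * a) ` OI k"
  have I: "cideal (OI k) I" unfolding I_def by (rule P.cideal_multiples[OF P.of_nat])
  have "of_nat p \<in> I" unfolding I_def using P.one by force
  then obtain V where V: "V \<subseteq> OI k" "finite V" "\<forall>a\<in>OI k. \<exists>v\<in>V. a - v \<in> I"
    using residue_system[OF assms(1) I p(1)] by blast
  define B where "B = insert (of_nat p) (V \<inter> P)"
  have fB: "finite B" using V(2) by (simp add: B_def)
  have "P \<subseteq> lspan (OI k) B"
  proof
    fix a assume a: "a \<in> P"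
    then obtain v where v: "v \<in> V" "a - v \<in> I" using V(3) P.sub by blast
    then obtain b where b: "b \<in> OI k" "a - v = of_nat p * b" unfolding I_def by blast
    have "v = a - b * of_nat p" using b(2) by (simp add: algebra_simps)
    then have "v \<in> P" using P.idiff[OF a P.imult[OF b(1) p(2)]] by simp
    then have vB: "v \<in> B" using v(1) by (simp add: B_def)
    have pB: "of_nat p \<in> B" by (simp add: B_def)
    have "v + b * of_nat p \<in> lspan (OI k) B"
      by (intro O.lspan_add O.lspan_smult b(1) lspan_base[OF fB vB] lspan_base[OF fB pB] P.zero P.one)
    then show "a \<in> lspan (OI k) B" using b(2) by (simp add: algebra_simps)
  qed
  moreover have "of_nat p \<noteq> (0::complex)" using p(1) by auto
  moreover have "B \<subseteq> P" using p(2) by (auto simp: B_def)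
  ultimately show ?thesis using fB by (intro exI[of _ B] exI[of _ "of_nat p"]) (auto simp: B_def)
qed

text \<open>Every prime number \<open>p\<close> lies in some prime of \<open>k\<close>, whose norm
  is a positive power of \<open>p\<close>. Different prime numbers give different ideals, because
  together they would generate 1.\<close>

lemma primes_with_large_norm:
  assumes "number_field k"
  shows "infinite {P. prime_of k P \<and> ideal_norm k P \<ge> n}"
proof -
  have kf: "cfield k" using assms by (simp add: number_field_def subfield_CC_iff)
  interpret k: cfield k by (rule kf)
  interpret O: csubring "OI k" by (rule k.csubring_OI)
  have ex: "\<exists>P. prime_of k P \<and> of_nat p \<in> P" if p: "Factorial_Ring.prime p" for p :: nat
  proof -
    define I where "I = (\<lambda>a. of_nat p * a) ` AI"
    interpret I: cideal AI I unfolding I_def by (rule AI.cideal_multiples[OF AI.of_nat])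
    \<comment> \<open>Otherwise the inverse of \<open>p\<close> would be an algebraic integer, and a
      rational one is an ordinary integer.\<close>
    have "1 \<notin> I"
    proof
      assume "1 \<in> I"
      then obtain a where a0: "1 = of_nat p * a" "a \<in> AI" unfolding I_def by (rule imageE)
      have a: "algebraic_int a" "1 = of_nat p * a" using a0 by simp_all
      have p1: "p > 1" by (rule prime_gt_1_nat[OF p])
      have "inverse (of_nat p) = a" by (rule inverse_unique) (rule a(2)[symmetric])
      moreover have "inverse (of_nat p) \<in> (\<rat> :: complex set)" by simp
      ultimately have "a \<in> \<rat>" by (simp only:)
      then have "a \<in> \<int>" by (rule rational_algebraic_int_is_int[OF a(1)])
      then obtain z where "a = of_int z" by (auto elim: Ints_cases)
      then have "(of_int 1 :: complex) = of_int (int p * z)" using a(2) by simp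
      then have "1 = int p * z" unfolding of_int_eq_iff .
      then have "int p dvd 1" by (rule dvdI)
      then show False using p1 by simp
    qed
    then obtain Q where Q: "cprime AI Q" "I \<subseteq> Q" using I.exists_prime_above by blast
    interpret Q: cprime AI Q by (rule Q(1))
    have pQ: "of_nat p \<in> Q" by (rule subsetD[OF Q(2)], unfold I_def, rule image_eqI[of _ _ 1]) simp_all
    have OA: "OI k \<subseteq> AI" by (auto simp: OI_def)
    have "cprime (OI k) (Q \<inter> OI k)"
    proof unfold_locales
      fix x y assume "x \<in> OI k" "y \<in> OI k" "x * y \<in> Q \<inter> OI k"
      then show "x \<in> Q \<inter> OI k \<or> y \<in> Q \<inter> OI k" using Q.prime[of x y] OA by blast
    next
      fix a x assume "a \<in> OI k" "x \<in> Q \<inter> OI k"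
      then show "a * x \<in> Q \<inter> OI k" using Q.imult[of a x] O.mult[of a x] OA by blast
    next
      fix x y assume "x \<in> Q \<inter> OI k" "y \<in> Q \<inter> OI k"
      then show "x + y \<in> Q \<inter> OI k" using Q.iadd[of x y] O.add[of x y] by blast
    qed (use Q.izero O.zero Q.one_notin in auto)
    moreover have "of_nat p \<in> Q \<inter> OI k" using pQ O.of_nat by blast
    moreover have "of_nat p \<noteq> (0::complex)" using p by auto
    ultimately show ?thesis unfolding prime_of_def k.primeideal_iff
      by (intro exI[of _ "Q \<inter> OI k"] conjI) (assumption, metis singletonD, assumption)
  qed
  then obtain P where P: "\<And>p. Factorial_Ring.prime p \<Longrightarrow> prime_of k (P p) \<and> of_nat p \<in> P p" by metis
  have cop: "p = p'" if "Factorial_Ring.prime p" "Factorial_Ring.prime p'" "cprime (OI k) I"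
    "of_nat p \<in> I" "of_nat p' \<in> I" for p p' :: nat and I
  proof (rule ccontr)
    assume "p \<noteq> p'"
    then have "coprime (int p) (int p')" using that(1,2) by (simp add: primes_coprime)
    then obtain u v where uv: "u * int p + v * int p' = 1"
      using bezout_int[of "int p" "int p'"] by (metis coprime_iff_gcd_eq_1)
    interpret I: cprime "OI k" I by (rule that(3))
    have "of_int u * of_nat p + of_int v * of_nat p' \<in> I"
      by (intro I.iadd I.imult that O.of_int)
    moreover have "of_int u * of_nat p + of_int v * of_nat p' = (of_int (u * int p + v * int p') :: complex)" by simp
    ultimately show False using uv I.one_notin by simp
  qed
  have norm: "ideal_norm k (P p) \<ge> p" if p: "Factorial_Ring.prime p" for p
  proof -
    obtain p' m V where "residue_prime k (P p) p' m (ideal_norm k (P p)) V"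
      using residue_prime_exists[OF assms] P[OF p] by blast
    then interpret r: residue_prime k "P p" p' m "ideal_norm k (P p)" V .
    have "p' = p" using cop[OF r.p(1) p r.P r.p(2)] P[OF p] by simp
    moreover have "p' ^ 1 \<le> p' ^ m" using r.q(2) r.p(1) prime_gt_0_nat[of p'] by (intro power_increasing) auto
    ultimately show ?thesis using r.q(1) by simp
  qed
  have inj: "inj_on P {p. Factorial_Ring.prime p \<and> p \<ge> n}"
  proof (rule inj_onI)
    fix p p' assume "p \<in> {p. Factorial_Ring.prime p \<and> p \<ge> n}" "p' \<in> {p. Factorial_Ring.prime p \<and> p \<ge> n}" "P p = P p'"
    moreover from this have "cprime (OI k) (P p)" using P[of p] by (simp add: prime_of_def k.primeideal_iff)
    ultimately show "p = p'" using cop[of p p' "P p"] P[of p] P[of p'] by simp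
  qed
  have "infinite {p. Factorial_Ring.prime p \<and> p \<ge> n}"
  proof
    assume fin: "finite {p. Factorial_Ring.prime p \<and> p \<ge> n}"
    have "{p::nat. Factorial_Ring.prime p} \<subseteq> {p. Factorial_Ring.prime p \<and> p \<ge> n} \<union> {..<n}" by auto
    then show False using primes_infinite finite_subset fin by (metis finite_Un finite_lessThan)
  qed
  then have "infinite (P ` {p. Factorial_Ring.prime p \<and> p \<ge> n})" using finite_imageD[OF _ inj] by blast
  moreover have "P ` {p. Factorial_Ring.prime p \<and> p \<ge> n} \<subseteq> {P. prime_of k P \<and> ideal_norm k P \<ge> n}"
  proof (rule image_subsetI)
    fix p assume "p \<in> {p. Factorial_Ring.prime p \<and> p \<ge> n}"
    then show "P p \<in> {P. prime_of k P \<and> ideal_norm k P \<ge> n}" using P[of p] norm[of p] by simp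
  qed
  ultimately show ?thesis using finite_subset by blast
qed

section \<open>Teichmueller representatives\<close>

lemma Fx_poly:
  assumes "q \<ge> 2" "j \<ge> 1"
  defines "f \<equiv> Polynomial.monom 1 (q ^ j) - [:0, 1 :: complex:]"
  shows "Polynomial.degree f = q ^ j" "monic f" "{x. poly f x = 0} = Fx q j" "f = (\<Prod>\<rho>\<in>Fx q j. [:- \<rho>, 1:])"
proof -
  have N: "q ^ j \<ge> 2"
  proof -
    have "q ^ 1 \<le> q ^ j" using assms by (intro power_increasing) auto
    then show ?thesis using assms(1) by simp
  qed
  have cf: "poly.coeff f i = (if i = q ^ j then 1 else 0) - (if i = 1 then 1 else 0)" for i
    by (auto simp: f_def coeff_pCons split: nat.splits)
  show deg: "Polynomial.degree f = q ^ j"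
  proof (rule antisym)
    show "Polynomial.degree f \<le> q ^ j" by (rule degree_le) (use N assms(1,2) in \<open>auto simp: cf\<close>)
    show "q ^ j \<le> Polynomial.degree f" by (rule le_degree) (use N assms(1,2) in \<open>auto simp: cf\<close>)
  qed
  show mon: "monic f" unfolding deg cf using assms(1,2) by simp
  show roots: "{x. poly f x = 0} = Fx q j" by (simp add: f_def poly_monom)
  have f0: "f \<noteq> 0" using mon by auto
  have "rsquarefree f"
    using rsquarefree_card_degree[OF f0] roots deg Fx_card(2)[OF assms(1,2)] by simp
  from complex_poly_decompose_rsquarefree[OF this] show "f = (\<Prod>\<rho>\<in>Fx q j. [:- \<rho>, 1:])"
    using mon roots by simp
qed

lemma Tch_AI:
  assumes "q \<ge> 2"
  shows "Tch q \<subseteq> AI"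
proof
  fix x assume "x \<in> Tch q"
  then obtain j where j: "j > 0" "x ^ (q ^ j) = x" by (auto simp: Tch_def)
  let ?f = "Polynomial.monom 1 (q ^ j) - [:0, 1 :: complex:]"
  have "j \<ge> 1" using j(1) by simp
  note F = Fx_poly[OF assms this]
  have "\<forall>i. poly.coeff ?f i \<in> \<int>" by (auto simp: coeff_pCons split: nat.splits)
  moreover have "poly ?f x = 0" using j(2) by (simp add: poly_monom)
  ultimately show "x \<in> AI" using algebraic_int.intros[OF F(2)] by simp
qed

locale residue_above = residue_prime k P p m q V for k P p m q V +
  fixes Q :: "complex set"
  assumes Q: "cprime AI Q" and QP: "Q \<inter> OI k = P"
begin

sublocale Q: cprime AI Q by (rule Q)

lemma pQ: "of_nat p \<in> Q" using p(2) QP by blast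

lemma qQ: "of_nat q \<in> Q"
proof -
  have "(of_nat p :: complex) ^ m \<in> Q" by (rule Q.ipower[OF pQ q(2)])
  then show ?thesis using q(1) by simp
qed

lemma frobQ: "x \<in> AI \<Longrightarrow> y \<in> AI \<Longrightarrow> Q.cg ((x + y) ^ q) (x ^ q + y ^ q)"
  using Q.freshman[OF p(1) pQ, of x y m] q(1) by simp

lemma teich_prod: "j \<ge> 1 \<Longrightarrow> (\<Prod>\<rho>\<in>Fx q j. y - \<rho>) = y ^ (q ^ j) - y"
proof -
  assume j: "j \<ge> 1"
  have "poly (\<Prod>\<rho>\<in>Fx q j. [:- \<rho>, 1:]) y = poly (Polynomial.monom 1 (q ^ j) - [:0, 1:]) y"
    using Fx_poly(4)[OF q2 j] by simp
  then show ?thesis by (simp add: poly_prod poly_monom)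
qed

text \<open>The product of \<open>y - \<rho>\<close> over \<open>Fx q j\<close> is
  \<open>y ^ (q ^ j) - y\<close>, and \<open>Q\<close> is prime.\<close>

lemma teich_exists:
  assumes "y \<in> AI" "j \<ge> 1" "y ^ (q ^ j) - y \<in> Q"
  shows "\<exists>\<rho>\<in>Fx q j. y - \<rho> \<in> Q"
proof (rule Q.prime_prod[OF Fx_card(1)[OF q2 assms(2)]])
  show "(\<Prod>\<rho>\<in>Fx q j. y - \<rho>) \<in> Q" using teich_prod[OF assms(2), of y] assms(3) by simp
  fix \<rho> assume "\<rho> \<in> Fx q j"
  then have "\<rho> \<in> AI" using Fx_Tch[OF assms(2)] Tch_AI[OF q2] by blast
  then show "y - \<rho> \<in> AI" by (rule AI.diff[OF assms(1)])
qed

text \<open>Both elements are roots of X^(q^l) - X for a common \<open>l\<close>. The derivative at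
  a root is congruent to -1 modulo \<open>Q\<close>, whereas it is also the product of the
  differences to all other roots and would lie in \<open>Q\<close>.\<close>

lemma teich_inj:
  assumes "\<rho> \<in> Tch q" "\<rho>' \<in> Tch q" "\<rho> - \<rho>' \<in> Q"
  shows "\<rho> = \<rho>'"
proof (rule ccontr)
  assume ne: "\<rho> \<noteq> \<rho>'"
  obtain i j where ij: "i > 0" "\<rho> \<in> Fx q i" "j > 0" "\<rho>' \<in> Fx q j" using assms(1,2) by (auto simp: Tch_def)
  define l where "l = i * j"
  have l: "l \<ge> 1" using ij by (simp add: l_def)
  have in_l: "\<rho> \<in> Fx q l" "\<rho>' \<in> Fx q l"
  proof -
    have "card (Orbits.orbit (\<lambda>x. x ^ q) \<rho>) dvd i" using Fx_iff[OF assms(1), of i] ij(2) by simp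
    then have "card (Orbits.orbit (\<lambda>x. x ^ q) \<rho>) dvd l" unfolding l_def by (rule dvd_mult2)
    then show "\<rho> \<in> Fx q l" using Fx_iff[OF assms(1), of l] by simp
    have "card (Orbits.orbit (\<lambda>x. x ^ q) \<rho>') dvd j" using Fx_iff[OF assms(2), of j] ij(4) by simp
    then have "card (Orbits.orbit (\<lambda>x. x ^ q) \<rho>') dvd l" unfolding l_def by (rule dvd_mult)
    then show "\<rho>' \<in> Fx q l" using Fx_iff[OF assms(2), of l] by simp
  qed
  let ?f = "Polynomial.monom 1 (q ^ l) - [:0, 1 :: complex:]"
  let ?h = "\<Prod>a\<in>Fx q l - {\<rho>}. [:- a, 1:]"
  have fin: "finite (Fx q l)" by (rule Fx_card(1)[OF q2 l])
  have AI: "a \<in> AI" if "a \<in> Fx q l" for a using that Fx_Tch[OF l] Tch_AI[OF q2] by blast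
  have "?f = [:- \<rho>, 1:] * ?h"
    unfolding Fx_poly(4)[OF q2 l] by (rule prod.remove[OF fin in_l(1)])
  then have "poly (pderiv ?f) \<rho> = poly (pderiv ([:- \<rho>, 1:] * ?h)) \<rho>" by (simp only:)
  also have "\<dots> = poly ?h \<rho>" unfolding pderiv_mult poly_add poly_mult by (simp add: pderiv_pCons)
  also have "\<dots> = (\<Prod>a\<in>Fx q l - {\<rho>}. \<rho> - a)" by (simp add: poly_prod)
  finally have eq: "(\<Prod>a\<in>Fx q l - {\<rho>}. \<rho> - a) = of_nat (q ^ l) * \<rho> ^ (q ^ l - 1) - 1"
    by (simp add: pderiv_diff pderiv_monom pderiv_pCons poly_monom)
  have "(\<Prod>a\<in>Fx q l - {\<rho>}. \<rho> - a) \<in> Q"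
  proof (rule Q.iprod[of _ \<rho>'])
    show "finite (Fx q l - {\<rho>})" using fin by simp
    show "\<rho>' \<in> Fx q l - {\<rho>}" using in_l ne by simp
    fix a assume "a \<in> Fx q l - {\<rho>}"
    then show "\<rho> - a \<in> AI" using AI[of a] AI[OF in_l(1)] by (intro AI.diff) auto
  qed (rule assms(3))
  moreover have "of_nat (q ^ l) * \<rho> ^ (q ^ l - 1) \<in> Q"
  proof (rule Q.imult'[OF AI.power[OF AI[OF in_l(1)]]])
    have "(of_nat q :: complex) ^ l \<in> Q" using l by (intro Q.ipower[OF qQ]) simp
    then show "of_nat (q ^ l) \<in> Q" by simp
  qed
  ultimately have "of_nat (q ^ l) * \<rho> ^ (q ^ l - 1) - (of_nat (q ^ l) * \<rho> ^ (q ^ l - 1) - 1) \<in> Q"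
    unfolding eq by (rule Q.idiff[rotated])
  then show False using Q.one_notin by simp
qed

text \<open>The \<open>q\<close> residues in \<open>V\<close> are congruent to roots of X^q - X,
  distinct ones to distinct roots. As there are \<open>q\<close> roots, every residue fixed by the
  power map is met by \<open>V\<close>.\<close>

lemma fixed_in_k:
  assumes "y \<in> AI" "y ^ q - y \<in> Q"
  shows "\<exists>a\<in>OI k. y - a \<in> Q"
proof -
  have "\<exists>\<rho>. \<rho> \<in> Fx q 1 \<and> v - \<rho> \<in> Q" if v: "v \<in> V" for v
  proof -
    have "v \<in> OI k" using v V(1) by blast
    then have "v ^ q - v \<in> Q" "v \<in> AI" using pow_q[of v] QP OI_AI by blast+
    then show ?thesis using teich_exists[of v 1] by (simp only: power_one_right) blast
  qed
  then obtain r where r: "\<And>v. v \<in> V \<Longrightarrow> r v \<in> Fx q 1 \<and> v - r v \<in> Q" by metis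
  have inj: "inj_on r V"
  proof (rule inj_onI)
    fix v w assume v: "v \<in> V" and w: "w \<in> V" and eq: "r v = r w"
    have "(v - r v) - (w - r w) \<in> Q" by (rule Q.idiff) (use r[OF v] r[OF w] in blast)+
    then have "v - w \<in> Q" using eq by simp
    moreover have "v - w \<in> OI k" using v w V(1) by (intro P.diff) blast+
    ultimately show "v = w" using QP by (intro V(5)[OF v w]) blast
  qed
  have "r ` V = Fx q 1"
  proof (rule card_subset_eq)
    show "finite (Fx q 1)" by (rule Fx_card(1)[OF q2]) simp
    show "r ` V \<subseteq> Fx q 1" using r by blast
    show "card (r ` V) = card (Fx q 1)" using card_image[OF inj] V(3) Fx_card(2)[OF q2, of 1] by simp
  qed
  moreover obtain \<rho> where \<rho>: "\<rho> \<in> Fx q 1" "y - \<rho> \<in> Q"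
    using teich_exists[OF assms(1), of 1] assms(2) by (auto simp only: power_one_right)
  ultimately obtain v where v: "v \<in> V" "\<rho> = r v" by blast
  have "(y - \<rho>) - (v - r v) \<in> Q" by (rule Q.idiff[OF \<rho>(2)]) (use r[OF v(1)] in blast)
  then have "y - v \<in> Q" using v(2) by simp
  then show ?thesis using v(1) V(1) by blast
qed

text \<open>Raising the coefficients to the power \<open>q\<close> gives, modulo \<open>Q\<close>,
  the polynomial whose roots are the \<open>q\<close>-th powers; linear factors are added one at a
  time.\<close>

lemma frob_coeff:
  assumes "finite R" "R \<subseteq> AI"
  shows "pover AI (\<Prod>\<rho>\<in>R. [:- \<rho>, 1:]) \<and> pover AI (\<Prod>\<rho>\<in>R. [:- (\<rho> ^ q), 1:]) \<and>
    (\<forall>i. Q.cg (poly.coeff (\<Prod>\<rho>\<in>R. [:- \<rho>, 1:]) i ^ q) (poly.coeff (\<Prod>\<rho>\<in>R. [:- (\<rho> ^ q), 1:]) i))"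
  using assms
proof (induction R rule: finite_induct)
  case empty
  have "q > 0" using q2 by simp
  then show ?case using AI.pover_1 by (auto simp: power_0_left)
next
  case (insert r R)
  let ?h = "\<Prod>\<rho>\<in>R. [:- \<rho>, 1:]" and ?h' = "\<Prod>\<rho>\<in>R. [:- (\<rho> ^ q), 1:]"
  have r: "r \<in> AI" using insert.prems by simp
  have IH: "pover AI ?h" "pover AI ?h'" "\<And>i. Q.cg (poly.coeff ?h i ^ q) (poly.coeff ?h' i)"
    using insert.IH insert.prems by auto
  have qpos: "q > 0" using q2 by simp
  \<comment> \<open>For even \<open>q\<close> the sign of the power differs. Additivity applied to
    \<open>r + - r\<close> yields the congruence for every \<open>q\<close>.\<close>
  have neg: "Q.cg ((- r) ^ q) (- (r ^ q))"
  proof -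
    have "Q.cg ((r + - r) ^ q) (r ^ q + (- r) ^ q)" by (rule frobQ[OF r AI.uminus[OF r]])
    then have "0 - (r ^ q + (- r) ^ q) \<in> Q" using qpos by (simp add: Q.cg_def power_0_left)
    then have "- (0 - (r ^ q + (- r) ^ q)) \<in> Q" by (rule Q.iuminus)
    then show ?thesis by (simp add: Q.cg_def algebra_simps)
  qed
  have co: "poly.coeff ([:- s, 1:] * g) i = (- s) * poly.coeff g i + (case i of 0 \<Rightarrow> 0 | Suc j \<Rightarrow> poly.coeff g j)"
    for s :: complex and g and i :: nat
    by (simp add: coeff_pCons split: nat.splits)
  have hA: "poly.coeff ?h i \<in> AI" "poly.coeff ?h' i \<in> AI" for i using IH(1,2) by (simp_all add: pover_def)
  have cgi: "Q.cg (poly.coeff ([:- r, 1:] * ?h) i ^ q) (poly.coeff ([:- (r ^ q), 1:] * ?h') i)" for i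
  proof -
    let ?u = "case i of 0 \<Rightarrow> 0 | Suc j \<Rightarrow> poly.coeff ?h j" and ?u' = "case i of 0 \<Rightarrow> 0 | Suc j \<Rightarrow> poly.coeff ?h' j"
    have u: "?u \<in> AI" "Q.cg (?u ^ q) ?u'"
      using hA IH(3) qpos AI.zero by (auto split: nat.splits simp: power_0_left)
    have "Q.cg (((- r) * poly.coeff ?h i + ?u) ^ q) (((- r) * poly.coeff ?h i) ^ q + ?u ^ q)"
      by (rule frobQ[OF AI.mult[OF AI.uminus[OF r] hA(1)] u(1)])
    also have "Q.cg (((- r) * poly.coeff ?h i) ^ q + ?u ^ q) ((- (r ^ q)) * poly.coeff ?h' i + ?u')"
    proof (rule Q.cg_add[OF _ u(2)])
      show "Q.cg (((- r) * poly.coeff ?h i) ^ q) ((- (r ^ q)) * poly.coeff ?h' i)"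
        unfolding power_mult_distrib by (rule Q.cg_mult[OF neg IH(3) AI.uminus[OF AI.power[OF r]] hA(2)])
    qed
    finally show ?thesis unfolding co .
  qed
  have lin: "pover AI [:- r, 1:]" "pover AI [:- (r ^ q), 1:]"
    by (intro AI.pover_pCons AI.pover_0 AI.one AI.uminus AI.power r)+
  show ?case unfolding prod.insert[OF insert.hyps(1,2)]
    using cgi AI.pover_mult[OF lin(1) IH(1)] AI.pover_mult[OF lin(2) IH(2)] by blast
qed

text \<open>The power map permutes \<open>R\<close>, so the coefficients are fixed by it modulo
  \<open>Q\<close> and are congruent to elements of \<open>OI k\<close>.\<close>

lemma type_coeff:
  assumes "finite R" "R \<subseteq> Tch q" "perm_on (\<lambda>x. x ^ q) R"
  shows "\<exists>a\<in>OI k. poly.coeff (\<Prod>\<rho>\<in>R. [:- \<rho>, 1:]) i - a \<in> Q"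
proof -
  have RA: "R \<subseteq> AI" using assms(2) Tch_AI[OF q2] by blast
  note F = frob_coeff[OF assms(1) RA]
  \<comment> \<open>Points with the same image share an orbit, so \<open>y\<close> is an iterate of
    \<open>x\<close>; comparing exponents modulo the period shows that the period divides
    \<open>i\<close>.\<close>
  have inj: "inj_on (\<lambda>x. x ^ q) R"
  proof (rule inj_onI)
    fix x y assume x: "x \<in> R" and y: "y \<in> R" and eq: "x ^ q = y ^ q"
    have "Orbits.orbit (\<lambda>x. x ^ q) x = Orbits.orbit (\<lambda>x. x ^ q) y"
      using self_in_orbit_step[OF perm_onD(2)[OF assms(3) x]] self_in_orbit_step[OF perm_onD(2)[OF assms(3) y]] eq by simp
    then have "y \<in> Orbits.orbit (\<lambda>x. x ^ q) x" using perm_onD(2)[OF assms(3) y] by simp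
    then obtain i where i: "y = x ^ (q ^ i)" by (auto simp: orbit_altdef funpow_power)
    have "((\<lambda>x. x ^ q) ^^ Suc 0) x = ((\<lambda>x. x ^ q) ^^ Suc i) x"
      using eq i by (simp only: funpow_power) (simp add: power_mult[symmetric] mult.commute)
    then have "Suc 0 mod card (Orbits.orbit (\<lambda>x. x ^ q) x) = Suc i mod card (Orbits.orbit (\<lambda>x. x ^ q) x)"
      using funpow_eq_iff_mod[OF perm_onD(2)[OF assms(3) x]] by blast
    then have "0 mod card (Orbits.orbit (\<lambda>x. x ^ q) x) = i mod card (Orbits.orbit (\<lambda>x. x ^ q) x)"
    proof -
      let ?c = "int (card (Orbits.orbit (\<lambda>x. x ^ q) x))"
      have "int (Suc 0) mod ?c = int (Suc i) mod ?c" using \<open>Suc 0 mod _ = _\<close> by (simp only: zmod_int[symmetric])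
      then have "?c dvd int (Suc 0) - int (Suc i)" by (simp only: mod_eq_dvd_iff)
      then have "?c dvd int i" by simp
      then have "card (Orbits.orbit (\<lambda>x. x ^ q) x) dvd i" by simp
      then show ?thesis by simp
    qed
    then have "((\<lambda>x. x ^ q) ^^ 0) x = ((\<lambda>x. x ^ q) ^^ i) x"
      using funpow_eq_iff_mod[OF perm_onD(2)[OF assms(3) x]] by blast
    then show "x = y" using i by (simp only: funpow_power) simp
  qed
  moreover have "(\<lambda>x. x ^ q) ` R \<subseteq> R" using perm_onD(1)[OF assms(3)] by blast
  ultimately have "bij_betw (\<lambda>x. x ^ q) R R" using endo_inj_surj[OF assms(1)] unfolding bij_betw_def by blast
  then have "(\<Prod>\<rho>\<in>R. [:- (\<rho> ^ q), 1:]) = (\<Prod>\<rho>\<in>R. [:- \<rho>, 1:])" by (rule prod.reindex_bij_betw)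
  then have "poly.coeff (\<Prod>\<rho>\<in>R. [:- \<rho>, 1:]) i ^ q - poly.coeff (\<Prod>\<rho>\<in>R. [:- \<rho>, 1:]) i \<in> Q"
    using F by (simp add: Q.cg_def)
  moreover have "poly.coeff (\<Prod>\<rho>\<in>R. [:- \<rho>, 1:]) i \<in> AI" using F by (simp add: pover_def)
  ultimately show ?thesis by (intro fixed_in_k)
qed

lemma cg_poly:
  assumes "pover AI g" "x \<in> AI" "\<And>i. poly.coeff f i - poly.coeff g i \<in> Q"
  shows "poly f x - poly g x \<in> Q"
proof -
  have "poly f x - poly g x = poly (f - g) x" by simp
  also have "\<dots> = (\<Sum>i\<le>Polynomial.degree (f - g). poly.coeff (f - g) i * x ^ i)" by (rule poly_altdef)
  also have "\<dots> \<in> Q" by (rule Q.isum, rule Q.imult'[OF AI.power[OF assms(2)]]) (simp add: assms(3))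
  finally show ?thesis .
qed

text \<open>Modulo \<open>Q\<close> the polynomial is the product of the \<open>X - \<rho>\<close>,
  so every root is congruent to some \<rho> and every \<rho> to some root. The \<rho> have
  \<open>n\<close> distinct residues and \<open>f\<close> has at most \<open>n\<close> roots, so the
  correspondence is bijective and \<open>f\<close> has \<open>n\<close> different roots.\<close>

lemma root_bijection:
  assumes f: "monic f" "Polynomial.degree f = n" "pover AI f"
    and R: "finite R" "R \<subseteq> Tch q" "card R = n"
    and cong: "\<And>i. poly.coeff f i - poly.coeff (\<Prod>\<rho>\<in>R. [:- \<rho>, 1:]) i \<in> Q"
  shows "\<exists>t. bij_betw t {\<theta>. poly f \<theta> = 0} R \<and> (\<forall>\<theta>. poly f \<theta> = 0 \<longrightarrow> \<theta> - t \<theta> \<in> Q)"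
proof -
  let ?g = "\<Prod>\<rho>\<in>R. [:- \<rho>, 1:]"
  let ?S = "{\<theta>. poly f \<theta> = 0}"
  have RA: "R \<subseteq> AI" using R(2) Tch_AI[OF q2] by blast
  have g: "pover AI ?g" using frob_coeff[OF R(1) RA] by blast
  have f0: "f \<noteq> 0" using f(1) by auto
  have finS: "finite ?S" by (rule poly_roots_finite[OF f0])
  have SA: "\<theta> \<in> AI" if "\<theta> \<in> ?S" for \<theta>
    using algebraic_int_root_of_monic[OF f(1), of \<theta>] that f(3) by (simp add: pover_def)
  have "\<exists>\<rho>. \<rho> \<in> R \<and> \<theta> - \<rho> \<in> Q" if t: "\<theta> \<in> ?S" for \<theta>
  proof -
    have "poly f \<theta> - poly ?g \<theta> \<in> Q" by (rule cg_poly[OF g SA[OF t] cong])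
    then have "- (poly f \<theta> - poly ?g \<theta>) \<in> Q" by (rule Q.iuminus)
    then have "(\<Prod>\<rho>\<in>R. \<theta> - \<rho>) \<in> Q" using t by (simp add: poly_prod)
    then have "\<exists>\<rho>\<in>R. \<theta> - \<rho> \<in> Q"
      by (rule Q.prime_prod[OF R(1), rotated]) (rule AI.diff[OF SA[OF t]], use RA in blast)
    then show ?thesis by blast
  qed
  then obtain t where t: "\<And>\<theta>. \<theta> \<in> ?S \<Longrightarrow> t \<theta> \<in> R \<and> \<theta> - t \<theta> \<in> Q" by metis
  have "R \<subseteq> t ` ?S"
  proof
    fix \<rho> assume r: "\<rho> \<in> R"
    have rA: "\<rho> \<in> AI" using r RA by blast
    have "poly ?g \<rho> = 0" using r R(1) by (auto simp: poly_prod)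
    then have "poly f \<rho> \<in> Q" using cg_poly[OF g rA cong] by simp
    moreover have "poly f \<rho> = (\<Prod>z\<in>?S. (\<rho> - z) ^ Polynomial.order z f)"
    proof -
      have "f = (\<Prod>z\<in>?S. [:- z, 1:] ^ Polynomial.order z f)" using complex_poly_decompose[of f] f(1) by simp
      then have "poly f \<rho> = poly (\<Prod>z\<in>?S. [:- z, 1:] ^ Polynomial.order z f) \<rho>" by (rule arg_cong)
      then show ?thesis by (simp add: poly_prod poly_power)
    qed
    ultimately have "(\<Prod>z\<in>?S. (\<rho> - z) ^ Polynomial.order z f) \<in> Q" by (simp only:)
    then have "\<exists>z\<in>?S. (\<rho> - z) ^ Polynomial.order z f \<in> Q"
      by (rule Q.prime_prod[OF finS, rotated]) (rule AI.power, rule AI.diff[OF rA], rule SA)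
    then obtain z where z: "z \<in> ?S" "(\<rho> - z) ^ Polynomial.order z f \<in> Q" by blast
    have "\<rho> - z \<in> Q" by (rule Q.prime_power[OF AI.diff[OF rA SA[OF z(1)]] z(2)])
    then have "(\<rho> - z) + (z - t z) \<in> Q" by (rule Q.iadd) (use t[OF z(1)] in blast)
    then have "\<rho> - t z \<in> Q" by simp
    then have "\<rho> = t z" by (rule teich_inj[rotated 2]) (use r t[OF z(1)] R(2) in blast)+
    then show "\<rho> \<in> t ` ?S" using z(1) by blast
  qed
  moreover have "t ` ?S \<subseteq> R" using t by blast
  ultimately have im: "t ` ?S = R" by (rule subset_antisym[rotated])
  have "card ?S \<le> n" using card_poly_roots_bound[OF f0] f(2) by simp
  then have "card (t ` ?S) = card ?S" using im R(3) card_image_le[OF finS, of t] by simp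
  then have "inj_on t ?S" by (rule eq_card_imp_inj_on[OF finS])
  then have "bij_betw t ?S R" using im by (simp add: bij_betw_def)
  then show ?thesis using t by blast
qed

end

section \<open>Polynomials with prescribed reductions\<close>

text \<open>A prime with finite residue field is maximal: an element \<open>x\<close> of
  \<open>P2\<close> outside \<open>P1\<close> would have \<open>x ^ (q1 - 1)\<close> congruent to 1
  modulo \<open>P1\<close>, hence modulo \<open>P2\<close>.\<close>

lemma prime_not_subset:
  assumes "residue_prime k P1 p1 m1 q1 V1" "residue_prime k P2 p2 m2 q2 V2" "P1 \<noteq> P2"
  shows "\<exists>z\<in>P1. z \<notin> P2"
proof (rule ccontr)
  interpret a: residue_prime k P1 p1 m1 q1 V1 by fact
  interpret b: residue_prime k P2 p2 m2 q2 V2 by fact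
  assume "\<not> ?thesis"
  then have sub: "P1 \<subseteq> P2" by blast
  then obtain x where x: "x \<in> P2" "x \<notin> P1" using assms(3) by blast
  have xO: "x \<in> OI k" using x(1) b.P.sub by blast
  have "x ^ (q1 - 1) - 1 \<in> P2" using a.pow_q_minus_1[OF xO x(2)] sub by blast
  moreover have "x ^ (q1 - 1) \<in> P2" by (rule b.P.ipower[OF x(1)]) (use a.q2 in simp)
  ultimately have "x ^ (q1 - 1) - (x ^ (q1 - 1) - 1) \<in> P2" by (rule b.P.idiff[rotated])
  then show False using b.P.one_notin by simp
qed

text \<open>The element that is 1 modulo \<open>P i\<close> and 0 modulo the other primes is a
  product of elements of these, taken outside \<open>P i\<close>, raised to the power
  \<open>q i - 1\<close>.\<close>

lemma crt:
  assumes J: "finite J" and rp: "\<And>j. j \<in> J \<Longrightarrow> residue_prime k (P j) (p j) (m j) (q j) (V j)"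
    and inj: "inj_on P J" and kf: "cfield k" and c: "\<And>j. j \<in> J \<Longrightarrow> c j \<in> OI k"
  shows "\<exists>x\<in>OI k. \<forall>j\<in>J. x - c j \<in> P j"
proof -
  interpret O: csubring "OI k" by (rule csubring.csubring_OI) (use kf in \<open>simp add: cfield_def\<close>)
  have "\<exists>e. e \<in> OI k \<and> e - 1 \<in> P i \<and> (\<forall>j\<in>J - {i}. e \<in> P j)" if i: "i \<in> J" for i
  proof -
    interpret i: residue_prime k "P i" "p i" "m i" "q i" "V i" by (rule rp[OF i])
    have "\<exists>z. z \<in> P j \<and> z \<notin> P i" if j: "j \<in> J - {i}" for j
    proof -
      have "P j \<noteq> P i" using inj_onD[OF inj, of j i] i j by blast
      then show ?thesis using prime_not_subset[OF rp[of j] rp[OF i]] j by blast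
    qed
    then obtain z where z: "\<And>j. j \<in> J - {i} \<Longrightarrow> z j \<in> P j \<and> z j \<notin> P i" by metis
    have sub: "P j \<subseteq> OI k" if j: "j \<in> J" for j
    proof -
      interpret j: residue_prime k "P j" "p j" "m j" "q j" "V j" by (rule rp[OF j])
      show ?thesis by (rule j.P.sub)
    qed
    have zO: "z j \<in> OI k" if "j \<in> J - {i}" for j using z[OF that] sub[of j] that by blast
    define e0 where "e0 = (\<Prod>j\<in>J - {i}. z j)"
    have e0O: "e0 \<in> OI k" unfolding e0_def by (rule O.prod, rule zO)
    have "e0 \<notin> P i"
    proof
      assume "e0 \<in> P i"
      then have "\<exists>j\<in>J - {i}. z j \<in> P i" unfolding e0_def
        by (rule i.P.prime_prod[rotated 2]) (use J zO in auto)
      then show False using z by blast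
    qed
    then have "e0 ^ (q i - 1) - 1 \<in> P i" by (rule i.pow_q_minus_1[OF e0O])
    moreover have "e0 ^ (q i - 1) \<in> P j" if j: "j \<in> J - {i}" for j
    proof -
      have jJ: "j \<in> J" using j by blast
      interpret j: residue_prime k "P j" "p j" "m j" "q j" "V j" by (rule rp[OF jJ])
      have "e0 \<in> P j" unfolding e0_def
        by (rule j.P.iprod[of _ j]) (use J j zO z in auto)
      then show ?thesis by (rule j.P.ipower) (use i.q2 in simp)
    qed
    ultimately show ?thesis using O.power[OF e0O] by blast
  qed
  then obtain e where e: "\<And>i. i \<in> J \<Longrightarrow> e i \<in> OI k \<and> e i - 1 \<in> P i \<and> (\<forall>j\<in>J - {i}. e i \<in> P j)" by metis
  define x where "x = (\<Sum>i\<in>J. e i * c i)"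
  have "x \<in> OI k" unfolding x_def by (rule O.sum, rule O.mult) (use e c in blast)+
  moreover have "x - c j \<in> P j" if j: "j \<in> J" for j
  proof -
    interpret j: residue_prime k "P j" "p j" "m j" "q j" "V j" by (rule rp[OF j])
    have "x - c j = (e j - 1) * c j + (\<Sum>i\<in>J - {j}. e i * c i)"
      unfolding x_def using sum.remove[OF J j, of "\<lambda>i. e i * c i"] by (simp add: algebra_simps)
    moreover have "(e j - 1) * c j \<in> P j" by (rule j.P.imult') (use e[OF j] c[OF j] in blast)+
    moreover have "(\<Sum>i\<in>J - {j}. e i * c i) \<in> P j"
    proof (rule j.P.isum)
      fix i assume i: "i \<in> J - {j}"
      then have "e i \<in> P j" using e[of i] j by blast
      then show "e i * c i \<in> P j" by (rule j.P.imult'[rotated]) (use c i in blast)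
    qed
    ultimately show ?thesis using j.P.iadd by simp
  qed
  ultimately show ?thesis by blast
qed

text \<open>The coefficients of the wanted reductions are congruent to elements of
  \<open>OI k\<close> by \<open>type_coeff\<close>, and the Chinese remainder theorem glues these
  coefficient by coefficient.\<close>

theorem exists_poly:
  assumes k: "number_field k" and J: "finite J" and P: "\<And>j. j \<in> J \<Longrightarrow> prime_of k (P j)" and inj: "inj_on P J"
    and R: "\<And>j. j \<in> J \<Longrightarrow> finite (R j)" "\<And>j. j \<in> J \<Longrightarrow> R j \<subseteq> Tch (ideal_norm k (P j))"
      "\<And>j. j \<in> J \<Longrightarrow> perm_on (\<lambda>x. x ^ ideal_norm k (P j)) (R j)" "\<And>j. j \<in> J \<Longrightarrow> card (R j) = n"
  shows "\<exists>f. monic f \<and> Polynomial.degree f = n \<and> pover (OI k) f \<and>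
    (\<forall>j\<in>J. \<exists>p m V Q t. residue_above k (P j) p m (ideal_norm k (P j)) V Q \<and>
      bij_betw t {\<theta>. poly f \<theta> = 0} (R j) \<and> (\<forall>\<theta>. poly f \<theta> = 0 \<longrightarrow> \<theta> - t \<theta> \<in> Q))"
proof -
  have kf: "cfield k" using k by (simp add: number_field_def subfield_CC_iff)
  interpret k: cfield k by (rule kf)
  interpret O: csubring "OI k" by (rule k.csubring_OI)
  let ?q = "\<lambda>j. ideal_norm k (P j)"
  let ?g = "\<lambda>j. \<Prod>\<rho>\<in>R j. [:- \<rho>, 1:]"
  have "\<forall>j\<in>J. \<exists>p m V. residue_prime k (P j) p m (?q j) V" using residue_prime_exists[OF k] P by blast
  then obtain p m V where rp: "\<And>j. j \<in> J \<Longrightarrow> residue_prime k (P j) (p j) (m j) (?q j) (V j)" by metis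
  have "\<exists>Q. residue_above k (P j) (p j) (m j) (?q j) (V j) Q" if j: "j \<in> J" for j
  proof -
    interpret j: residue_prime k "P j" "p j" "m j" "?q j" "V j" by (rule rp[OF j])
    obtain Q where "cprime AI Q" "Q \<inter> OI k = P j" using j.exists_above by blast
    then show ?thesis using rp[OF j] unfolding residue_above_def residue_above_axioms_def by blast
  qed
  then obtain Q where ra: "\<And>j. j \<in> J \<Longrightarrow> residue_above k (P j) (p j) (m j) (?q j) (V j) (Q j)" by metis
  have "\<exists>a. a \<in> OI k \<and> poly.coeff (?g j) i - a \<in> Q j" if j: "j \<in> J" for j i
  proof -
    interpret j: residue_above k "P j" "p j" "m j" "?q j" "V j" "Q j" by (rule ra[OF j])
    show ?thesis using j.type_coeff[OF R(1)[OF j] R(2)[OF j] R(3)[OF j], of i] by blast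
  qed
  then obtain a where a: "\<And>j i. j \<in> J \<Longrightarrow> a j i \<in> OI k \<and> poly.coeff (?g j) i - a j i \<in> Q j" by metis
  have "\<exists>x\<in>OI k. \<forall>j\<in>J. x - a j i \<in> P j" for i
    by (rule crt[OF J rp inj kf]) (use a in blast)+
  then obtain x where x: "\<And>i. x i \<in> OI k" "\<And>i j. j \<in> J \<Longrightarrow> x i - a j i \<in> P j" by metis
  define f where "f = (\<Sum>i<n. Polynomial.monom (x i) i) + Polynomial.monom 1 n"
  have cf: "poly.coeff f i = (if i < n then x i else if i = n then 1 else 0)" for i
  proof -
    have "poly.coeff (\<Sum>i<n. Polynomial.monom (x i) i) i = (\<Sum>l<n. if l = i then x l else 0)"
      by (simp add: coeff_sum)
    then show ?thesis by (simp add: f_def sum.delta)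
  qed
  have deg: "Polynomial.degree f = n"
  proof (rule antisym)
    show "Polynomial.degree f \<le> n" by (rule degree_le) (simp add: cf)
    show "n \<le> Polynomial.degree f" by (rule le_degree) (simp add: cf)
  qed
  have mon: "monic f" by (simp add: deg cf)
  have fO: "pover (OI k) f" using x(1) O.zero O.one by (simp add: pover_def cf)
  have "\<exists>p m V Q t. residue_above k (P j) p m (?q j) V Q \<and>
      bij_betw t {\<theta>. poly f \<theta> = 0} (R j) \<and> (\<forall>\<theta>. poly f \<theta> = 0 \<longrightarrow> \<theta> - t \<theta> \<in> Q)" if j: "j \<in> J" for j
  proof -
    interpret j: residue_above k "P j" "p j" "m j" "?q j" "V j" "Q j" by (rule ra[OF j])
    have dg: "Polynomial.degree (?g j) = n" "monic (?g j)"
    proof -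
      have "Polynomial.degree (?g j) = (\<Sum>\<rho>\<in>R j. Polynomial.degree [:- \<rho>, 1:])"
        by (rule degree_prod_sum_eq) auto
      then show "Polynomial.degree (?g j) = n" using R(4)[OF j] by simp
      show "monic (?g j)" by (rule monic_prod) simp
    qed
    have "poly.coeff f i - poly.coeff (?g j) i \<in> Q j" for i
    proof (cases "i < n")
      case True
      have "x i - a j i \<in> Q j" using x(2)[OF j, of i] j.QP by blast
      moreover have "poly.coeff (?g j) i - a j i \<in> Q j" using a[OF j, of i] by blast
      ultimately have "(x i - a j i) - (poly.coeff (?g j) i - a j i) \<in> Q j" by (rule j.Q.idiff)
      then show ?thesis using True by (simp add: cf)
    next
      case False
      then have "poly.coeff f i = poly.coeff (?g j) i"
        using dg by (cases "i = n") (auto simp: cf coeff_eq_0)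
      then show ?thesis using j.Q.izero by simp
    qed
    moreover have "pover AI f" using fO j.OI_AI by (rule pover_mono)
    ultimately have "\<exists>t. bij_betw t {\<theta>. poly f \<theta> = 0} (R j) \<and> (\<forall>\<theta>. poly f \<theta> = 0 \<longrightarrow> \<theta> - t \<theta> \<in> Q j)"
      using j.root_bijection[OF mon deg _ R(1)[OF j] R(2)[OF j] R(4)[OF j]] by blast
    then show ?thesis using ra[OF j] by blast
  qed
  then show ?thesis using mon deg fO by blast
qed

section \<open>Simple extensions and their Galois closure\<close>

lemma Span_CC: "csubring A \<Longrightarrow> CC.Span A Us = {\<Sum>i<length Us. c i * Us ! i | c. \<forall>i. c i \<in> A}"
proof (induction Us)
  case Nil
  then show ?case using csubring.zero[OF Nil] by auto
next
  case (Cons u Us)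
  have "CC.Span A (u # Us) = CC.line_extension A u (CC.Span A Us)" by simp
  also have "\<dots> = {c * u + v | c v. c \<in> A \<and> v \<in> CC.Span A Us}"    by (intro Set.set_eqI) (simp only: CC.line_extension_mem_iff CC_simps mem_Collect_eq, blast)
  also have "\<dots> = {\<Sum>i<length (u # Us). c i * (u # Us) ! i | c. \<forall>i. c i \<in> A}"
  proof (intro subset_antisym subsetI)
    fix x assume "x \<in> {c * u + v | c v. c \<in> A \<and> v \<in> CC.Span A Us}"
    then obtain c0 c where c: "c0 \<in> A" "\<forall>i. c i \<in> A" "x = c0 * u + (\<Sum>i<length Us. c i * Us ! i)"
      unfolding Cons.IH[OF Cons.prems] by blast
    show "x \<in> {\<Sum>i<length (u # Us). c i * (u # Us) ! i | c. \<forall>i. c i \<in> A}"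
      using c by (intro CollectI exI[of _ "\<lambda>i. case i of 0 \<Rightarrow> c0 | Suc j \<Rightarrow> c j"])
        (simp add: sum.lessThan_Suc_shift del: sum.lessThan_Suc split: nat.splits)
  next
    fix x assume "x \<in> {\<Sum>i<length (u # Us). c i * (u # Us) ! i | c. \<forall>i. c i \<in> A}"
    then obtain c where c: "\<forall>i. c i \<in> A" "x = (\<Sum>i<length (u # Us). c i * (u # Us) ! i)" by blast
    have "x = c 0 * u + (\<Sum>i<length Us. c (Suc i) * Us ! i)"
      unfolding c(2) by (simp add: sum.lessThan_Suc_shift del: sum.lessThan_Suc)
    moreover have "(\<Sum>i<length Us. c (Suc i) * Us ! i) \<in> CC.Span A Us"
      unfolding Cons.IH[OF Cons.prems] using c(1) by (intro CollectI exI[of _ "\<lambda>i. c (Suc i)"]) simp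
    ultimately show "x \<in> {c * u + v | c v. c \<in> A \<and> v \<in> CC.Span A Us}" using c(1) by blast
  qed
  finally show ?case .
qed

text \<open>The degree bound is expressed by vanishing coefficients, so that the zero polynomial
  needs no exception.\<close>

lemma Span_powers:
  assumes "csubring A"
  shows "CC.Span A (map (\<lambda>i. \<theta> ^ i) [0..<n]) = {poly p \<theta> | p. pover A p \<and> (\<forall>i\<ge>n. poly.coeff p i = 0)}"
proof (intro subset_antisym subsetI)
  interpret A: csubring A by fact
  fix x assume "x \<in> CC.Span A (map (\<lambda>i. \<theta> ^ i) [0..<n])"
  then obtain c where c: "\<forall>i. c i \<in> A" "x = (\<Sum>i<n. c i * \<theta> ^ i)" unfolding Span_CC[OF assms] by auto
  define p where "p = (\<Sum>i<n. Polynomial.monom (c i) i)"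
  have cf: "poly.coeff p i = (if i < n then c i else 0)" for i
  proof -
    have "poly.coeff p i = (\<Sum>l<n. if l = i then c l else 0)" by (simp add: p_def coeff_sum)
    then show ?thesis by (simp add: sum.delta)
  qed
  have "x = poly p \<theta>" unfolding c(2) p_def by (simp add: poly_sum poly_monom)
  moreover have "pover A p" using c(1) A.zero by (simp add: pover_def cf)
  ultimately show "x \<in> {poly p \<theta> | p. pover A p \<and> (\<forall>i\<ge>n. poly.coeff p i = 0)}" using cf by auto
next
  interpret A: csubring A by fact
  fix x assume "x \<in> {poly p \<theta> | p. pover A p \<and> (\<forall>i\<ge>n. poly.coeff p i = 0)}"
  then obtain p where p: "pover A p" "\<forall>i\<ge>n. poly.coeff p i = 0" "x = poly p \<theta>" by blast
  have "poly p \<theta> = (\<Sum>i<n. poly.coeff p i * \<theta> ^ i)"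
  proof (cases "p = 0")
    case False
    have "\<not> Polynomial.degree p \<ge> n"
    proof
      assume "Polynomial.degree p \<ge> n"
      then have "lead_coeff p = 0" using p(2) by blast
      then show False using False by simp
    qed
    then have "{..Polynomial.degree p} \<subseteq> {..<n}" by auto
    then show ?thesis unfolding poly_altdef by (intro sum.mono_neutral_left) (auto simp: coeff_eq_0)
  qed simp
  then show "x \<in> CC.Span A (map (\<lambda>i. \<theta> ^ i) [0..<n])"
    unfolding Span_CC[OF assms] using p(1,3) by (intro CollectI exI[of _ "poly.coeff p"]) (simp add: pover_def)
qed

locale simple_ext = k: cfield k for k +
  fixes K :: "complex set" and \<theta> :: complex
  assumes Kf: "cfield K" and kK: "k \<subseteq> K" and thK: "\<theta> \<in> K"
    and gen: "x \<in> K \<Longrightarrow> \<exists>p. pover k p \<and> x = poly p \<theta>" and thAI: "algebraic_int \<theta>"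
begin

sublocale K: cfield K by (rule Kf)

abbreviation "E \<equiv> embeddings k K"

definition S where "S = (\<lambda>\<tau>. \<tau> \<theta>) ` E"

abbreviation "L \<equiv> galois_closure k K"

lemma E_D:
  assumes "\<tau> \<in> E"
  shows "\<tau> \<in> extensional K" "fhom K \<tau>" "x \<in> k \<Longrightarrow> \<tau> x = x"
  using assms by (simp_all add: embeddings_iff[OF Kf])

lemma E_poly:
  assumes "\<tau> \<in> E" "pover k p"
  shows "\<tau> (poly p \<theta>) = poly p (\<tau> \<theta>)"
proof -
  interpret t: fhom K \<tau> by (rule E_D(2)[OF assms(1)])
  have "map_poly \<tau> p = p" by (rule t.hfix_poly[OF E_D(3)[OF assms(1)] assms(2)])
  then show ?thesis using t.hpoly_poly[OF pover_mono[OF assms(2) kK] thK] by simp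
qed

lemma E_I:
  assumes "fhom K \<chi>" "\<And>x. x \<in> k \<Longrightarrow> \<chi> x = x"
  shows "restrict \<chi> K \<in> E"
proof -
  interpret c: fhom K \<chi> by fact
  have "fhom K (restrict \<chi> K)"
    by unfold_locales (simp_all add: c.hone c.hadd c.hmult K.one K.add K.mult)
  moreover have "\<forall>x\<in>k. restrict \<chi> K x = x" using assms(2) kK by (simp add: subset_iff)
  ultimately show ?thesis by (simp add: embeddings_iff[OF Kf])
qed

lemma E_id: "restrict (\<lambda>x. x) K \<in> E"
  by (rule E_I[OF fhom_id[OF Kf]]) simp

lemma E_eqI:
  assumes "\<tau> \<in> E" "\<tau>' \<in> E" "\<tau> \<theta> = \<tau>' \<theta>"
  shows "\<tau> = \<tau>'"
proof (rule extensionalityI[OF E_D(1)[OF assms(1)] E_D(1)[OF assms(2)]])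
  fix x assume "x \<in> K"
  then obtain p where "pover k p" "x = poly p \<theta>" using gen by blast
  then show "\<tau> x = \<tau>' x" using E_poly[OF assms(1)] E_poly[OF assms(2)] assms(3) by simp
qed

lemma inj_E: "inj_on (\<lambda>\<tau>. \<tau> \<theta>) E"
  by (rule inj_onI) (rule E_eqI)

lemma E_AI: "\<tau> \<in> E \<Longrightarrow> x \<in> K \<Longrightarrow> algebraic_int x \<Longrightarrow> algebraic_int (\<tau> x)"
  using fhom.halgebraic_int[OF E_D(2)] by simp

lemma S_roots: "pover k p \<Longrightarrow> poly p \<theta> = 0 \<Longrightarrow> s \<in> S \<Longrightarrow> poly p s = 0"
proof -
  assume p: "pover k p" "poly p \<theta> = 0" and "s \<in> S"
  then obtain \<tau> where t: "\<tau> \<in> E" "s = \<tau> \<theta>" by (auto simp: S_def)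
  interpret t: fhom K \<tau> by (rule E_D(2)[OF t(1)])
  show ?thesis using E_poly[OF t(1) p(1)] p(2) t(2) by simp
qed

lemma finite_S: "finite S"
proof -
  obtain p where p: "monic p" "\<forall>i. poly.coeff p i \<in> \<int>" "poly p \<theta> = 0"
    using thAI by (auto simp: algebraic_int.simps)
  have "pover k p" using p(2) k.Ints by (simp add: pover_def)
  then have "S \<subseteq> {x. poly p x = 0}" using S_roots[OF _ p(3)] by blast
  moreover have "p \<noteq> 0" using p(1) by auto
  ultimately show ?thesis using poly_roots_finite finite_subset by blast
qed

lemma finite_E: "finite E"
  using finite_S unfolding S_def by (rule finite_imageD[OF _ inj_E])

text \<open>Each conjugate of \<open>K\<close> consists of polynomial values at a conjugate of
  \<open>\<theta>\<close>; conversely \<open>k\<close> enters the Galois closure through the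
  identity embedding.\<close>

lemma L_eq_adj: "L = adj k S"
proof
  have "L = adj {} (\<Union>\<tau>\<in>E. \<tau> ` K)" by (simp add: galois_closure_def generate_field_CC)
  note L = this
  interpret A: cfield "adj k S" by (rule cfield_adj)
  show "L \<subseteq> adj k S" unfolding L
  proof (rule adj_least[OF A.cfield_axioms])
    show "(\<Union>\<tau>\<in>E. \<tau> ` K) \<subseteq> adj k S"
    proof
      fix y assume "y \<in> (\<Union>\<tau>\<in>E. \<tau> ` K)"
      then obtain \<tau> x where t: "\<tau> \<in> E" "x \<in> K" "y = \<tau> x" by blast
      obtain p where p: "pover k p" "x = poly p \<theta>" using gen[OF t(2)] by blast
      have "pover (adj k S) p" using p(1) adj_base by (rule pover_mono)
      moreover have "\<tau> \<theta> \<in> adj k S" using t(1) adj_gen[of S k] by (auto simp: S_def)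
      ultimately have "poly p (\<tau> \<theta>) \<in> adj k S" by (rule A.poly_in)
      then show "y \<in> adj k S" using t(3) p E_poly[OF t(1) p(1)] by simp
    qed
  qed simp
  show "adj k S \<subseteq> L" unfolding L
  proof (rule adj_least[OF cfield_adj])
    have "(\<Union>\<tau>\<in>E. \<tau> ` K) \<subseteq> adj {} (\<Union>\<tau>\<in>E. \<tau> ` K)" by (rule adj_gen)
    moreover have "k \<subseteq> (\<Union>\<tau>\<in>E. \<tau> ` K)"
    proof
      fix x assume x: "x \<in> k"
      then have "restrict (\<lambda>x. x) K x = x" "x \<in> K" using kK by auto
      then show "x \<in> (\<Union>\<tau>\<in>E. \<tau> ` K)" using E_id by (intro UN_I[OF E_id] image_eqI[of _ _ x]) simp_all
    qed
    moreover have "S \<subseteq> (\<Union>\<tau>\<in>E. \<tau> ` K)" unfolding S_def using thK by blast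
    ultimately show "k \<subseteq> adj {} (\<Union>\<tau>\<in>E. \<tau> ` K)" "S \<subseteq> adj {} (\<Union>\<tau>\<in>E. \<tau> ` K)" by blast+
  qed
qed

lemma E_in_L: "\<tau> \<in> E \<Longrightarrow> x \<in> K \<Longrightarrow> \<tau> x \<in> L"
proof -
  assume "\<tau> \<in> E" "x \<in> K"
  then have "\<tau> x \<in> (\<Union>\<tau>\<in>E. \<tau> ` K)" by blast
  then show ?thesis unfolding galois_closure_def generate_field_CC by (rule subsetD[OF adj_gen])
qed

lemma comp_E:
  assumes "fhom L \<chi>" "\<And>x. x \<in> k \<Longrightarrow> \<chi> x = x" "\<tau> \<in> E"
  shows "compose K \<chi> \<tau> \<in> E"
proof -
  interpret c: fhom L \<chi> by fact
  interpret t: fhom K \<tau> by (rule E_D(2)[OF assms(3)])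
  have "fhom K (\<lambda>x. \<chi> (\<tau> x))"
    by unfold_locales (simp_all add: c.hone t.hone t.hadd t.hmult c.hadd c.hmult E_in_L[OF assms(3)])
  then have "restrict (\<lambda>x. \<chi> (\<tau> x)) K \<in> E"
    by (rule E_I) (simp add: E_D(3)[OF assms(3)] assms(2))
  then show ?thesis by (simp add: compose_def)
qed

sublocale normal_ext k S L
proof unfold_locales
  show "finite S" by (rule finite_S)
  show "S \<subseteq> AI" unfolding S_def using E_AI[OF _ thK thAI] by auto
  show "L = adj k S" by (rule L_eq_adj)
  fix \<chi> s assume "fhom L \<chi>" "\<And>x. x \<in> k \<Longrightarrow> \<chi> x = x" "s \<in> S"
  then obtain \<tau> where t: "\<tau> \<in> E" "s = \<tau> \<theta>" by (auto simp: S_def)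
  have "compose K \<chi> \<tau> \<in> E" by (rule comp_E) fact+
  moreover have "compose K \<chi> \<tau> \<theta> = \<chi> s" using t(2) thK by (simp add: compose_def)
  ultimately show "\<chi> s \<in> S" unfolding S_def by (metis image_eqI)
qed

lemma G_comp_E: "\<sigma> \<in> G \<Longrightarrow> \<tau> \<in> E \<Longrightarrow> compose K \<sigma> \<tau> \<in> E"
  by (rule comp_E[OF G_D(3)]) (simp_all add: G_D(4))

lemma G_bij_E:
  assumes "\<sigma> \<in> G"
  shows "bij_betw (\<lambda>\<tau>. compose K \<sigma> \<tau>) E E"
proof -
  have "inj_on (\<lambda>\<tau>. compose K \<sigma> \<tau>) E"
  proof (rule inj_onI, rule E_eqI)
    fix \<tau> \<tau>' assume t: "\<tau> \<in> E" "\<tau>' \<in> E" "compose K \<sigma> \<tau> = compose K \<sigma> \<tau>'"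
    have "\<sigma> (\<tau> \<theta>) = \<sigma> (\<tau>' \<theta>)" using fun_cong[OF t(3), of \<theta>] thK by (simp add: compose_def)
    moreover have "\<tau> \<theta> \<in> L" "\<tau>' \<theta> \<in> L" by (rule E_in_L[OF t(1) thK], rule E_in_L[OF t(2) thK])
    ultimately show "\<tau> \<theta> = \<tau>' \<theta>" using inj_onD[OF fhom.hinj[OF G_D(3)[OF assms]]] by blast
  qed
  moreover have "(\<lambda>\<tau>. compose K \<sigma> \<tau>) ` E \<subseteq> E" by (rule image_subsetI, rule G_comp_E[OF assms])
  ultimately show ?thesis using endo_inj_surj[OF finite_E] unfolding bij_betw_def by blast
qed

text \<open>An embedding is determined by its value at \<open>\<theta>\<close>, and composition with
  \<open>\<sigma>\<close> acts on these values as \<open>\<sigma>\<close> does.\<close>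

lemma cycle_type_E:
  assumes "\<sigma> \<in> G"
  shows "cycle_type (\<lambda>\<tau>. compose K \<sigma> \<tau>) E = cycle_type \<sigma> S"
  unfolding S_def
  by (rule cycle_type_image[symmetric, OF bij_betw_imp_perm_on[OF finite_E G_bij_E[OF assms]] inj_E])
    (simp add: compose_def thK)

lemma cycle_class_eq: "cycle_class k K mu = {\<sigma> \<in> G. cycle_type \<sigma> S = mu}"
  unfolding cycle_class_def using cycle_type_E by auto

lemma trace_in_k: "x \<in> K \<Longrightarrow> field_trace k K x \<in> k"
proof (rule fixed_field)
  assume x: "x \<in> K"
  show "field_trace k K x \<in> L" unfolding field_trace_def by (rule L.sum, rule E_in_L[OF _ x])
  fix \<sigma> assume s: "\<sigma> \<in> G"
  interpret s: fhom L \<sigma> by (rule G_D(3)[OF s])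
  have "\<sigma> (field_trace k K x) = (\<Sum>\<tau>\<in>E. \<sigma> (\<tau> x))" unfolding field_trace_def by (rule s.hsum, rule E_in_L[OF _ x])
  also have "\<dots> = (\<Sum>\<tau>\<in>E. compose K \<sigma> \<tau> x)" using x by (simp add: compose_def)
  also have "\<dots> = field_trace k K x" unfolding field_trace_def by (rule sum.reindex_bij_betw[OF G_bij_E[OF s]])
  finally show "\<sigma> (field_trace k K x) = field_trace k K x" .
qed

lemma trace_OI: "x \<in> OI K \<Longrightarrow> field_trace k K x \<in> OI k"
proof -
  assume x: "x \<in> OI K"
  then have "x \<in> K" "algebraic_int x" by (simp_all add: OI_def)
  moreover have "field_trace k K x \<in> AI" unfolding field_trace_def
    by (rule AI.sum) (simp add: E_AI \<open>x \<in> K\<close> \<open>algebraic_int x\<close>)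
  ultimately show ?thesis using trace_in_k by (simp add: OI_def)
qed

lemma disc_OI:
  assumes "set Us \<subseteq> OI K"
  shows "basis_disc k K Us \<in> OI k"
proof -
  interpret Ok: csubring "OI k" by (rule k.csubring_OI)
  interpret OK: csubring "OI K" by (rule K.csubring_OI)
  interpret Ik: cideal "OI k" "OI k" by (rule Ok.cideal_self)
  have "Us ! i * Us ! j \<in> OI K" if "i < length Us" "j < length Us" for i j
    using assms nth_mem[OF that(1)] nth_mem[OF that(2)] by (intro OK.mult) blast+
  then show ?thesis unfolding basis_disc_def
    by (intro Ik.det_in[of _ "\<lambda>i j. field_trace k K (Us ! i * Us ! j)"] trace_OI)
qed

text \<open>The trace matrix is a transposed matrix times the matrix itself, with the values of the
  embeddings as entries. Zero rows make it square, so that an upper bound for the number of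
  embeddings suffices.\<close>

lemma disc_square:
  assumes h: "bij_betw h {..<card E} E" and n: "card E \<le> length Us" and Us: "set Us \<subseteq> K"
  shows "basis_disc k K Us =
    (det (mat (length Us) (length Us) (\<lambda>(a, j). if a < card E then h a (Us ! j) else 0)))\<^sup>2"
proof -
  let ?n = "length Us" and ?N = "card E"
  let ?A = "mat ?n ?n (\<lambda>(a, j). if a < ?N then h a (Us ! j) else 0)"
  have A: "?A \<in> carrier_mat ?n ?n" by simp
  have hE: "h a \<in> E" if "a < ?N" for a using h that by (auto simp: bij_betw_def)
  have "mat ?n ?n (\<lambda>(i, j). field_trace k K (Us ! i * Us ! j)) = transpose_mat ?A * ?A"
  proof (rule eq_matI)
    fix i j assume "i < dim_row (transpose_mat ?A * ?A)" "j < dim_col (transpose_mat ?A * ?A)"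
    then have ij: "i < ?n" "j < ?n" by simp_all
    have uK: "Us ! i \<in> K" "Us ! j \<in> K" using Us nth_mem[OF ij(1)] nth_mem[OF ij(2)] by blast+
    have "(transpose_mat ?A * ?A) $$ (i, j) =
        (\<Sum>a<?n. (if a < ?N then h a (Us ! i) else 0) * (if a < ?N then h a (Us ! j) else 0))"
      using ij by (simp add: scalar_prod_def atLeast0LessThan)
    also have "\<dots> = (\<Sum>a<?N. h a (Us ! i) * h a (Us ! j))"
      using n by (intro sum.mono_neutral_cong_right) auto
    also have "\<dots> = (\<Sum>a<?N. h a (Us ! i * Us ! j))"
    proof (rule sum.cong[OF refl])
      fix a assume "a \<in> {..<?N}"
      then interpret t: fhom K "h a" using E_D(2)[OF hE] by simp
      show "h a (Us ! i) * h a (Us ! j) = h a (Us ! i * Us ! j)" by (rule t.hmult[OF uK, symmetric])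
    qed
    also have "\<dots> = field_trace k K (Us ! i * Us ! j)"
      unfolding field_trace_def by (rule sum.reindex_bij_betw[OF h])
    finally show "mat ?n ?n (\<lambda>(i, j). field_trace k K (Us ! i * Us ! j)) $$ (i, j) = (transpose_mat ?A * ?A) $$ (i, j)"
      using ij by simp
  qed simp_all
  then have "basis_disc k K Us = det (transpose_mat ?A * ?A)" by (simp add: basis_disc_def)
  also have "\<dots> = det (transpose_mat ?A) * det ?A" by (rule det_mult[OF _ A]) simp
  also have "\<dots> = (det ?A)\<^sup>2" by (simp add: det_transpose[OF A] power2_eq_square)
  finally show ?thesis .
qed

text \<open>Two embeddings that agree modulo \<open>Q\<close> on \<open>Us\<close> give congruent
  rows; replacing one row by the other makes the determinant 0.\<close>

lemma disc_congruent:
  assumes Q: "cprime AI Q" and n: "card E \<le> length Us" and Us: "set Us \<subseteq> OI K"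
    and t: "\<tau> \<in> E" "\<tau>' \<in> E" "\<tau> \<noteq> \<tau>'" and cong: "\<And>u. u \<in> set Us \<Longrightarrow> \<tau>' u - \<tau> u \<in> Q"
  shows "basis_disc k K Us \<in> Q"
proof -
  interpret Q: cprime AI Q by (rule Q)
  obtain h where h: "bij_betw h {..<card E} E"
    using ex_bij_betw_nat_finite[OF finite_E] atLeast0LessThan by auto
  let ?n = "length Us" and ?N = "card E"
  have hE: "h a \<in> E" if "a < ?N" for a using h that by (auto simp: bij_betw_def)
  have "\<tau> \<in> h ` {..<?N}" "\<tau>' \<in> h ` {..<?N}" using h t by (simp_all add: bij_betw_def)
  then obtain a b where ab: "a < ?N" "h a = \<tau>" "b < ?N" "h b = \<tau>'" by blast
  have ne: "a \<noteq> b" using ab t(3) by auto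
  let ?Y = "\<lambda>c j. if c = b then \<tau> (Us ! j) else if c < ?N then h c (Us ! j) else 0"
  let ?Z = "\<lambda>c j. if c < ?N then h c (Us ! j) else 0"
  have AIu: "\<chi> (Us ! j) \<in> AI" if "\<chi> \<in> E" "j < ?n" for \<chi> j
  proof -
    have "Us ! j \<in> OI K" using Us nth_mem[OF that(2)] by blast
    then show ?thesis using E_AI[OF that(1)] by (simp add: OI_def)
  qed
  have UsK: "set Us \<subseteq> K" using Us by (auto simp: OI_def)
  have "Q.cg (det (mat ?n ?n (\<lambda>(c, j). ?Z c j))) (det (mat ?n ?n (\<lambda>(c, j). ?Y c j)))"
  proof (rule Q.cg_det)
    fix c j assume j: "j < ?n"
    show "Q.cg (?Z c j) (?Y c j)" using cong[OF nth_mem[OF j]] ab by (simp add: Q.cg_def Q.izero)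
    show "?Y c j \<in> AI" using AIu[OF t(1) j] AIu[OF hE j, of c] AI.zero by simp
  qed
  moreover have "det (mat ?n ?n (\<lambda>(c, j). ?Y c j)) = 0"
  proof (rule det_identical_rows[of _ ?n a b])
    show "row (mat ?n ?n (\<lambda>(c, j). ?Y c j)) a = row (mat ?n ?n (\<lambda>(c, j). ?Y c j)) b"
      by (rule eq_vecI) (use ab ne n in simp_all)
  qed (use ab ne n in simp_all)
  ultimately have "det (mat ?n ?n (\<lambda>(c, j). ?Z c j)) \<in> Q" by (simp add: Q.cg_0)
  then have "(det (mat ?n ?n (\<lambda>(c, j). ?Z c j)))\<^sup>2 \<in> Q" by (rule Q.ipower) simp
  then show ?thesis using disc_square[OF h n UsK] by simp
qed

end

section \<open>Frobenius at the primes above a given prime\<close>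

context normal_ext
begin

text \<open>Every automorphism permutes the ordered pairs of distinct elements of
  \<open>S\<close>.\<close>

lemma dsc_in_k: "dsc \<in> OI k"
proof -
  have "dsc \<in> k"
  proof (rule fixed_field)
    show "dsc \<in> L" using dsc_OI OI_L by blast
    fix \<sigma> assume s: "\<sigma> \<in> G"
    interpret s: fhom L \<sigma> by (rule G_D(3)[OF s])
    have pL: "fst x \<in> L" "snd x \<in> L" if "x \<in> pairs" for x using pairs_OI[OF that] OI_L by blast+
    have "\<sigma> dsc = (\<Prod>x\<in>pairs. \<sigma> (snd x - fst x))"
      unfolding dsc_def by (rule s.hprod, rule L.diff) (simp_all add: pL)
    also have "\<dots> = (\<Prod>x\<in>pairs. snd (map_prod \<sigma> \<sigma> x) - fst (map_prod \<sigma> \<sigma> x))"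
      by (rule prod.cong) (simp_all add: pL s.hdiff)
    also have "\<dots> = dsc" unfolding dsc_def
    proof (rule prod.reindex_bij_betw)
      have injS: "inj_on \<sigma> S" using G_S_bij[OF s] by (simp add: bij_betw_def)
      have "inj_on (map_prod \<sigma> \<sigma>) pairs"
      proof (rule inj_on_subset)
        show "inj_on (map_prod \<sigma> \<sigma>) (S \<times> S)" by (rule map_prod_inj_on[OF injS injS])
        show "pairs \<subseteq> S \<times> S" by (auto simp: pairs_def)
      qed
      moreover have "map_prod \<sigma> \<sigma> ` pairs \<subseteq> pairs"
      proof (rule image_subsetI)
        fix x assume x: "x \<in> pairs"
        then have "fst x \<in> S" "snd x \<in> S" "fst x \<noteq> snd x" by (auto simp: pairs_def)
        then have "\<sigma> (fst x) \<in> S" "\<sigma> (snd x) \<in> S" "\<sigma> (fst x) \<noteq> \<sigma> (snd x)"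
          using G_S[OF s] inj_onD[OF injS] by blast+
        then show "map_prod \<sigma> \<sigma> x \<in> pairs" by (cases x) (simp add: pairs_def)
      qed
      ultimately show "bij_betw (map_prod \<sigma> \<sigma>) pairs pairs"
        using endo_inj_surj[OF finite_pairs] unfolding bij_betw_def by blast
    qed
    finally show "\<sigma> dsc = dsc" .
  qed
  then show ?thesis using dsc_OI by (simp add: OI_def)
qed

lemma dsc_notin_if_distinct:
  assumes "cprime AI Q" "\<And>s t. s \<in> S \<Longrightarrow> t \<in> S \<Longrightarrow> s - t \<in> Q \<Longrightarrow> s = t"
  shows "dsc \<notin> Q"
proof
  interpret Q: cprime AI Q by fact
  assume "dsc \<in> Q"
  then have "\<exists>x\<in>pairs. snd x - fst x \<in> Q" unfolding dsc_def
  proof (rule Q.prime_prod[OF finite_pairs, rotated])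
    fix x assume "x \<in> pairs"
    then have "snd x \<in> AI" "fst x \<in> AI" using pairs_OI[of x] by (simp_all add: OI_def)
    then show "snd x - fst x \<in> AI" by (rule AI.diff)
  qed
  then obtain x where "x \<in> pairs" "snd x - fst x \<in> Q" by blast
  then show False using assms(2)[of "snd x" "fst x"] by (auto simp: pairs_def)
qed

text \<open>Additivity of the power map and Fermat's theorem pass to any prime of \<open>L\<close>
  above \<open>P\<close>. So does distinctness of the elements of \<open>S\<close>, because
  \<open>dsc\<close> lies in \<open>k\<close>: outside \<open>P\<close> it is outside every prime
  above \<open>P\<close>.\<close>

lemma frob_at:
  assumes r: "residue_prime k P p m q V" and d: "dsc \<notin> P" and P': "cprime (OI L) P'" "P' \<inter> OI k = P"
  shows "frob k S L P' q"
proof -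
  interpret r: residue_prime k P p m q V by fact
  interpret P': cprime "OI L" P' by (rule P'(1))
  show ?thesis
  proof unfold_locales
    show "0 < q" using r.q2 by simp
    fix x y assume "x \<in> OI L" "y \<in> OI L"
    then have "P'.cg ((x + y) ^ (p ^ m)) (x ^ (p ^ m) + y ^ (p ^ m))"
      using r.p P'(2) by (intro P'.freshman) blast+
    then show "(x + y) ^ q - (x ^ q + y ^ q) \<in> P'" by (simp add: P'.cg_def r.q(1))
  next
    fix a assume "a \<in> OI k"
    then show "a ^ q - a \<in> P'" using r.pow_q[of a] P'(2) by blast
  next
    fix s t assume st: "s \<in> S" "t \<in> S" "s - t \<in> P'"
    show "s = t"
    proof (rule ccontr)
      assume "s \<noteq> t"
      then have x: "(t, s) \<in> pairs" using st by (simp add: pairs_def)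
      have "dsc \<in> P'" unfolding dsc_def
      proof (rule P'.iprod[OF finite_pairs x])
        fix x assume "x \<in> pairs"
        then show "snd x - fst x \<in> OI L" using pairs_OI[of x] by (intro OL.diff) blast+
      qed (use st in simp)
      then show False using d P'(2) dsc_in_k by blast
    qed
  qed
qed

lemma restrict_prime:
  assumes "residue_above k P p m q V Q"
  shows "cprime (OI L) (Q \<inter> OI L)" "(Q \<inter> OI L) \<inter> OI k = P" "(Q \<inter> OI L) \<inter> k = P"
proof -
  interpret r: residue_above k P p m q V Q by fact
  have OA: "x \<in> AI" if "x \<in> OI L" for x using that by (simp add: OI_def)
  show "cprime (OI L) (Q \<inter> OI L)"
  proof unfold_locales
    show "Q \<inter> OI L \<subseteq> OI L" by blast
    show "0 \<in> Q \<inter> OI L" using r.Q.izero OL.zero by blast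
    show "1 \<notin> Q \<inter> OI L" using r.Q.one_notin by blast
  next
    fix x y assume "x \<in> Q \<inter> OI L" "y \<in> Q \<inter> OI L"
    then show "x + y \<in> Q \<inter> OI L" using r.Q.iadd[of x y] OL.add[of x y] by blast
  next
    fix a x assume "a \<in> OI L" "x \<in> Q \<inter> OI L"
    then show "a * x \<in> Q \<inter> OI L" using r.Q.imult[OF OA, of a x] OL.mult[of a x] by blast
  next
    fix x y assume "x \<in> OI L" "y \<in> OI L" "x * y \<in> Q \<inter> OI L"
    then show "x \<in> Q \<inter> OI L \<or> y \<in> Q \<inter> OI L" using r.Q.prime[OF OA OA, of x y] by blast
  qed
  show "(Q \<inter> OI L) \<inter> OI k = P" using r.QP OI_k by blast
  then show "(Q \<inter> OI L) \<inter> k = P" using kL by (auto simp: OI_def)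
qed

lemma prime_above:
  assumes "residue_above k P p m q V Q" "P \<noteq> {0}"
  shows "Q \<inter> OI L \<in> primes_above k L P"
proof -
  interpret r: residue_above k P p m q V Q by fact
  have "P \<subseteq> Q \<inter> OI L" using restrict_prime(2)[OF assms(1)] by blast
  then have "Q \<inter> OI L \<noteq> {0}" using assms(2) r.P.izero by blast
  then show ?thesis using restrict_prime[OF assms(1)] L.primeideal_iff
    by (simp add: primes_above_def prime_of_def)
qed

text \<open>Modulo \<open>Q\<close>, \<open>t (\<phi> s)\<close> is congruent to
  \<open>\<phi> s\<close>, to \<open>s ^ q\<close> and to \<open>t s ^ q\<close>. Both ends are
  representatives, so they are equal and \<open>t\<close> intertwines \<open>\<phi>\<close> with the
  power map.\<close>

lemma frobenius_cycle_type:
  assumes r: "residue_above k P p m q V Q" and \<phi>: "\<phi> \<in> G" "\<forall>y\<in>OI L. \<phi> y - y ^ q \<in> Q"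
    and t: "inj_on t S" "\<And>s. s \<in> S \<Longrightarrow> t s \<in> Tch q" "\<And>s. s \<in> S \<Longrightarrow> s - t s \<in> Q"
  shows "cycle_type (\<lambda>x. x ^ q) (t ` S) = cycle_type \<phi> S"
proof (rule cycle_type_image[OF bij_betw_imp_perm_on[OF finS G_S_bij[OF \<phi>(1)]] t(1)])
  interpret r: residue_above k P p m q V Q by fact
  fix s assume s: "s \<in> S"
  have s': "\<phi> s \<in> S" by (rule G_S[OF \<phi>(1) s])
  have tA: "t s \<in> AI" using t(2)[OF s] Tch_AI[OF r.q2] by blast
  have "r.Q.cg (t (\<phi> s)) (\<phi> s)" by (rule r.Q.cg_sym) (simp add: r.Q.cg_def t(3)[OF s'])
  also have "r.Q.cg (\<phi> s) (s ^ q)" using \<phi>(2) s S_OI by (auto simp: r.Q.cg_def)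
  also have "r.Q.cg (s ^ q) (t s ^ q)" by (rule r.Q.cg_power[OF _ tA]) (simp add: r.Q.cg_def t(3)[OF s])
  finally have "t (\<phi> s) - t s ^ q \<in> Q" by (simp add: r.Q.cg_def)
  then show "t (\<phi> s) = t s ^ q"
    by (rule r.teich_inj[OF t(2)[OF s'] perm_onD(1)[OF Tch_perm t(2)[OF s]]])
qed

text \<open>Some iterate of \<open>\<phi>\<close> fixes \<open>s\<close>, and modulo
  \<open>Q\<close> the \<open>j\<close>-th iterate raises \<open>s\<close> to the power
  \<open>q ^ j\<close>.\<close>

lemma teich_of_S:
  assumes r: "residue_above k P p m q V Q" and \<phi>: "\<phi> \<in> G" "\<forall>y\<in>OI L. \<phi> y - y ^ q \<in> Q" and s: "s \<in> S"
  shows "\<exists>\<rho>. \<rho> \<in> Tch q \<and> s - \<rho> \<in> Q"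
proof -
  interpret r: residue_above k P p m q V Q by fact
  have it: "(\<phi> ^^ j) s \<in> S \<and> (\<phi> ^^ j) s - s ^ (q ^ j) \<in> Q" for j
  proof (induction j)
    case 0
    then show ?case using s r.Q.izero by simp
  next
    case (Suc j)
    let ?u = "(\<phi> ^^ j) s"
    have sA: "s \<in> AI" using s S_AI by blast
    have "r.Q.cg (\<phi> ?u) (?u ^ q)" using \<phi>(2) Suc S_OI by (auto simp: r.Q.cg_def)
    also have "r.Q.cg (?u ^ q) ((s ^ (q ^ j)) ^ q)"
      by (rule r.Q.cg_power[OF _ AI.power[OF sA]]) (use Suc in \<open>simp add: r.Q.cg_def\<close>)
    finally have "\<phi> ?u - s ^ (q ^ Suc j) \<in> Q" by (simp add: r.Q.cg_def power_mult[symmetric] mult.commute)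
    then show ?case using G_S[OF \<phi>(1)] Suc by simp
  qed
  have "s \<in> Orbits.orbit \<phi> s" by (rule perm_onD(2)[OF bij_betw_imp_perm_on[OF finS G_S_bij[OF \<phi>(1)]] s])
  then obtain j where j: "j > 0" "(\<phi> ^^ j) s = s" by (auto simp: orbit_altdef)
  have "- ((\<phi> ^^ j) s - s ^ (q ^ j)) \<in> Q" using it[of j] by (intro r.Q.iuminus) blast
  then have "s ^ (q ^ j) - s \<in> Q" using j(2) by simp
  moreover have "s \<in> AI" using s S_AI by blast
  ultimately obtain \<rho> where "\<rho> \<in> Fx q j" "s - \<rho> \<in> Q" using r.teich_exists[of s j] j(1) by (auto simp: Suc_le_eq)
  then show ?thesis using Fx_Tch[of j q] j(1) by (intro exI[of _ \<rho>]) auto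
qed

end

section \<open>Necessity\<close>

lemma finprod_ideals_subset:
  assumes kf: "cfield k" and P: "\<And>i. i \<in> J \<Longrightarrow> cprime (OI k) (P i)" and "finite J" "i \<in> J"
  shows "(\<Otimes>\<^bsub>ideals_set (ring_of_integers k)\<^esub> i\<in>J. P i) \<subseteq> P i"
proof -
  interpret k: cfield k by (rule kf)
  interpret R: cring "ring_of_integers k" by (rule k.cring_OI)
  interpret I: comm_monoid "ideals_set (ring_of_integers k)" by (rule R.ideals_set_is_comm_monoid)
  have car: "I' \<in> carrier (ideals_set (ring_of_integers k)) \<longleftrightarrow> ideal I' (ring_of_integers k)" for I'
    by (simp add: ideals_set_def)
  have Pi: "ideal (P l) (ring_of_integers k)" if "l \<in> J" for l
    using P[OF that] k.ideal_iff by (simp add: cprime_def)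
  have J': "P \<in> J - {i} \<rightarrow> carrier (ideals_set (ring_of_integers k))" using Pi car by auto
  let ?r = "\<Otimes>\<^bsub>ideals_set (ring_of_integers k)\<^esub> i\<in>J - {i}. P i"
  have rc: "ideal ?r (ring_of_integers k)" using I.finprod_closed[OF J'] car by simp
  have "J = insert i (J - {i})" using assms(4) by blast
  then have "(\<Otimes>\<^bsub>ideals_set (ring_of_integers k)\<^esub> i\<in>J. P i) = P i \<otimes>\<^bsub>ideals_set (ring_of_integers k)\<^esub> ?r"
    using I.finprod_insert[of "J - {i}" i P] J' assms(3) Pi[OF assms(4)] car by auto
  also have "\<dots> = ideal_prod (ring_of_integers k) (P i) ?r" by (simp add: ideals_set_def)
  also have "\<dots> \<subseteq> P i" using R.ideal_prod_inter[OF Pi[OF assms(4)] rc] by blast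
  finally show ?thesis .
qed

text \<open>The span of the powers is a ring, so \<open>\<theta> ^ n\<close> is a combination of
  lower powers: \<open>\<theta>\<close> is integral and has at most \<open>n\<close> conjugates. A
  basis inside the order shows that \<open>\<theta>\<close> generates \<open>K\<close>.\<close>

lemma order_imp_simple_ext:
  assumes kf: "cfield k" and K: "cfield K" "k \<subseteq> K" and n: "n \<ge> 2"
    and th: "\<theta> \<in> K" "is_order k K (power_order k n \<theta>)"
  shows "simple_ext k K \<theta>" "card (embeddings k K) \<le> n" "power_order k n \<theta> \<subseteq> OI K"
    "power_order k n \<theta> = {poly p \<theta> | p. pover (OI k) p \<and> (\<forall>i\<ge>n. poly.coeff p i = 0)}"
proof -
  interpret k: cfield k by (rule kf)
  interpret K: cfield K by (rule K(1))
  interpret O: csubring "OI k" by (rule k.csubring_OI)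
  let ?R = "power_order k n \<theta>"
  show R: "?R = {poly p \<theta> | p. pover (OI k) p \<and> (\<forall>i\<ge>n. poly.coeff p i = 0)}"
    unfolding power_order_def ring_of_integers_simps by (rule Span_powers[OF k.csubring_OI])
  interpret R: csubring ?R using th(2) csubring_if_subring_CC by (simp add: is_order_def)
  have "poly [:0, 1:] \<theta> \<in> ?R" unfolding R
    using n O.zero O.one by (intro CollectI exI[of _ "[:0, 1:]"])
      (auto simp: pover_def coeff_pCons split: nat.splits)
  then have "\<theta> \<in> ?R" by simp
  then have "\<theta> ^ n \<in> ?R" by (rule R.power)
  then obtain p where p: "pover (OI k) p" "\<forall>i\<ge>n. poly.coeff p i = 0" "\<theta> ^ n = poly p \<theta>" unfolding R by blast
  define f where "f = Polynomial.monom 1 n - p"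
  have cf: "poly.coeff f i = (if i = n then 1 else 0) - poly.coeff p i" for i by (simp add: f_def)
  have deg: "Polynomial.degree f = n"
  proof (rule antisym)
    show "Polynomial.degree f \<le> n" by (rule degree_le) (use p(2) in \<open>simp add: cf\<close>)
    show "n \<le> Polynomial.degree f" by (rule le_degree) (use p(2) in \<open>simp add: cf\<close>)
  qed
  have mon: "monic f" using p(2) by (simp add: deg cf)
  have fO: "pover (OI k) f" unfolding f_def by (intro O.pover_diff O.pover_monom O.one p(1))
  have f0: "poly f \<theta> = 0" using p(3) by (simp add: f_def poly_monom)
  have thA: "algebraic_int \<theta>"
    by (rule algebraic_int_root_of_monic[OF mon f0]) (use fO in \<open>simp add: pover_def OI_def\<close>)
  have "\<exists>Us. set Us \<subseteq> ?R \<and> field_basis k K Us" using th(2) by (simp add: is_order_def)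
  then obtain Us where Us: "set Us \<subseteq> ?R" "CC.Span k Us = K" by (auto simp: field_basis_def)
  have OIk: "OI k \<subseteq> k" by (auto simp: OI_def)
  have gen: "\<exists>p. pover k p \<and> x = poly p \<theta>" if x: "x \<in> K" for x
  proof -
    obtain c where c: "\<forall>i. c i \<in> k" "x = (\<Sum>i<length Us. c i * Us ! i)"
      using x Us(2) unfolding Span_CC[OF k.csubring_axioms] by blast
    have "\<forall>i<length Us. \<exists>p. pover k p \<and> Us ! i = poly p \<theta>"
    proof (intro allI impI)
      fix i assume "i < length Us"
      then have "Us ! i \<in> ?R" using Us(1) nth_mem by blast
      then show "\<exists>p. pover k p \<and> Us ! i = poly p \<theta>" unfolding R using pover_mono[OF _ OIk] by blast
    qed
    then obtain g where g: "\<And>i. i < length Us \<Longrightarrow> pover k (g i) \<and> Us ! i = poly (g i) \<theta>" by metis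
    have "x = poly (\<Sum>i<length Us. Polynomial.smult (c i) (g i)) \<theta>"
      unfolding c(2) poly_sum by (rule sum.cong) (simp_all add: g)
    moreover have "pover k (\<Sum>i<length Us. Polynomial.smult (c i) (g i))"
      by (rule k.pover_sum, rule k.pover_smult) (use c(1) g in simp_all)
    ultimately show ?thesis by blast
  qed
  show se: "simple_ext k K \<theta>"
    unfolding simple_ext_def simple_ext_axioms_def using kf K th(1) gen thA by blast
  interpret se: simple_ext k K \<theta> by (rule se)
  have fne: "f \<noteq> 0" using mon by auto
  have "card se.E = card se.S" unfolding se.S_def by (rule card_image[OF se.inj_E, symmetric])
  also have "\<dots> \<le> card {x. poly f x = 0}"
  proof (rule card_mono[OF poly_roots_finite[OF fne]])
    show "se.S \<subseteq> {x. poly f x = 0}" using se.S_roots[OF pover_mono[OF fO OIk] f0] by blast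
  qed
  also have "\<dots> \<le> n" using card_poly_roots_bound[OF fne] deg by simp
  finally show "card (embeddings k K) \<le> n" .
  show "?R \<subseteq> OI K"
  proof
    fix x assume "x \<in> ?R"
    then obtain p where p: "pover (OI k) p" "x = poly p \<theta>" unfolding R by blast
    interpret OK: csubring "OI K" by (rule K.csubring_OI)
    have "pover (OI K) p" by (rule pover_mono[OF p(1)]) (use K(2) in \<open>auto simp: OI_def\<close>)
    then show "x \<in> OI K" unfolding p(2) by (rule OK.poly_in) (use th(1) thA in \<open>simp add: OI_def\<close>)
  qed
qed

theorem necessity:
  assumes k: "number_field k" and n: "n \<ge> 2" and P: "\<And>i. i \<in> {1..r} \<Longrightarrow> prime_of k (P i)"
    and mu: "\<And>i. i \<in> {1..r} \<Longrightarrow> partition_of (mu i) n"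
    and Sn: "Sn_field n k K" and P1: "property_P1 k n r P K" and P2: "property_P2 k r P mu K"
    and i: "i \<in> {1..r}"
  shows "nu_star n (ideal_norm k (P i)) (mu i) > 0"
proof -
  have kf: "cfield k" using k by (simp add: number_field_def subfield_CC_iff)
  interpret k: cfield k by (rule kf)
  interpret R: cring "ring_of_integers k" by (rule k.cring_OI)
  have Kf: "cfield K" and kK: "k \<subseteq> K" and dim: "CC.dimension n k K"
    using Sn by (simp_all add: Sn_field_def subfield_CC_iff)
  obtain \<theta> where th: "\<theta> \<in> K" "is_order k K (power_order k n \<theta>)"
    "coprime_ideals (ring_of_integers k) (rel_disc k K (power_order k n \<theta>))
      (\<Otimes>\<^bsub>ideals_set (ring_of_integers k)\<^esub> i\<in>{1..r}. P i)"
    using P1 by (auto simp: property_P1_def)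
  note ord = order_imp_simple_ext[OF kf Kf kK n th(1,2)]
  interpret se: simple_ext k K \<theta> by (rule ord(1))
  let ?q = "ideal_norm k (P i)"
  have cp: "cprime (OI k) (P j)" "P j \<noteq> {0}" if "j \<in> {1..r}" for j
    using P[OF that] k.primeideal_iff by (simp_all add: prime_of_def)
  obtain p m V where rp: "residue_prime k (P i) p m ?q V" using residue_prime_exists[OF k P[OF i]] by blast
  interpret rp: residue_prime k "P i" p m ?q V by (rule rp)
  obtain Q where Q: "cprime AI Q" "Q \<inter> OI k = P i" using rp.exists_above by blast
  have ra: "residue_above k (P i) p m ?q V Q"
    using rp Q unfolding residue_above_def residue_above_axioms_def by blast
  interpret ra: residue_above k "P i" p m ?q V Q by (rule ra)
  have sub: "CC.Span k Us = K \<Longrightarrow> CC.independent k Us \<Longrightarrow> length Us = n" for Us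
  proof -
    assume "CC.Span k Us = K" "CC.independent k Us"
    then have "CC.dimension (length Us) k K" using CC.dimension_independent[of k Us] by simp
    then show "length Us = n" using CC.dimension_is_inj[OF _ _ dim] by (simp add: subfield_CC_iff kf)
  qed
  \<comment> \<open>If \<open>P i\<close> contained every basis discriminant, it would contain both
    ideals that are assumed coprime, and hence 1.\<close>
  have "\<exists>Us. set Us \<subseteq> power_order k n \<theta> \<and> field_basis k K Us \<and> basis_disc k K Us \<notin> P i"
  proof (rule ccontr)
    assume no: "\<not> ?thesis"
    let ?D = "{basis_disc k K Us | Us. set Us \<subseteq> power_order k n \<theta> \<and> field_basis k K Us}"
    have "?D \<subseteq> P i" using no by blast
    moreover have idl: "ideal (P i) (ring_of_integers k)" using cp(1)[OF i] k.ideal_iff by (simp add: cprime_def)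
    ultimately have D: "rel_disc k K (power_order k n \<theta>) \<subseteq> P i"
      unfolding rel_disc_def by (intro R.genideal_minimal)
    have F: "(\<Otimes>\<^bsub>ideals_set (ring_of_integers k)\<^esub> i\<in>{1..r}. P i) \<subseteq> P i"
      by (rule finprod_ideals_subset[OF kf cp(1) _ i]) simp_all
    have "OI k \<subseteq> P i"
    proof
      fix x assume "x \<in> OI k"
      then have "x \<in> rel_disc k K (power_order k n \<theta>) <+>\<^bsub>ring_of_integers k\<^esub>
          (\<Otimes>\<^bsub>ideals_set (ring_of_integers k)\<^esub> i\<in>{1..r}. P i)"
        using th(3) by (simp add: coprime_ideals_def)
      then obtain u v where "u \<in> P i" "v \<in> P i" "x = u + v" using D F by (auto simp: set_add_def')
      then show "x \<in> P i" using rp.P.iadd by simp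
    qed
    then show False using rp.P.one rp.P.one_notin by blast
  qed
  then obtain Us where Us: "set Us \<subseteq> power_order k n \<theta>" "field_basis k K Us" "basis_disc k K Us \<notin> P i" by blast
  have UsO: "set Us \<subseteq> OI K" using Us(1) ord(3) by blast
  have len: "length Us = n" using Us(2) sub by (simp add: field_basis_def)
  have discQ: "basis_disc k K Us \<notin> Q" using se.disc_OI[OF UsO] Us(3) Q(2) by blast
  \<comment> \<open>Elements of the order are polynomials in \<open>\<theta>\<close> over
    \<open>OI k\<close>, so congruent conjugates of \<open>\<theta>\<close> make two embeddings
    congruent on the whole basis, and the discriminant of \<open>Us\<close> would lie in
    \<open>Q\<close>.\<close>
  have dist: "s = t" if st: "s \<in> se.S" "t \<in> se.S" "s - t \<in> Q" for s t
  proof (rule ccontr)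
    assume ne: "s \<noteq> t"
    obtain \<tau> \<tau>' where t: "\<tau> \<in> se.E" "\<tau>' \<in> se.E" "s = \<tau>' \<theta>" "t = \<tau> \<theta>" using st(1,2) by (auto simp: se.S_def)
    have sA: "s \<in> AI" "t \<in> AI" using st(1,2) se.S_AI by blast+
    have "basis_disc k K Us \<in> Q"
    proof (rule se.disc_congruent[OF Q(1) _ UsO t(1,2)])
      show "card se.E \<le> length Us" using ord(2) len by simp
      show "\<tau> \<noteq> \<tau>'" using ne t by auto
      fix u assume "u \<in> set Us"
      then have "u \<in> power_order k n \<theta>" using Us(1) by blast
      then obtain g where g: "pover (OI k) g" "u = poly g \<theta>" unfolding ord(4) by blast
      have gk: "pover k g" by (rule pover_mono[OF g(1)]) (auto simp: OI_def)
      have gA: "poly.coeff g i \<in> AI" for i using g(1) by (simp add: pover_def OI_def)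
      have "ra.Q.cg (poly g s) (poly g t)" unfolding poly_altdef
        by (intro ra.Q.cg_sum ra.Q.cg_mult ra.Q.cg_refl ra.Q.cg_power gA AI.power sA)
          (simp add: ra.Q.cg_def st(3))
      then show "\<tau>' u - \<tau> u \<in> Q" using se.E_poly[OF t(1) gk] se.E_poly[OF t(2) gk] g(2) t(3,4) by (simp add: ra.Q.cg_def)
    qed
    then show False using discQ by simp
  qed
  have "se.dsc \<notin> Q" by (rule se.dsc_notin_if_distinct[OF Q(1) dist])
  then have "se.dsc \<notin> P i" using Q(2) by blast
  then interpret fr: frob k se.S se.L "Q \<inter> OI se.L" ?q
    using se.frob_at[OF rp _ se.restrict_prime(1)[OF ra] se.restrict_prime(2)[OF ra]] by blast
  obtain \<phi> where \<phi>: "\<phi> \<in> se.G" "\<forall>y\<in>OI se.L. \<phi> y - y ^ ?q \<in> Q \<inter> OI se.L" using fr.frobenius_exists by blast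
  then have \<phi>Q: "\<forall>y\<in>OI se.L. \<phi> y - y ^ ?q \<in> Q" by blast
  have "is_frobenius k se.L (P i) (Q \<inter> OI se.L) \<phi>" using \<phi> by (simp add: is_frobenius_def)
  moreover have "Q \<inter> OI se.L \<in> primes_above k se.L (P i)" by (rule se.prime_above[OF ra cp(2)[OF i]])
  moreover have "\<phi> \<in> conj_class (galois_group k se.L) \<phi>"
  proof -
    interpret Gr: group "galois_group k se.L" by (rule se.group_G)
    have "\<phi> = \<one>\<^bsub>galois_group k se.L\<^esub> \<otimes>\<^bsub>galois_group k se.L\<^esub> \<phi> \<otimes>\<^bsub>galois_group k se.L\<^esub> inv\<^bsub>galois_group k se.L\<^esub> \<one>\<^bsub>galois_group k se.L\<^esub>"
      using \<phi>(1) by simp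
    then show ?thesis unfolding conj_class_def using Gr.one_closed by blast
  qed
  ultimately have "\<phi> \<in> artin_symbol k se.L (P i)" unfolding artin_symbol_def by blast
  \<comment> \<open>The second property enters here and fixes the cycle type of the Frobenius at
    \<open>Q\<close>.\<close>
  then have "\<phi> \<in> cycle_class k K (mu i)" using P2 i by (simp add: property_P2_def)
  then have ct: "cycle_type \<phi> se.S = mu i" by (simp add: se.cycle_class_eq)
  have "\<forall>s\<in>se.S. \<exists>\<rho>. \<rho> \<in> Tch ?q \<and> s - \<rho> \<in> Q" using se.teich_of_S[OF ra \<phi>(1) \<phi>Q] by blast
  then obtain t where t: "\<And>s. s \<in> se.S \<Longrightarrow> t s \<in> Tch ?q \<and> s - t s \<in> Q" by metis
  have injt: "inj_on t se.S"
  proof (rule inj_onI)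
    fix u v assume u: "u \<in> se.S" and v: "v \<in> se.S" and eq: "t u = t v"
    have "(u - t u) - (v - t v) \<in> Q" by (rule ra.Q.idiff) (use t[OF u] t[OF v] in blast)+
    then have "u - v \<in> Q" using eq by simp
    then show "u = v" by (rule dist[OF u v])
  qed
  have "cycle_type (\<lambda>x. x ^ ?q) (t ` se.S) = cycle_type \<phi> se.S"
    by (rule se.frobenius_cycle_type[OF ra \<phi>(1) \<phi>Q injt]) (use t in blast)+
  then have "cycle_type (\<lambda>x. x ^ ?q) (t ` se.S) = mu i" using ct by simp
  moreover have "t ` se.S \<subseteq> Tch ?q" using t by blast
  ultimately have "\<forall>j\<in>{1..n}. count (mu i) j \<le> NO ?q j"
    using type_bounded[OF rp.q2, of "t ` se.S"] se.finite_S by (metis atLeastAtMost_iff finite_imageI)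
  then show ?thesis using nu_star_pos_iff[OF rp.q2] by blast
qed

section \<open>Sufficiency\<close>

text \<open>Column operations replace the power of exponent \<open>j\<close> by the monic polynomial
  \<open>g j\<close> with roots \<open>x 0\<close>, ..., \<open>x (j - 1)\<close>. The matrix
  \<open>?U\<close> of these operations is unitriangular, and the resulting matrix \<open>?W\<close>
  is lower triangular.\<close>

lemma vandermonde:
  fixes x :: "nat \<Rightarrow> complex"
  shows "det (mat n n (\<lambda>(a, j). x a ^ j)) = (\<Prod>a<n. \<Prod>b<a. x a - x b)"
proof -
  let ?V = "mat n n (\<lambda>(a, j). x a ^ j)"
  define g where "g j = (\<Prod>b<j. [:- x b, 1:])" for j
  have deg: "Polynomial.degree (g j) = j" for j
  proof -
    have "Polynomial.degree (g j) = (\<Sum>b<j. Polynomial.degree [:- x b, 1:])"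
      unfolding g_def by (rule degree_prod_sum_eq) auto
    then show ?thesis by simp
  qed
  have mon: "poly.coeff (g j) j = 1" for j
    using monic_prod[of "{..<j}" "\<lambda>b. [:- x b, 1:]"] deg[of j] by (simp add: g_def)
  let ?U = "mat n n (\<lambda>(l, j). poly.coeff (g j) l)"
  let ?W = "mat n n (\<lambda>(a, j). poly (g j) (x a))"
  have W: "?W = ?V * ?U"
  proof (rule eq_matI)
    fix a j assume "a < dim_row (?V * ?U)" "j < dim_col (?V * ?U)"
    then have aj: "a < n" "j < n" by simp_all
    have "(?V * ?U) $$ (a, j) = (\<Sum>l<n. x a ^ l * poly.coeff (g j) l)"
      using aj by (simp add: scalar_prod_def atLeast0LessThan)
    also have "\<dots> = (\<Sum>l\<le>j. x a ^ l * poly.coeff (g j) l)"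
      using aj by (intro sum.mono_neutral_right) (auto simp: coeff_eq_0 deg)
    also have "\<dots> = poly (g j) (x a)" unfolding poly_altdef deg by (simp add: mult.commute)
    finally show "?W $$ (a, j) = (?V * ?U) $$ (a, j)" using aj by simp
  qed simp_all
  have "det ?U = prod_list (diag_mat ?U)"
    by (rule det_upper_triangular[of _ n]) (auto simp: upper_triangular_def coeff_eq_0 deg)
  also have "\<dots> = 1" by (simp add: prod_list_diag_prod mon)
  finally have U: "det ?U = 1" .
  have "det ?W = prod_list (diag_mat ?W)"
  proof (rule det_lower_triangular[of n])
    fix a j assume "a < j" "j < n"
    then show "?W $$ (a, j) = 0" by (auto simp: g_def poly_prod)
  qed simp
  also have "\<dots> = (\<Prod>a<n. poly (g a) (x a))" by (simp add: prod_list_diag_prod atLeast0LessThan)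
  also have "\<dots> = (\<Prod>a<n. \<Prod>b<a. x a - x b)" by (simp add: g_def poly_prod)
  finally have "det ?W = (\<Prod>a<n. \<Prod>b<a. x a - x b)" .
  moreover have "det ?W = det ?V * det ?U" unfolding W by (rule det_mult[of _ n]) simp_all
  ultimately show ?thesis using U by simp
qed

section \<open>Polynomials with prescribed reductions and their Frobenius elements\<close>

locale split_poly =
  fixes k :: "complex set" and n :: nat and f :: "complex poly" and J :: "nat set"
    and P :: "nat \<Rightarrow> complex set" and mu :: "nat \<Rightarrow> nat multiset"
  assumes nf: "number_field k" and n2: "n \<ge> 2"
    and fmon: "monic f" and fdeg: "Polynomial.degree f = n" and fO: "pover (OI k) f"
    and Pprime: "j \<in> J \<Longrightarrow> prime_of k (P j)"
    and data: "j \<in> J \<Longrightarrow> \<exists>p m V Q t R. residue_above k (P j) p m (ideal_norm k (P j)) V Q \<and>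
      bij_betw t {\<theta>. poly f \<theta> = 0} R \<and> R \<subseteq> Tch (ideal_norm k (P j)) \<and> card R = n \<and>
      cycle_type (\<lambda>x. x ^ ideal_norm k (P j)) R = mu j \<and> (\<forall>\<theta>. poly f \<theta> = 0 \<longrightarrow> \<theta> - t \<theta> \<in> Q)"
begin

abbreviation "S \<equiv> {\<theta>. poly f \<theta> = 0}"
abbreviation "L \<equiv> adj k S"
abbreviation "q j \<equiv> ideal_norm k (P j)"

lemma kf: "cfield k" using nf by (simp add: number_field_def subfield_CC_iff)

lemma fk: "pover k f" by (rule pover_mono[OF fO]) (auto simp: OI_def)

lemma f0: "f \<noteq> 0" using fmon by auto

sublocale normal_ext k S L
proof -
  interpret k: cfield k by (rule kf)
  show "normal_ext k S L"
  proof unfold_locales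
    show "finite S" by (rule poly_roots_finite[OF f0])
    show "S \<subseteq> AI"
    proof
      fix x assume "x \<in> S"
      then show "x \<in> AI" using algebraic_int_root_of_monic[OF fmon, of x] fO by (simp add: pover_def OI_def)
    qed
    fix \<tau> s assume t: "fhom L \<tau>" "\<And>x. x \<in> k \<Longrightarrow> \<tau> x = x" and s: "s \<in> S"
    interpret t: fhom L \<tau> by (rule t(1))
    have "map_poly \<tau> f = f" by (rule t.hfix_poly[OF t(2) fk])
    moreover have "pover L f" by (rule pover_mono[OF fk adj_base])
    moreover have "s \<in> L" using s adj_gen[of S k] by blast
    ultimately have "poly f (\<tau> s) = \<tau> (poly f s)" using t.hpoly_poly[of f s] by simp
    then show "\<tau> s \<in> S" using s by simp
  qed simp
qed

lemma P_prime: "j \<in> J \<Longrightarrow> cprime (OI k) (P j)" "j \<in> J \<Longrightarrow> P j \<noteq> {0}"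
  using Pprime[of j] k.primeideal_iff by (simp_all add: prime_of_def)

lemma distinct_mod:
  assumes "residue_above k (P j) p m (q j) V Q" "bij_betw t S R" "R \<subseteq> Tch (q j)" "\<forall>\<theta>. poly f \<theta> = 0 \<longrightarrow> \<theta> - t \<theta> \<in> Q"
    and "s \<in> S" "u \<in> S" "s - u \<in> Q"
  shows "s = u"
proof -
  interpret r: residue_above k "P j" p m "q j" V Q by fact
  have tT: "t s \<in> Tch (q j)" "t u \<in> Tch (q j)" using assms(2,3,5,6) by (auto simp: bij_betw_def)
  have "s - t s \<in> Q" "u - t u \<in> Q" using assms(4-6) by simp_all
  then have "(u - t u) - (s - t s) \<in> Q" by (rule r.Q.idiff[rotated])
  then have "(u - t u) - (s - t s) + (s - u) \<in> Q" by (rule r.Q.iadd) (rule assms(7))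
  then have "t s - t u \<in> Q" by simp
  then have "t s = t u" by (rule r.teich_inj[OF tT])
  then show ?thesis using assms(2,5,6) by (auto simp: bij_betw_def inj_on_def)
qed

lemma frob_data:
  assumes "j \<in> J"
  shows "\<exists>p m V Q \<phi>. residue_above k (P j) p m (q j) V Q \<and> dsc \<notin> Q \<and> \<phi> \<in> G \<and>
    (\<forall>y\<in>OI L. \<phi> y - y ^ q j \<in> Q \<inter> OI L) \<and> cycle_type \<phi> S = mu j \<and> card S = n"
proof -
  obtain p m V Q t R where d: "residue_above k (P j) p m (q j) V Q" "bij_betw t S R" "R \<subseteq> Tch (q j)" "card R = n"
    "cycle_type (\<lambda>x. x ^ q j) R = mu j" "\<forall>\<theta>. poly f \<theta> = 0 \<longrightarrow> \<theta> - t \<theta> \<in> Q"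
    using data[OF assms] by blast
  interpret r: residue_above k "P j" p m "q j" V Q by (rule d(1))
  have dQ: "dsc \<notin> Q" by (rule dsc_notin_if_distinct[OF r.Q]) (rule distinct_mod[OF d(1-3,6)])
  then have dP: "dsc \<notin> P j" using r.QP by blast
  interpret fr: frob k S L "Q \<inter> OI L" "q j"
    by (rule frob_at[OF r.residue_prime_axioms dP restrict_prime(1)[OF d(1)] restrict_prime(2)[OF d(1)]])
  obtain \<phi> where \<phi>: "\<phi> \<in> G" "\<forall>y\<in>OI L. \<phi> y - y ^ q j \<in> Q \<inter> OI L" using fr.frobenius_exists by blast
  then have \<phi>Q: "\<forall>y\<in>OI L. \<phi> y - y ^ q j \<in> Q" by blast
  have inj: "inj_on t S" and im: "t ` S = R" using d(2) by (simp_all add: bij_betw_def)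
  have "cycle_type (\<lambda>x. x ^ q j) (t ` S) = cycle_type \<phi> S"
  proof (rule frobenius_cycle_type[OF d(1) \<phi>(1) \<phi>Q inj])
    fix s assume s: "s \<in> S"
    then have "t s \<in> R" using im by blast
    then show "t s \<in> Tch (q j)" using d(3) by blast
    show "s - t s \<in> Q" using d(6) s by simp
  qed
  then have "cycle_type \<phi> S = mu j" using im d(5) by simp
  moreover have "card S = n" using bij_betw_same_card[OF d(2)] d(4) by simp
  ultimately show ?thesis using d(1) dQ \<phi> by blast
qed

lemma dsc_notin_P: "j \<in> J \<Longrightarrow> dsc \<notin> P j"
proof -
  assume "j \<in> J"
  then obtain p m V Q where r: "residue_above k (P j) p m (q j) V Q" "dsc \<notin> Q" using frob_data by blast
  then show ?thesis using residue_above.QP[OF r(1)] by blast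
qed

lemma primes_above_D:
  assumes "P' \<in> primes_above k L (P j)"
  shows "cprime (OI L) P'" "P' \<inter> OI k = P j" "P' \<inter> k = P j"
proof -
  have *: "prime_of L P'" "P' \<inter> OI k = P j" using assms by (simp_all add: primes_above_def)
  show c: "cprime (OI L) P'" using *(1) L.primeideal_iff by (simp add: prime_of_def)
  show "P' \<inter> OI k = P j" by (rule *(2))
  have "P' \<subseteq> OI L" by (rule cideal.sub[OF cprime.axioms(1)[OF c]])
  then have "P' \<inter> k \<subseteq> OI k" by (auto simp: OI_def)
  moreover have "OI k \<subseteq> k" by (auto simp: OI_def)
  ultimately show "P' \<inter> k = P j" using *(2) by blast
qed

lemma frob_any:
  assumes "j \<in> J" "P' \<in> primes_above k L (P j)"
  shows "frob k S L P' (q j)"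
proof -
  obtain p m V where "residue_prime k (P j) p m (q j) V" using residue_prime_exists[OF nf Pprime[OF assms(1)]] by blast
  then show ?thesis
    by (rule frob_at[OF _ dsc_notin_P[OF assms(1)] primes_above_D(1,2)[OF assms(2)]])
qed

text \<open>\<open>P j\<close> is contained in \<open>P'\<close> but, by
  \<open>not_in_square\<close>, not in its square; so the greatest admissible exponent is 1.\<close>

lemma unramified:
  assumes j: "j \<in> J"
  shows "unramified_above k L (P j)"
  unfolding unramified_above_def
proof
  fix P' assume P': "P' \<in> primes_above k L (P j)"
  interpret fr: frob k S L P' "q j" by (rule frob_any[OF j P'])
  interpret R: cring "ring_of_integers L" by (rule L.cring_OI)
  interpret M: comm_monoid "ideals_set (ring_of_integers L)" by (rule R.ideals_set_is_comm_monoid)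
  note P'D = primes_above_D[OF P']
  have idl: "ideal P' (ring_of_integers L)" using L.ideal_iff fr.P.cideal_axioms by blast
  then have car: "P' \<in> carrier (ideals_set (ring_of_integers L))" by (simp add: ideals_set_def)
  have PL: "P j \<subseteq> carrier (ring_of_integers L)" using P'D(2) OI_k by auto
  let ?I = "Idl\<^bsub>ring_of_integers L\<^esub> (P j)"
  obtain B b0 where B: "finite B" "B \<subseteq> P j" "b0 \<in> B" "b0 \<noteq> 0" "P j \<subseteq> lspan (OI k) B"
    using finitely_generated[OF nf Pprime[OF j]] by blast
  have nsq: "\<not> P' \<inter> k \<subseteq> ideal_prod (ring_of_integers L) P' P'"
    by (rule fr.not_in_square[OF B(1) _ B(3,4)]) (use B(2,5) P'D(3) in blast)+
  show "ramification_index L (P j) P' = 1"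
    unfolding ramification_index_def
  proof (rule Greatest_equality)
    have "?I \<subseteq> P'" by (rule R.genideal_minimal[OF idl]) (use P'D(2) in blast)
    then show "?I \<subseteq> P' [^]\<^bsub>ideals_set (ring_of_integers L)\<^esub> (1::nat)" using car by simp
    fix e :: nat assume e: "?I \<subseteq> P' [^]\<^bsub>ideals_set (ring_of_integers L)\<^esub> e"
    show "e \<le> 1"
    proof (rule ccontr)
      assume "\<not> e \<le> 1"
      then obtain i where i: "e = Suc (Suc i)" by (metis One_nat_def Suc_le_eq not_less_eq_eq not0_implies_Suc le_SucI le0)
      have ic: "P' [^]\<^bsub>ideals_set (ring_of_integers L)\<^esub> i \<in> carrier (ideals_set (ring_of_integers L))" by (rule M.nat_pow_closed[OF car])
      have "P' [^]\<^bsub>ideals_set (ring_of_integers L)\<^esub> e =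
          P' [^]\<^bsub>ideals_set (ring_of_integers L)\<^esub> i \<otimes>\<^bsub>ideals_set (ring_of_integers L)\<^esub> (P' \<otimes>\<^bsub>ideals_set (ring_of_integers L)\<^esub> P')"
        unfolding i using M.m_assoc[OF ic car car] by simp
      also have "\<dots> = ideal_prod (ring_of_integers L) (P' [^]\<^bsub>ideals_set (ring_of_integers L)\<^esub> i) (ideal_prod (ring_of_integers L) P' P')"
        by (simp add: ideals_set_def)
      also have "\<dots> \<subseteq> ideal_prod (ring_of_integers L) P' P'"
        using R.ideal_prod_inter[OF _ R.ideal_prod_is_ideal[OF idl idl]] ic by (auto simp: ideals_set_def)
      finally have "?I \<subseteq> ideal_prod (ring_of_integers L) P' P'" using e by blast
      moreover have "P j \<subseteq> ?I" by (rule R.genideal_self[OF PL])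
      ultimately show False using nsq P'D(3) by blast
    qed
  qed
qed

lemma conj_apply:
  assumes "g \<in> G" "\<phi> \<in> G"
  defines "c \<equiv> g \<otimes>\<^bsub>galois_group k L\<^esub> \<phi> \<otimes>\<^bsub>galois_group k L\<^esub> inv\<^bsub>galois_group k L\<^esub> g"
  shows "c \<in> G" "x \<in> L \<Longrightarrow> c (g x) = g (\<phi> x)"
proof -
  interpret Gr: group "galois_group k L" by (rule group_G)
  show "c \<in> G" unfolding c_def using assms(1,2) by simp
  note i = G_inv_eq[OF assms(1)]
  assume x: "x \<in> L"
  have "c = compose L (compose L g \<phi>) (inv\<^bsub>galois_group k L\<^esub> g)"
    unfolding c_def by (simp add: G_mult assms(1,2) G_comp i(1))
  then have "c (g x) = compose L (compose L g \<phi>) (inv\<^bsub>galois_group k L\<^esub> g) (g x)" by (rule fun_cong)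
  also have "\<dots> = g (\<phi> x)" using i(2)[OF x] x by (simp add: G_comp_apply G_in[OF assms(1)])
  finally show "c (g x) = g (\<phi> x)" .
qed

lemma conj_cycle_type:
  assumes "g \<in> G" "\<phi> \<in> G"
  shows "cycle_type (g \<otimes>\<^bsub>galois_group k L\<^esub> \<phi> \<otimes>\<^bsub>galois_group k L\<^esub> inv\<^bsub>galois_group k L\<^esub> g) S = cycle_type \<phi> S"
proof -
  have im: "g ` S = S" and inj: "inj_on g S" using G_S_bij[OF assms(1)] by (simp_all add: bij_betw_def)
  have "cycle_type (g \<otimes>\<^bsub>galois_group k L\<^esub> \<phi> \<otimes>\<^bsub>galois_group k L\<^esub> inv\<^bsub>galois_group k L\<^esub> g) (g ` S) = cycle_type \<phi> S"
  proof (rule cycle_type_image[OF bij_betw_imp_perm_on[OF finS G_S_bij[OF assms(2)]] inj])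
    fix x assume "x \<in> S"
    then have "x \<in> L" using SL by blast
    then show "g (\<phi> x) = (g \<otimes>\<^bsub>galois_group k L\<^esub> \<phi> \<otimes>\<^bsub>galois_group k L\<^esub> inv\<^bsub>galois_group k L\<^esub> g) (g x)"
      using conj_apply(2)[OF assms] by simp
  qed
  then show ?thesis using im by simp
qed

text \<open>Some \<open>g\<close> in the Galois group carries the restriction of \<open>Q\<close>
  into \<open>P'\<close>, and conjugation by \<open>g\<close> turns the Frobenius at
  \<open>Q\<close> into one at \<open>P'\<close>. By uniqueness this is \<open>\<psi>\<close>, and
  conjugation preserves the cycle type.\<close>

lemma frobenius_type:
  assumes j: "j \<in> J" and P': "P' \<in> primes_above k L (P j)" and \<psi>: "is_frobenius k L (P j) P' \<psi>"
  shows "cycle_type \<psi> S = mu j"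
proof -
  obtain p m V Q \<phi> where d: "residue_above k (P j) p m (q j) V Q" "\<phi> \<in> G"
    "\<forall>y\<in>OI L. \<phi> y - y ^ q j \<in> Q \<inter> OI L" "cycle_type \<phi> S = mu j"
    using frob_data[OF j] by blast
  interpret fr: frob k S L P' "q j" by (rule frob_any[OF j P'])
  have \<psi>D: "\<psi> \<in> G" "\<forall>y\<in>OI L. \<psi> y - y ^ q j \<in> P'" using \<psi> by (simp_all add: is_frobenius_def)
  have "(Q \<inter> OI L) \<inter> k \<subseteq> P'" using restrict_prime(3)[OF d(1)] primes_above_D(2)[OF P'] by blast
  then obtain g where g: "g \<in> G" "\<forall>x\<in>Q \<inter> OI L. g x \<in> P'" using fr.primes_conjugate[OF restrict_prime(1)[OF d(1)]] by blast
  let ?c = "g \<otimes>\<^bsub>galois_group k L\<^esub> \<phi> \<otimes>\<^bsub>galois_group k L\<^esub> inv\<^bsub>galois_group k L\<^esub> g"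
  interpret h: fhom L g by (rule G_D(3)[OF g(1)])
  note i = G_inv_eq[OF g(1)]
  have "?c y - y ^ q j \<in> P'" if y: "y \<in> OI L" for y
  proof -
    let ?z = "(inv\<^bsub>galois_group k L\<^esub> g) y"
    have zO: "?z \<in> OI L" by (rule G_OI[OF i(1) y])
    then have zL: "?z \<in> L" using OI_L by blast
    have gz: "g ?z = y" by (rule i(3)) (use y OI_L in blast)
    have fz: "\<phi> ?z \<in> L" by (rule G_in[OF d(2) zL])
    have "g (\<phi> ?z - ?z ^ q j) \<in> P'" using d(3) zO g(2) by blast
    moreover have "g (\<phi> ?z - ?z ^ q j) = g (\<phi> ?z) - g ?z ^ q j"
      using h.hdiff[OF fz L.power[OF zL]] h.hpower[OF zL] by simp
    moreover have "?c (g ?z) = g (\<phi> ?z)" by (rule conj_apply(2)[OF g(1) d(2) zL])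
    ultimately show ?thesis using gz by simp
  qed
  then have "\<psi> = ?c" using fr.frobenius_unique[OF \<psi>D(1) conj_apply(1)[OF g(1) d(2)] \<psi>D(2)] by blast
  then show ?thesis using conj_cycle_type[OF g(1) d(2)] d(4) by simp
qed

end

section \<open>The Artin symbol and the field when the Galois group is the full symmetric
  group\<close>

locale split_full = split_poly +
  assumes full: "p permutes S \<Longrightarrow> \<exists>\<sigma>\<in>G. \<forall>x\<in>S. \<sigma> x = p x" and cardS: "card S = n"
begin

text \<open>All Frobenius elements have type \<open>mu j\<close>. Conversely, permutations of the
  same type are conjugate by a permutation of \<open>S\<close>, and fullness realises the
  conjugating permutation inside the Galois group.\<close>

lemma artin:
  assumes j: "j \<in> J"
  shows "artin_symbol k L (P j) = {\<sigma> \<in> G. cycle_type \<sigma> S = mu j}"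
proof (intro subset_antisym subsetI)
  fix \<sigma> assume "\<sigma> \<in> artin_symbol k L (P j)"
  then obtain \<psi> P' where "\<sigma> \<in> conj_class (galois_group k L) \<psi>" "P' \<in> primes_above k L (P j)" and f: "is_frobenius k L (P j) P' \<psi>"
    unfolding artin_symbol_def by blast
  moreover from this obtain g where g: "g \<in> G" "\<sigma> = g \<otimes>\<^bsub>galois_group k L\<^esub> \<psi> \<otimes>\<^bsub>galois_group k L\<^esub> inv\<^bsub>galois_group k L\<^esub> g"
    unfolding conj_class_def by blast
  moreover have "\<psi> \<in> G" using f by (simp add: is_frobenius_def)
  ultimately show "\<sigma> \<in> {\<sigma> \<in> G. cycle_type \<sigma> S = mu j}"
    using conj_apply(1)[of g \<psi>] conj_cycle_type[of g \<psi>] frobenius_type[OF j] by simp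
next
  fix \<sigma> assume "\<sigma> \<in> {\<sigma> \<in> G. cycle_type \<sigma> S = mu j}"
  then have \<sigma>: "\<sigma> \<in> G" "cycle_type \<sigma> S = mu j" by simp_all
  obtain p m V Q \<phi> where d: "residue_above k (P j) p m (q j) V Q" "\<phi> \<in> G"
    "\<forall>y\<in>OI L. \<phi> y - y ^ q j \<in> Q \<inter> OI L" "cycle_type \<phi> S = mu j"
    using frob_data[OF j] by blast
  have "is_frobenius k L (P j) (Q \<inter> OI L) \<phi>" using d by (simp add: is_frobenius_def)
  moreover have "Q \<inter> OI L \<in> primes_above k L (P j)" by (rule prime_above[OF d(1) P_prime(2)[OF j]])
  moreover have "\<sigma> \<in> conj_class (galois_group k L) \<phi>"
  proof -
    obtain h where h: "bij_betw h S S" "\<forall>x\<in>S. h (\<phi> x) = \<sigma> (h x)"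
      using conjugating_bijection[OF finS finS bij_betw_imp_perm_on[OF finS G_S_bij[OF d(2)]]
          bij_betw_imp_perm_on[OF finS G_S_bij[OF \<sigma>(1)]]] d(4) \<sigma>(2) by auto
    define h' where "h' x = (if x \<in> S then h x else x)" for x
    have "h' permutes S"
    proof (rule bij_imp_permutes)
      show "bij_betw h' S S" using h(1) by (subst bij_betw_cong[of _ _ h]) (simp_all add: h'_def)
    qed (simp add: h'_def)
    then obtain g where g: "g \<in> G" "\<forall>x\<in>S. g x = h' x" using full by blast
    have gh: "g x = h x" if "x \<in> S" for x using g(2) that by (simp add: h'_def)
    let ?c = "g \<otimes>\<^bsub>galois_group k L\<^esub> \<phi> \<otimes>\<^bsub>galois_group k L\<^esub> inv\<^bsub>galois_group k L\<^esub> g"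
    have "\<sigma> = ?c"
    proof (rule G_eqI[OF \<sigma>(1) conj_apply(1)[OF g(1) d(2)]])
      fix s assume "s \<in> S"
      then have "s \<in> h ` S" using h(1) by (simp add: bij_betw_def)
      then obtain x where x: "x \<in> S" "s = h x" by blast
      have xL: "x \<in> L" using x(1) SL by blast
      have "\<sigma> s = h (\<phi> x)" using h(2) x by simp
      also have "\<dots> = g (\<phi> x)" using gh[OF G_S[OF d(2) x(1)]] by simp
      also have "\<dots> = ?c (g x)" using conj_apply(2)[OF g(1) d(2) xL] by simp
      also have "g x = s" using gh[OF x(1)] x(2) by simp
      finally show "\<sigma> s = ?c s" .
    qed
    then show ?thesis unfolding conj_class_def using g(1) by blast
  qed
  ultimately show "\<sigma> \<in> artin_symbol k L (P j)" unfolding artin_symbol_def by blast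
qed

lemma iso_sym: "galois_group k L \<cong> sym_group n"
proof -
  obtain b where b: "bij_betw b {1..n} S"
    using ex_bij_betw_nat_finite_1[OF finS] cardS by auto
  define b' where "b' = inv_into {1..n} b"
  have b1: "b x \<in> S" if "x \<in> {1..n}" for x using b that by (auto simp: bij_betw_def)
  have b2: "b' s \<in> {1..n}" "b (b' s) = s" if "s \<in> S" for s
  proof -
    have "s \<in> b ` {1..n}" using b that unfolding bij_betw_def by blast
    then show "b' s \<in> {1..n}" "b (b' s) = s" unfolding b'_def by (rule inv_into_into, rule f_inv_into_f)
  qed
  have b3: "b' (b x) = x" if "x \<in> {1..n}" for x
    using b that by (auto simp: b'_def bij_betw_def)
  define \<Phi> where "\<Phi> \<sigma> x = (if x \<in> {1..n} then b' (\<sigma> (b x)) else x)" for \<sigma> x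
  have \<Phi>_in: "\<Phi> \<sigma> x \<in> {1..n}" if "\<sigma> \<in> G" "x \<in> {1..n}" for \<sigma> x
    using b2(1)[OF G_S[OF that(1) b1[OF that(2)]]] that(2) by (simp add: \<Phi>_def)
  have perm: "\<Phi> \<sigma> permutes {1..n}" if s: "\<sigma> \<in> G" for \<sigma>
  proof (rule bij_imp_permutes)
    have "inj_on (\<Phi> \<sigma>) {1..n}"
    proof (rule inj_onI)
      fix x y assume x: "x \<in> {1..n}" and y: "y \<in> {1..n}" and eq: "\<Phi> \<sigma> x = \<Phi> \<sigma> y"
      have "b' (\<sigma> (b x)) = b' (\<sigma> (b y))" using eq x y by (simp add: \<Phi>_def)
      then have "\<sigma> (b x) = \<sigma> (b y)" using b2(2)[OF G_S[OF s b1[OF x]]] b2(2)[OF G_S[OF s b1[OF y]]] by metis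
      then have "b x = b y" using G_S_bij[OF s] b1[OF x] b1[OF y] by (auto simp: bij_betw_def inj_on_def)
      then show "x = y" using b3[OF x] b3[OF y] by metis
    qed
    moreover have "\<Phi> \<sigma> ` {1..n} \<subseteq> {1..n}" by (rule image_subsetI, rule \<Phi>_in[OF s])
    ultimately show "bij_betw (\<Phi> \<sigma>) {1..n} {1..n}" using endo_inj_surj[of "{1..n}"] unfolding bij_betw_def by blast
  next
    fix x assume "x \<notin> {1..n}"
    then show "\<Phi> \<sigma> x = x" unfolding \<Phi>_def by (rule if_not_P)
  qed
  have hom: "\<Phi> (\<sigma> \<otimes>\<^bsub>galois_group k L\<^esub> \<tau>) = \<Phi> \<sigma> \<circ> \<Phi> \<tau>" if st: "\<sigma> \<in> G" "\<tau> \<in> G" for \<sigma> \<tau>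
  proof
    fix x
    show "\<Phi> (\<sigma> \<otimes>\<^bsub>galois_group k L\<^esub> \<tau>) x = (\<Phi> \<sigma> \<circ> \<Phi> \<tau>) x"
    proof (cases "x \<in> {1..n}")
      case True
      have bL: "b x \<in> L" using b1[OF True] SL by blast
      have "\<Phi> (\<sigma> \<otimes>\<^bsub>galois_group k L\<^esub> \<tau>) x = b' (\<sigma> (\<tau> (b x)))"
        using True by (simp add: \<Phi>_def G_mult[OF st] G_comp_apply[OF bL])
      moreover have "\<Phi> \<tau> x = b' (\<tau> (b x))" using True by (simp add: \<Phi>_def)
      moreover have "b (b' (\<tau> (b x))) = \<tau> (b x)" by (rule b2(2)[OF G_S[OF st(2) b1[OF True]]])
      ultimately show ?thesis using \<Phi>_in[OF st(2) True] by (simp add: \<Phi>_def)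
    next
      case False
      have "\<Phi> \<rho> x = x" for \<rho> using False unfolding \<Phi>_def by (rule if_not_P)
      then show ?thesis by simp
    qed
  qed
  have inj: "inj_on \<Phi> G"
  proof (rule inj_onI)
    fix \<sigma> \<tau> assume st: "\<sigma> \<in> G" "\<tau> \<in> G" and eq: "\<Phi> \<sigma> = \<Phi> \<tau>"
    show "\<sigma> = \<tau>"
    proof (rule G_eqI[OF st])
      fix s assume s: "s \<in> S"
      have "\<Phi> \<sigma> (b' s) = \<Phi> \<tau> (b' s)" using eq by simp
      then have "b' (\<sigma> s) = b' (\<tau> s)" using b2[OF s] by (simp add: \<Phi>_def)
      then show "\<sigma> s = \<tau> s" using b2(2)[OF G_S[OF st(1) s]] b2(2)[OF G_S[OF st(2) s]] by metis
    qed
  qed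
  have surj: "\<exists>\<sigma>\<in>G. \<Phi> \<sigma> = p" if p: "p permutes {1..n}" for p
  proof -
    define p' where "p' s = (if s \<in> S then b (p (b' s)) else s)" for s
    have pin: "p x \<in> {1..n}" if "x \<in> {1..n}" for x using permutes_in_image[OF p] that by blast
    have "p' permutes S"
    proof (rule bij_imp_permutes)
      have "inj_on p' S"
      proof (rule inj_onI)
        fix s t assume s: "s \<in> S" and t: "t \<in> S" and eq: "p' s = p' t"
        have "b (p (b' s)) = b (p (b' t))" using eq s t by (simp add: p'_def)
        then have "p (b' s) = p (b' t)" using b3[OF pin[OF b2(1)[OF s]]] b3[OF pin[OF b2(1)[OF t]]] by metis
        then have "b' s = b' t" using permutes_inj[OF p] by (simp add: inj_eq)
        then show "s = t" using b2(2)[OF s] b2(2)[OF t] by metis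
      qed
      moreover have "p' ` S \<subseteq> S"
      proof (rule image_subsetI)
        fix s assume s: "s \<in> S"
        show "p' s \<in> S" using b1[OF pin[OF b2(1)[OF s]]] s by (simp add: p'_def)
      qed
      ultimately show "bij_betw p' S S" using endo_inj_surj[OF finS] unfolding bij_betw_def by blast
    next
      fix s assume "s \<notin> S"
      then show "p' s = s" unfolding p'_def by (rule if_not_P)
    qed
    then obtain \<sigma> where s: "\<sigma> \<in> G" "\<forall>x\<in>S. \<sigma> x = p' x" using full by blast
    have "\<Phi> \<sigma> = p"
    proof
      fix x
      show "\<Phi> \<sigma> x = p x"
      proof (cases "x \<in> {1..n}")
        case True
        have "\<sigma> (b x) = b (p x)" using s(2) b1[OF True] b3[OF True] by (simp add: p'_def)
        then show ?thesis using True b3[OF pin[OF True]] by (simp add: \<Phi>_def)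
      next
        case False
        then have "p x = x" by (rule permutes_not_in[OF p])
        moreover have "\<Phi> \<sigma> x = x" using False unfolding \<Phi>_def by (rule if_not_P)
        ultimately show ?thesis by simp
      qed
    qed
    then show ?thesis using s(1) by blast
  qed
  have "bij_betw \<Phi> G (carrier (sym_group n))"
    unfolding bij_betw_def
  proof (intro conjI inj subset_antisym)
    show "\<Phi> ` G \<subseteq> carrier (sym_group n)" using perm by (auto simp: sym_group_carrier)
    show "carrier (sym_group n) \<subseteq> \<Phi> ` G"
    proof
      fix p assume "p \<in> carrier (sym_group n)"
      then have "p permutes {1..n}" by (simp only: sym_group_carrier)
      then show "p \<in> \<Phi> ` G" using surj by blast
    qed
  qed
  moreover have "\<Phi> \<in> hom (galois_group k L) (sym_group n)"
  proof (rule homI)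
    fix \<sigma> assume "\<sigma> \<in> G"
    then show "\<Phi> \<sigma> \<in> carrier (sym_group n)" unfolding sym_group_carrier by (rule perm)
  qed (simp add: sym_group_mult hom)
  ultimately show ?thesis unfolding is_iso_def iso_def by blast
qed

lemma transitive:
  assumes "s \<in> S" "t \<in> S"
  shows "\<exists>\<sigma>\<in>G. \<sigma> s = t"
proof -
  have "Transposition.transpose s t permutes S" by (rule permutes_swap_id[OF assms])
  then obtain \<sigma> where "\<sigma> \<in> G" "\<forall>x\<in>S. \<sigma> x = Transposition.transpose s t x" using full by blast
  then show ?thesis using assms(1) by (intro bexI[of _ \<sigma>]) simp_all
qed

text \<open>\<open>K\<close> is generated by an arbitrary root. Transitivity makes all of
  \<open>S\<close> conjugate to it, so the Galois closure is \<open>L\<close> and the degree is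
  \<open>n\<close>. Nonemptiness of the classes is recorded for \<open>infinitely_many\<close>,
  where empty classes could not tell two types apart.\<close>

theorem field_exists:
  shows "\<exists>K. Sn_field n k K \<and> (\<forall>r. {1..r} \<subseteq> J \<longrightarrow> property_P1 k n r P K) \<and>
    (\<forall>j\<in>J. unramified_above k (galois_closure k K) (P j) \<and>
      artin_symbol k (galois_closure k K) (P j) = cycle_class k K (mu j) \<and> cycle_class k K (mu j) \<noteq> {})"
proof -
  have "S \<noteq> {}"
  proof
    assume "S = {}"
    then have "card S = 0" by (simp only: card.empty)
    then show False using cardS n2 by simp
  qed
  then obtain \<theta> where th: "\<theta> \<in> S" by blast
  have thA: "algebraic_int \<theta>" using th S_AI by blast
  define K where "K = adj k {\<theta>}"
  obtain m0 where "minpoly k \<theta> m0"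
    using k.minpoly_exists[OF k.algebraic_over_if_algebraic_int[OF thA]] by blast
  then have Keq: "K = {poly p \<theta> | p. pover k p}" unfolding K_def by (rule k.adj_single)
  have se: "simple_ext k K \<theta>"
    unfolding simple_ext_def simple_ext_axioms_def
  proof (intro conjI allI impI)
    show "cfield K" unfolding K_def by (rule cfield_adj)
    show "k \<subseteq> K" unfolding K_def by (rule adj_base)
    show "\<theta> \<in> K" unfolding K_def using adj_gen[of "{\<theta>}" k] by blast
    fix x assume "x \<in> K"
    then show "\<exists>p. pover k p \<and> x = poly p \<theta>" unfolding Keq by blast
  qed (rule kf, rule thA)
  interpret se: simple_ext k K \<theta> by (rule se)
  have KL: "K \<subseteq> L" unfolding K_def using th SL kL by (intro adj_least[OF L.cfield_axioms]) auto
  have SS: "se.S = S"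
  proof
    have "poly f \<theta> = 0" using th by simp
    then show "se.S \<subseteq> S" using se.S_roots[OF fk] by blast
    show "S \<subseteq> se.S"
    proof
      fix t assume "t \<in> S"
      then obtain \<sigma> where s: "\<sigma> \<in> G" "\<sigma> \<theta> = t" using transitive[OF th] by blast
      interpret s: fhom L \<sigma> by (rule G_D(3)[OF s(1)])
      have "fhom K \<sigma>"
      proof (rule fhom.intro[OF se.Kf], unfold_locales)
        show "\<sigma> 1 = 1" by (rule s.hone)
        fix x y assume "x \<in> K" "y \<in> K"
        then show "\<sigma> (x + y) = \<sigma> x + \<sigma> y" "\<sigma> (x * y) = \<sigma> x * \<sigma> y"
          using KL by (intro s.hadd s.hmult; blast)+
      qed
      then have "restrict \<sigma> K \<in> se.E" by (rule se.E_I) (rule G_D(4)[OF s(1)])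
      moreover have "restrict \<sigma> K \<theta> = t" using se.thK s(2) by simp
      ultimately show "t \<in> se.S" unfolding se.S_def by blast
    qed
  qed
  have LL: "galois_closure k K = L" using se.L_eq_adj SS by simp
  have cardE: "card se.E = n" using card_image[OF se.inj_E] SS cardS by (simp add: se.S_def)
  let ?Us = "map (\<lambda>i. \<theta> ^ i) [0..<n]"
  interpret O: csubring "OI k" by (rule k.csubring_OI)
  \<comment> \<open>Division by the monic \<open>f\<close> brings the degree below \<open>n\<close>
    without changing the value at \<open>\<theta>\<close>; it serves for coefficients in
    \<open>k\<close> and in \<open>OI k\<close>.\<close>
  have red: "\<exists>p'. pover A p' \<and> (\<forall>i\<ge>n. poly.coeff p' i = 0) \<and> poly p' \<theta> = poly p \<theta>"
    if A: "csubring A" "pover A f" "pover A p" for A p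
  proof -
    interpret A: csubring A by (rule A(1))
    obtain q' r' where qr: "pover A q'" "pover A r'" "p = q' * f + r'" "r' = 0 \<or> Polynomial.degree r' < Polynomial.degree f"
      using A.monic_division[OF A(3,2) fmon] by blast
    have "poly r' \<theta> = poly p \<theta>" using qr(3) th by simp
    moreover have "\<forall>i\<ge>n. poly.coeff r' i = 0" using qr(4) fdeg by (auto simp: coeff_eq_0)
    ultimately show ?thesis using qr(2) by blast
  qed
  have SpanK: "CC.Span k ?Us = K"
    unfolding Span_powers[OF k.csubring_axioms] Keq
    using red[OF k.csubring_axioms fk] by (intro subset_antisym subsetI; clarsimp; metis)
  have Req: "power_order k n \<theta> = {poly p \<theta> | p. pover (OI k) p}"
    unfolding power_order_def ring_of_integers_simps Span_powers[OF O.csubring_axioms]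
    using red[OF O.csubring_axioms fO] by (intro subset_antisym subsetI; clarsimp; metis)
  have kfs: "subfield k CC" by (simp add: subfield_CC_iff kf)
  have ind: "CC.independent k ?Us"
  proof (rule CC.trivial_combine_imp_independent[OF kfs])
    fix Ks assume Ks: "set Ks \<subseteq> k" "CC.combine Ks ?Us = \<zero>\<^bsub>CC\<^esub>"
    \<comment> \<open>The list \<open>Ks\<close> has arbitrary length; it is cut or padded with
      zeros to length \<open>n\<close>.\<close>
    define Ks' where "Ks' = take n Ks @ replicate (n - length Ks) 0"
    have len: "length Ks' = length ?Us" by (simp add: Ks'_def)
    have "CC.combine (take (length ?Us) Ks) ?Us = 0" using CC.combine_take[of ?Us Ks] Ks(2) by simp
    then have "CC.combine Ks' ?Us = 0"
      using CC.combine_append_replicate[of ?Us "take n Ks" "n - length Ks"] by (simp add: Ks'_def)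
    then have rel: "(\<Sum>i<n. Ks' ! i * \<theta> ^ i) = 0" using combine_CC[OF len] by simp
    have Ksk: "set Ks' \<subseteq> k" using Ks(1) k.zero set_take_subset[of n Ks] by (auto simp: Ks'_def)
    define g where "g = (\<Sum>i<n. Polynomial.monom (Ks' ! i) i)"
    have cg: "poly.coeff g i = (if i < n then Ks' ! i else 0)" for i
    proof -
      have "poly.coeff g i = (\<Sum>l<n. if l = i then Ks' ! l else 0)" by (simp add: g_def coeff_sum)
      then show ?thesis by (simp add: sum.delta)
    qed
    have gk: "pover k g" using Ksk len k.zero by (auto simp: pover_def cg subset_iff)
    have "poly g \<theta> = 0" using rel by (simp add: g_def poly_sum poly_monom)
    then have "S \<subseteq> {x. poly g x = 0}" using se.S_roots[OF gk] SS by blast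
    \<comment> \<open>A relation of degree below \<open>n\<close> also holds for all
      \<open>n\<close> conjugates of \<open>\<theta>\<close>, too many zeros for a nonzero
      polynomial.\<close>
    have "g = 0"
    proof (rule ccontr)
      assume g0: "g \<noteq> 0"
      have "n \<le> card {x. poly g x = 0}" using card_mono[OF poly_roots_finite[OF g0] \<open>S \<subseteq> _\<close>] cardS by simp
      also have "\<dots> \<le> Polynomial.degree g" by (rule card_poly_roots_bound[OF g0])
      also have "\<dots> < n"
      proof -
        have "Polynomial.degree g \<le> n - 1" by (rule degree_le) (use n2 in \<open>auto simp: cg\<close>)
        then show ?thesis using n2 by simp
      qed
      finally show False by simp
    qed
    then have "Ks' ! i = 0" if "i < n" for i using cg[of i] that by simp
    then have "set Ks' \<subseteq> {0}" using len by (auto simp: in_set_conv_nth)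
    then show "set (take (length ?Us) Ks) \<subseteq> {\<zero>\<^bsub>CC\<^esub>}" by (auto simp: Ks'_def)
  qed simp
  have basis: "field_basis k K ?Us" using ind SpanK by (simp add: field_basis_def)
  have "CC.dimension (length ?Us) k (CC.Span k ?Us)" by (rule CC.dimension_independent[OF ind])
  then have dim: "CC.dimension n k K" using SpanK by simp
  have Sn: "Sn_field n k K"
    unfolding Sn_field_def LL using se.Kf se.kK dim iso_sym by (simp add: subfield_CC_iff)
  have OIK: "OI k \<subseteq> OI K" using se.kK by (auto simp: OI_def)
  interpret OK: csubring "OI K" by (rule se.K.csubring_OI)
  have thOK: "\<theta> \<in> OI K" using se.thK thA by (simp add: OI_def)
  have ROK: "power_order k n \<theta> \<subseteq> OI K"
  proof
    fix x assume "x \<in> power_order k n \<theta>"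
    then obtain p where p: "pover (OI k) p" "x = poly p \<theta>" unfolding Req by blast
    show "x \<in> OI K" unfolding p(2) by (rule OK.poly_in[OF pover_mono[OF p(1) OIK] thOK])
  qed
  have UsR: "set ?Us \<subseteq> power_order k n \<theta>"
  proof
    fix x assume "x \<in> set ?Us"
    then obtain i where "x = \<theta> ^ i" by auto
    then have "x = poly (Polynomial.monom 1 i) \<theta>" by (simp add: poly_monom)
    then show "x \<in> power_order k n \<theta>" unfolding Req using O.pover_monom[OF O.one] by blast
  qed
  have Rsub: "csubring (power_order k n \<theta>)"
    unfolding Req
  proof unfold_locales
    show "0 \<in> {poly p \<theta> | p. pover (OI k) p}" using O.pover_0 by (auto intro!: exI[of _ 0])
    show "1 \<in> {poly p \<theta> | p. pover (OI k) p}" using O.pover_1 by (auto intro!: exI[of _ 1])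
    fix x y assume "x \<in> {poly p \<theta> | p. pover (OI k) p}" "y \<in> {poly p \<theta> | p. pover (OI k) p}"
    then obtain p p' where p: "pover (OI k) p" "pover (OI k) p'" "x = poly p \<theta>" "y = poly p' \<theta>" by blast
    show "x + y \<in> {poly p \<theta> | p. pover (OI k) p}"
      by (rule CollectI, rule exI[of _ "p + p'"]) (simp add: p O.pover_add)
    show "x - y \<in> {poly p \<theta> | p. pover (OI k) p}"
      by (rule CollectI, rule exI[of _ "p - p'"]) (simp add: p O.pover_diff)
    show "x * y \<in> {poly p \<theta> | p. pover (OI k) p}"
      by (rule CollectI, rule exI[of _ "p * p'"]) (simp add: p O.pover_mult)
  qed
  have OR: "OI k \<subseteq> power_order k n \<theta>"
  proof
    fix x assume "x \<in> OI k"
    then have "pover (OI k) [:x:]" by (rule O.pover_const)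
    moreover have "x = poly [:x:] \<theta>" by simp
    ultimately show "x \<in> power_order k n \<theta>" unfolding Req by blast
  qed
  have ord: "is_order k K (power_order k n \<theta>)"
    unfolding is_order_def ring_of_integers_simps
  proof (intro conjI OR)
    show "subring (power_order k n \<theta>) CC" by (rule csubring.subring_CC[OF Rsub])
    show "power_order k n \<theta> \<subseteq> K" using ROK by (auto simp: OI_def)
    show "\<exists>Us. CC.Span (OI k) Us = power_order k n \<theta>" unfolding power_order_def by auto
    show "\<exists>Us. set Us \<subseteq> power_order k n \<theta> \<and> field_basis k K Us" using UsR basis by blast
  qed
  let ?d = "basis_disc k K ?Us"
  have UsO: "set ?Us \<subseteq> OI K" using UsR ROK by blast
  have dO: "?d \<in> OI k" by (rule se.disc_OI[OF UsO])
  \<comment> \<open>The discriminant is the square of the Vandermonde product of the conjugates of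
    \<open>\<theta>\<close>; if it lay in \<open>P j\<close>, the prime \<open>Q\<close> would
    contain a difference of two of them.\<close>
  have dP: "?d \<notin> P j" if j: "j \<in> J" for j
  proof
    assume dPj: "?d \<in> P j"
    obtain p m V Q t R where D: "residue_above k (P j) p m (q j) V Q" "bij_betw t S R" "R \<subseteq> Tch (q j)"
      "\<forall>\<theta>. poly f \<theta> = 0 \<longrightarrow> \<theta> - t \<theta> \<in> Q" using data[OF j] by blast
    interpret r: residue_above k "P j" p m "q j" V Q by (rule D(1))
    obtain h where h: "bij_betw h {..<card se.E} se.E"
      using ex_bij_betw_nat_finite[OF se.finite_E] atLeast0LessThan by auto
    have hE: "h a \<in> se.E" if "a < n" for a using h that cardE by (auto simp: bij_betw_def)
    have UsK: "set ?Us \<subseteq> K" using UsO by (auto simp: OI_def)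
    define x where "x a = h a \<theta>" for a
    have xS: "x a \<in> S" if "a < n" for a using hE[OF that] SS unfolding se.S_def x_def by blast
    have "mat n n (\<lambda>(a, j). if a < n then h a (?Us ! j) else 0) = mat n n (\<lambda>(a, j). x a ^ j)"
    proof (rule eq_matI)
      fix a j assume "a < dim_row (mat n n (\<lambda>(a, j). x a ^ j))" "j < dim_col (mat n n (\<lambda>(a, j). x a ^ j))"
      then have aj: "a < n" "j < n" by simp_all
      have "h a (\<theta> ^ j) = h a \<theta> ^ j" by (rule fhom.hpower[OF se.E_D(2)[OF hE[OF aj(1)]] se.thK])
      then show "mat n n (\<lambda>(a, j). if a < n then h a (?Us ! j) else 0) $$ (a, j) = mat n n (\<lambda>(a, j). x a ^ j) $$ (a, j)"
        using aj by (simp add: x_def)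
    qed simp_all
    moreover have "?d = (det (mat n n (\<lambda>(a, j). if a < n then h a (?Us ! j) else 0)))\<^sup>2"
      using se.disc_square[OF h _ UsK] cardE by simp
    ultimately have "?d = (\<Prod>a<n. \<Prod>b<a. x a - x b)\<^sup>2" using vandermonde[of n x] by simp
    then have "(\<Prod>a<n. \<Prod>b<a. x a - x b)\<^sup>2 \<in> Q" using dPj r.QP by auto
    moreover have xA: "x a \<in> AI" if "a < n" for a using xS[OF that] S_AI by blast
    have inn: "(\<Prod>b<a. x a - x b) \<in> AI" if "a < n" for a
      by (rule AI.prod, rule AI.diff) (use xA that in \<open>simp_all\<close>)
    have "(\<Prod>a<n. \<Prod>b<a. x a - x b) \<in> AI" by (rule AI.prod) (use inn in simp)
    ultimately have "(\<Prod>a<n. \<Prod>b<a. x a - x b) \<in> Q" using r.Q.prime_power by blast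
    then have "\<exists>a\<in>{..<n}. (\<Prod>b<a. x a - x b) \<in> Q"
      by (rule r.Q.prime_prod[rotated 2]) (use inn in simp_all)
    then obtain a where a: "a < n" "(\<Prod>b<a. x a - x b) \<in> Q" by auto
    have "\<exists>b\<in>{..<a}. x a - x b \<in> Q"
    proof (rule r.Q.prime_prod[OF _ _ a(2)])
      fix b assume "b \<in> {..<a}"
      then have "b < n" using a(1) by simp
      then show "x a - x b \<in> AI" by (rule AI.diff[OF xA[OF a(1)] xA])
    qed simp
    then obtain b where b: "b < a" "x a - x b \<in> Q" by auto
    have bn: "b < n" using b(1) a(1) by simp
    have "x a = x b" by (rule distinct_mod[OF D xS[OF a(1)] xS[OF bn] b(2)])
    then have "h a = h b" by (intro se.E_eqI hE a(1) bn) (simp add: x_def)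
    then have "a = b" using h a(1) bn cardE by (auto simp: bij_betw_def inj_on_def)
    then show False using b(1) by simp
  qed
  have P1: "property_P1 k n r P K" if r: "{1..r} \<subseteq> J" for r
  proof -
    interpret Rk: cring "ring_of_integers k" by (rule k.cring_OI)
    interpret M: comm_monoid "ideals_set (ring_of_integers k)" by (rule Rk.ideals_set_is_comm_monoid)
    let ?D = "{basis_disc k K Us | Us. set Us \<subseteq> power_order k n \<theta> \<and> field_basis k K Us}"
    have DO: "?D \<subseteq> carrier (ring_of_integers k)"
    proof
      fix x assume "x \<in> ?D"
      then obtain Us where "x = basis_disc k K Us" "set Us \<subseteq> power_order k n \<theta>" by blast
      then show "x \<in> carrier (ring_of_integers k)" using se.disc_OI[of Us] ROK by auto
    qed
    have dI: "?d \<in> rel_disc k K (power_order k n \<theta>)"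
      unfolding rel_disc_def using Rk.genideal_self[OF DO] UsR basis by blast
    have Iid: "ideal (rel_disc k K (power_order k n \<theta>)) (ring_of_integers k)"
      unfolding rel_disc_def by (rule Rk.genideal_ideal[OF DO])
    have Pid: "ideal (P j) (ring_of_integers k)" if "j \<in> J" for j
      using P_prime(1)[OF that] k.ideal_iff by (simp add: cprime_def)
    \<comment> \<open>An inverse of the discriminant modulo the product of the primes, built up one
      prime at a time: a product of two elements of the form \<open>1 - ?d * y\<close> has this form
      again.\<close>
    have ex: "\<exists>y\<in>OI k. 1 - ?d * y \<in> (\<Otimes>\<^bsub>ideals_set (ring_of_integers k)\<^esub> i\<in>A. P i) \<and>
        ideal (\<Otimes>\<^bsub>ideals_set (ring_of_integers k)\<^esub> i\<in>A. P i) (ring_of_integers k)" if "finite A" "A \<subseteq> J" for A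
      using that
    proof (induction A rule: finite_induct)
      case empty
      have "(\<Otimes>\<^bsub>ideals_set (ring_of_integers k)\<^esub> i\<in>{}. P i) = \<one>\<^bsub>ideals_set (ring_of_integers k)\<^esub>" by (rule M.finprod_empty)
      also have "\<dots> = OI k" by (simp add: ideals_set_def)
      finally have "(\<Otimes>\<^bsub>ideals_set (ring_of_integers k)\<^esub> i\<in>{}. P i) = OI k" .
      then show ?case using O.zero O.one Rk.oneideal by (intro bexI[of _ 0]) simp_all
    next
      case (insert j A)
      let ?F = "\<Otimes>\<^bsub>ideals_set (ring_of_integers k)\<^esub> i\<in>A. P i"
      obtain y where y: "y \<in> OI k" "1 - ?d * y \<in> ?F" "ideal ?F (ring_of_integers k)" using insert by auto
      have jJ: "j \<in> J" using insert.prems by simp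
      obtain p m V where "residue_prime k (P j) p m (q j) V" using residue_prime_exists[OF nf Pprime[OF jJ]] by blast
      then interpret r: residue_prime k "P j" p m "q j" V .
      \<comment> \<open>The inverse of the discriminant modulo \<open>P j\<close>, by Fermat's
        theorem.\<close>
      define z where "z = ?d ^ (q j - 2)"
      have zO: "z \<in> OI k" unfolding z_def by (rule O.power[OF dO])
      have "Suc (q j - 2) = q j - 1" using r.q2 by simp
      then have "?d * z = ?d ^ (q j - 1)" unfolding z_def by (metis power_Suc)
      then have "- (?d * z - 1) \<in> P j" using r.P.iuminus[OF r.pow_q_minus_1[OF dO dP[OF jJ]]] by simp
      then have z: "1 - ?d * z \<in> P j" by simp
      have car: "P \<in> A \<rightarrow> carrier (ideals_set (ring_of_integers k))" "P j \<in> carrier (ideals_set (ring_of_integers k))"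
        using Pid insert.prems by (auto simp: ideals_set_def)
      have F: "(\<Otimes>\<^bsub>ideals_set (ring_of_integers k)\<^esub> i\<in>insert j A. P i) = ideal_prod (ring_of_integers k) (P j) ?F"
        using M.finprod_insert[OF insert.hyps(1,2) car] by (simp add: ideals_set_def)
      have "(1 - ?d * z) \<otimes>\<^bsub>ring_of_integers k\<^esub> (1 - ?d * y) \<in> ideal_prod (ring_of_integers k) (P j) ?F"
        by (rule ideal_prod.prod[OF z y(2)])
      moreover have "(1 - ?d * z) * (1 - ?d * y) = 1 - ?d * (z + y - ?d * z * y)" by (simp add: algebra_simps)
      moreover have "z + y - ?d * z * y \<in> OI k" by (intro O.diff O.add O.mult zO y(1) dO)
      ultimately show ?case unfolding F using Rk.ideal_prod_is_ideal[OF Pid[OF jJ] y(3)]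
        by (intro bexI[of _ "z + y - ?d * z * y"]) simp_all
    qed
    let ?F = "\<Otimes>\<^bsub>ideals_set (ring_of_integers k)\<^esub> i\<in>{1..r}. P i"
    obtain y where y: "y \<in> OI k" "1 - ?d * y \<in> ?F" "ideal ?F (ring_of_integers k)" using ex[of "{1..r}"] r by auto
    interpret I1: cideal "OI k" "rel_disc k K (power_order k n \<theta>)" using Iid k.ideal_iff by blast
    interpret I2: cideal "OI k" ?F using y(3) k.ideal_iff by blast
    have "coprime_ideals (ring_of_integers k) (rel_disc k K (power_order k n \<theta>)) ?F"
      unfolding coprime_ideals_def
    proof (intro subset_antisym subsetI)
      fix x assume "x \<in> rel_disc k K (power_order k n \<theta>) <+>\<^bsub>ring_of_integers k\<^esub> ?F"
      then obtain u v where "u \<in> rel_disc k K (power_order k n \<theta>)" "v \<in> ?F" "x = u + v" by (auto simp: set_add_def')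
      then show "x \<in> carrier (ring_of_integers k)" using I1.sub I2.sub O.add[of u v] by auto
    next
      fix x assume "x \<in> carrier (ring_of_integers k)"
      then have x: "x \<in> OI k" by simp
      have "x * y * ?d \<in> rel_disc k K (power_order k n \<theta>)" by (rule I1.imult[OF O.mult[OF x y(1)] dI])
      moreover have "x * (1 - ?d * y) \<in> ?F" by (rule I2.imult[OF x y(2)])
      moreover have "x = x * y * ?d + x * (1 - ?d * y)" by (simp add: algebra_simps)
      ultimately show "x \<in> rel_disc k K (power_order k n \<theta>) <+>\<^bsub>ring_of_integers k\<^esub> ?F"
        unfolding set_add_def' ring_of_integers_simps by blast
    qed
    then show ?thesis unfolding property_P1_def using se.thK ord by blast
  qed
  have P2: "\<forall>i\<in>J. unramified_above k (galois_closure k K) (P i) \<and>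
      artin_symbol k (galois_closure k K) (P i) = cycle_class k K (mu i) \<and> cycle_class k K (mu i) \<noteq> {}"
  proof
    fix i assume i: "i \<in> J"
    have c: "cycle_class k K (mu i) = {\<sigma> \<in> G. cycle_type \<sigma> S = mu i}"
      using se.cycle_class_eq SS LL by simp
    moreover obtain \<phi> where "\<phi> \<in> G" "cycle_type \<phi> S = mu i" using frob_data[OF i] by blast
    ultimately have "cycle_class k K (mu i) \<noteq> {}" by blast
    then show "unramified_above k (galois_closure k K) (P i) \<and>
        artin_symbol k (galois_closure k K) (P i) = cycle_class k K (mu i) \<and> cycle_class k K (mu i) \<noteq> {}"
      unfolding LL using unramified[OF i] artin[OF i] c by simp
  qed
  show ?thesis using Sn P1 P2 by blast
qed

end

context split_poly
begin

text \<open>The permutations of \<open>S\<close> induced by Galois elements form the group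
  \<open>H\<close>. The Frobenius of type \<open>{#n#}\<close> is transitive, the second is
  transitive off a fixed point, and the third is a transposition.\<close>

lemma full_if_types:
  assumes a: "a \<in> J" "mu a = {#n#}" and b: "b \<in> J" "mu b = {#n - 1, 1#}"
    and c: "c \<in> J" "mu c = {#2#} + replicate_mset (n - 2) 1"
    and p: "p permutes S"
  shows "\<exists>\<sigma>\<in>G. \<forall>x\<in>S. \<sigma> x = p x"
proof -
  define H where "H = {p. p permutes S \<and> (\<exists>\<sigma>\<in>G. \<forall>x\<in>S. \<sigma> x = p x)}"
  have res: "perm_restrict \<sigma> S \<in> H" if s: "\<sigma> \<in> G" for \<sigma>
  proof -
    have "bij_betw (perm_restrict \<sigma> S) S S"
      using G_S_bij[OF s] by (subst bij_betw_cong[of _ _ \<sigma>]) (simp_all add: perm_restrict_def)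
    then have "perm_restrict \<sigma> S permutes S" by (rule bij_imp_permutes) (simp add: perm_restrict_def)
    then show ?thesis unfolding H_def using s by (auto simp: perm_restrict_def)
  qed
  have orb: "Orbits.orbit (perm_restrict \<sigma> S) x = Orbits.orbit \<sigma> x" if "\<sigma> \<in> G" "x \<in> S" for \<sigma> x
    using that(2) by (rule orbit_cong0[symmetric]) (use G_S[OF that(1)] in \<open>simp_all add: perm_restrict_def\<close>)
  have po: "perm_on \<sigma> S" if "\<sigma> \<in> G" for \<sigma> by (rule bij_betw_imp_perm_on[OF finS G_S_bij[OF that]])
  obtain \<alpha> where \<alpha>: "\<alpha> \<in> G" "cycle_type \<alpha> S = {#n#}" using frob_data[OF a(1)] a(2) by auto
  obtain \<beta> where \<beta>: "\<beta> \<in> G" "cycle_type \<beta> S = {#n - 1, 1#}" using frob_data[OF b(1)] b(2) by auto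
  obtain \<gamma> where \<gamma>: "\<gamma> \<in> G" "cycle_type \<gamma> S = {#2#} + replicate_mset (n - 2) 1" using frob_data[OF c(1)] c(2) by auto
  obtain u where u: "u \<in> S" "\<beta> u = u" "\<forall>x\<in>S - {u}. \<forall>y\<in>S - {u}. y \<in> Orbits.orbit \<beta> x"
    using cycle_type_fix_one[OF finS po[OF \<beta>(1)] \<beta>(2)] by blast
  obtain v w where vw: "v \<in> S" "w \<in> S" "v \<noteq> w" "\<gamma> v = w" "\<gamma> w = v" "\<forall>x\<in>S - {v, w}. \<gamma> x = x"
    using cycle_type_transposition[OF finS po[OF \<gamma>(1)] \<gamma>(2)] by blast
  have tr: "perm_restrict \<gamma> S = Transposition.transpose v w"
  proof
    fix x show "perm_restrict \<gamma> S x = Transposition.transpose v w x"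
      using vw by (cases "x = v"; cases "x = w"; cases "x \<in> S") (auto simp: perm_restrict_def)
  qed
  have "p \<in> H"
  proof (rule all_permutations[where A = S and ?c1.0 = "perm_restrict \<alpha> S" and ?c2.0 = "perm_restrict \<beta> S" and a = u and b = v and c = w])
    show "finite S" by (rule finS)
    show "p permutes S" if "p \<in> H" for p using that by (simp add: H_def)

    show "id \<in> H"
    proof -
      obtain \<rho> where \<rho>: "\<rho> \<in> G" "\<And>x. x \<in> L \<Longrightarrow> \<rho> (\<alpha> x) = x" using G_inv[OF \<alpha>(1)] by metis
      have "\<forall>x\<in>S. compose L \<rho> \<alpha> x = id x" using \<rho>(2) SL by (auto simp: compose_def)
      then show ?thesis unfolding H_def using G_comp[OF \<rho>(1) \<alpha>(1)] permutes_id by blast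
    qed
    show "p \<circ> r \<in> H" if pr: "p \<in> H" "r \<in> H" for p r
    proof -
      obtain \<sigma> \<tau> where st: "\<sigma> \<in> G" "\<forall>x\<in>S. \<sigma> x = p x" "\<tau> \<in> G" "\<forall>x\<in>S. \<tau> x = r x"
        and per: "p permutes S" "r permutes S" using pr by (auto simp: H_def)
      have "compose L \<sigma> \<tau> x = (p \<circ> r) x" if x: "x \<in> S" for x
      proof -
        have "x \<in> L" using x SL by blast
        then have "compose L \<sigma> \<tau> x = \<sigma> (\<tau> x)" by (simp add: compose_def)
        also have "\<dots> = \<sigma> (r x)" using st(4) x by simp
        also have "\<dots> = p (r x)" using st(2) permutes_in_image[OF per(2), of x] x by blast
        finally show ?thesis by simp
      qed
      then show ?thesis unfolding H_def using G_comp[OF st(1,3)] permutes_compose[OF per(2,1)] by blast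
    qed
    show "Hilbert_Choice.inv p \<in> H" if pH: "p \<in> H" for p
    proof -
      obtain \<sigma> where s: "\<sigma> \<in> G" "\<forall>x\<in>S. \<sigma> x = p x" and per: "p permutes S" using pH by (auto simp: H_def)
      obtain \<rho> where \<rho>: "\<rho> \<in> G" "\<And>x. x \<in> L \<Longrightarrow> \<rho> (\<sigma> x) = x" using G_inv[OF s(1)] by metis
      have "\<rho> x = Hilbert_Choice.inv p x" if x: "x \<in> S" for x
      proof -
        let ?y = "Hilbert_Choice.inv p x"
        have y: "?y \<in> S" using permutes_in_image[OF permutes_inv[OF per], of x] x by blast
        then have "\<sigma> ?y = x" using s(2) permutes_inverses(1)[OF per] by simp
        moreover have "\<rho> (\<sigma> ?y) = ?y" by (rule \<rho>(2)) (use y SL in blast)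
        ultimately show ?thesis by simp
      qed
      then show ?thesis unfolding H_def using \<rho>(1) permutes_inv[OF per] by blast
    qed
    show "perm_restrict \<alpha> S \<in> H" by (rule res[OF \<alpha>(1)])
    show "perm_restrict \<beta> S \<in> H" by (rule res[OF \<beta>(1)])
    show "y \<in> Orbits.orbit (perm_restrict \<alpha> S) x" if "x \<in> S" "y \<in> S" for x y
      unfolding orb[OF \<alpha>(1) that(1)] cycle_type_single[OF po[OF \<alpha>(1)] \<alpha>(2) that(1)] by (rule that(2))
    show "u \<in> S" by (rule u(1))
    show "perm_restrict \<beta> S u = u" using u(1,2) by (simp add: perm_restrict_def)
    show "y \<in> Orbits.orbit (perm_restrict \<beta> S) x" if xy: "x \<in> S - {u}" "y \<in> S - {u}" for x y
    proof -
      have "x \<in> S" using xy(1) by blast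
      then show ?thesis unfolding orb[OF \<beta>(1) \<open>x \<in> S\<close>] using u(3) xy by blast
    qed
    show "Transposition.transpose v w \<in> H" using res[OF \<gamma>(1)] by (simp only: tr)
    show "v \<in> S" "w \<in> S" "v \<noteq> w" by (rule vw)+
    show "p permutes S" by (rule p)
  qed
  then show ?thesis by (simp add: H_def)
qed

end

section \<open>Adding auxiliary primes, and infinitely many fields\<close>

lemma norm_ge_2:
  assumes "number_field k" "prime_of k P"
  shows "ideal_norm k P \<ge> 2"
proof -
  obtain p m V where "residue_prime k P p m (ideal_norm k P) V" using residue_prime_exists[OF assms] by blast
  then show ?thesis by (rule residue_prime.q2)
qed

theorem Sn_field_exists:
  assumes k: "number_field k" and n: "n \<ge> 2" and J: "finite J"
    and P: "\<And>j. j \<in> J \<Longrightarrow> prime_of k (P j)" and inj: "inj_on P J"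
    and mu: "\<And>j. j \<in> J \<Longrightarrow> partition_of (mu j) n"
    and cnt: "\<And>j. j \<in> J \<Longrightarrow> \<forall>i\<in>{1..n}. count (mu j) i \<le> NO (ideal_norm k (P j)) i"
    and types: "{{#n#}, {#n - 1, 1#}, {#2#} + replicate_mset (n - 2) 1} \<subseteq> mu ` J"
  shows "\<exists>K. Sn_field n k K \<and> (\<forall>r. {1..r} \<subseteq> J \<longrightarrow> property_P1 k n r P K) \<and>
    (\<forall>j\<in>J. unramified_above k (galois_closure k K) (P j) \<and>
      artin_symbol k (galois_closure k K) (P j) = cycle_class k K (mu j) \<and> cycle_class k K (mu j) \<noteq> {})"
proof -
  let ?q = "\<lambda>j. ideal_norm k (P j)"
  have "\<forall>j\<in>J. \<exists>R. R \<subseteq> Tch (?q j) \<and> finite R \<and> perm_on (\<lambda>x. x ^ ?q j) R \<and> cycle_type (\<lambda>x. x ^ ?q j) R = mu j \<and> card R = n"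
    using type_realizable[OF norm_ge_2[OF k P] mu cnt] by blast
  then obtain R where R: "\<And>j. j \<in> J \<Longrightarrow> R j \<subseteq> Tch (?q j) \<and> finite (R j) \<and> perm_on (\<lambda>x. x ^ ?q j) (R j) \<and>
      cycle_type (\<lambda>x. x ^ ?q j) (R j) = mu j \<and> card (R j) = n" by metis
  obtain f where f: "monic f" "Polynomial.degree f = n" "pover (OI k) f"
    "\<forall>j\<in>J. \<exists>p m V Q t. residue_above k (P j) p m (?q j) V Q \<and>
      bij_betw t {\<theta>. poly f \<theta> = 0} (R j) \<and> (\<forall>\<theta>. poly f \<theta> = 0 \<longrightarrow> \<theta> - t \<theta> \<in> Q)"
    using exists_poly[OF k J P inj, of R n] R by blast
  have sp: "split_poly k n f J P mu"
  proof (rule split_poly.intro[OF k n f(1-3)])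
    fix j assume j: "j \<in> J"
    then show "prime_of k (P j)" by (rule P)
    obtain p m V Q t where "residue_above k (P j) p m (?q j) V Q" "bij_betw t {\<theta>. poly f \<theta> = 0} (R j)"
      "\<forall>\<theta>. poly f \<theta> = 0 \<longrightarrow> \<theta> - t \<theta> \<in> Q" using f(4) j by blast
    then show "\<exists>p m V Q t R. residue_above k (P j) p m (?q j) V Q \<and>
      bij_betw t {\<theta>. poly f \<theta> = 0} R \<and> R \<subseteq> Tch (?q j) \<and> card R = n \<and>
      cycle_type (\<lambda>x. x ^ ?q j) R = mu j \<and> (\<forall>\<theta>. poly f \<theta> = 0 \<longrightarrow> \<theta> - t \<theta> \<in> Q)"
      using R[OF j] by blast
  qed
  interpret sp: split_poly k n f J P mu by (rule sp)
  have "{#n#} \<in> mu ` J" "{#n - 1, 1#} \<in> mu ` J" "{#2#} + replicate_mset (n - 2) 1 \<in> mu ` J"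
    using types unfolding insert_subset by blast+
  then obtain a b c where abc: "a \<in> J" "mu a = {#n#}" "b \<in> J" "mu b = {#n - 1, 1#}"
    "c \<in> J" "mu c = {#2#} + replicate_mset (n - 2) 1" by (elim imageE) (rule that; (assumption | rule sym, assumption))
  interpret sf: split_full k n f J P mu
  proof unfold_locales
    fix p assume "p permutes {\<theta>. poly f \<theta> = 0}"
    then show "\<exists>\<sigma>\<in>sp.G. \<forall>x\<in>{\<theta>. poly f \<theta> = 0}. \<sigma> x = p x" by (rule sp.full_if_types[OF abc])
  next
    show "card {\<theta>. poly f \<theta> = 0} = n" using sp.frob_data[OF abc(1)] by blast
  qed
  show ?thesis by (rule sf.field_exists)
qed

text \<open>The family of primes is extended beyond the index \<open>r\<close>; the product over
  \<open>{1..r}\<close> sees only the original members.\<close>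

lemma property_P1_cong:
  assumes "cfield k" "\<And>i. i \<in> {1..r} \<Longrightarrow> prime_of k (P i)" "\<And>i. i \<in> {1..r} \<Longrightarrow> P' i = P i"
  shows "property_P1 k n r P' K \<longleftrightarrow> property_P1 k n r P K"
proof -
  interpret k: cfield k by (rule assms(1))
  interpret R: cring "ring_of_integers k" by (rule k.cring_OI)
  interpret M: comm_monoid "ideals_set (ring_of_integers k)" by (rule R.ideals_set_is_comm_monoid)
  have "(\<Otimes>\<^bsub>ideals_set (ring_of_integers k)\<^esub> i\<in>{1..r}. P' i) = (\<Otimes>\<^bsub>ideals_set (ring_of_integers k)\<^esub> i\<in>{1..r}. P i)"
  proof (rule M.finprod_cong'[OF refl])
    show "P \<in> {1..r} \<rightarrow> carrier (ideals_set (ring_of_integers k))"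
      using assms(2) by (auto simp: prime_of_def ideals_set_def primeideal_def)
  qed (rule assms(3))
  then show ?thesis by (simp add: property_P1_def)
qed

text \<open>The primes in \<open>l\<close>, with types \<open>ts\<close>, are appended to the given
  ones. Norm at least \<open>n\<close> provides at least \<open>n\<close> orbits of length one,
  enough for every type allowed in \<open>ts\<close>.\<close>

lemma Sn_field_exists_extra:
  assumes k: "number_field k" and n: "n \<ge> 2"
    and P: "\<And>i. i \<in> {1..r} \<Longrightarrow> prime_of k (P i)" and inj: "inj_on P {1..r}"
    and mu: "\<And>i. i \<in> {1..r} \<Longrightarrow> partition_of (mu i) n"
    and nu: "\<And>i. i \<in> {1..r} \<Longrightarrow> nu_star n (ideal_norm k (P i)) (mu i) > 0"
    and l: "distinct l" "\<And>Q. Q \<in> set l \<Longrightarrow> prime_of k Q \<and> ideal_norm k Q \<ge> n \<and> Q \<notin> P ` {1..r}"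
    and ts: "length ts = length l" "set ts \<subseteq> insert (replicate_mset n 1) A" "A \<subseteq> set ts"
    and A: "A = {{#n#}, {#n - 1, 1#}, {#2#} + replicate_mset (n - 2) 1}"
  shows "\<exists>K. Sn_field n k K \<and> property_P1 k n r P K \<and> property_P2 k r P mu K \<and>
    (\<forall>i<length l. artin_symbol k (galois_closure k K) (l ! i) = cycle_class k K (ts ! i) \<and>
      cycle_class k K (ts ! i) \<noteq> {})"
proof -
  let ?m = "length l"
  \<comment> \<open>List positions start at 0 and the given primes use \<open>1\<close>, ...,
    \<open>r\<close>, so position \<open>i\<close> of \<open>l\<close> has index
    \<open>r + i + 1\<close>.\<close>
  define P' where "P' i = (if i \<le> r then P i else l ! (i - r - 1))" for i
  define mu' where "mu' i = (if i \<le> r then mu i else ts ! (i - r - 1))" for i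
  have new: "i - r - 1 < ?m" if "i \<in> {1..r + ?m}" "\<not> i \<le> r" for i using that by auto
  have lP: "prime_of k (l ! i)" "ideal_norm k (l ! i) \<ge> n" "l ! i \<notin> P ` {1..r}" if "i < ?m" for i
    using l(2)[OF nth_mem[OF that]] by blast+
  have tsA: "ts ! i \<in> insert (replicate_mset n 1) A" if "i < ?m" for i
    by (rule subsetD[OF ts(2) nth_mem]) (use ts(1) that in simp)
  have "\<exists>K. Sn_field n k K \<and> (\<forall>s. {1..s} \<subseteq> {1..r + ?m} \<longrightarrow> property_P1 k n s P' K) \<and>
    (\<forall>j\<in>{1..r + ?m}. unramified_above k (galois_closure k K) (P' j) \<and>
      artin_symbol k (galois_closure k K) (P' j) = cycle_class k K (mu' j) \<and> cycle_class k K (mu' j) \<noteq> {})"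
  proof (rule Sn_field_exists[OF k n])
    fix j assume j: "j \<in> {1..r + ?m}"
    show pr: "prime_of k (P' j)"
      using P[of j] lP(1)[of "j - r - 1"] new[OF j] j by (auto simp: P'_def)
    show "partition_of (mu' j) n"
    proof (cases "j \<le> r")
      case False
      then have "mu' j \<in> insert (replicate_mset n 1) A" using tsA[OF new[OF j]] by (simp add: mu'_def)
      then show ?thesis using n by (auto simp: A partition_of_def split: if_splits)
    qed (use mu[of j] j in \<open>simp add: mu'_def\<close>)
    show "\<forall>i\<in>{1..n}. count (mu' j) i \<le> NO (ideal_norm k (P' j)) i"
    proof (cases "j \<le> r")
      case True
      then show ?thesis using nu[of j] P[of j] j nu_star_pos_iff[OF norm_ge_2[OF k P[of j]]]
        by (simp add: mu'_def P'_def)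
    next
      case False
      have t: "mu' j \<in> insert (replicate_mset n 1) A" using tsA[OF new[OF j]] False by (simp add: mu'_def)
      have q: "ideal_norm k (P' j) \<ge> n" using lP(2)[OF new[OF j]] False by (simp add: P'_def)
      show ?thesis
      proof (rule simple_type_bounded[OF norm_ge_2[OF k pr]])
        show "count (mu' j) i \<le> 1" if "i \<noteq> 1" for i using t that by (auto simp: A)
        show "count (mu' j) 1 \<le> ideal_norm k (P' j)" using t q n by (auto simp: A)
      qed
    qed
  next
    show "inj_on P' {1..r + ?m}"
    proof (rule inj_onI)
      fix i j assume i: "i \<in> {1..r + ?m}" and j: "j \<in> {1..r + ?m}" and eq: "P' i = P' j"
      consider "i \<le> r" "j \<le> r" | "i \<le> r" "\<not> j \<le> r" | "\<not> i \<le> r" "j \<le> r" | "\<not> i \<le> r" "\<not> j \<le> r" by blast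
      then show "i = j"
      proof cases
        case 1
        then show ?thesis using inj_onD[OF inj, of i j] eq i j by (simp add: P'_def)
      next
        case 2
        then have "l ! (j - r - 1) = P i" using eq by (simp add: P'_def)
        moreover have "i \<in> {1..r}" using i 2 by simp
        ultimately show ?thesis using lP(3)[OF new[OF j 2(2)]] by blast
      next
        case 3
        then have "l ! (i - r - 1) = P j" using eq by (simp add: P'_def)
        moreover have "j \<in> {1..r}" using j 3 by simp
        ultimately show ?thesis using lP(3)[OF new[OF i 3(1)]] by blast
      next
        case 4
        then have "l ! (i - r - 1) = l ! (j - r - 1)" using eq by (simp add: P'_def)
        then have "i - r - 1 = j - r - 1" using nth_eq_iff_index_eq[OF l(1) new[OF i 4(1)] new[OF j 4(2)]] by blast
        then show ?thesis using 4 by simp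
      qed
    qed
    have "t \<in> mu' ` {1..r + ?m}" if t: "t \<in> set ts" for t
    proof -
      obtain i where i: "i < ?m" "ts ! i = t" using t ts(1) by (auto simp: in_set_conv_nth)
      have "mu' (r + i + 1) = t" using i(2) by (simp add: mu'_def)
      moreover have "r + i + 1 \<in> {1..r + ?m}" using i(1) by simp
      ultimately show ?thesis by blast
    qed
    then show "{{#n#}, {#n - 1, 1#}, {#2#} + replicate_mset (n - 2) 1} \<subseteq> mu' ` {1..r + ?m}"
      using ts(3) unfolding A by blast
  qed simp
  then obtain K where K: "Sn_field n k K" "\<forall>s. {1..s} \<subseteq> {1..r + ?m} \<longrightarrow> property_P1 k n s P' K"
    "\<And>j. j \<in> {1..r + ?m} \<Longrightarrow> unramified_above k (galois_closure k K) (P' j) \<and>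
      artin_symbol k (galois_closure k K) (P' j) = cycle_class k K (mu' j) \<and> cycle_class k K (mu' j) \<noteq> {}"
    by blast
  have kf: "cfield k" using k by (simp add: number_field_def subfield_CC_iff)
  have "property_P1 k n r P' K" using K(2) by simp
  then have "property_P1 k n r P K" using property_P1_cong[where P = P and P' = P' and r = r, OF kf P] by (simp add: P'_def)
  moreover have "property_P2 k r P mu K"
    unfolding property_P2_def
  proof
    fix i assume i: "i \<in> {1..r}"
    then show "unramified_above k (galois_closure k K) (P i) \<and>
        artin_symbol k (galois_closure k K) (P i) = cycle_class k K (mu i)"
      using K(3)[of i] by (simp add: P'_def mu'_def)
  qed
  moreover have "artin_symbol k (galois_closure k K) (l ! i) = cycle_class k K (ts ! i) \<and> cycle_class k K (ts ! i) \<noteq> {}"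
    if "i < ?m" for i using K(3)[of "r + i + 1"] that by (simp add: P'_def mu'_def)
  ultimately show ?thesis using K(1) by blast
qed

text \<open>
  Given finitely many fields, one more prime for each of them, prescribed to be inert or totally
  split in a way the given field is not, produces a field different from all of them.
\<close>

theorem infinitely_many:
  assumes k: "number_field k" and n: "n \<ge> 2"
    and P: "\<And>i. i \<in> {1..r} \<Longrightarrow> prime_of k (P i)" and inj: "inj_on P {1..r}"
    and mu: "\<And>i. i \<in> {1..r} \<Longrightarrow> partition_of (mu i) n"
    and nu: "\<And>i. i \<in> {1..r} \<Longrightarrow> nu_star n (ideal_norm k (P i)) (mu i) > 0"
  shows "infinite {K. Sn_field n k K \<and> property_P1 k n r P K \<and> property_P2 k r P mu K}"
proof
  let ?good = "{K. Sn_field n k K \<and> property_P1 k n r P K \<and> property_P2 k r P mu K}"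
  let ?one = "replicate_mset n (1::nat)"
  \<comment> \<open>A nonempty class of type (1, ..., 1) is what distinguishes this type from the
    type \<open>{#n#}\<close> below. Every field constructed here has it, so the count takes place
    inside \<open>B\<close>.\<close>
  define B where "B = {K \<in> ?good. cycle_class k K ?one \<noteq> {}}"
  assume "finite ?good"
  then have "finite B" by (rule rev_finite_subset) (auto simp: B_def)
  then obtain Ks where Ks: "set Ks = B" using finite_list by blast
  let ?m = "length Ks"
  have "infinite ({Q. prime_of k Q \<and> ideal_norm k Q \<ge> n} - P ` {1..r})"
    by (rule Diff_infinite_finite[OF _ primes_with_large_norm[OF k]]) simp
  then obtain C where C: "finite C" "card C = ?m + 4" "C \<subseteq> {Q. prime_of k Q \<and> ideal_norm k Q \<ge> n} - P ` {1..r}"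
    using infinite_arbitrarily_large by blast
  obtain l where l: "set l = C" "distinct l" using finite_distinct_list[OF C(1)] by blast
  have len: "length l = ?m + 4" using distinct_card[OF l(2)] l(1) C(2) by simp
  \<comment> \<open>\<open>T i\<close> is a type whose class is not the Artin symbol of
    \<open>l ! i\<close> in the field \<open>Ks ! i\<close>.\<close>
  define T where "T i = (if artin_symbol k (galois_closure k (Ks ! i)) (l ! i) = cycle_class k (Ks ! i) ?one
    then {#n#} else ?one)" for i
  define ts where "ts = map T [0..<?m] @ [{#n#}, {#n - 1, 1#}, {#2#} + replicate_mset (n - 2) 1, ?one]"
  have Tne: "artin_symbol k (galois_closure k (Ks ! i)) (l ! i) \<noteq> cycle_class k (Ks ! i) (T i)" if "i < ?m" for i
  proof (cases "artin_symbol k (galois_closure k (Ks ! i)) (l ! i) = cycle_class k (Ks ! i) ?one")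
    case True
    have "cycle_class k (Ks ! i) ?one \<noteq> {}" using nth_mem[OF that] unfolding Ks B_def by simp
    moreover have "cycle_class k (Ks ! i) ?one \<inter> cycle_class k (Ks ! i) {#n#} = {}"
    proof -
      have "?one \<noteq> {#n#}" using n by (metis One_nat_def Suc_n_not_le_n numeral_2_eq_2 size_replicate_mset size_single)
      then show ?thesis unfolding cycle_class_def by auto
    qed
    ultimately show ?thesis using True by (auto simp: T_def)
  next
    case False
    then show ?thesis by (simp add: T_def)
  qed
  have "\<exists>K. Sn_field n k K \<and> property_P1 k n r P K \<and> property_P2 k r P mu K \<and>
    (\<forall>i<length l. artin_symbol k (galois_closure k K) (l ! i) = cycle_class k K (ts ! i) \<and>
      cycle_class k K (ts ! i) \<noteq> {})"
  proof (rule Sn_field_exists_extra[OF k n P inj mu nu l(2)])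
    show "prime_of k Q \<and> ideal_norm k Q \<ge> n \<and> Q \<notin> P ` {1..r}" if "Q \<in> set l" for Q using that C(3) l(1) by blast
    show "length ts = length l" by (simp add: ts_def len)
    show "set ts \<subseteq> insert ?one {{#n#}, {#n - 1, 1#}, {#2#} + replicate_mset (n - 2) 1}" by (auto simp: ts_def T_def)
    show "{{#n#}, {#n - 1, 1#}, {#2#} + replicate_mset (n - 2) 1} \<subseteq> set ts" by (auto simp: ts_def)
  qed simp_all
  then obtain K where K: "K \<in> ?good" and Ka: "\<And>i. i < length l \<Longrightarrow>
      artin_symbol k (galois_closure k K) (l ! i) = cycle_class k K (ts ! i) \<and> cycle_class k K (ts ! i) \<noteq> {}" by blast
  \<comment> \<open>The last of the four additional primes shows that the new field belongs to
    \<open>B\<close>. It would therefore be some \<open>Ks ! i\<close>, which contradicts the choice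
    of \<open>T i\<close>.\<close>
  have "ts ! (?m + 3) = ?one" by (simp add: ts_def nth_append)
  then have "K \<in> B" using K Ka[of "?m + 3"] len unfolding B_def by simp
  then obtain i where i: "i < ?m" "Ks ! i = K" using Ks by (metis in_set_conv_nth)
  have "ts ! i = T i" using i(1) by (simp add: ts_def nth_append)
  then show False using Tne[OF i(1)] Ka[of i] i len by simp
qed

theorem theorem6p2:
  fixes k :: "complex set" and n r :: nat
    and \<pp> :: "nat \<Rightarrow> complex set" and mu :: "nat \<Rightarrow> nat multiset"
  assumes "number_field k"
    and "n \<ge> 2"
    and "\<forall>i\<in>{1..r}. prime_of k (\<pp> i)"
    and "inj_on \<pp> {1..r}"
    and "\<forall>i\<in>{1..r}. partition_of (mu i) n"
  shows
    "((\<forall>i\<in>{1..r}. nu_star n (ideal_norm k (\<pp> i)) (mu i) > 0) \<longleftrightarrow>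
      (\<exists>K. Sn_field n k K \<and> property_P1 k n r \<pp> K \<and> property_P2 k r \<pp> mu K)) \<and>
     ((\<exists>K. Sn_field n k K \<and> property_P1 k n r \<pp> K \<and> property_P2 k r \<pp> mu K) \<longleftrightarrow>
      infinite {K. Sn_field n k K \<and> property_P1 k n r \<pp> K \<and> property_P2 k r \<pp> mu K})"
    (is "(?nu \<longleftrightarrow> ?ex) \<and> (?ex \<longleftrightarrow> infinite ?good)")
proof -
  have P: "\<And>i. i \<in> {1..r} \<Longrightarrow> prime_of k (\<pp> i)" and mu: "\<And>i. i \<in> {1..r} \<Longrightarrow> partition_of (mu i) n"
    using assms(3,5) by blast+
  have "?nu" if ex: "?ex"
  proof
    fix i assume i: "i \<in> {1..r}"
    obtain K where K: "Sn_field n k K" "property_P1 k n r \<pp> K" "property_P2 k r \<pp> mu K" using ex by blast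
    show "nu_star n (ideal_norm k (\<pp> i)) (mu i) > 0"
      by (rule necessity[where P = \<pp> and mu = mu, OF assms(1,2) P mu K i])
  qed
  moreover have "infinite ?good" if nu: "?nu"
    by (rule infinitely_many[OF assms(1,2) P assms(4) mu]) (use nu in blast)+
  moreover have "?ex" if "infinite ?good"
  proof -
    have "?good \<noteq> {}" using that by (metis finite.emptyI)
    then show ?thesis by blast
  qed
  ultimately show ?thesis by blast
qed

end
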